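(* For every integer $n\geq 1$ there exist an elementary group $E$ and a chief factor $K/N$ of $E$ such that $K/N$ is of stacking type and has decomposition rank $\xi(K/N)=\omega^n+1$.
   Context: All groups are totally disconnected, locally compact, second countable (t.d.l.c.s.c.) topological groups. A topological group is compactly generated if it is generated by a compact subset. The class $\mathcal{E}$ of elementary groups is the smallest class of t.d.l.c.s.c. groups such that: (i) $\mathcal{E}$ contains all second countable profinite groups and all countable discrete groups; (ii) $\mathcal{E}$ is closed under group extensions; (iii) $\mathcal{E}$ is closed under closed subgroups; (iv) $\mathcal{E}$ is closed under quotients by closed normal subgroups; (v) if a t.d.l.c.s.c. group $G$ is the union of an increasing sequence of open subgroups $O_i\in\mathcal{E}$, $i\in\mathbb{N}$, then $G\in\mathcal{E}$. The discrete residual $\mathrm{Res}(G)$ is the intersection of all open normal subgroups of $G$. The decomposition rank $\xi:\mathcal{E}\to[1,\omega_1)$ is the (well-defined) function with: $\xi(\{1\})=1$; $\xi(G)=\xi(\mathrm{Res}(G))+1$ if $G$ is non-trivial and compactly generated; and, for $G$ non-trivial and any increasing sequence $(O_i)_{i\in\mathbb{N}}$ of compactly generated open subgroups with union $G$, $\xi(G)=\sup_{i}\xi(\mathrm{Res}(O_i))+1$. A normal factor of a topological group $G$ is a quotient $K/L$ where $L<K$ are distinct closed normal subgroups of $G$. It is a chief factor of $G$ if there is no closed normal subgroup $M$ of $G$ with $L<M<K$. Its centralizer is $C_G(K/L)=\{g\in G:\ [g,k]\in L\ \forall k\in K\}$. Two normal factors $K_1/L_1$, $K_2/L_2$ are associated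 if $\overline{K_1L_2}=\overline{K_2L_1}$, $K_1\cap\overline{L_1L_2}=L_1$ and $K_2\cap\overline{L_1L_2}=L_2$. Association is an equivalence relation on non-abelian chief factors, and associated non-abelian chief factors have the same centralizer. A chief block of $G$ is an association class of non-abelian chief factors of $G$; for a chief block $\mathfrak{a}$ let $C_G(\mathfrak{a})$ be the centralizer of any representative. Chief blocks are partially ordered by $\mathfrak{a}\leq\mathfrak{b}$ iff $C_G(\mathfrak{a})\leq C_G(\mathfrak{b})$, and $\mathfrak{a}<\mathfrak{b}$ means $\mathfrak{a}\le\mathfrak{b}$ and $\mathfrak{a}\neq\mathfrak{b}$. A normal subgroup $N$ of $G$ covers $\mathfrak{a}$ if there are $B\leq A\leq N$ with $A/B\in\mathfrak{a}$. A chief block is minimally covered if there is a unique smallest closed normal subgroup of $G$ covering it; $\mathfrak{B}_G^{\min}$ denotes the set of minimally covered chief blocks of $G$. Continuous automorphisms $\psi$ of $G$ act on chief blocks by sending the class of $A/B$ to the class of $\psi(A)/\psi(B)$. A chief factor $K/N$ of $G$ is of stacking type if $\mathfrak{B}_{K/N}^{\min}\neq\emptyset$ and for all $\mathfrak{a},\mathfrak{b}\in\mathfrak{B}_{K/N}^{\min}$ there exists a topological group automorphism $\psi$ of $K/N$ such that $\psi.\mathfrak{a}<\mathfrak{b}$. *)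

theory Defs
  imports "HOL-Analysis.Analysis" "HOL-Algebra.Coset" "HOL-Algebra.Generated_Groups" "HOL-Library.Countable_Set_Type"
begin

section \<open>Countable ordinals\<close>

text \<open>
  The well-order \<open>cardSuc natLeq\<close> has order type \<open>\<omega>\<^sub>1\<close>, so the type below consists of
  exactly the ordinals less than \<open>\<omega>\<^sub>1\<close>.
\<close>

typedef omega1 = "Field (cardSuc natLeq)"
  using Field_cardSuc_not_empty[OF natLeq_Card_order] by blast

lemma cardSuc_natLeq_Well_order: "Well_order (cardSuc natLeq)"
  by (rule cardSuc_Well_order[OF natLeq_Card_order])

instantiation omega1 :: linorder
begin

definition less_eq_omega1 :: "omega1 \<Rightarrow> omega1 \<Rightarrow> bool" where
  "\<alpha> \<le> \<beta> \<longleftrightarrow> (Rep_omega1 \<alpha>, Rep_omega1 \<beta>) \<in> cardSuc natLeq"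

definition less_omega1 :: "omega1 \<Rightarrow> omega1 \<Rightarrow> bool" where
  "\<alpha> < \<beta> \<longleftrightarrow> \<alpha> \<le> \<beta> \<and> \<not> \<beta> \<le> \<alpha>" for \<alpha> \<beta> :: omega1

instance
proof
  fix x y z :: omega1
  have wo: "refl_on (Field (cardSuc natLeq)) (cardSuc natLeq)" "trans (cardSuc natLeq)"
    "antisym (cardSuc natLeq)" "total_on (Field (cardSuc natLeq)) (cardSuc natLeq)"
    using cardSuc_natLeq_Well_order
    by (auto simp: order_on_defs)
  show "x < y \<longleftrightarrow> x \<le> y \<and> \<not> y \<le> x"
    by (simp add: less_omega1_def)
  show "x \<le> x"
    using wo(1) Rep_omega1[of x] by (simp add: less_eq_omega1_def refl_onD)
  show "x \<le> y \<Longrightarrow> y \<le> z \<Longrightarrow> x \<le> z"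
    using wo(2) by (meson less_eq_omega1_def transD)
  show "x \<le> y \<Longrightarrow> y \<le> x \<Longrightarrow> x = y"
    using wo(3) by (meson less_eq_omega1_def antisymD Rep_omega1_inject)
  show "x \<le> y \<or> y \<le> x"
    using wo(1,4) Rep_omega1[of x] Rep_omega1[of y]
    by (metis less_eq_omega1_def refl_onD total_on_def)
qed

end

instance omega1 :: wellorder
proof
  fix P :: "omega1 \<Rightarrow> bool" and a
  assume step: "\<And>x. (\<And>y. y < x \<Longrightarrow> P y) \<Longrightarrow> P x"
  have "wf (cardSuc natLeq - Id)"
    using cardSuc_natLeq_Well_order by (simp add: well_order_on_def)
  then have "wf (inv_image (cardSuc natLeq - Id) Rep_omega1)"
    by (rule wf_inv_image)
  moreover have "{(x, y). x < y} \<subseteq> inv_image (cardSuc natLeq - Id) Rep_omega1"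
    by (auto simp: less_le less_eq_omega1_def Rep_omega1_inject)
  ultimately have "wf {(x, y :: omega1). x < y}"
    by (rule wf_subset)
  then show "P a"
    using step by (induction a rule: wf_induct_rule) auto
qed

lemma countable_lessThan_omega1:
  includes cardinal_syntax
  shows "countable {..< \<alpha> :: omega1}"
proof -
  have "Rep_omega1 ` {..<\<alpha>} \<subseteq> underS (cardSuc natLeq) (Rep_omega1 \<alpha>)"
    by (auto simp: underS_def less_le less_eq_omega1_def Rep_omega1_inject)
  moreover have "|underS (cardSuc natLeq) (Rep_omega1 \<alpha>)| \<le>o natLeq"
    using card_of_underS[OF cardSuc_Card_order[OF natLeq_Card_order] Rep_omega1]
    by (simp only: cardSuc_ordLeq_ordLess[OF natLeq_Card_order card_of_Card_order])
  ultimately have "countable (Rep_omega1 ` {..<\<alpha>})"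
    by (auto simp: countable_card_le_natLeq[symmetric] intro: countable_subset)
  then show ?thesis
    by (rule countable_image_inj_on) (simp add: inj_on_def Rep_omega1_inject)
qed

lemma uncountable_omega1:
  includes cardinal_syntax
  shows "uncountable (UNIV :: omega1 set)"
proof
  assume "countable (UNIV :: omega1 set)"
  then have "countable (Rep_omega1 ` UNIV)"
    by (rule countable_image)
  then have "|Field (cardSuc natLeq)| \<le>o natLeq"
    by (simp add: type_definition.Rep_range[OF type_definition_omega1] countable_card_le_natLeq)
  moreover have "|Field (cardSuc natLeq)| =o cardSuc natLeq"
    by (rule card_of_Field_ordIso[OF cardSuc_Card_order[OF natLeq_Card_order]])
  ultimately show False
    using cardSuc_greater[OF natLeq_Card_order]
    by (meson not_ordLess_ordLeq ordIso_ordLeq_trans ordIso_symmetric)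
qed

lemma bdd_above_countable_omega1:
  assumes "countable (A :: omega1 set)"
  shows "bdd_above A"
proof (rule ccontr)
  assume "\<not> bdd_above A"
  then have "\<exists>a\<in>A. x < a" for x
    by (meson bdd_aboveI not_le)
  then have "UNIV = (\<Union>a\<in>A. {..<a})"
    by auto
  moreover have "countable (\<Union>a\<in>A. {..<a})"
    by (intro countable_UN assms countable_lessThan_omega1)
  ultimately show False
    using uncountable_omega1 by simp
qed

instantiation omega1 :: distrib_lattice
begin

definition inf_omega1 :: "omega1 \<Rightarrow> omega1 \<Rightarrow> omega1" where
  "inf_omega1 = min"

definition sup_omega1 :: "omega1 \<Rightarrow> omega1 \<Rightarrow> omega1" where
  "sup_omega1 = max"

instance
  by standard (simp_all add: inf_omega1_def sup_omega1_def max_min_distrib2)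

end

instantiation omega1 :: conditionally_complete_linorder
begin

definition Inf_omega1 :: "omega1 set \<Rightarrow> omega1" where
  "Inf A = (LEAST \<alpha>. \<alpha> \<in> A)" for A :: "omega1 set"

definition Sup_omega1 :: "omega1 set \<Rightarrow> omega1" where
  "Sup A = (LEAST \<alpha>. \<forall>\<beta>\<in>A. \<beta> \<le> \<alpha>)" for A :: "omega1 set"

instance
proof
  fix x z :: omega1 and X :: "omega1 set"
  show "x \<in> X \<Longrightarrow> Inf X \<le> x"
    by (simp add: Inf_omega1_def Least_le)
  show "X \<noteq> {} \<Longrightarrow> (\<And>x. x \<in> X \<Longrightarrow> z \<le> x) \<Longrightarrow> z \<le> Inf X"
    unfolding Inf_omega1_def by (metis LeastI ex_in_conv)
  show "x \<le> Sup X" if "x \<in> X" "bdd_above X"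
  proof -
    from that(2) obtain b where "\<forall>\<beta>\<in>X. \<beta> \<le> b"
      by (auto simp: bdd_above_def)
    then have "\<forall>\<beta>\<in>X. \<beta> \<le> Sup X"
      unfolding Sup_omega1_def by (rule LeastI)
    with that(1) show ?thesis by blast
  qed
  show "X \<noteq> {} \<Longrightarrow> (\<And>x. x \<in> X \<Longrightarrow> x \<le> z) \<Longrightarrow> Sup X \<le> z"
    unfolding Sup_omega1_def by (rule Least_le) blast
qed

end

text \<open>
  Ordinal arithmetic by the usual transfinite recursions
  \<open>\<alpha> + \<beta> = sup ({\<alpha>} \<union> {(\<alpha> + \<gamma>) + 1 | \<gamma> < \<beta>})\<close> and
  \<open>\<alpha> * \<beta> = sup {\<alpha> * \<gamma> + \<alpha> | \<gamma> < \<beta>}\<close>.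
\<close>

function ord_add :: "omega1 \<Rightarrow> omega1 \<Rightarrow> omega1" where
  "ord_add \<alpha> \<beta> = (LEAST \<delta>. \<alpha> \<le> \<delta> \<and> (\<forall>\<gamma>\<in>{..<\<beta>}. ord_add \<alpha> \<gamma> < \<delta>))"
  by auto
termination
  by (relation "inv_image {(x, y). x < y} snd") (auto simp: wf)

declare ord_add.simps [simp del]

function ord_mult :: "omega1 \<Rightarrow> omega1 \<Rightarrow> omega1" where
  "ord_mult \<alpha> \<beta> = (LEAST \<delta>. \<forall>\<gamma>\<in>{..<\<beta>}. ord_add (ord_mult \<alpha> \<gamma>) \<alpha> \<le> \<delta>)"
  by auto
termination
  by (relation "inv_image {(x, y). x < y} snd") (auto simp: wf)

declare ord_mult.simps [simp del]

instantiation omega1 :: "{zero, power, plus}"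
begin

definition zero_omega1 :: omega1 where
  "0 = (LEAST \<alpha> :: omega1. True)"

definition one_omega1 :: omega1 where
  "1 = (LEAST \<alpha> :: omega1. 0 < \<alpha>)"

definition plus_omega1 :: "omega1 \<Rightarrow> omega1 \<Rightarrow> omega1" where
  "plus_omega1 = ord_add"

definition times_omega1 :: "omega1 \<Rightarrow> omega1 \<Rightarrow> omega1" where
  "times_omega1 = ord_mult"

instance ..

end

definition omega :: omega1 where
  "omega = (SUP k::nat. ((\<lambda>\<alpha>. \<alpha> + 1) ^^ k) 0)"

lemma zero_le_omega1 [simp]: "(0 :: omega1) \<le> \<alpha>"
  by (simp add: zero_omega1_def Least_le)

lemma ex_greater_omega1: "\<exists>\<beta>. (\<alpha> :: omega1) < \<beta>"
proof (rule ccontr)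
  assume "\<nexists>\<beta>. \<alpha> < \<beta>"
  then have "UNIV = insert \<alpha> {..<\<alpha>}"
    by (auto simp: not_less le_less)
  then show False
    using countable_lessThan_omega1[of \<alpha>] uncountable_omega1 by (metis countable_insert)
qed

lemma ord_add_bounds:
  fixes \<alpha> \<beta> :: omega1
  shows "\<alpha> \<le> \<alpha> + \<beta>" "\<gamma> < \<beta> \<Longrightarrow> \<alpha> + \<gamma> < \<alpha> + \<beta>"
    "\<lbrakk>\<alpha> \<le> \<delta>; \<And>\<gamma>. \<gamma> < \<beta> \<Longrightarrow> \<alpha> + \<gamma> < \<delta>\<rbrakk> \<Longrightarrow> \<alpha> + \<beta> \<le> \<delta>"
proof -
  let ?P = "\<lambda>\<delta>. \<alpha> \<le> \<delta> \<and> (\<forall>\<gamma>\<in>{..<\<beta>}. ord_add \<alpha> \<gamma> < \<delta>)"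
  have "bdd_above (insert \<alpha> (ord_add \<alpha> ` {..<\<beta>}))"
    by (intro bdd_above_countable_omega1) (simp add: countable_lessThan_omega1)
  then obtain b where "\<forall>x \<in> insert \<alpha> (ord_add \<alpha> ` {..<\<beta>}). x \<le> b"
    unfolding bdd_above_def by blast
  moreover obtain c where "b < c" using ex_greater_omega1 by blast
  ultimately have "?P c"
    by (auto intro: le_less_trans less_imp_le)
  then have "?P (Least ?P)"
    by (rule LeastI)
  then have P: "?P (ord_add \<alpha> \<beta>)"
    unfolding ord_add.simps[of \<alpha> \<beta>] .
  show "\<alpha> \<le> \<alpha> + \<beta>" "\<gamma> < \<beta> \<Longrightarrow> \<alpha> + \<gamma> < \<alpha> + \<beta>"
    using P by (auto simp: plus_omega1_def)
  show "\<lbrakk>\<alpha> \<le> \<delta>; \<And>\<gamma>. \<gamma> < \<beta> \<Longrightarrow> \<alpha> + \<gamma> < \<delta>\<rbrakk> \<Longrightarrow> \<alpha> + \<beta> \<le> \<delta>"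
    unfolding plus_omega1_def by (subst ord_add.simps) (auto intro: Least_le)
qed

lemma ord_add_0_right [simp]: "\<alpha> + 0 = (\<alpha> :: omega1)"
  by (intro antisym ord_add_bounds) (auto simp: leD)

lemma less_one_iff_omega1: "(\<alpha> :: omega1) < 1 \<longleftrightarrow> \<alpha> = 0"
proof -
  have "(0 :: omega1) < 1"
    unfolding one_omega1_def by (rule LeastI_ex) (rule ex_greater_omega1)
  moreover have "\<alpha> = 0" if "\<alpha> < 1"
    using that not_less_Least[of \<alpha> "\<lambda>\<alpha>. 0 < \<alpha>"] zero_le_omega1[of \<alpha>]
    by (auto simp: one_omega1_def less_le)
  ultimately show ?thesis by auto
qed

lemma less_add_one_iff_omega1: "(\<alpha> :: omega1) < \<beta> + 1 \<longleftrightarrow> \<alpha> \<le> \<beta>"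
proof -
  have *: "\<beta> < \<beta> + 1"
    using ord_add_bounds(2)[of 0 1 \<beta>] by (simp add: less_one_iff_omega1)
  moreover have "\<beta> + 1 \<le> \<alpha>" if "\<beta> < \<alpha>"
    using that by (intro ord_add_bounds) (auto simp: less_one_iff_omega1)
  ultimately show ?thesis by (meson leD le_less_trans not_le)
qed

lemma ord_add_add_one: "\<alpha> + (\<beta> + 1) = (\<alpha> + \<beta>) + (1 :: omega1)"
proof (rule antisym)
  show "\<alpha> + (\<beta> + 1) \<le> (\<alpha> + \<beta>) + 1"
  proof (rule ord_add_bounds(3))
    show "\<alpha> \<le> \<alpha> + \<beta> + 1"
      by (meson ord_add_bounds(1) order_trans)
    show "\<alpha> + \<gamma> < \<alpha> + \<beta> + 1" if "\<gamma> < \<beta> + 1" for \<gamma>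
      using that ord_add_bounds(2)[of \<gamma> \<beta> \<alpha>]
      by (auto simp: less_add_one_iff_omega1 le_less)
  qed
  have "\<alpha> + \<beta> < \<alpha> + (\<beta> + 1)"
    by (rule ord_add_bounds(2)) (simp add: less_add_one_iff_omega1)
  then show "(\<alpha> + \<beta>) + 1 \<le> \<alpha> + (\<beta> + 1)"
    by (meson less_add_one_iff_omega1 not_le)
qed

lemma ord_mult_bounds:
  fixes \<alpha> \<beta> :: omega1
  shows "\<gamma> < \<beta> \<Longrightarrow> \<alpha> * \<gamma> + \<alpha> \<le> \<alpha> * \<beta>"
    "(\<And>\<gamma>. \<gamma> < \<beta> \<Longrightarrow> \<alpha> * \<gamma> + \<alpha> \<le> \<delta>) \<Longrightarrow> \<alpha> * \<beta> \<le> \<delta>"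
proof -
  let ?f = "\<lambda>\<gamma>. ord_add (ord_mult \<alpha> \<gamma>) \<alpha>"
  have "bdd_above (?f ` {..<\<beta>})"
    by (intro bdd_above_countable_omega1) (simp add: countable_lessThan_omega1)
  then obtain b where "\<forall>\<gamma>\<in>{..<\<beta>}. ?f \<gamma> \<le> b"
    unfolding bdd_above_def by blast
  then have "\<forall>\<gamma>\<in>{..<\<beta>}. ?f \<gamma> \<le> (LEAST \<delta>. \<forall>\<gamma>\<in>{..<\<beta>}. ?f \<gamma> \<le> \<delta>)"
    by (rule LeastI)
  then have "\<forall>\<gamma>\<in>{..<\<beta>}. ?f \<gamma> \<le> ord_mult \<alpha> \<beta>"
    unfolding ord_mult.simps[of \<alpha> \<beta>] .
  then show "\<gamma> < \<beta> \<Longrightarrow> \<alpha> * \<gamma> + \<alpha> \<le> \<alpha> * \<beta>"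
    by (simp add: plus_omega1_def times_omega1_def)
  show "(\<And>\<gamma>. \<gamma> < \<beta> \<Longrightarrow> \<alpha> * \<gamma> + \<alpha> \<le> \<delta>) \<Longrightarrow> \<alpha> * \<beta> \<le> \<delta>"
    unfolding plus_omega1_def times_omega1_def
    by (subst ord_mult.simps) (auto intro: Least_le)
qed

lemma ord_mult_0_right: "\<alpha> * 0 = (0 :: omega1)"
  by (intro antisym ord_mult_bounds zero_le_omega1)
    (auto simp: leD)

lemma ord_mult_add_one: "\<alpha> * (\<beta> + 1) = \<alpha> * \<beta> + (\<alpha> :: omega1)"
proof (rule antisym)
  have "\<alpha> * \<gamma> + \<alpha> \<le> \<alpha> * \<beta> + \<alpha>" if "\<gamma> \<le> \<beta>" for \<gamma>
  proof (cases "\<gamma> = \<beta>")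
    case False
    with that have "\<alpha> * \<gamma> + \<alpha> \<le> \<alpha> * \<beta>"
      by (intro ord_mult_bounds(1)) simp
    also have "\<dots> \<le> \<alpha> * \<beta> + \<alpha>"
      by (rule ord_add_bounds(1))
    finally show ?thesis .
  qed simp
  then show "\<alpha> * (\<beta> + 1) \<le> \<alpha> * \<beta> + \<alpha>"
    by (intro ord_mult_bounds(2)) (simp add: less_add_one_iff_omega1)
  show "\<alpha> * \<beta> + \<alpha> \<le> \<alpha> * (\<beta> + 1)"
    by (rule ord_mult_bounds(1)) (simp add: less_add_one_iff_omega1)
qed


section \<open>Topological groups\<close>

record 'a tgroup = "'a monoid" +
  gtop :: "'a topology"

definition topological_group :: "'a tgroup \<Rightarrow> bool" where
  "topological_group G \<longleftrightarrow>
     group G \<and> topspace (gtop G) = carrier G \<and>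
     continuous_map (prod_topology (gtop G) (gtop G)) (gtop G) (\<lambda>(x, y). x \<otimes>\<^bsub>G\<^esub> y) \<and>
     continuous_map (gtop G) (gtop G) (\<lambda>x. inv\<^bsub>G\<^esub> x)"

definition tdlcsc :: "'a tgroup \<Rightarrow> bool" where
  "tdlcsc G \<longleftrightarrow>
     topological_group G \<and> Hausdorff_space (gtop G) \<and>
     (\<forall>x \<in> carrier G. connected_component_of_set (gtop G) x = {x}) \<and>
     locally_compact_space (gtop G) \<and> second_countable (gtop G)"

definition closed_subgroup :: "'a set \<Rightarrow> 'a tgroup \<Rightarrow> bool" where
  "closed_subgroup H G \<longleftrightarrow> subgroup H G \<and> closedin (gtop G) H"

definition open_subgroup :: "'a set \<Rightarrow> 'a tgroup \<Rightarrow> bool" where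
  "open_subgroup H G \<longleftrightarrow> subgroup H G \<and> openin (gtop G) H"

definition closed_normal :: "'a set \<Rightarrow> 'a tgroup \<Rightarrow> bool" where
  "closed_normal N G \<longleftrightarrow> N \<lhd> G \<and> closedin (gtop G) N"

definition subgrp :: "'a tgroup \<Rightarrow> 'a set \<Rightarrow> 'a tgroup" where
  "subgrp G H = G\<lparr>carrier := H, gtop := subtopology (gtop G) H\<rparr>"

definition quotient_topology :: "'a tgroup \<Rightarrow> 'a set \<Rightarrow> 'a set topology" where
  "quotient_topology G N =
     topology (\<lambda>U. U \<subseteq> carrier (G Mod N) \<and> openin (gtop G) {x \<in> carrier G. N #>\<^bsub>G\<^esub> x \<in> U})"

definition quotient_group :: "'a tgroup \<Rightarrow> 'a set \<Rightarrow> 'a set tgroup" where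
  "quotient_group G N =
     \<lparr>carrier = carrier (G Mod N), mult = mult (G Mod N), one = one (G Mod N),
      gtop = quotient_topology G N\<rparr>"

definition top_iso :: "'a tgroup \<Rightarrow> 'b tgroup \<Rightarrow> ('a \<Rightarrow> 'b) set" where
  "top_iso G H = {\<phi> \<in> iso G H. homeomorphic_map (gtop G) (gtop H) \<phi>}"

definition compactly_generated :: "'a tgroup \<Rightarrow> bool" where
  "compactly_generated G \<longleftrightarrow> (\<exists>C. compactin (gtop G) C \<and> generate G C = carrier G)"

definition discrete_residual :: "'a tgroup \<Rightarrow> 'a set" where
  "discrete_residual G = \<Inter> {N. N \<lhd> G \<and> openin (gtop G) N}"

abbreviation Res :: "'a tgroup \<Rightarrow> 'a tgroup" where
  "Res G \<equiv> subgrp G (discrete_residual G)"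

lemma openin_quotient_topology:
  assumes "topspace (gtop G) = carrier G"
  shows "openin (quotient_topology G N) U \<longleftrightarrow>
     U \<subseteq> carrier (G Mod N) \<and> openin (gtop G) {x \<in> carrier G. N #>\<^bsub>G\<^esub> x \<in> U}"
proof -
  let ?P = "\<lambda>U. {x \<in> carrier G. N #>\<^bsub>G\<^esub> x \<in> U}"
  have "?P (S \<inter> T) = ?P S \<inter> ?P T" for S T by auto
  moreover have "?P (\<Union>K) = (\<Union>S\<in>K. ?P S)" for K by auto
  ultimately have "istopology (\<lambda>U. U \<subseteq> carrier (G Mod N) \<and> openin (gtop G) (?P U))"
    unfolding istopology_def by auto
  then show ?thesis
    by (simp add: quotient_topology_def topology_inverse')
qed

lemma quotient_map_quotient_topology:
  assumes "topspace (gtop G) = carrier G"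
  shows "quotient_map (gtop G) (quotient_topology G N) (\<lambda>x. N #>\<^bsub>G\<^esub> x)"
proof -
  have "openin (quotient_topology G N) (carrier (G Mod N))"
    using openin_topspace[of "gtop G"] assms
    by (simp add: openin_quotient_topology carrier_FactGroup cong: conj_cong)
  then have "topspace (quotient_topology G N) = carrier (G Mod N)"
    using openin_quotient_topology[OF assms, of N "topspace (quotient_topology G N)"]
    by (meson openin_subset openin_topspace subset_antisym)
  then show ?thesis
    using assms
    by (auto simp: quotient_map_def carrier_FactGroup openin_quotient_topology)
qed


section \<open>Elementary groups and decomposition rank\<close>

text \<open>
  Every t.d.l.c.s.c. group has at most continuum many elements (indeed it embeds as a closed
  subgroup in the permutation group of the natural numbers), so up to isomorphism all of them have
  their carrier in the type \<open>nat \<Rightarrow> nat\<close>. The class of elementary groups is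
  defined on that type. As the elements of a quotient are cosets, quotients only enter
  through isomorphic copies; taking the trivial normal subgroup in the rule
  \<open>quotient\<close> shows that the class is closed under isomorphism.
\<close>

inductive elementary :: "(nat \<Rightarrow> nat) tgroup \<Rightarrow> bool" where
  profinite: "\<lbrakk>tdlcsc G; compact_space (gtop G)\<rbrakk> \<Longrightarrow> elementary G"
| discrete: "\<lbrakk>group G; countable (carrier G); gtop G = discrete_topology (carrier G)\<rbrakk>
    \<Longrightarrow> elementary G"
| extension: "\<lbrakk>tdlcsc G; closed_normal N G; elementary (subgrp G N);
      elementary Q; \<phi> \<in> top_iso (quotient_group G N) Q\<rbrakk>
    \<Longrightarrow> elementary G"
| closed_subgroup: "\<lbrakk>elementary G; closed_subgroup H G\<rbrakk> \<Longrightarrow> elementary (subgrp G H)"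
| quotient: "\<lbrakk>elementary G; closed_normal N G; topological_group Q;
      \<phi> \<in> top_iso (quotient_group G N) Q\<rbrakk>
    \<Longrightarrow> elementary Q"
| increasing_union: "\<lbrakk>tdlcsc G; incseq S; \<And>i. open_subgroup (S i) G;
      (\<Union>i. S i) = carrier G; \<And>i. elementary (subgrp G (S i))\<rbrakk>
    \<Longrightarrow> elementary G"

text \<open>
  The graph of the decomposition rank, generated by its defining recursion. Each instance of the
  recursion only involves topological subgroups of the given group, hence no change of type.
  The groups that acquire a rank are exactly the elementary ones.
\<close>

inductive has_decomposition_rank :: "'a tgroup \<Rightarrow> omega1 \<Rightarrow> bool" where
  trivial: "\<lbrakk>tdlcsc G; carrier G = {\<one>\<^bsub>G\<^esub>}\<rbrakk> \<Longrightarrow> has_decomposition_rank G 1"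
| compactly_generated: "\<lbrakk>tdlcsc G; carrier G \<noteq> {\<one>\<^bsub>G\<^esub>}; compactly_generated G;
      has_decomposition_rank (Res G) \<alpha>\<rbrakk>
    \<Longrightarrow> has_decomposition_rank G (\<alpha> + 1)"
| increasing_union: "\<lbrakk>tdlcsc G; carrier G \<noteq> {\<one>\<^bsub>G\<^esub>};
      incseq S; \<And>i. open_subgroup (S i) G; (\<Union>i. S i) = carrier G;
      \<And>i. compactly_generated (subgrp G (S i));
      \<And>i. has_decomposition_rank (Res (subgrp G (S i))) (\<rho> i)\<rbrakk>
    \<Longrightarrow> has_decomposition_rank G ((SUP i::nat. \<rho> i) + 1)"

definition decomposition_rank :: "'a tgroup \<Rightarrow> omega1" where
  "decomposition_rank G = (THE \<alpha>. has_decomposition_rank G \<alpha>)"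


section \<open>Chief factors and chief blocks\<close>

text \<open>A normal factor \<open>K/L\<close> is represented by the pair \<open>(K, L)\<close>.\<close>

definition normal_factor :: "'a tgroup \<Rightarrow> 'a set \<times> 'a set \<Rightarrow> bool" where
  "normal_factor G = (\<lambda>(K, L). closed_normal K G \<and> closed_normal L G \<and> L \<subset> K)"

definition factor_group :: "'a tgroup \<Rightarrow> 'a set \<times> 'a set \<Rightarrow> 'a set tgroup" where
  "factor_group G = (\<lambda>(K, L). quotient_group (subgrp G K) L)"

definition chief_factor :: "'a tgroup \<Rightarrow> 'a set \<times> 'a set \<Rightarrow> bool" where
  "chief_factor G = (\<lambda>(K, L). normal_factor G (K, L) \<and>
     \<not> (\<exists>M. closed_normal M G \<and> L \<subset> M \<and> M \<subset> K))"

definition nonabelian_chief_factors :: "'a tgroup \<Rightarrow> ('a set \<times> 'a set) set" where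
  "nonabelian_chief_factors G = {F. chief_factor G F \<and> \<not> comm_group (factor_group G F)}"

definition centralizer :: "'a tgroup \<Rightarrow> 'a set \<times> 'a set \<Rightarrow> 'a set" where
  "centralizer G = (\<lambda>(K, L).
     {g \<in> carrier G. \<forall>k\<in>K. g \<otimes>\<^bsub>G\<^esub> k \<otimes>\<^bsub>G\<^esub> inv\<^bsub>G\<^esub> g \<otimes>\<^bsub>G\<^esub> inv\<^bsub>G\<^esub> k \<in> L})"

definition associated :: "'a tgroup \<Rightarrow> 'a set \<times> 'a set \<Rightarrow> 'a set \<times> 'a set \<Rightarrow> bool" where
  "associated G = (\<lambda>(K\<^sub>1, L\<^sub>1) (K\<^sub>2, L\<^sub>2).
     gtop G closure_of (K\<^sub>1 <#>\<^bsub>G\<^esub> L\<^sub>2) = gtop G closure_of (K\<^sub>2 <#>\<^bsub>G\<^esub> L\<^sub>1) \<and>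
     K\<^sub>1 \<inter> gtop G closure_of (L\<^sub>1 <#>\<^bsub>G\<^esub> L\<^sub>2) = L\<^sub>1 \<and>
     K\<^sub>2 \<inter> gtop G closure_of (L\<^sub>1 <#>\<^bsub>G\<^esub> L\<^sub>2) = L\<^sub>2)"

definition association :: "'a tgroup \<Rightarrow> (('a set \<times> 'a set) \<times> ('a set \<times> 'a set)) set" where
  "association G = {(F, F'). F \<in> nonabelian_chief_factors G \<and>
     F' \<in> nonabelian_chief_factors G \<and> associated G F F'}"

definition chief_blocks :: "'a tgroup \<Rightarrow> ('a set \<times> 'a set) set set" where
  "chief_blocks G = nonabelian_chief_factors G // association G"

definition block_centralizer :: "'a tgroup \<Rightarrow> ('a set \<times> 'a set) set \<Rightarrow> 'a set" where
  "block_centralizer G \<aa> = centralizer G (SOME F. F \<in> \<aa>)"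

definition block_le :: "'a tgroup \<Rightarrow> ('a set \<times> 'a set) set \<Rightarrow> ('a set \<times> 'a set) set \<Rightarrow> bool" where
  "block_le G \<aa> \<bb> \<longleftrightarrow> block_centralizer G \<aa> \<subseteq> block_centralizer G \<bb>"

definition block_less :: "'a tgroup \<Rightarrow> ('a set \<times> 'a set) set \<Rightarrow> ('a set \<times> 'a set) set \<Rightarrow> bool" where
  "block_less G \<aa> \<bb> \<longleftrightarrow> block_le G \<aa> \<bb> \<and> \<aa> \<noteq> \<bb>"

definition covers :: "'a set \<Rightarrow> ('a set \<times> 'a set) set \<Rightarrow> bool" where
  "covers N \<aa> \<longleftrightarrow> (\<exists>(A, B) \<in> \<aa>. A \<subseteq> N)"

definition minimally_covered_blocks :: "'a tgroup \<Rightarrow> ('a set \<times> 'a set) set set" where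
  "minimally_covered_blocks G = {\<aa> \<in> chief_blocks G.
     \<exists>M. closed_normal M G \<and> covers M \<aa> \<and>
       (\<forall>N. closed_normal N G \<and> covers N \<aa> \<longrightarrow> M \<subseteq> N)}"

text \<open>
  The block \<open>\<psi>.\<aa>\<close> is the common association class of the factors \<open>\<psi>(A)/\<psi>(B)\<close>
  with \<open>A/B \<in> \<aa>\<close>.
\<close>

definition block_action ::
  "'a tgroup \<Rightarrow> ('a \<Rightarrow> 'a) \<Rightarrow> ('a set \<times> 'a set) set \<Rightarrow> ('a set \<times> 'a set) set" where
  "block_action G \<psi> \<aa> = (\<Union>(A, B) \<in> \<aa>. association G `` {(\<psi> ` A, \<psi> ` B)})"

definition stacking_type :: "'a tgroup \<Rightarrow> 'a set \<times> 'a set \<Rightarrow> bool" where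
  "stacking_type G F \<longleftrightarrow> chief_factor G F \<and>
     minimally_covered_blocks (factor_group G F) \<noteq> {} \<and>
     (\<forall>\<aa> \<in> minimally_covered_blocks (factor_group G F).
      \<forall>\<bb> \<in> minimally_covered_blocks (factor_group G F).
        \<exists>\<psi> \<in> top_iso (factor_group G F) (factor_group G F).
          block_less (factor_group G F) (block_action (factor_group G F) \<psi> \<aa>) \<bb>)"

end

(*
Let H be a transitive group of permutations of the naturals whose stabiliser V of 0 is compact
open. The finitary tree automorphisms of a tree with levels indexed by the integers, with local
actions in H, almost all of them in V, form a group K. It has a shift automorphism, and every
closed normal subgroup of K is trapped between consecutive members of the chain of the subgroups
fixing all levels >= k. If H has a largest proper closed normal subgroup with a non-abelian
quotient, this chain yields minimally covered chief blocks that the shift moves along a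
descending sequence, and K is a chief factor of the group E generated by K and the shift.
Each level adds a bounded amount to the rank, so rank(K) = omega^(n+1) + 1 when rank(H) lies
in the right range below omega^(n+1). The induction on n feeds E back into the role of H: five
copies of E with total degree 0, permuted by Alt(5), form a compactly generated group H' with
the required normal structure, acting on the cosets of a compact open subgroup. The induction
starts with E replaced by the group of integers.
*)
theory Submission
 imports Defs "HOL-Algebra.SndIsomorphismGrp" "HOL-Library.Poly_Mapping" "HOL-Combinatorics.Permutations"
  "HOL-Library.Numeral_Type"
begin

section \<open>Topological groups\<close>

text \<open>The group E cannot itself take the place of H: it maps onto the integers, which have no
  largest proper subgroup. Total degree 0 in five permuted copies removes this quotient, and every
  proper closed normal subgroup then lies in the kernel of the map onto Alt(5). Five points make the
  alternating group simple and leave enough free coordinates to isolate one of them by commutators.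
  The rank needs control from both sides. Above: the residual of a compactly generated open subgroup
  of K is free on finitely many levels only, and although a level has infinitely many vertices, a
  restricted product over them adds a single ordinal below omega^(n+1). Below: every level must add
  at least omega^n, so the residual of H must already have large rank. H' inherits this from the
  copies of K in its residual, and the surplus 1 in rank(K) is what makes the induction close. All
  groups are carried as permutation groups with a chosen compact open subgroup; passing to cosets
  brings them back to the naturals, and elementarity is read off from the existence of a
  rank.\<close>

lemma subgrp_sel [simp]:
 "carrier (subgrp G H) = H" "mult (subgrp G H) = mult G" "one (subgrp G H) = one G"
 "gtop (subgrp G H) = subtopology (gtop G) H" by (simp_all add: subgrp_def)

lemma (in group) inv_cancel:
 assumes "x : carrier G" "y : carrier G" shows "x \<otimes> (inv x \<otimes> y) = y" "inv x \<otimes> (x \<otimes> y) = y"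
 using assms by (simp_all add: m_assoc[symmetric])

lemmas (in group) group_simps = m_assoc inv_mult_group inv_cancel

lemma group_subgrp: "group G ==> subgroup H G ==> group (subgrp G H)"
 by (rule groupI) (auto simp: subgroup.one_closed subgroup.m_closed subgroup.mem_carrier
   group.is_monoid monoid.m_assoc monoid.l_one intro!: bexI[of _ "inv\<^bsub>G\<^esub> _"] subgroup.m_inv_closed
   group.l_inv)

lemma inv_subgrp:
 assumes "group G" "subgroup H G" "x : H" shows "inv\<^bsub>subgrp G H\<^esub> x = inv\<^bsub>G\<^esub> x"
proof -
 interpret G: group G by fact
 interpret S: group "subgrp G H" using assms by (simp add: group_subgrp)
 show ?thesis using assms by (intro S.inv_equality)
   (auto simp: subgroup.m_inv_closed subgroup.mem_carrier[OF assms(2)])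
qed

lemma subgroup_subgrp_iff:
 assumes "group G" "subgroup H G" shows "subgroup K (subgrp G H) \<longleftrightarrow> subgroup K G \<and> K \<subseteq> H"
proof
 assume K: "subgroup K (subgrp G H)"
 then have "K \<subseteq> H" using subgroup.subset by fastforce
 moreover have "inv\<^bsub>G\<^esub> x : K" if "x : K" for x
  using subgroup.m_inv_closed[OF K that] inv_subgrp[OF assms, of x] that \<open>K \<subseteq> H\<close> by auto
 then have "subgroup K G" by (intro group.subgroupI[OF assms(1)])
    (use K subgroup.subset[OF K] subgroup.subset[OF assms(2)] subgroup.one_closed[OF K]
     subgroup.m_closed[OF K] in \<open>auto\<close>)
 ultimately show "subgroup K G \<and> K \<subseteq> H" by blast
next
 assume K: "subgroup K G \<and> K \<subseteq> H"
 then show "subgroup K (subgrp G H)" by (intro group.subgroupI[OF group_subgrp[OF assms]])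
    (use subgroup.one_closed[of K G] in \<open>auto simp: inv_subgrp[OF assms] subgroup.m_closed
     subgroup.m_inv_closed subset_iff\<close>)
qed

lemma subgrp_subgrp: "K \<subseteq> H ==> subgrp (subgrp G H) K = subgrp G K"
 by (simp add: subgrp_def subtopology_subtopology Int_absorb1 Int_commute)

lemma subgrp_self: "topspace (gtop G) = carrier G ==> subgrp G (carrier G) = G"
 using subtopology_topspace[of "gtop G"] by (simp add: subgrp_def)

lemma compactin_finite_subfamily:
 assumes "compactin X C" "!!i. i : I ==> openin X (A i)" "C \<subseteq> (\<Union>i\<in>I. A i)"
 shows "\<exists>M. finite M \<and> M \<subseteq> I \<and> C \<subseteq> (\<Union>i\<in>M. A i)"
proof -
 have "\<forall>U\<in>A ` I. openin X U" using assms(2) by auto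
 then obtain \<F> where "finite \<F>" "\<F> \<subseteq> A ` I" "C \<subseteq> \<Union>\<F>" using assms(1,3) unfolding compactin_def by meson
 then show ?thesis by (metis finite_subset_image)
qed

section \<open>Translations, open subgroups and coset covers\<close>

locale top_group =
 fixes G :: "'a tgroup" (structure)
 assumes topological_group: "topological_group G"

sublocale top_group \<subseteq> group G using topological_group by (simp add: topological_group_def)

context top_group
begin

lemma topspace [simp]: "topspace (gtop G) = carrier G" using topological_group by (simp add: topological_group_def)

lemma open_subset: "openin (gtop G) S ==> S \<subseteq> carrier G" using openin_subset by fastforce

lemma closed_subset: "closedin (gtop G) S ==> S \<subseteq> carrier G" using closedin_subset by fastforce

lemma continuous_map_mult:
 assumes "continuous_map X (gtop G) f" "continuous_map X (gtop G) g" shows "continuous_map X (gtop G) (\<lambda>x. f x \<otimes> g x)"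
proof -
 have "continuous_map X (prod_topology (gtop G) (gtop G)) (\<lambda>x. (f x, g x))"
  using assms by (simp add: continuous_map_pairedI)
 moreover have "continuous_map (prod_topology (gtop G) (gtop G)) (gtop G) (\<lambda>(x, y). x \<otimes> y)"
  using topological_group by (simp add: topological_group_def)
 ultimately have "continuous_map X (gtop G) ((\<lambda>(x, y). x \<otimes> y) o (\<lambda>x. (f x, g x)))" by (rule continuous_map_compose)
 then show ?thesis by (simp add: o_def)
qed

lemma continuous_map_inv:
 assumes "continuous_map X (gtop G) f" shows "continuous_map X (gtop G) (\<lambda>x. inv (f x))"
 using continuous_map_compose[OF assms, of "gtop G" "\<lambda>x. inv x"] topological_group
 by (simp add: o_def topological_group_def)

lemma continuous_map_const_G: "c : carrier G ==> continuous_map X (gtop G) (\<lambda>x. c)" by simp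

lemmas continuous_intros_G =
 continuous_map_mult continuous_map_inv continuous_map_const_G continuous_map_id[unfolded id_def]

lemma continuous_preimage:
 assumes "continuous_map X Y f" "openin Y S" shows "openin X {x : topspace X. f x : S}"
 using assms by (simp add: continuous_map_def)

lemma closed_preimage:
 assumes "continuous_map X Y f" "closedin Y S" shows "closedin X {x : topspace X. f x : S}"
 using assms by (simp add: continuous_map_closedin)

lemma lmult_image_eq:
 assumes "g : carrier G" "S \<subseteq> carrier G" shows "(\<lambda>x. g \<otimes> x) ` S = {x : carrier G. inv g \<otimes> x : S}"
proof (intro equalityI subsetI)
 fix x assume "x : (\<lambda>x. g \<otimes> x) ` S"
 then show "x : {x : carrier G. inv g \<otimes> x : S}"
  using assms by (auto simp: inv_solve_left' m_assoc[symmetric] subset_iff)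
next
 fix x assume "x : {x : carrier G. inv g \<otimes> x : S}"
 then show "x : (\<lambda>x. g \<otimes> x) ` S" using assms by (intro image_eqI[of _ _ "inv g \<otimes> x"]) (auto simp: m_assoc[symmetric])
qed

lemma openin_lmult:
 assumes "g : carrier G" "openin (gtop G) S" shows "openin (gtop G) ((\<lambda>x. g \<otimes> x) ` S)"
proof -
 have "continuous_map (gtop G) (gtop G) (\<lambda>x. inv g \<otimes> x)" using assms(1) by (intro continuous_intros_G) simp
 from continuous_preimage[OF this assms(2)] show ?thesis using assms open_subset by (simp add: lmult_image_eq)
qed

lemma closedin_lmult:
 assumes "g : carrier G" "closedin (gtop G) S" shows "closedin (gtop G) ((\<lambda>x. g \<otimes> x) ` S)"
proof -
 have "continuous_map (gtop G) (gtop G) (\<lambda>x. inv g \<otimes> x)" using assms(1) by (intro continuous_intros_G) simp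
 from closed_preimage[OF this assms(2)] show ?thesis using assms closed_subset by (simp add: lmult_image_eq)
qed

lemma openin_conj_vimage:
 assumes "g : carrier G" "openin (gtop G) S" shows "openin (gtop G) {x : carrier G. g \<otimes> x \<otimes> inv g : S}"
proof -
 have "continuous_map (gtop G) (gtop G) (\<lambda>x. g \<otimes> x \<otimes> inv g)" using assms(1) by (intro continuous_intros_G) simp_all
 from continuous_preimage[OF this assms(2)] show ?thesis by simp
qed

text \<open>The subgroup is the union of the translates of the neighbourhood \<open>W\<close> by its
  own elements.\<close>

lemma open_subgroupI:
 assumes "subgroup H G" "openin (gtop G) W" "\<one> : W" "W \<subseteq> H" shows "open_subgroup H G"
proof -
 have "openin (gtop G) (\<Union>h\<in>H. (\<lambda>x. h \<otimes> x) ` W)"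
  using assms subgroup.mem_carrier by (intro openin_Union) (auto intro!: openin_lmult)
 moreover have "(\<Union>h\<in>H. (\<lambda>x. h \<otimes> x) ` W) = H"
 proof (intro equalityI subsetI)
  fix h assume "h : H"
  then show "h : (\<Union>h\<in>H. (\<lambda>x. h \<otimes> x) ` W)"
   using assms(1,3) by (intro UN_I[of h] image_eqI[of _ _ \<one>]) (auto dest: subgroup.mem_carrier)
 next
  fix x assume "x : (\<Union>h\<in>H. (\<lambda>x. h \<otimes> x) ` W)"
  then show "x : H" using assms by (auto simp: subset_iff subgroup.m_closed)
 qed
 ultimately show ?thesis using assms(1) by (simp add: open_subgroup_def)
qed

lemma coset_mem_iff:
 assumes "subgroup H G" "a : carrier G" "b : carrier G" "inv a \<otimes> b : H" shows "a : H \<longleftrightarrow> b : H"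
proof -
 have "b = a \<otimes> (inv a \<otimes> b)" using assms by (simp add: m_assoc[symmetric])
 moreover have "a = b \<otimes> inv (inv a \<otimes> b)" using assms by (simp add: inv_mult_group m_assoc[symmetric])
 ultimately show ?thesis using assms by (metis subgroup.m_closed subgroup.m_inv_closed)
qed

text \<open>The complement is a union of left cosets, which are open.\<close>

lemma closedin_open_subgroup:
 assumes "open_subgroup H G" shows "closedin (gtop G) H"
proof -
 have H: "subgroup H G" "openin (gtop G) H" using assms by (auto simp: open_subgroup_def)
 have "carrier G - H = (\<Union>x\<in>carrier G - H. (\<lambda>y. x \<otimes> y) ` H)"
 proof (intro equalityI subsetI)
  fix x assume "x : carrier G - H"
  then show "x : (\<Union>x\<in>carrier G - H. (\<lambda>y. x \<otimes> y) ` H)"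
   using subgroup.one_closed[OF H(1)] by (intro UN_I[of x] image_eqI[of _ _ \<one>]) auto
 next
  fix x assume "x : (\<Union>x\<in>carrier G - H. (\<lambda>y. x \<otimes> y) ` H)"
  then obtain a b where ab: "a : carrier G - H" "b : H" "x = a \<otimes> b" by auto
  then have "b : carrier G" using H subgroup.mem_carrier by auto
  then have "inv a \<otimes> x : H" "x : carrier G" using ab by (auto simp: m_assoc[symmetric])
  then show "x : carrier G - H" using coset_mem_iff[OF H(1), of a x] ab by auto
 qed
 moreover have "openin (gtop G) (\<Union>x\<in>carrier G - H. (\<lambda>y. x \<otimes> y) ` H)"
  using H by (intro openin_Union) (auto intro!: openin_lmult)
 ultimately show ?thesis using subgroup.subset[OF H(1)] by (simp add: closedin_def)
qed

text \<open>\<open>J\<close> meets every left coset of \<open>C\<close>, so \<open>C\<close> has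
  finite index, and the intersection of its conjugates by the finitely many elements of
  \<open>J\<close> is open. It is also the normal core of \<open>C\<close>, hence takes part in the
  intersection that defines the residual.\<close>

lemma residual_subset_finite_index:
 assumes "open_subgroup C G" "finite J" "J \<subseteq> carrier G"
  "!!x. x : carrier G ==> \<exists>g\<in>J. inv g \<otimes> x : C" shows "discrete_residual G \<subseteq> C"
proof -
 have C: "subgroup C G" "openin (gtop G) C" using assms(1) by (auto simp: open_subgroup_def)
 note Ci = subgroup.m_closed[OF C(1)] subgroup.m_inv_closed[OF C(1)]
 let ?P = "\<lambda>g. {y : carrier G. inv g \<otimes> y \<otimes> g : C}"
 define N where "N = carrier G \<inter> (\<Inter>g\<in>J. ?P g)"
 \<comment> \<open>Openness needs the finite description by \<open>J\<close>, normality the one by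
   all conjugates. They agree because every g is an element of \<open>J\<close> times an element of
   \<open>C\<close>.\<close>
 have N: "y : N \<longleftrightarrow> y : carrier G \<and> (\<forall>g\<in>carrier G. inv g \<otimes> y \<otimes> g : C)" for y
 proof
  assume y: "y : N"
  have "inv g \<otimes> y \<otimes> g : C" if g: "g : carrier G" for g
  proof -
   obtain a where a: "a : J" "inv a \<otimes> g : C" using assms(4)[OF g] by blast
   then have "inv (inv a \<otimes> g) \<otimes> (inv a \<otimes> y \<otimes> a) \<otimes> (inv a \<otimes> g) : C" using y Ci by (auto simp: N_def)
   then show ?thesis using a(1) g y assms(3) by (simp add: group_simps subset_iff N_def)
  qed
  then show "y : carrier G \<and> (\<forall>g\<in>carrier G. inv g \<otimes> y \<otimes> g : C)" using y by (simp add: N_def)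
 qed (use assms(3) in \<open>auto simp: N_def\<close>)
 have "openin (gtop G) (?P g)" if "g : J" for g using openin_conj_vimage[of "inv g" C] that assms(3) C(2) by auto
 then have "openin (gtop G) N" using assms(2) openin_topspace[of "gtop G"] unfolding N_def by (cases "J = {}") auto
 moreover have "N \<lhd> G" unfolding normal_inv_iff
 proof (intro conjI ballI subgroupI)
  have "\<one> : N" using subgroup.one_closed[OF C(1)] by (simp add: N)
  then show "N \<noteq> {}" by blast
  show "inv a : N" if a: "a : N" for a
  proof -
   have "inv g \<otimes> inv a \<otimes> g = inv (inv g \<otimes> a \<otimes> g)" if "g : carrier G" for g using a that by (simp add: group_simps N)
   then show ?thesis using a Ci by (simp add: N)
  qed
  show "a \<otimes> b : N" if a: "a : N" "b : N" for a b
  proof -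
   have "inv g \<otimes> (a \<otimes> b) \<otimes> g = (inv g \<otimes> a \<otimes> g) \<otimes> (inv g \<otimes> b \<otimes> g)" if "g : carrier G" for g
    using a that by (simp add: group_simps N)
   then show ?thesis using a Ci by (simp add: N)
  qed
  show "a \<otimes> y \<otimes> inv a : N" if a: "a : carrier G" "y : N" for a y
  proof -
   have "inv g \<otimes> (a \<otimes> y \<otimes> inv a) \<otimes> g = inv (inv a \<otimes> g) \<otimes> y \<otimes> (inv a \<otimes> g)" if "g : carrier G" for g
    using a that by (simp add: group_simps N)
   then show ?thesis using a by (simp add: N)
  qed
 qed (auto simp: N)
 ultimately have "discrete_residual G \<subseteq> N" by (auto simp: discrete_residual_def)
 also have "N \<subseteq> C" using N by force
 finally show ?thesis .
qed

lemma compact_coset_cover: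
 assumes "compactin (gtop G) C" "open_subgroup W G"
 obtains M where "finite M" "M \<subseteq> C" "!!x. x : C ==> \<exists>g\<in>M. inv g \<otimes> x : W"
proof -
 have W: "subgroup W G" "openin (gtop G) W" "W \<subseteq> carrier G"
  using assms(2) by (auto simp: open_subgroup_def dest: subgroup.subset)
 have C: "C \<subseteq> carrier G" using compactin_subset_topspace[OF assms(1)] by simp
 have "openin (gtop G) ((\<lambda>x. g \<otimes> x) ` W)" if "g : C" for g using that C W(2) by (intro openin_lmult) auto
 moreover have "C \<subseteq> (\<Union>g\<in>C. (\<lambda>x. g \<otimes> x) ` W)"
 proof
  fix x assume "x : C"
  moreover have "x : (\<lambda>y. x \<otimes> y) ` W"
   using calculation C subgroup.one_closed[OF W(1)] by (intro image_eqI[of _ _ \<one>]) auto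
  ultimately show "x : (\<Union>g\<in>C. (\<lambda>x. g \<otimes> x) ` W)" by (rule UN_I)
 qed
 ultimately have "\<exists>M. finite M \<and> M \<subseteq> C \<and> C \<subseteq> (\<Union>g\<in>M. (\<lambda>x. g \<otimes> x) ` W)"
  by (rule compactin_finite_subfamily[OF assms(1)])
 then obtain M where M: "finite M" "M \<subseteq> C" "C \<subseteq> (\<Union>g\<in>M. (\<lambda>x. g \<otimes> x) ` W)" by auto
 have "\<exists>g\<in>M. inv g \<otimes> x : W" if x: "x : C" for x
 proof -
  obtain g y where gy: "g : M" "y : W" "x = g \<otimes> y" using M(3) x by blast
  then have "inv g \<otimes> x = y" using M(2) C W(3) by (auto simp: inv_cancel subset_iff)
  then show ?thesis using gy(1,2) by blast
 qed
 then show thesis using that M by blast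
qed

lemma top_group_subgrp:
 assumes "subgroup H G" shows "topological_group (subgrp G H)" unfolding topological_group_def
proof (intro conjI)
 show "group (subgrp G H)" by (rule group_subgrp[OF is_group assms])
 show "topspace (gtop (subgrp G H)) = carrier (subgrp G H)" using subgroup.subset[OF assms] by auto
 have H: "H \<subseteq> carrier G" using subgroup.subset[OF assms] .
 have p: "prod_topology (subtopology (gtop G) H) (subtopology (gtop G) H)
   = subtopology (prod_topology (gtop G) (gtop G)) (H \<times> H)" by (simp add: subtopology_Times)
 show "continuous_map (prod_topology (gtop (subgrp G H)) (gtop (subgrp G H))) (gtop (subgrp G H))
   (\<lambda>(x, y). x \<otimes>\<^bsub>subgrp G H\<^esub> y)"
  using topological_group subgroup.m_closed[OF assms] unfolding subgrp_sel p topological_group_def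
  by (auto simp: continuous_map_in_subtopology intro: continuous_map_from_subtopology)
 have "continuous_map (subtopology (gtop G) H) (subtopology (gtop G) H) (\<lambda>x. inv x)"
  using topological_group subgroup.m_inv_closed[OF assms] unfolding topological_group_def
  by (auto simp: continuous_map_in_subtopology intro: continuous_map_from_subtopology)
 then show "continuous_map (gtop (subgrp G H)) (gtop (subgrp G H)) (m_inv (subgrp G H))"
  unfolding subgrp_sel by (rule continuous_map_eq) (use H in \<open>auto simp: inv_subgrp[OF is_group assms]\<close>)
qed

end

text \<open>
 For closed subgroups of a group of this kind the existence of small compact open subgroups is
 inherited, so that van Dantzig's theorem is not needed.
\<close>

definition tdlc_group :: "'a tgroup => bool" where
 "tdlc_group G \<longleftrightarrow> topological_group G \<and> Hausdorff_space (gtop G) \<and> second_countable (gtop G) \<and>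
   (\<forall>W. openin (gtop G) W \<and> \<one>\<^bsub>G\<^esub> : W -->
    (\<exists>C. open_subgroup C G \<and> compactin (gtop G) C \<and> C \<subseteq> W))"

locale tdlc = top_group +
 assumes tdlc_group: "tdlc_group G"
begin

lemma Hausdorff: "Hausdorff_space (gtop G)" using tdlc_group by (simp add: tdlc_group_def)

lemma second_countable: "second_countable (gtop G)" using tdlc_group by (simp add: tdlc_group_def)

lemma small_compact_open:
 assumes "openin (gtop G) W" "\<one> : W"
 obtains C where "open_subgroup C G" "compactin (gtop G) C" "C \<subseteq> W"
 using tdlc_group assms by (auto simp: tdlc_group_def)

lemma compact_open:
 obtains C where "open_subgroup C G" "compactin (gtop G) C"
 using small_compact_open[of "carrier G"] by (metis one_closed openin_topspace topspace)

lemma closed_singleton: "x : carrier G ==> closedin (gtop G) {x}"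
 using Hausdorff_imp_t1_space[OF Hausdorff] t1_space_closedin_singleton by (metis topspace)

lemma separating_open_subgroup:
 assumes "x : carrier G" "x \<noteq> \<one>"
 obtains C where "open_subgroup C G" "compactin (gtop G) C" "x \<notin> C"
proof -
 have "openin (gtop G) (carrier G - {x})"
  using closed_singleton[OF assms(1)] by (metis openin_diff openin_topspace topspace)
 then show thesis using small_compact_open[of "carrier G - {x}"] assms that by auto
qed

lemma tdlcsc: "tdlcsc G" unfolding tdlcsc_def
proof (intro conjI ballI)
 fix x assume x: "x : carrier G"
 show "connected_component_of_set (gtop G) x = {x}"
 proof (intro equalityI subsetI)
  fix y assume "y : connected_component_of_set (gtop G) x"
  then obtain T where T: "connectedin (gtop G) T" "x : T" "y : T" by (auto simp: connected_component_of_def)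
  then have y: "y : carrier G" using connectedin_subset_topspace by fastforce
  show "y : {x}"
  proof (rule ccontr)
   assume "y \<notin> {x}"
   \<comment> \<open>An open subgroup missing this element gives a clopen coset that contains x but
     not y.\<close>
   then have "inv x \<otimes> y \<noteq> \<one>" using x y by (metis inv_equality inv_inv inv_closed singletonI)
   then obtain C where C: "open_subgroup C G" "compactin (gtop G) C" "inv x \<otimes> y \<notin> C"
    using separating_open_subgroup[of "inv x \<otimes> y"] x y by auto
   let ?S = "(\<lambda>z. x \<otimes> z) ` C"
   have CG: "C \<subseteq> carrier G" and C1: "\<one> : C" using C by (auto simp: open_subgroup_def subgroup.subset subgroup.one_closed)
   have "openin (gtop G) ?S" "closedin (gtop G) ?S"
    using C closedin_open_subgroup x by (auto intro!: openin_lmult closedin_lmult simp: open_subgroup_def)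
   then have "T \<subseteq> ?S \<or> disjnt T ?S" using connectedin_clopen_cases[OF T(1)] by blast
   moreover have "x : ?S" using x C1 by (auto intro!: image_eqI[of _ _ \<one>])
   moreover have "y \<notin> ?S" using C(3) x y CG by (auto simp: lmult_image_eq)
   ultimately show False using T by (auto simp: disjnt_def)
  qed
 next
  fix y assume "y : {x}"
  then show "y : connected_component_of_set (gtop G) x" using x by (simp add: connected_component_of_refl)
 qed
next
 show "locally_compact_space (gtop G)" unfolding locally_compact_space_def
 proof
  fix x assume x: "x : topspace (gtop G)"
  obtain C where C: "open_subgroup C G" "compactin (gtop G) C" by (rule compact_open)
  have "continuous_map (gtop G) (gtop G) (\<lambda>z. x \<otimes> z)" using x by (intro continuous_intros_G) auto
  then have "compactin (gtop G) ((\<lambda>z. x \<otimes> z) ` C)" using C(2) image_compactin by blast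
  moreover have "openin (gtop G) ((\<lambda>z. x \<otimes> z) ` C)" using C x by (auto intro!: openin_lmult simp: open_subgroup_def)
  moreover have "x : (\<lambda>z. x \<otimes> z) ` C"
   using C x by (intro image_eqI[of _ _ \<one>]) (auto simp: open_subgroup_def subgroup.one_closed)
  ultimately show "\<exists>U K. openin (gtop G) U \<and> compactin (gtop G) K \<and> x : U \<and> U \<subseteq> K" by blast
 qed
qed (use topological_group Hausdorff second_countable in auto)

text \<open>A compact open subgroup of the big group meets the closed subgroup \<open>H\<close> in a
  compact and relatively open one.\<close>

lemma tdlc_subgrp:
 assumes "closed_subgroup H G" shows "tdlc (subgrp G H)"
proof -
 have H: "subgroup H G" "closedin (gtop G) H" using assms by (auto simp: closed_subgroup_def)
 interpret H: top_group "subgrp G H" by unfold_locales (rule top_group_subgrp[OF H(1)])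
 have "\<exists>C. open_subgroup C (subgrp G H) \<and> compactin (gtop (subgrp G H)) C \<and> C \<subseteq> W"
  if "openin (gtop (subgrp G H)) W" "\<one>\<^bsub>subgrp G H\<^esub> : W" for W
 proof -
  obtain W' where W': "openin (gtop G) W'" "W = W' \<inter> H"
   using \<open>openin (gtop (subgrp G H)) W\<close> by (auto simp: openin_subtopology)
  then have "\<one> : W'" using that by simp
  then obtain C where C: "open_subgroup C G" "compactin (gtop G) C" "C \<subseteq> W'" using small_compact_open W' by blast
  have "subgroup (C \<inter> H) G" using C(1) H(1) by (auto simp: open_subgroup_def intro: subgroups_Inter_pair)
  moreover have "openin (subtopology (gtop G) H) (C \<inter> H)"
   using C(1) by (auto simp: open_subgroup_def openin_subtopology)
  moreover have "compactin (subtopology (gtop G) H) (C \<inter> H)"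
   using closed_Int_compactin[OF H(2) C(2)] by (simp add: compactin_subtopology Int_commute)
  ultimately show ?thesis using C(3) W' by (intro exI[of _ "C \<inter> H"])
    (auto simp: open_subgroup_def subgroup_subgrp_iff[OF is_group H(1)])
 qed
 then have "tdlc_group (subgrp G H)" using H.topological_group Hausdorff second_countable
  by (auto simp: tdlc_group_def Hausdorff_space_subtopology second_countable_subtopology)
 then show ?thesis by unfold_locales
qed

end

section \<open>The decomposition rank\<close>

lemma zero_add_one_omega1 [simp]: "(0 :: omega1) + 1 = 1"
proof (rule antisym)
 show "(0 :: omega1) + 1 \<le> 1" using less_one_iff_omega1 ord_add_bounds(3)[of 0 1 1] by (simp add: less_one_iff_omega1)
 show "1 \<le> (0 :: omega1) + 1" by (metis less_add_one_iff_omega1 less_one_iff_omega1 not_le zero_le_omega1)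
qed

lemma add_one_le_iff_omega1 [simp]: "(\<alpha> :: omega1) + 1 \<le> \<beta> + 1 \<longleftrightarrow> \<alpha> \<le> \<beta>"
 by (metis less_add_one_iff_omega1 not_le less_imp_le order_refl le_less_trans less_le_not_le)

lemma add_one_le_iff_less_omega1: "(\<alpha> :: omega1) + 1 \<le> \<beta> \<longleftrightarrow> \<alpha> < \<beta>" by (metis less_add_one_iff_omega1 not_le)

lemma one_le_add_one_omega1 [simp]: "(1 :: omega1) \<le> \<alpha> + 1"
 by (metis add_one_le_iff_omega1 zero_add_one_omega1 zero_le_omega1)

lemma bdd_above_seq_omega1 [simp]: "bdd_above (range (\<rho> :: nat => omega1))" by (intro bdd_above_countable_omega1) simp

lemma SUP_seq_upper_omega1: "\<rho> i \<le> (SUP i::nat. \<rho> i :: omega1)" by (rule cSUP_upper) simp_all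

lemma SUP_seq_least_omega1: "(!!i. \<rho> i \<le> \<alpha>) ==> (SUP i::nat. \<rho> i :: omega1) \<le> \<alpha>" by (rule cSUP_least) simp_all

section \<open>Continuous homomorphisms and the discrete residual\<close>

definition cont_hom :: "'a tgroup => 'b tgroup => ('a => 'b) set" where
 "cont_hom G H = {\<pi> : hom G H. continuous_map (gtop G) (gtop H) \<pi>}"

lemma cont_hom_subgrp:
 assumes "\<pi> : cont_hom G Q" "T \<subseteq> carrier G" "\<pi> ` T \<subseteq> S" shows "\<pi> : cont_hom (subgrp G T) (subgrp Q S)" using assms
 by (auto simp: cont_hom_def hom_def subset_iff continuous_map_in_subtopology
   intro!: continuous_map_from_subtopology)

lemma cont_hom_closed: "\<pi> : cont_hom G Q ==> x : carrier G ==> \<pi> x : carrier Q" by (auto simp: cont_hom_def hom_def)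

lemma cont_hom_group_hom: "group G ==> group Q ==> \<pi> : cont_hom G Q ==> group_hom G Q \<pi>"
 by (auto simp: cont_hom_def group_hom_def group_hom_axioms_def)

lemma tdlcsc_top_group: "tdlcsc G ==> top_group G" by (simp add: top_group_def tdlcsc_def)

lemma cont_hom_preimage_open_normal:
 assumes "topological_group G" "topological_group Q" "\<pi> : cont_hom G Q" "N \<lhd> Q" "openin (gtop Q) N"
 shows "{x : carrier G. \<pi> x : N} \<lhd> G" "openin (gtop G) {x : carrier G. \<pi> x : N}"
proof -
 interpret G: top_group G using assms(1) by unfold_locales
 interpret Q: top_group Q using assms(2) by unfold_locales
 interpret h: group_hom G Q \<pi> by (rule cont_hom_group_hom) (use assms in \<open>auto intro: G.is_group Q.is_group\<close>)
 have N: "subgroup N Q" "!!x h. x : carrier Q ==> h : N ==> x \<otimes>\<^bsub>Q\<^esub> h \<otimes>\<^bsub>Q\<^esub> inv\<^bsub>Q\<^esub> x : N"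
  using assms(4) by (auto simp: Q.normal_inv_iff)
 show "{x : carrier G. \<pi> x : N} \<lhd> G"
  using N by (auto simp: G.normal_inv_iff subgroup.one_closed subgroup.m_closed subgroup.m_inv_closed
    intro!: G.subgroupI exI[of _ "\<one>\<^bsub>G\<^esub>"])
 show "openin (gtop G) {x : carrier G. \<pi> x : N}"
  using assms(3,5) G.continuous_preimage[of "gtop G" "gtop Q" \<pi> N] by (simp add: cont_hom_def)
qed

text \<open>Preimages of open normal subgroups are open and normal. Every comparison of ranks below
  rests on this functoriality of the residual.\<close>

lemma residual_hom:
 assumes "topological_group G" "topological_group Q" "\<pi> : cont_hom G Q"
 shows "\<pi> ` discrete_residual G \<subseteq> discrete_residual Q"
 using cont_hom_preimage_open_normal[OF assms] unfolding discrete_residual_def by blast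

lemma id_cont_hom_subgrp:
 "T \<subseteq> S ==> (\<lambda>x. x) : cont_hom (subgrp G T) (subgrp G S)"
 by (auto simp: cont_hom_def hom_def continuous_map_in_subtopology
   intro!: continuous_map_from_subtopology)

context top_group
begin

lemma normal_carrier: "carrier G \<lhd> G" using normal_inv_iff subgroup_self by auto

lemma open_normal_carrier: "carrier G \<lhd> G \<and> openin (gtop G) (carrier G)"
 using normal_carrier openin_topspace[of "gtop G"] by simp

lemma residual_subset: "discrete_residual G \<subseteq> carrier G"
 using open_normal_carrier by (auto simp: discrete_residual_def)

lemma normal_residual: "discrete_residual G \<lhd> G" unfolding normal_inv_iff
proof (intro conjI ballI)
 show "subgroup (discrete_residual G) G" unfolding discrete_residual_def
  using open_normal_carrier by (intro subgroups_Inter) (auto simp: normal_inv_iff)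
 show "x \<otimes> h \<otimes> inv x : discrete_residual G" if "x : carrier G" "h : discrete_residual G" for x h
  using that by (auto simp: discrete_residual_def normal_inv_iff)
qed

lemma closed_normal_residual: "closed_normal (discrete_residual G) G"
proof -
 have "closedin (gtop G) (discrete_residual G)" unfolding discrete_residual_def using open_normal_carrier
  by (intro closedin_Inter) (auto intro!: closedin_open_subgroup simp: open_subgroup_def normal_inv_iff)
 then show ?thesis using normal_residual by (simp add: closed_normal_def)
qed

lemma closed_subgroup_residual: "closed_subgroup (discrete_residual G) G"
 using closed_normal_residual by (simp add: closed_normal_def closed_subgroup_def normal_inv_iff)

lemma closed_subgroup_trans:
 assumes "closed_subgroup H G" "closed_subgroup K (subgrp G H)" shows "closed_subgroup K G"
 using assms subgroup_subgrp_iff[OF is_group, of H K] by (auto simp: closed_subgroup_def intro: closedin_trans_full)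

lemma closed_open_subgroup: "open_subgroup H G ==> closed_subgroup H G"
 using closedin_open_subgroup by (simp add: closed_subgroup_def open_subgroup_def)

lemma generate_subgrp:
 assumes "subgroup H G" "C \<subseteq> H" shows "generate (subgrp G H) C = generate G C"
proof
 interpret H: top_group "subgrp G H" by unfold_locales (rule top_group_subgrp[OF assms(1)])
 have "subgroup (generate (subgrp G H) C) G"
  using H.generate_is_subgroup[of C] assms by (simp add: subgroup_subgrp_iff[OF is_group])
 then show "generate G C \<subseteq> generate (subgrp G H) C" by (intro generate_subgroup_incl) (auto intro: generate.incl)
 have "subgroup (generate G C) (subgrp G H)"
  using generate_is_subgroup[of C] generate_subgroup_incl[OF assms(2,1)] assms subgroup.subset[OF assms(1)]
  by (simp add: subgroup_subgrp_iff[OF is_group])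
 then show "generate (subgrp G H) C \<subseteq> generate G C" by (intro H.generate_subgroup_incl) (auto intro: generate.incl)
qed

lemma compactly_generated_subgrp:
 assumes "compactin (gtop G) C" shows "compactly_generated (subgrp G (generate G C))"
proof -
 have C: "C \<subseteq> carrier G" using assms compactin_subset_topspace by fastforce
 have "subgroup (generate G C) G" by (rule generate_is_subgroup[OF C])
 moreover have "C \<subseteq> generate G C" by (auto intro: generate.incl)
 ultimately show ?thesis using assms by (auto simp: compactly_generated_def compactin_subtopology generate_subgrp)
qed

text \<open>The image of a compact generating set is covered by finitely many of the open groups
  \<open>S i\<close>, hence by the largest of these.\<close>

lemma compactly_generated_subset_directed_union:
 assumes "compactly_generated G" "topological_group Q" "\<pi> : cont_hom G Q" "incseq S" 
  "!!i. open_subgroup (S i) Q" "(\<Union>i. S i) = carrier Q" shows "\<exists>i :: nat. \<pi> ` carrier G \<subseteq> S i"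
proof -
 interpret Q: top_group Q using assms(2) by unfold_locales
 interpret h: group_hom G Q \<pi> by (rule cont_hom_group_hom) (use assms in \<open>auto intro: is_group Q.is_group\<close>)
 obtain C where C: "compactin (gtop G) C" "generate G C = carrier G"
  using assms(1) by (auto simp: compactly_generated_def)
 have CG: "C \<subseteq> carrier G" using C compactin_subset_topspace by fastforce
 have "compactin (gtop Q) (\<pi> ` C)" using C assms(3) by (auto simp: cont_hom_def intro: image_compactin)
 moreover have "\<pi> ` C \<subseteq> (\<Union>i. S i)" using CG assms(6) by (auto intro: h.hom_closed)
 ultimately have "\<exists>J. finite J \<and> J \<subseteq> UNIV \<and> \<pi> ` C \<subseteq> (\<Union>i\<in>J. S i)"
  using assms(5) by (intro compactin_finite_subfamily) (auto simp: open_subgroup_def)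
 then obtain J where J: "finite J" "\<pi> ` C \<subseteq> (\<Union>i\<in>J. S i)" by blast
 define m where "m = Max (insert 0 J)"
 have "S j \<subseteq> S m" if "j : J" for j using J that assms(4) by (intro incseqD[of S]) (auto simp: m_def)
 then have "\<pi> ` C \<subseteq> S m" using J(2) by blast
 then have "generate Q (\<pi> ` C) \<subseteq> S m"
  using assms(5) by (intro Q.generate_subgroup_incl) (simp_all add: open_subgroup_def)
 then show ?thesis using h.generate_img[OF CG] C(2) by auto
qed

end

text \<open>Second countable spaces are Lindelof, so countably many of the open left cosets already
  cover the group.\<close>

lemma (in tdlc) countable_coset_cover:
 assumes "open_subgroup C G"
 obtains J where "countable J" "J \<subseteq> carrier G" "!!x. x : carrier G ==> \<exists>g\<in>J. inv g \<otimes> x : C"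
proof -
 have C: "subgroup C G" "openin (gtop G) C" "C \<subseteq> carrier G"
  using assms by (auto simp: open_subgroup_def dest: subgroup.subset)
 have "Lindelof_space (gtop G)" by (rule second_countable_imp_Lindelof_space[OF second_countable])
 moreover have "\<forall>U\<in>(\<lambda>g. (\<lambda>x. g \<otimes> x) ` C) ` carrier G. openin (gtop G) U" using C by (auto intro: openin_lmult)
 moreover have "\<Union> ((\<lambda>g. (\<lambda>x. g \<otimes> x) ` C) ` carrier G) = topspace (gtop G)"
 proof (intro equalityI subsetI)
  fix x assume "x : topspace (gtop G)"
  then show "x : \<Union> ((\<lambda>g. (\<lambda>x. g \<otimes> x) ` C) ` carrier G)"
   using subgroup.one_closed[OF C(1)] by (auto intro!: bexI[of _ x] image_eqI[of _ _ \<one>])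
 qed (use C in auto)
 ultimately obtain V where V: "countable V" "V \<subseteq> (\<lambda>g. (\<lambda>x. g \<otimes> x) ` C) ` carrier G" "\<Union>V = topspace (gtop G)"
  unfolding Lindelof_space_def by meson
 then obtain J where J: "countable J" "J \<subseteq> carrier G" "V = (\<lambda>g. (\<lambda>x. g \<otimes> x) ` C) ` J"
  by (meson countable_subset_image)
 have "\<exists>g\<in>J. inv g \<otimes> x : C" if "x : carrier G" for x
 proof -
  have "x : \<Union>V" using that V by simp
  then obtain g y where "g : J" "y : C" "x = g \<otimes> y" unfolding J(3) by auto
  moreover from this have "inv g \<otimes> x = y" using J C by (auto simp: m_assoc[symmetric] subset_iff)
  ultimately show ?thesis by (intro bexI[of _ g]) simp_all
 qed
 with J show thesis using that by blast
qed

text \<open>\<open>S i\<close> is generated by a compact open subgroup, the set \<open>D\<close> and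
  an initial piece of a countable list of coset representatives. Placing \<open>D\<close> in every
  term lets a prescribed compact set be caught by a single compactly generated open
  subgroup.\<close>

lemma (in tdlc) compactly_generated_exhaustion:
 assumes "compactin (gtop G) D"
 obtains S :: "nat => 'a set" where "incseq S" "!!i. open_subgroup (S i) G" "(\<Union>i. S i) = carrier G"
  "!!i. compactly_generated (subgrp G (S i))" "!!i. D \<subseteq> S i"
proof -
 obtain C where C: "open_subgroup C G" "compactin (gtop G) C" by (rule compact_open)
 have C1: "\<one> : C" "C \<subseteq> carrier G" using C by (auto simp: open_subgroup_def subgroup.one_closed subgroup.subset)
 have D: "D \<subseteq> carrier G" using assms compactin_subset_topspace by fastforce
 obtain J where J: "countable J" "J \<subseteq> carrier G" "!!x. x : carrier G ==> \<exists>g\<in>J. inv g \<otimes> x : C"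
  by (rule countable_coset_cover[OF C(1)], rule that)
 have "J \<noteq> {}" using J(3)[of \<one>] by auto
 then have rJ: "range (from_nat_into J) = J" using J by (simp add: range_from_nat_into)
 define X where "X i = C \<union> D \<union> from_nat_into J ` {..i}" for i :: nat
 have fin: "compactin (gtop G) (from_nat_into J ` {..i})" for i using rJ J(2) by (intro finite_imp_compactin) auto
 have X: "compactin (gtop G) (X i)" "X i \<subseteq> carrier G" for i
  using fin C assms C1 D rJ J(2) unfolding X_def by (auto intro!: compactin_Un)
 define S where "S i = generate G (X i)" for i
 have S: "subgroup (S i) G" for i unfolding S_def by (rule generate_is_subgroup[OF X(2)])
 have XS: "X i \<subseteq> S i" for i unfolding S_def by (auto intro: generate.incl)
 show thesis
 proof (rule that[of S])
  show "incseq S" unfolding S_def by (intro monoI mono_generate) (auto simp: X_def)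
  show op: "open_subgroup (S i) G" for i
   using C C1 XS[of i] by (intro open_subgroupI[OF S, of C]) (auto simp: open_subgroup_def X_def)
  show "compactly_generated (subgrp G (S i))" for i unfolding S_def by (rule compactly_generated_subgrp[OF X(1)])
  show "D \<subseteq> S i" for i using XS[of i] by (auto simp: X_def)
  show "(\<Union>i. S i) = carrier G"
  proof (intro equalityI subsetI)
   fix x assume "x : carrier G"
   then obtain g where g: "g : J" "inv g \<otimes> x : C" "g \<otimes> (inv g \<otimes> x) = x" using J(2,3) by (meson inv_cancel(1) subsetD)
   then obtain i where "g = from_nat_into J i" using rJ by (metis image_iff)
   then have "g : S i" "inv g \<otimes> x : S i" using XS[of i] g by (auto simp: X_def)
   then show "x : (\<Union>i. S i)" using g(3) subgroup.m_closed[OF S[of i], of g "inv g \<otimes> x"] by auto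
  qed (use S subgroup.mem_carrier in fastforce)
 qed
qed

section \<open>The rank as a relation: monotonicity, uniqueness, existence\<close>

abbreviation has_rank :: "'a tgroup => omega1 => bool" where "has_rank \<equiv> has_decomposition_rank"

lemma rank_tdlcsc: "has_rank G \<alpha> ==> tdlcsc G" by (cases rule: has_decomposition_rank.cases) auto

definition cg_exhaustion :: "'a tgroup => (nat => 'a set) => bool" where
 "cg_exhaustion G S \<longleftrightarrow> incseq S \<and> (\<forall>i. open_subgroup (S i) G) \<and> (\<Union>i. S i) = carrier G \<and>
   (\<forall>i. compactly_generated (subgrp G (S i)))"

lemma cg_exhaustion_const:
 assumes "tdlcsc G" "compactly_generated G" shows "cg_exhaustion G (\<lambda>i. carrier G)"
proof -
 interpret top_group G using assms(1) by (rule tdlcsc_top_group)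
 show ?thesis using assms open_normal_carrier
  by (auto simp: cg_exhaustion_def open_subgroup_def subgrp_self subgroup_self incseq_def)
qed

text \<open>The clause for compactly generated groups is the union clause for a constant sequence,
  so two cases are left.\<close>

lemma rank_induct [consumes 1, case_names trivial union]:
 assumes "has_rank G \<alpha>" and "!!G. [|tdlcsc G; carrier G = {\<one>\<^bsub>G\<^esub>}|] ==> P G 1"
  and "!!G S \<rho>. [|tdlcsc G; carrier G \<noteq> {\<one>\<^bsub>G\<^esub>}; cg_exhaustion G S;
   !!i. has_rank (Res (subgrp G (S i))) (\<rho> i);
   !!i. P (Res (subgrp G (S i))) (\<rho> i)|] ==> P G ((SUP i. \<rho> i) + 1)" shows "P G \<alpha>" using assms(1)
proof (induction rule: has_decomposition_rank.induct)
 case (trivial G)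
 then show ?case by (rule assms(2))
next
 case (compactly_generated G \<alpha>)
 interpret top_group G using compactly_generated(1) by (rule tdlcsc_top_group)
 have "P G ((SUP i::nat. \<alpha>) + 1)" using compactly_generated cg_exhaustion_const[of G]
  by (intro assms(3)[of G "\<lambda>i. carrier G" "\<lambda>i. \<alpha>"]) (auto simp: subgrp_self)
 then show ?case by simp
next
 case (increasing_union G S \<rho>)
 then show ?case by (intro assms(3)[of G S]) (auto simp: cg_exhaustion_def)
qed

lemma rank_cases [consumes 1, case_names trivial union]:
 fixes G (structure)
 assumes "has_rank G \<alpha>"
 obtains "carrier G = {\<one>}" "\<alpha> = 1"
 | S \<rho> where "carrier G \<noteq> {\<one>}" "cg_exhaustion G S"
   "!!i. has_rank (Res (subgrp G (S i))) (\<rho> i)" "\<alpha> = (SUP i. \<rho> i) + 1"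
proof -
 have "(carrier G = {\<one>} \<and> \<alpha> = 1) \<or> (\<exists>S \<rho>. carrier G \<noteq> {\<one>} \<and> cg_exhaustion G S \<and>
   (\<forall>i. has_rank (Res (subgrp G (S i))) (\<rho> i)) \<and> \<alpha> = (SUP i. \<rho> i) + 1)"
  using assms by (induction rule: rank_induct) blast+
 then show thesis using that by blast
qed

lemma rank_union:
 assumes "tdlcsc G" "carrier G \<noteq> {\<one>\<^bsub>G\<^esub>}" "cg_exhaustion G S"
  "!!i. has_rank (Res (subgrp G (S i))) (\<rho> i)" shows "has_rank G ((SUP i. \<rho> i) + 1)"
 using assms by (intro has_decomposition_rank.increasing_union) (auto simp: cg_exhaustion_def)

lemma rank_successor:
 assumes "has_rank G \<alpha>"
 obtains \<beta> where "\<alpha> = \<beta> + 1" using assms by (cases rule: rank_cases) (metis zero_add_one_omega1)+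

text \<open>The compactly generated subgroup \<open>T\<close> lands in one member of the exhaustion,
  and the residual is functorial. This is how two unrelated exhaustions are compared.\<close>

lemma residual_cont_hom_into_exhaustion:
 assumes "topological_group H" "topological_group G" "\<pi> : cont_hom H G" "subgroup T H"
  "compactly_generated (subgrp H T)" "cg_exhaustion G S"
 obtains i where "\<pi> ` T \<subseteq> S i" "subgroup (S i) G" "\<pi> : cont_hom (Res (subgrp H T)) (Res (subgrp G (S i)))"
  "discrete_residual (subgrp H T) \<subseteq> carrier H"
proof -
 interpret H: top_group H using assms(1) by unfold_locales
 interpret G: top_group G using assms(2) by unfold_locales
 interpret T: top_group "subgrp H T" by unfold_locales (rule H.top_group_subgrp[OF assms(4)])
 have T: "T \<subseteq> carrier H" using assms(4) by (rule subgroup.subset)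
 have S: "subgroup (S i) G" for i using assms(6) by (simp add: cg_exhaustion_def open_subgroup_def)
 have "\<pi> : cont_hom (subgrp H T) (subgrp G (carrier G))"
  using assms(3) T by (intro cont_hom_subgrp) (auto intro: cont_hom_closed)
 then have "\<pi> : cont_hom (subgrp H T) G" by (simp add: subgrp_self)
 then obtain i where i: "\<pi> ` T \<subseteq> S i" using T.compactly_generated_subset_directed_union[OF assms(5) assms(2)] assms(6)
  by (force simp: cg_exhaustion_def)
 have \<pi>: "\<pi> : cont_hom (subgrp H T) (subgrp G (S i))" using cont_hom_subgrp[OF assms(3) T i] .
 then have "\<pi> ` discrete_residual (subgrp H T) \<subseteq> discrete_residual (subgrp G (S i))"
  by (intro residual_hom T.topological_group G.top_group_subgrp S)
 then have "\<pi> : cont_hom (Res (subgrp H T)) (Res (subgrp G (S i)))"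
  by (intro cont_hom_subgrp[OF \<pi>]) (use T.residual_subset in auto)
 moreover have "discrete_residual (subgrp H T) \<subseteq> carrier H" using T.residual_subset T by auto
 ultimately show thesis using i S that by blast
qed

lemma residual_subgrp_subset: "topological_group H ==> subgroup T H ==> discrete_residual (subgrp H T) \<subseteq> T"
 using top_group.residual_subset[of "subgrp H T"] top_group.top_group_subgrp[of H T] by (simp add: top_group_def)

lemma inj_trivial_codomain:
 assumes "topological_group H" "\<pi> : cont_hom H G" "inj_on \<pi> (carrier H)" "carrier G = {\<one>\<^bsub>G\<^esub>}"
 shows "carrier H = {\<one>\<^bsub>H\<^esub>}"
proof -
 interpret H: top_group H using assms(1) by unfold_locales
 have "\<pi> x = \<pi> \<one>\<^bsub>H\<^esub>" if "x : carrier H" for x using cont_hom_closed[OF assms(2)] that assms(4) by force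
 then have "x = \<one>\<^bsub>H\<^esub>" if "x : carrier H" for x using inj_onD[OF assms(3)] that H.one_closed by blast
 then show ?thesis using H.one_closed by blast
qed

text \<open>Induction on the rank of \<open>G\<close>: each residual from an exhaustion of
  \<open>H\<close> injects into a residual from the exhaustion of \<open>G\<close>. For the identity
  map, used in both directions, this says that the rank does not depend on the exhaustion.\<close>

lemma rank_mono:
 assumes "has_rank G \<alpha>" "has_rank H \<beta>"
  "\<pi> : cont_hom H G" "inj_on \<pi> (carrier H)" shows "\<beta> \<le> \<alpha>" using assms
proof (induction arbitrary: H \<beta> rule: rank_induct)
 case (trivial G)
 have "topological_group H" using trivial(3) rank_tdlcsc by (auto simp: tdlcsc_def)
 then have "carrier H = {\<one>\<^bsub>H\<^esub>}" by (rule inj_trivial_codomain[OF _ trivial(4,5,2)])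
 with trivial(3) show ?case by (cases rule: rank_cases) auto
next
 case (union G S \<rho>)
 from union(6) show ?case
 proof (cases rule: rank_cases)
  case trivial
  then show ?thesis by simp
 next
  case H: (union T \<sigma>)
  have tg: "topological_group H" "topological_group G" using union(1,6) rank_tdlcsc by (auto simp: tdlcsc_def)
  have "\<sigma> j \<le> (SUP i. \<rho> i)" for j
  proof -
   have T: "subgroup (T j) H" "compactly_generated (subgrp H (T j))"
    using H(2) by (auto simp: cg_exhaustion_def open_subgroup_def)
   obtain i where i: "\<pi> : cont_hom (Res (subgrp H (T j))) (Res (subgrp G (S i)))"
    "discrete_residual (subgrp H (T j)) \<subseteq> carrier H"
    by (rule residual_cont_hom_into_exhaustion[OF tg union(7) T union(3)])
   have "\<sigma> j \<le> \<rho> i" by (rule union(5)[OF H(3) i(1)]) (simp add: inj_on_subset[OF union(8) i(2)])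
   also have "\<dots> \<le> (SUP i. \<rho> i)" by (rule SUP_seq_upper_omega1)
   finally show ?thesis .
  qed
  then show ?thesis unfolding H(4) by (simp add: SUP_seq_least_omega1)
 qed
qed

lemma rank_unique:
 assumes "has_rank G \<alpha>" "has_rank G \<beta>" shows "\<alpha> = \<beta>"
proof -
 have "(\<lambda>x. x) : cont_hom G G" by (auto simp: cont_hom_def hom_def)
 then show ?thesis using assms rank_mono by (metis antisym inj_on_id2)
qed

lemma decomposition_rank_eq: "has_rank G \<alpha> ==> decomposition_rank G = \<alpha>"
 unfolding decomposition_rank_def using rank_unique by blast

lemma tdlc_residual:
 assumes "tdlc H" "open_subgroup T H" shows "tdlc (Res (subgrp H T))"
proof -
 interpret H: tdlc H by fact
 interpret T: tdlc "subgrp H T" by (rule H.tdlc_subgrp[OF H.closed_open_subgroup[OF assms(2)]])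
 show ?thesis by (rule T.tdlc_subgrp[OF T.closed_subgroup_residual])
qed

text \<open>An exhaustion exists, its residuals have rank at most \<beta>, and the recursion takes
  the supremum plus one. Ranks are mostly produced in this way, existence and upper bound at
  once.\<close>

lemma (in tdlc) rank_exists_le:
 assumes "!!T. [|open_subgroup T G; subgroup T G; compactly_generated (subgrp G T)|]
  ==> \<exists>\<sigma>\<le>\<beta>. has_rank (Res (subgrp G T)) \<sigma>" shows "\<exists>\<gamma>\<le>\<beta> + 1. has_rank G \<gamma>"
proof (cases "carrier G = {\<one>}")
 case True
 then show ?thesis using tdlcsc has_decomposition_rank.trivial one_le_add_one_omega1 by blast
next
 case False
 obtain T where T: "cg_exhaustion G T"
  using compactly_generated_exhaustion[of "{}"] unfolding cg_exhaustion_def by (metis compactin_empty)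
 then have "\<exists>\<sigma>\<le>\<beta>. has_rank (Res (subgrp G (T j))) \<sigma>" for j
  by (intro assms) (auto simp: cg_exhaustion_def open_subgroup_def)
 then obtain \<sigma> where \<sigma>: "!!j. \<sigma> j \<le> \<beta>" "!!j. has_rank (Res (subgrp G (T j))) (\<sigma> j)" by metis
 then show ?thesis using rank_union[OF tdlcsc False T, of \<sigma>]
  by (intro exI[of _ "(SUP i. \<sigma> i) + 1"]) (simp add: SUP_seq_least_omega1)
qed

text \<open>The comparison of \<open>rank_mono\<close> once more, except that the rank of
  \<open>H\<close> is constructed along the way; \<open>tdlc H\<close> supplies the exhaustion of
  \<open>H\<close>.\<close>

lemma rank_exists_mono:
 assumes "has_rank G \<alpha>" "tdlc H" "\<pi> : cont_hom H G" "inj_on \<pi> (carrier H)"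
 obtains \<beta> where "\<beta> \<le> \<alpha>" "has_rank H \<beta>"
proof -
 have "\<exists>\<beta>\<le>\<alpha>. has_rank H \<beta>" using assms
 proof (induction arbitrary: H rule: rank_induct)
  case (trivial G)
  interpret H: tdlc H by fact
  show ?case using inj_trivial_codomain[OF H.topological_group trivial(4,5,2)] H.tdlcsc has_decomposition_rank.trivial by blast
 next
  case (union G S \<rho>)
  interpret H: tdlc H by fact
  have tg: "topological_group G" using union(1) by (auto simp: tdlcsc_def)
  show ?case
  proof (rule H.rank_exists_le)
   fix T assume T: "open_subgroup T H" "subgroup T H" "compactly_generated (subgrp H T)"
   obtain i where i: "\<pi> : cont_hom (Res (subgrp H T)) (Res (subgrp G (S i)))" "discrete_residual (subgrp H T) \<subseteq> carrier H"
    by (rule residual_cont_hom_into_exhaustion[OF H.topological_group tg union(7) T(2,3) union(3)])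
   have "\<exists>\<sigma>\<le>\<rho> i. has_rank (Res (subgrp H T)) \<sigma>"
    by (rule union(5)[OF tdlc_residual[OF union(6) T(1)] i(1)]) (simp add: inj_on_subset[OF union(8) i(2)])
   then show "\<exists>\<sigma>\<le>(SUP i. \<rho> i). has_rank (Res (subgrp H T)) \<sigma>" using SUP_seq_upper_omega1[of \<rho> i] order_trans by blast
  qed
 qed
 then show thesis using that by blast
qed

lemma (in tdlc) rank_residual_subset:
 assumes "open_subgroup T G" "discrete_residual (subgrp G T) \<subseteq> X" "has_rank (subgrp G X) \<alpha>"
 shows "\<exists>\<beta>\<le>\<alpha>. has_rank (Res (subgrp G T)) \<beta>"
proof -
 have "(\<lambda>x. x) : cont_hom (Res (subgrp G T)) (subgrp G X)"
  using id_cont_hom_subgrp[OF assms(2), of G] residual_subgrp_subset[OF topological_group] assms(1)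
  by (simp add: subgrp_subgrp open_subgroup_def)
 then show ?thesis by (rule rank_exists_mono[OF assms(3) tdlc_residual[OF tdlc_axioms assms(1)]]) auto
qed

text \<open>\<open>T\<close> lies in some member of the exhaustion of \<open>G\<close>, so its
  residual embeds into one of those over which the supremum is taken.\<close>

lemma rank_lower_bound:
 assumes "has_rank G \<gamma>" "carrier G \<noteq> {\<one>\<^bsub>G\<^esub>}" "subgroup T G" "compactly_generated (subgrp G T)"
  "has_rank (Res (subgrp G T)) \<beta>" shows "\<beta> + 1 \<le> \<gamma>" using assms(1)
proof (cases rule: rank_cases)
 case (union S \<rho>)
 have tg: "topological_group G" using assms(1) rank_tdlcsc by (auto simp: tdlcsc_def)
 have id: "(\<lambda>x. x) : cont_hom G G" by (auto simp: cont_hom_def hom_def)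
 obtain i where "(\<lambda>x. x) : cont_hom (Res (subgrp G T)) (Res (subgrp G (S i)))"
  by (rule residual_cont_hom_into_exhaustion[OF tg tg id assms(3,4) union(2)])
 then have "\<beta> \<le> \<rho> i" using rank_mono[OF union(3) assms(5)] by (metis inj_on_id2)
 also have "\<dots> \<le> (SUP i. \<rho> i)" by (rule SUP_seq_upper_omega1)
 finally show ?thesis unfolding union(4) by simp
qed (use assms in simp)

lemma (in top_group) residual_mono:
 assumes "subgroup T G" shows "discrete_residual (subgrp G T) \<subseteq> discrete_residual G"
proof -
 interpret T: top_group "subgrp G T" by unfold_locales (rule top_group_subgrp[OF assms])
 have "(\<lambda>x. x) : cont_hom (subgrp G T) (subgrp G (carrier G))"
  using subgroup.subset[OF assms] by (rule id_cont_hom_subgrp)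
 then show ?thesis using residual_hom[OF T.topological_group topological_group, of "\<lambda>x. x"] by (simp add: subgrp_self)
qed

lemma (in top_group) closed_subgroup_kernel_family:
 assumes "!!i. i : I ==> \<pi> i : cont_hom G (Q i)" "!!i. i : I ==> tdlcsc (Q i)"
 shows "closed_subgroup {g : carrier G. \<forall>i\<in>I. \<pi> i g = \<one>\<^bsub>Q i\<^esub>} G"
proof -
 let ?K = "\<lambda>i. {g : carrier G. \<pi> i g = \<one>\<^bsub>Q i\<^esub>}"
 have K: "subgroup (?K i) G \<and> closedin (gtop G) (?K i)" if "i : I" for i
 proof -
  interpret Q: top_group "Q i" using assms(2)[OF that] by (rule tdlcsc_top_group)
  interpret h: group_hom G "Q i" "\<pi> i"
   by (rule cont_hom_group_hom) (use assms that in \<open>auto intro: is_group Q.is_group\<close>)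
  have "subgroup (?K i) G" by (rule subgroupI) auto
  moreover have "closedin (gtop (Q i)) {\<one>\<^bsub>Q i\<^esub>}" using Hausdorff_imp_t1_space assms(2)[OF that]
   by (intro t1_space_closedin_singleton[THEN iffD1, rule_format]) (auto simp: tdlcsc_def)
  then have "closedin (gtop G) (?K i)"
   using closed_preimage[of "gtop G" "gtop (Q i)" "\<pi> i" "{\<one>\<^bsub>Q i\<^esub>}"] assms(1)[OF that] by (simp add: cont_hom_def)
  ultimately show ?thesis by simp
 qed
 show ?thesis
 proof (cases "I = {}")
  case True
  then show ?thesis using subgroup_self closedin_topspace[of "gtop G"] by (simp add: closed_subgroup_def)
 next
  case False
  then have e: "{g : carrier G. \<forall>i\<in>I. \<pi> i g = \<one>\<^bsub>Q i\<^esub>} = (\<Inter>i\<in>I. ?K i)" by auto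
  show ?thesis unfolding e closed_subgroup_def using K False by (auto intro!: subgroups_Inter closedin_Inter)
 qed
qed

text \<open>
 All but finitely many coordinates of a compactly generated group lie in residually discrete
 groups, and these coordinates disappear after passing to the discrete residual. Hence each step
 of the recursion for the rank only involves finitely many of the groups \<open>Q i\<close>, and it
 lowers the ranks of all of them simultaneously.
\<close>

lemma rank_restricted_family:
 fixes G :: "'a tgroup" and Q :: "'i => 'b tgroup"
 assumes "tdlc G" "!!i. i : I ==> \<pi> i : cont_hom G (Q i)"
  "!!i. i : I ==> \<exists>\<rho>\<le>\<beta> + 1. has_rank (Q i) \<rho>"
  "!!C. compactin (gtop G) C ==> finite {i : I. \<not> (\<exists>R. subgroup R (Q i) \<and>
    discrete_residual (subgrp (Q i) R) = {\<one>\<^bsub>Q i\<^esub>} \<and> \<pi> i ` C \<subseteq> R)}"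
  "has_rank (subgrp G {g : carrier G. \<forall>i\<in>I. \<pi> i g = \<one>\<^bsub>Q i\<^esub>}) \<alpha>'" "\<alpha>' \<le> \<alpha>"
 obtains \<gamma> where "\<gamma> \<le> \<alpha> + \<beta> + 1" "has_rank G \<gamma>"
proof -
 have "\<exists>\<gamma>\<le>\<alpha> + \<beta> + 1. has_rank G \<gamma>" using assms
 proof (induction \<beta> arbitrary: G Q \<pi> I \<alpha>' rule: less_induct)
  case (less \<beta>)
  note hom = less.prems(2) and rk = less.prems(3) and cpt = less.prems(4) and
   ker = less.prems(5) and \<alpha>' = less.prems(6)
  interpret G: tdlc G by fact
  define K where "K = {g : carrier G. \<forall>i\<in>I. \<pi> i g = \<one>\<^bsub>Q i\<^esub>}"
  have Qt: "tdlcsc (Q i)" if "i : I" for i using rk[OF that] rank_tdlcsc by blast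
  then have Qg: "topological_group (Q i)" if "i : I" for i using that by (simp add: tdlcsc_def)
  have K: "closed_subgroup K G" unfolding K_def by (rule G.closed_subgroup_kernel_family[OF hom Qt])
  note ker = ker[folded K_def]
  show ?case
  proof (rule G.rank_exists_le)
   fix T assume Tj: "open_subgroup T G" "subgroup T G" "compactly_generated (subgrp G T)"
   define D where "D = discrete_residual (subgrp G T)"
   interpret T: tdlc "subgrp G T" by (rule G.tdlc_subgrp[OF G.closed_open_subgroup[OF Tj(1)]])
   have TG: "T \<subseteq> carrier G" using Tj(2) by (rule subgroup.subset)
   have DT: "D \<subseteq> T" using T.residual_subset by (simp add: D_def)
   have eqD: "Res (subgrp G T) = subgrp G D" using DT unfolding D_def by (rule subgrp_subgrp)
   have Dtd: "tdlc (subgrp G D)" using tdlc_residual[OF less.prems(1) Tj(1)] unfolding eqD .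
   interpret D: tdlc "subgrp G D" by fact
   obtain C where C: "compactin (gtop (subgrp G T)) C" "generate (subgrp G T) C = T"
    using Tj(3) by (auto simp: compactly_generated_def)
   have CT: "C \<subseteq> T" "compactin (gtop G) C" using C by (auto simp: compactin_subtopology)
   then have gC: "generate G C = T" using C G.generate_subgrp[OF Tj(2)] by simp
   define F where "F = {i : I. \<not> (\<exists>R. subgroup R (Q i) \<and>
    discrete_residual (subgrp (Q i) R) = {\<one>\<^bsub>Q i\<^esub>} \<and> \<pi> i ` C \<subseteq> R)}"
   \<comment> \<open>Coordinates with a trivial group are split off: their rank 1 cannot drop any
     further, whereas for those in \<open>F'\<close> one step of the recursion lowers the
     rank.\<close>
   define F' where "F' = {i : F. carrier (Q i) \<noteq> {\<one>\<^bsub>Q i\<^esub>}}"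
   have "finite F" using cpt[OF CT(2)] unfolding F_def .
   then have F': "finite F'" "F' \<subseteq> I" by (simp add: F'_def) (auto simp: F_def F'_def)
   have triv: "\<pi> i g = \<one>\<^bsub>Q i\<^esub>" if iF: "i : I - F'" and "g : D" for i g
   proof (cases "i : F")
    case True
    then have "carrier (Q i) = {\<one>\<^bsub>Q i\<^esub>}" using that by (auto simp: F'_def)
    then show ?thesis using cont_hom_closed[OF hom] that DT TG by blast
   next
    case False
    then obtain R where R: "subgroup R (Q i)" "discrete_residual (subgrp (Q i) R) = {\<one>\<^bsub>Q i\<^esub>}" "\<pi> i ` C \<subseteq> R"
     using iF by (auto simp: F_def)
    have i: "i : I" using that by simp
    interpret Q: top_group "Q i" using Qg[OF i] by unfold_locales
    interpret h: group_hom G "Q i" "\<pi> i" by (rule cont_hom_group_hom[OF G.is_group Q.is_group hom[OF i]])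
    have "\<pi> i ` T = generate (Q i) (\<pi> i ` C)" using h.generate_img[of C] CT(1) TG gC by auto
    also have "\<dots> \<subseteq> R" by (rule Q.generate_subgroup_incl[OF R(3,1)])
    finally have "\<pi> i : cont_hom (subgrp G T) (subgrp (Q i) R)" by (rule cont_hom_subgrp[OF hom[OF i] TG])
    then have "\<pi> i ` D \<subseteq> {\<one>\<^bsub>Q i\<^esub>}"
     using residual_hom[OF T.topological_group Q.top_group_subgrp[OF R(1)]] R(2) by (simp add: D_def)
    then show ?thesis using that by auto
   qed
   have "\<exists>S b. subgroup S (Q i) \<and> \<pi> i : cont_hom (subgrp G D) (Res (subgrp (Q i) S)) \<and>
     has_rank (Res (subgrp (Q i) S)) (b + 1) \<and> b < \<beta>" if "i : F'" for i
   proof -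
    have i: "i : I" using that F' by auto
    obtain \<rho> where \<rho>: "\<rho> \<le> \<beta> + 1" "has_rank (Q i) \<rho>" using rk[OF i] by blast
    from \<rho>(2) show ?thesis
    proof (cases rule: rank_cases)
     case trivial
     then show ?thesis using that by (simp add: F'_def)
    next
     case (union S r)
     obtain k where k: "subgroup (S k) (Q i)"
      "\<pi> i : cont_hom (Res (subgrp G T)) (Res (subgrp (Q i) (S k)))"
      by (rule residual_cont_hom_into_exhaustion[OF G.topological_group Qg[OF i] hom[OF i] Tj(2,3) union(2)])
     obtain b where b: "r k = b + 1" using union(3) by (rule rank_successor)
     have "r k \<le> \<beta>" using SUP_seq_upper_omega1[of r k] \<rho>(1) union(4) by simp
     then have "b < \<beta>" unfolding b by (simp add: add_one_le_iff_less_omega1)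
     then show ?thesis using k union(3)[of k] unfolding eqD b by blast
    qed
   qed
   then obtain S b where Sb: "!!i. i : F' ==> subgroup (S i) (Q i)"
    "!!i. i : F' ==> \<pi> i : cont_hom (subgrp G D) (Res (subgrp (Q i) (S i)))"
    "!!i. i : F' ==> has_rank (Res (subgrp (Q i) (S i))) (b i + 1)"
    "!!i. i : F' ==> b i < \<beta>" by metis
   define K' where "K' = {g : D. \<forall>i\<in>F'. \<pi> i g = \<one>\<^bsub>Q i\<^esub>}"
   have "closed_subgroup {g : carrier (subgrp G D). \<forall>i\<in>F'. \<pi> i g = \<one>\<^bsub>Res (subgrp (Q i) (S i))\<^esub>} (subgrp G D)"
    by (rule D.closed_subgroup_kernel_family[OF Sb(2) rank_tdlcsc[OF Sb(3)]])
   then have K': "closed_subgroup K' (subgrp G D)" by (simp add: K'_def)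
   \<comment> \<open>Elements of \<open>D\<close> are trivial in every coordinate outside
     \<open>F'\<close>, so being trivial in the coordinates of \<open>F'\<close> puts them into the
     kernel of the whole family.\<close>
   have K'K: "K' \<subseteq> K" using triv DT TG by (auto simp: K'_def K_def)
   have "tdlc (subgrp (subgrp G D) K')" by (rule D.tdlc_subgrp[OF K'])
   moreover have "(\<lambda>x. x) : cont_hom (subgrp (subgrp G D) K') (subgrp G K)"
    using id_cont_hom_subgrp[OF K'K, of G] by (simp add: subgrp_subgrp K'_def)
   ultimately obtain \<alpha>'' where \<alpha>'': "\<alpha>'' \<le> \<alpha>'" "has_rank (subgrp (subgrp G D) K') \<alpha>''"
    by (rule rank_exists_mono[OF ker]) auto
   show "\<exists>\<sigma>\<le>\<alpha> + \<beta>. has_rank (Res (subgrp G T)) \<sigma>"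
   proof (cases "F' = {}")
    case True
    then have "K' = D" by (auto simp: K'_def)
    then have "has_rank (subgrp G D) \<alpha>''" using \<alpha>''(2) by (simp add: subgrp_subgrp)
    moreover have "\<alpha>'' \<le> \<alpha> + \<beta>" using \<alpha>''(1) \<alpha>' ord_add_bounds(1)[of \<alpha> \<beta>] by order
    ultimately show ?thesis unfolding eqD by blast
   next
    case False
    \<comment> \<open>A maximum over the finite set \<open>F'\<close> stays strictly below \<beta>;
      a supremum over infinitely many coordinates could reach it.\<close>
    define \<beta>' where "\<beta>' = Max (b ` F')"
    have "\<beta>' < \<beta>" using False F' Sb(4) by (auto simp: \<beta>'_def)
    have *: "\<exists>\<gamma>\<le>\<alpha> + \<beta>' + 1. has_rank (subgrp G D) \<gamma>"
    proof (rule less.IH[OF \<open>\<beta>' < \<beta>\<close> Dtd, of F' \<pi> "\<lambda>i. Res (subgrp (Q i) (S i))" \<alpha>''])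
     show "\<pi> i : cont_hom (subgrp G D) (Res (subgrp (Q i) (S i)))" if "i : F'" for i by (rule Sb(2)[OF that])
     show "\<exists>\<rho>\<le>\<beta>' + 1. has_rank (Res (subgrp (Q i) (S i))) \<rho>" if "i : F'" for i
      using Sb(3)[OF that] that F' by (intro exI[of _ "b i + 1"]) (simp add: \<beta>'_def)
     show "finite {i : F'. \<not> (\<exists>R. subgroup R (Res (subgrp (Q i) (S i))) \<and>
       discrete_residual (subgrp (Res (subgrp (Q i) (S i))) R) = {\<one>\<^bsub>Res (subgrp (Q i) (S i))\<^esub>} \<and> \<pi> i ` C \<subseteq> R)}" for C
      using F' by simp
     show "has_rank (subgrp (subgrp G D)
       {g : carrier (subgrp G D). \<forall>i\<in>F'. \<pi> i g = \<one>\<^bsub>Res (subgrp (Q i) (S i))\<^esub>}) \<alpha>''" using \<alpha>''(2) by (simp add: K'_def)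
     show "\<alpha>'' \<le> \<alpha>" using \<alpha>''(1) \<alpha>' by order
    qed
    moreover have "\<alpha> + \<beta>' + 1 \<le> \<alpha> + \<beta>" unfolding add_one_le_iff_less_omega1 by (rule ord_add_bounds(2)[OF \<open>\<beta>' < \<beta>\<close>])
    ultimately show ?thesis unfolding eqD by (meson order_trans)
   qed
  qed
 qed
 then show thesis using that by blast
qed

text \<open>The residual of a subgroup lies in the residual of the group, so all residuals in the
  recursion are trivial and have rank 1.\<close>

lemma rank_residually_discrete:
 assumes "tdlc G" "discrete_residual G = {\<one>\<^bsub>G\<^esub>}" shows "\<exists>\<gamma>\<le>1 + 1. has_rank G \<gamma>"
proof -
 interpret G: tdlc G by fact
 show ?thesis
 proof (rule G.rank_exists_le)
  fix T assume T: "open_subgroup T G" "subgroup T G"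
  interpret R: tdlc "Res (subgrp G T)" by (rule tdlc_residual[OF assms(1) T(1)])
  have "carrier (Res (subgrp G T)) = {\<one>\<^bsub>Res (subgrp G T)\<^esub>}"
   using G.residual_mono[OF T(2)] assms(2) R.one_closed by auto
  then show "\<exists>\<sigma>\<le>1. has_rank (Res (subgrp G T)) \<sigma>" using has_decomposition_rank.trivial[OF R.tdlcsc] by blast
 qed
qed

text \<open>An open subgroup missing a given element has finite index in a compact group, so the
  residual misses that element too.\<close>

lemma (in tdlc) residual_trivial_compact:
 assumes "compactin (gtop G) (carrier G)" shows "discrete_residual G = {\<one>}"
proof -
 have "x = \<one>" if x: "x : discrete_residual G" for x
 proof (rule ccontr)
  assume "x \<noteq> \<one>"
  then obtain C where C: "open_subgroup C G" "compactin (gtop G) C" "x \<notin> C"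
   using separating_open_subgroup residual_subset x by blast
  obtain J where "finite J" "J \<subseteq> carrier G" "!!x. x : carrier G ==> \<exists>g\<in>J. inv g \<otimes> x : C"
   by (rule compact_coset_cover[OF assms C(1)]) (rule that)
  then show False using residual_subset_finite_index[OF C(1)] C(3) x by blast
 qed
 then show ?thesis using closed_subgroup_residual by (auto simp: closed_subgroup_def dest: subgroup.one_closed)
qed

lemma (in tdlc) residual_trivial_compact_subgroup:
 assumes "subgroup C G" "compactin (gtop G) C" shows "discrete_residual (subgrp G C) = {\<one>}"
proof -
 have "closedin (gtop G) C" using assms Hausdorff by (simp add: compactin_imp_closedin)
 then interpret C: tdlc "subgrp G C" using assms by (intro tdlc_subgrp) (simp add: closed_subgroup_def)
 show ?thesis using C.residual_trivial_compact assms by (simp add: compactin_subtopology)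
qed

section \<open>Isomorphic copies\<close>

lemma top_iso_cont_hom: "\<phi> : top_iso G H ==> \<phi> : cont_hom G H"
 by (auto simp: top_iso_def cont_hom_def iso_def homeomorphic_imp_continuous_map)

lemma top_iso_bij: "\<phi> : top_iso G H ==> bij_betw \<phi> (carrier G) (carrier H)" by (auto simp: top_iso_def iso_def)

lemma top_iso_inv:
 assumes "topological_group G" "group H" "topspace (gtop H) = carrier H" "\<phi> : top_iso G H"
 shows "inv_into (carrier G) \<phi> : top_iso H G"
proof -
 interpret G: top_group G using assms(1) by unfold_locales
 let ?\<psi> = "inv_into (carrier G) \<phi>"
 have "?\<psi> : iso H G" using assms(4) by (intro G.iso_set_sym) (simp add: top_iso_def)
 moreover have "homeomorphic_map (gtop H) (gtop G) ?\<psi>"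
 proof -
  obtain g where g: "homeomorphic_maps (gtop G) (gtop H) \<phi> g"
   using assms(4) by (auto simp: top_iso_def homeomorphic_map_maps)
  have b: "bij_betw \<phi> (carrier G) (carrier H)" by (rule top_iso_bij[OF assms(4)])
  have "g y = ?\<psi> y" if "y : carrier H" for y
  proof -
   have "g y : carrier G" "\<phi> (g y) = y"
    using g that assms(3) continuous_map_image_subset_topspace[of "gtop H" "gtop G" g]
    by (auto simp: homeomorphic_maps_def)
   then show ?thesis using b by (metis bij_betw_def inv_into_f_f)
  qed
  then have "homeomorphic_maps (gtop H) (gtop G) ?\<psi> \<phi>"
   by (intro homeomorphic_maps_eq[OF homeomorphic_maps_sym[THEN iffD1, OF g]]) (simp_all add: assms(3))
  then show ?thesis using homeomorphic_map_maps by blast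
 qed
 ultimately show ?thesis by (simp add: top_iso_def)
qed

lemma top_iso_open_image:
 assumes "\<phi> : top_iso G H" "topspace (gtop G) = carrier G" "S \<subseteq> carrier G"
 shows "openin (gtop H) (\<phi> ` S) \<longleftrightarrow> openin (gtop G) S"
  "closedin (gtop H) (\<phi> ` S) \<longleftrightarrow> closedin (gtop G) S"
  "compactin (gtop H) (\<phi> ` S) \<longleftrightarrow> compactin (gtop G) S"
 using assms by (auto simp: top_iso_def homeomorphic_map_openness homeomorphic_map_closedness
   homeomorphic_map_compactness)

lemma top_iso_topological_group:
 fixes G (structure)
 assumes "topological_group G" "group H" "topspace (gtop H) = carrier H" "\<phi> : top_iso G H" shows "topological_group H"
proof -
 interpret G: top_group G using assms(1) by unfold_locales
 interpret H: group H by fact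
 define \<psi> where "\<psi> = inv_into (carrier G) \<phi>"
 have \<psi>: "\<psi> : top_iso H G" unfolding \<psi>_def by (rule top_iso_inv[OF assms])
 interpret p: group_hom G H \<phi> using top_iso_cont_hom[OF assms(4)] by (rule cont_hom_group_hom[OF G.is_group assms(2)])
 interpret q: group_hom H G \<psi> using top_iso_cont_hom[OF \<psi>] by (rule cont_hom_group_hom[OF assms(2) G.is_group])
 have c\<psi>: "continuous_map (gtop H) (gtop G) \<psi>" and c\<phi>: "continuous_map (gtop G) (gtop H) \<phi>"
  using top_iso_cont_hom[OF assms(4)] top_iso_cont_hom[OF \<psi>] by (auto simp: cont_hom_def)
 have \<phi>\<psi>: "\<phi> (\<psi> y) = y" if "y : carrier H" for y
  using that top_iso_bij[OF assms(4)] unfolding \<psi>_def by (metis bij_betw_def f_inv_into_f)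
 have "continuous_map (prod_topology (gtop H) (gtop H)) (gtop G)
   (\<lambda>x. \<psi> (fst x) \<otimes> \<psi> (snd x))"
  by (intro G.continuous_map_mult continuous_map_compose[OF continuous_map_fst c\<psi>, unfolded o_def]
   continuous_map_compose[OF continuous_map_snd c\<psi>, unfolded o_def])
 then have "continuous_map (prod_topology (gtop H) (gtop H)) (gtop H)
   (\<lambda>x. \<phi> (\<psi> (fst x) \<otimes> \<psi> (snd x)))" using continuous_map_compose[OF _ c\<phi>] by (auto simp: o_def)
 then have m: "continuous_map (prod_topology (gtop H) (gtop H)) (gtop H) (\<lambda>(x, y). x \<otimes>\<^bsub>H\<^esub> y)"
  by (rule continuous_map_eq) (auto simp: assms(3) \<phi>\<psi>)
 have "continuous_map (gtop H) (gtop G) (\<lambda>x. inv (\<psi> x))" by (rule G.continuous_map_inv[OF c\<psi>])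
 then have "continuous_map (gtop H) (gtop H) (\<lambda>x. \<phi> (inv (\<psi> x)))"
  using continuous_map_compose[OF _ c\<phi>] by (auto simp: o_def)
 then have i: "continuous_map (gtop H) (gtop H) (\<lambda>x. inv\<^bsub>H\<^esub> x)" by (rule continuous_map_eq) (auto simp: assms(3) \<phi>\<psi>)
 show ?thesis using m i assms(2,3) by (simp add: topological_group_def)
qed

lemma top_iso_subgroup_image:
 assumes "group G" "group H" "\<phi> : top_iso G H" "subgroup S G" shows "subgroup (\<phi> ` S) H"
 using group_hom.subgroup_img_is_subgroup[OF cont_hom_group_hom[OF assms(1,2) top_iso_cont_hom[OF assms(3)]] assms(4)] .

lemma top_iso_tdlc:
 assumes "tdlc G" "group H" "topspace (gtop H) = carrier H" "\<phi> : top_iso G H" shows "tdlc H"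
proof -
 interpret G: tdlc G by fact
 interpret H: top_group H by unfold_locales (rule top_iso_topological_group[OF G.topological_group assms(2-4)])
 have hs: "gtop G homeomorphic_space gtop H"
  using assms(4) by (auto simp: top_iso_def homeomorphic_map_imp_homeomorphic_space)
 interpret p: group_hom G H \<phi> by (rule cont_hom_group_hom[OF G.is_group assms(2) top_iso_cont_hom[OF assms(4)]])
 have "\<exists>C. open_subgroup C H \<and> compactin (gtop H) C \<and> C \<subseteq> W" if W: "openin (gtop H) W" "\<one>\<^bsub>H\<^esub> : W" for W
 proof -
  have "openin (gtop G) {x : carrier G. \<phi> x : W}"
   using G.continuous_preimage[of "gtop G" "gtop H" \<phi> W] W top_iso_cont_hom[OF assms(4)] by (simp add: cont_hom_def)
  then obtain C where C: "open_subgroup C G" "compactin (gtop G) C" "C \<subseteq> {x : carrier G. \<phi> x : W}"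
   using G.small_compact_open[of "{x : carrier G. \<phi> x : W}"] W by auto
  then have CG: "C \<subseteq> carrier G" by auto
  show ?thesis using C top_iso_open_image[OF assms(4) G.topspace CG] top_iso_subgroup_image[OF G.is_group assms(2,4)]
   by (intro exI[of _ "\<phi> ` C"]) (auto simp: open_subgroup_def)
 qed
 then have "tdlc_group H" using H.topological_group G.Hausdorff G.second_countable homeomorphic_Hausdorff_space[OF hs]
   homeomorphic_space_second_countability[OF hs] by (auto simp: tdlc_group_def)
 then show ?thesis by unfold_locales
qed

lemma top_iso_rank:
 assumes "tdlc G" "group H" "topspace (gtop H) = carrier H" "\<phi> : top_iso G H" "has_rank G \<alpha>" shows "has_rank H \<alpha>"
proof -
 interpret G: tdlc G by fact
 have H: "tdlc H" by (rule top_iso_tdlc[OF assms(1-4)])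
 have \<psi>: "inv_into (carrier G) \<phi> : top_iso H G" by (rule top_iso_inv[OF G.topological_group assms(2-4)])
 obtain \<beta> where \<beta>: "\<beta> \<le> \<alpha>" "has_rank H \<beta>" by (rule rank_exists_mono[OF assms(5) H top_iso_cont_hom[OF \<psi>]])
   (use top_iso_bij[OF \<psi>] in \<open>auto simp: bij_betw_def\<close>)
 have "\<alpha> \<le> \<beta>" by (rule rank_mono[OF \<beta>(2) assms(5) top_iso_cont_hom[OF assms(4)]])
   (use top_iso_bij[OF assms(4)] in \<open>auto simp: bij_betw_def\<close>)
 with \<beta> show ?thesis by simp
qed

section \<open>Groups with a decomposition rank are elementary\<close>

definition open_quotient :: "'a tgroup => 'b tgroup => ('a => 'b) => bool" where
 "open_quotient G Q \<pi> \<longleftrightarrow> \<pi> : cont_hom G Q \<and> \<pi> ` carrier G = carrier Q \<and>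
   (\<forall>S. openin (gtop G) S --> openin (gtop Q) (\<pi> ` S))"

text \<open>The product of two open surjections is an open surjection and thus a quotient map, which
  lets multiplication descend continuously.\<close>

lemma open_quotient_topological_group:
 fixes G (structure)
 assumes "topological_group G" "group Q" "topspace (gtop Q) = carrier Q" "open_quotient G Q \<pi>"
 shows "topological_group Q"
proof -
 interpret G: top_group G using assms(1) by unfold_locales
 interpret Q: group Q by fact
 have \<pi>: "\<pi> : cont_hom G Q" "\<pi> ` carrier G = carrier Q"
  "!!S. openin (gtop G) S ==> openin (gtop Q) (\<pi> ` S)" "continuous_map (gtop G) (gtop Q) \<pi>"
  using assms(4) by (auto simp: open_quotient_def cont_hom_def)
 interpret h: group_hom G Q \<pi> using \<pi>(1) by (rule cont_hom_group_hom[OF G.is_group assms(2)])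
 have o: "open_map (gtop G) (gtop Q) \<pi>" using \<pi>(3) by (simp add: open_map_def)
 let ?p = "\<lambda>p. (\<pi> (fst p), \<pi> (snd p))"
 have "quotient_map (prod_topology (gtop G) (gtop G)) (prod_topology (gtop Q) (gtop Q)) ?p"
 proof (rule continuous_open_imp_quotient_map)
  show "continuous_map (prod_topology (gtop G) (gtop G)) (prod_topology (gtop Q) (gtop Q)) ?p"
   using \<pi>(4) by (intro continuous_map_pairedI continuous_map_compose[OF continuous_map_fst, unfolded o_def]
    continuous_map_compose[OF continuous_map_snd, unfolded o_def])
  show "open_map (prod_topology (gtop G) (gtop G)) (prod_topology (gtop Q) (gtop Q)) ?p"
   unfolding open_map_def openin_prod_topology_alt
  proof (intro allI impI)
   fix S a b assume S: "\<forall>x y. (x, y) : S --> (\<exists>A B. openin (gtop G) A \<and> openin (gtop G) B \<and> x : A \<and> y : B \<and> A \<times> B \<subseteq> S)"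
    and "(a, b) : ?p ` S"
   then obtain x y where xy: "(x, y) : S" "a = \<pi> x" "b = \<pi> y" by auto
   then obtain A B where AB: "openin (gtop G) A" "openin (gtop G) B" "x : A" "y : B" "A \<times> B \<subseteq> S" using S by meson
   have "\<pi> ` A \<times> \<pi> ` B \<subseteq> ?p ` (A \<times> B)" by force
   then have "\<pi> ` A \<times> \<pi> ` B \<subseteq> ?p ` S" using AB(5) by blast
   then show "\<exists>A B. openin (gtop Q) A \<and> openin (gtop Q) B \<and> a : A \<and> b : B \<and> A \<times> B \<subseteq> ?p ` S"
    using \<pi>(3)[OF AB(1)] \<pi>(3)[OF AB(2)] AB(3,4) xy(2,3) by (intro exI[of _ "\<pi> ` A"] exI[of _ "\<pi> ` B"]) auto
  qed
  show "?p ` topspace (prod_topology (gtop G) (gtop G)) = topspace (prod_topology (gtop Q) (gtop Q))"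
   unfolding topspace_prod_topology assms(3) G.topspace \<pi>(2)[symmetric] by force
 qed
 moreover have "continuous_map (prod_topology (gtop G) (gtop G)) (gtop Q) (\<pi> o (\<lambda>(x, y). x \<otimes> y))"
  using G.topological_group \<pi>(4) unfolding topological_group_def by (intro continuous_map_compose) auto
 then have "continuous_map (prod_topology (gtop G) (gtop G)) (gtop Q) ((\<lambda>(x, y). x \<otimes>\<^bsub>Q\<^esub> y) o ?p)"
  by (rule continuous_map_eq) auto
 ultimately have m: "continuous_map (prod_topology (gtop Q) (gtop Q)) (gtop Q) (\<lambda>(x, y). x \<otimes>\<^bsub>Q\<^esub> y)"
  by (rule continuous_compose_quotient_map)
 have "quotient_map (gtop G) (gtop Q) \<pi>"
  by (rule continuous_open_imp_quotient_map[OF \<pi>(4) o]) (simp add: \<pi>(2) assms(3))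
 moreover have "continuous_map (gtop G) (gtop Q) (\<lambda>x. \<pi> (inv x))"
  using continuous_map_compose[OF G.continuous_map_inv[OF continuous_map_id[unfolded id_def]] \<pi>(4)] by (simp add: o_def)
 then have "continuous_map (gtop G) (gtop Q) ((\<lambda>x. inv\<^bsub>Q\<^esub> x) o \<pi>)" by (rule continuous_map_eq) auto
 ultimately have i: "continuous_map (gtop Q) (gtop Q) (\<lambda>x. inv\<^bsub>Q\<^esub> x)" by (rule continuous_compose_quotient_map)
 show ?thesis using m i assms(2,3) by (simp add: topological_group_def)
qed

lemma open_quotient_top_iso:
 fixes G (structure)
 assumes "topological_group G" "topological_group Q" "open_quotient G Q \<pi>"
 shows "(\<lambda>X. the_elem (\<pi> ` X)) : top_iso (quotient_group G {g : carrier G. \<pi> g = \<one>\<^bsub>Q\<^esub>}) Q"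
proof -
 interpret G: top_group G using assms(1) by unfold_locales
 interpret Q: top_group Q using assms(2) by unfold_locales
 have \<pi>: "\<pi> : cont_hom G Q" "\<pi> ` carrier G = carrier Q"
  "!!S. openin (gtop G) S ==> openin (gtop Q) (\<pi> ` S)" "continuous_map (gtop G) (gtop Q) \<pi>"
  using assms(3) by (auto simp: open_quotient_def cont_hom_def)
 interpret h: group_hom G Q \<pi> using \<pi>(1) by (rule cont_hom_group_hom[OF G.is_group Q.is_group])
 let ?N = "{g : carrier G. \<pi> g = \<one>\<^bsub>Q\<^esub>}" and ?\<psi> = "\<lambda>X. the_elem (\<pi> ` X)"
 have N: "kernel G Q \<pi> = ?N" by (simp add: kernel_def)
 have iso: "?\<psi> : iso (G Mod ?N) Q" using h.FactGroup_iso_set[OF \<pi>(2)] by (simp add: N)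
 have iso': "?\<psi> : iso (quotient_group G ?N) Q" using iso by (simp add: iso_def hom_def quotient_group_def)
 have \<psi>: "?\<psi> (?N #> x) = \<pi> x" if "x : carrier G" for x
 proof -
  have "\<pi> ` (?N #> x) = {\<pi> x}" using that by (auto simp: r_coset_def image_iff intro!: bexI[of _ "\<one>"])
  then show ?thesis by simp
 qed
 have q: "quotient_map (gtop G) (quotient_topology G ?N) (\<lambda>x. ?N #> x)"
  by (rule quotient_map_quotient_topology[OF G.topspace])
 have ts: "topspace (quotient_topology G ?N) = carrier (G Mod ?N)"
  using q by (auto simp: quotient_map_def carrier_FactGroup)
 have "continuous_map (gtop G) (gtop Q) (?\<psi> o (\<lambda>x. ?N #> x))" using \<pi>(4) by (rule continuous_map_eq) (use \<psi> in auto)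
 then have c: "continuous_map (quotient_topology G ?N) (gtop Q) ?\<psi>" by (rule continuous_compose_quotient_map[OF q])
 have o: "open_map (quotient_topology G ?N) (gtop Q) ?\<psi>" unfolding open_map_def
 proof (intro allI impI)
  fix U assume U: "openin (quotient_topology G ?N) U"
  have UG: "U \<subseteq> carrier (G Mod ?N)" using U openin_subset ts by blast
  have "openin (gtop G) {x : carrier G. ?N #> x : U}"
   using U openin_quotient_topology[OF G.topspace, of ?N U] by blast
  then have "openin (gtop Q) (\<pi> ` {x : carrier G. ?N #> x : U})" by (rule \<pi>(3))
  also have "\<pi> ` {x : carrier G. ?N #> x : U} = ?\<psi> ` U"
  proof (intro equalityI subsetI)
   fix y assume "y : \<pi> ` {x : carrier G. ?N #> x : U}"
   then obtain x where "x : carrier G" "?N #> x : U" "y = \<pi> x" by blast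
   then show "y : ?\<psi> ` U" using \<psi>[of x] by (intro image_eqI[of _ _ "?N #> x"]) simp_all
  next
   fix y assume "y : ?\<psi> ` U"
   then obtain X where X: "X : U" "y = ?\<psi> X" by blast
   then obtain x where "x : carrier G" "X = ?N #> x" using UG by (auto simp: carrier_FactGroup)
   then show "y : \<pi> ` {x : carrier G. ?N #> x : U}" using X \<psi>[of x] by (intro image_eqI[of _ _ x]) simp_all
  qed
  finally show "openin (gtop Q) (?\<psi> ` U)" .
 qed
 have "homeomorphic_map (quotient_topology G ?N) (gtop Q) ?\<psi>"
  using iso by (intro bijective_open_imp_homeomorphic_map[OF c o]) (auto simp: ts iso_def bij_betw_def)
 then show ?thesis using iso' by (simp add: top_iso_def quotient_group_def)
qed

lemma group_quotient_group:
 assumes "group G" "N \<lhd> G" shows "group (quotient_group G N)"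
proof -
 interpret Q: group "G Mod N" by (rule normal.factorgroup_is_group[OF assms(2)])
 show ?thesis by (rule groupI) (use Q.m_closed Q.one_closed Q.m_assoc Q.l_one Q.l_inv_ex in
   \<open>auto simp: quotient_group_def simp del: mult_FactGroup one_FactGroup\<close>)
qed

text \<open>The projection is open because the preimage of the image of \<open>S\<close> is the
  union of the translates of \<open>S\<close> by elements of \<open>N\<close>.\<close>

lemma (in top_group) topological_group_quotient:
 assumes "N \<lhd> G" shows "open_quotient G (quotient_group G N) (\<lambda>x. N #> x)" "topological_group (quotient_group G N)"
proof -
 interpret N: normal N G by fact
 let ?Q = "quotient_group G N"
 have q: "quotient_map (gtop G) (quotient_topology G N) (\<lambda>x. N #> x)" by (rule quotient_map_quotient_topology) simp
 have img: "(\<lambda>x. N #> x) ` carrier G = carrier ?Q" by (auto simp: quotient_group_def carrier_FactGroup)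
 have ts: "topspace (gtop ?Q) = carrier ?Q"
  using quotient_imp_surjective_map[OF q] img by (simp add: quotient_group_def)
 have "openin (gtop ?Q) ((\<lambda>x. N #> x) ` S)" if S: "openin (gtop G) S" for S
 proof -
  have SG: "S \<subseteq> carrier G" using S by (rule open_subset)
  have "{x : carrier G. N #> x : (\<lambda>x. N #> x) ` S} = (\<Union>n\<in>N. (\<lambda>x. n \<otimes> x) ` S)"
  proof (intro equalityI subsetI)
   fix x assume "x : {x : carrier G. N #> x : (\<lambda>x. N #> x) ` S}"
   then obtain s where s: "s : S" "N #> x = N #> s" "x : carrier G" by auto
   then have "x : N #> s" using rcos_self[OF s(3) N.subgroup_axioms] by simp
   then show "x : (\<Union>n\<in>N. (\<lambda>x. n \<otimes> x) ` S)" using s by (auto simp: r_coset_def)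
  next
   fix x assume "x : (\<Union>n\<in>N. (\<lambda>x. n \<otimes> x) ` S)"
   then obtain n s where ns: "n : N" "s : S" "x = n \<otimes> s" by auto
   then have "N #> s = N #> x" using SG by (intro repr_independence N.subgroup_axioms) (auto simp: r_coset_def)
   then show "x : {x : carrier G. N #> x : (\<lambda>x. N #> x) ` S}" using ns SG N.subset by auto
  qed
  moreover have "openin (gtop G) (\<Union>n\<in>N. (\<lambda>x. n \<otimes> x) ` S)"
   using S N.subset by (intro openin_Union) (auto intro!: openin_lmult)
  ultimately show ?thesis using SG by (auto simp: quotient_group_def openin_quotient_topology carrier_FactGroup)
 qed
 then show *: "open_quotient G ?Q (\<lambda>x. N #> x)" using N.r_coset_hom_Mod img quotient_imp_continuous_map[OF q]
  by (simp add: open_quotient_def cont_hom_def hom_def quotient_group_def)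
 show "topological_group ?Q"
  by (rule open_quotient_topological_group[OF topological_group group_quotient_group[OF is_group assms] ts *])
qed

text \<open>Multiplication and topology are pulled back along the inverse of the injection f; this
  moves a group into another type.\<close>

lemma transport_topological_group:
 fixes H (structure)
 assumes "topological_group H" "inj_on f (carrier H)"
 obtains Q where "topological_group Q" "f : top_iso H Q"
proof -
 interpret H: top_group H using assms(1) by unfold_locales
 let ?g = "inv_into (carrier H) f"
 define Q where "Q = \<lparr>carrier = f ` carrier H, mult = (\<lambda>a b. f (?g a \<otimes> ?g b)), one = f \<one>,
  gtop = pullback_topology (f ` carrier H) ?g (gtop H)\<rparr>"
 have g: "?g (f x) = x" if "x : carrier H" for x using assms(2) that by (rule inv_into_f_f)
 have Q: "carrier Q = f ` carrier H" "mult Q = (\<lambda>a b. f (?g a \<otimes> ?g b))" "one Q = f \<one>" by (simp_all add: Q_def)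
 have gQ: "group Q" by (rule groupI) (auto simp: Q g H.m_assoc intro!: bexI[of _ "inv _"])
 have ts: "topspace (gtop Q) = carrier Q" by (auto simp: Q_def topspace_pullback_topology g)
 have "homeomorphic_maps (gtop H) (gtop Q) f ?g" unfolding homeomorphic_maps_def
 proof (intro conjI)
  show "continuous_map (gtop H) (gtop Q) f" unfolding Q_def
   by (simp, rule continuous_map_pullback', rule continuous_map_eq[OF continuous_map_id]) (auto simp: g)
  show "continuous_map (gtop Q) (gtop H) ?g"
   using continuous_map_pullback[OF continuous_map_id[of "gtop H"], of "f ` carrier H" ?g] by (simp add: Q_def)
 qed (auto simp: ts Q g)
 then have iso: "f : top_iso H Q"
  using assms(2) by (auto simp: top_iso_def iso_def hom_def bij_betw_def Q g homeomorphic_map_maps)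
 then show thesis using that top_iso_topological_group[OF assms(1) gQ ts] by blast
qed

text \<open>
 The quotient is modelled on a set of coset representatives, in order to stay in the same type.
\<close>

lemma (in top_group) quotient_on_representatives:
 assumes "N \<lhd> G"
 obtains Q :: "'a tgroup" and r where "topological_group Q" "open_quotient G Q r"
  "{g : carrier G. r g = \<one>\<^bsub>Q\<^esub>} = N"
proof -
 interpret N: normal N G by fact
 note q = topological_group_quotient[OF assms]
 \<comment> \<open>A coset is replaced by one of its elements; the coset can be recovered from the
   element, so the choice is injective.\<close>
 define f where "f X = (SOME y. y : X)" for X :: "'a set"
 have c: "carrier (quotient_group G N) = (\<lambda>x. N #> x) ` carrier G" "\<one>\<^bsub>quotient_group G N\<^esub> = N"
  by (auto simp: quotient_group_def carrier_FactGroup)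
 have "f (N #> x) : N #> x" if "x : carrier G" for x
  unfolding f_def using rcos_self[OF that N.subgroup_axioms] by (rule someI)
 then have "N #> f (N #> x) = N #> x" if "x : carrier G" for x using repr_independence that N.subgroup_axioms by metis
 then have inj: "inj_on f (carrier (quotient_group G N))" unfolding c by (intro inj_onI) (metis imageE)
 obtain Q :: "'a tgroup" where Q: "topological_group Q" "f : top_iso (quotient_group G N) Q"
  by (rule transport_topological_group[OF q(2) inj])
 interpret Q: top_group Q using Q(1) by unfold_locales
 interpret F: top_group "quotient_group G N" using q(2) by unfold_locales
 interpret f: group_hom "quotient_group G N" Q f
  by (rule cont_hom_group_hom[OF F.is_group Q.is_group top_iso_cont_hom[OF Q(2)]])
 have oc: "open_map (gtop (quotient_group G N)) (gtop Q) f" "continuous_map (gtop (quotient_group G N)) (gtop Q) f"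
  using Q(2) by (auto simp: top_iso_def homeomorphic_imp_open_map homeomorphic_imp_continuous_map)
 have n: "(\<lambda>x. N #> x) : hom G (quotient_group G N)" "continuous_map (gtop G) (gtop (quotient_group G N)) (\<lambda>x. N #> x)"
  "!!S. openin (gtop G) S ==> openin (gtop (quotient_group G N)) ((\<lambda>x. N #> x) ` S)"
  using q(1) by (auto simp: open_quotient_def cont_hom_def)
 have im: "(\<lambda>x. f (N #> x)) ` S = f ` (\<lambda>x. N #> x) ` S" for S by auto
 have "f ` carrier (quotient_group G N) = carrier Q" using top_iso_bij[OF Q(2)] by (simp add: bij_betw_def)
 then have "open_quotient G Q (\<lambda>x. f (N #> x))"
  using Group.hom_compose[OF n(1) f.homh] continuous_map_compose[OF n(2) oc(2)] n(3) oc(1)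
  by (simp add: open_quotient_def cont_hom_def o_def open_map_def im c)
 moreover have "f (N #> g) = \<one>\<^bsub>Q\<^esub> \<longleftrightarrow> g : N" if g: "g : carrier G" for g
 proof -
  have "f (N #> g) = \<one>\<^bsub>Q\<^esub> \<longleftrightarrow> N #> g = N"
   using inj_on_eq_iff[OF inj, of "N #> g" N] g f.hom_one F.one_closed unfolding c by auto
  then show ?thesis using coset_join2[OF g N.subgroup_axioms] rcos_self[OF g N.subgroup_axioms] by auto
 qed
 then have "{g : carrier G. f (N #> g) = \<one>\<^bsub>Q\<^esub>} = N" using N.subset by auto
 ultimately show thesis using that Q(1) by blast
qed

text \<open>The quotient by an open normal subgroup is discrete and second countable, hence
  countable.\<close>

lemma elementary_extension_discrete:
 fixes G :: "(nat => nat) tgroup"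
 assumes "tdlc G" "L \<lhd> G" "openin (gtop G) L" "elementary (subgrp G L)" shows "elementary G"
proof -
 interpret G: tdlc G by fact
 obtain Q :: "(nat => nat) tgroup" and r where Q: "topological_group Q" "open_quotient G Q r"
  "{g : carrier G. r g = \<one>\<^bsub>Q\<^esub>} = L" by (rule G.quotient_on_representatives[OF assms(2)])
 interpret Q: top_group Q using Q(1) by unfold_locales
 have \<pi>: "r : cont_hom G Q" "r ` carrier G = carrier Q"
  "!!S. openin (gtop G) S ==> openin (gtop Q) (r ` S)" "continuous_map (gtop G) (gtop Q) r"
  using Q(2) by (auto simp: open_quotient_def cont_hom_def)
 interpret h: group_hom G Q r using \<pi>(1) by (rule cont_hom_group_hom[OF G.is_group Q.is_group])
 have L: "subgroup L G" using assms(2) by (simp add: G.normal_inv_iff)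
 have "openin (gtop Q) {y}" if y: "y : carrier Q" for y
 proof -
  obtain x where x: "x : carrier G" "y = r x" using y unfolding \<pi>(2)[symmetric] by blast
  have "r ` ((\<lambda>z. x \<otimes>\<^bsub>G\<^esub> z) ` L) = {y}"
   using x subgroup.one_closed[OF L] unfolding Q(3)[symmetric] by (auto simp: image_iff)
  then show ?thesis using \<pi>(3) G.openin_lmult[OF x(1) assms(3)] by metis
 qed
 then have d: "gtop Q = discrete_topology (carrier Q)" using discrete_topology_unique[of "carrier Q" "gtop Q"] by simp
 have "Abstract_Topological_Spaces.second_countable (gtop Q)"
  by (rule second_countable_open_map_image[OF \<pi>(4) _ _ G.second_countable]) (auto simp: \<pi> open_map_def)
 then have "countable (carrier Q)" unfolding d second_countable_discrete_topology .
 then have "elementary Q" using d Q.is_group by (intro elementary.discrete)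
 moreover have "closed_normal L G"
  using assms(2,3) L G.closedin_open_subgroup by (simp add: closed_normal_def open_subgroup_def)
 ultimately show ?thesis using open_quotient_top_iso[OF G.topological_group Q(1,2)] unfolding Q(3)
  by (intro elementary.extension[OF G.tdlcsc _ assms(4)])
qed

text \<open>Since \<open>W <#> R\<close> is the whole group, the quotient by \<open>R\<close> is
  already a quotient of the profinite group \<open>W\<close>, hence elementary.\<close>

lemma elementary_extension_compact:
 fixes G :: "(nat => nat) tgroup" (structure)
 assumes "tdlc G" "closed_normal R G" "elementary (subgrp G R)"
  "subgroup W G" "openin (gtop G) W" "compactin (gtop G) W" "W <#> R = carrier G" shows "elementary G"
proof -
 interpret G: tdlc G by fact
 have R: "R \<lhd> G" using assms(2) by (simp add: closed_normal_def)
 have Rs: "subgroup R G" using R by (simp add: G.normal_inv_iff)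
 obtain Q :: "(nat => nat) tgroup" and r where Q: "topological_group Q" "open_quotient G Q r"
  "{g : carrier G. r g = \<one>\<^bsub>Q\<^esub>} = R" by (rule G.quotient_on_representatives[OF R])
 interpret Q: top_group Q using Q(1) by unfold_locales
 have \<pi>: "r : cont_hom G Q" "r ` carrier G = carrier Q"
  "!!S. openin (gtop G) S ==> openin (gtop Q) (r ` S)" using Q(2) by (auto simp: open_quotient_def)
 interpret h: group_hom G Q r using \<pi>(1) by (rule cont_hom_group_hom[OF G.is_group Q.is_group])
 have WG: "W \<subseteq> carrier G" using assms(4) by (rule subgroup.subset)
 have clW: "closed_subgroup W G" using assms(4,5) by (intro G.closed_open_subgroup) (simp add: open_subgroup_def)
 interpret W: tdlc "subgrp G W" by (rule G.tdlc_subgrp[OF clW])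
 have "r ` W = carrier Q"
 proof -
  have "y : r ` W" if y: "y : carrier Q" for y
  proof -
   obtain x where x: "x : W <#> R" "y = r x" using y \<pi>(2) assms(7) by auto
   then obtain w s where ws: "w : W" "s : R" "x = w \<otimes> s" by (auto simp: set_mult_def)
   then have "s : carrier G" "r s = \<one>\<^bsub>Q\<^esub>" unfolding Q(3)[symmetric] by auto
   then have "y = r w" using x ws WG by auto
   then show ?thesis using ws by auto
  qed
  then show ?thesis using WG by auto
 qed
 moreover have "r : cont_hom (subgrp G W) (subgrp Q (carrier Q))"
  by (rule cont_hom_subgrp[OF \<pi>(1) WG]) (use WG in auto)
 moreover have "openin (gtop Q) (r ` S)" if "openin (subtopology (gtop G) W) S" for S
  using that assms(5) openin_trans_full \<pi>(3) by blast
 ultimately have oW: "open_quotient (subgrp G W) Q r" by (auto simp: open_quotient_def subgrp_self)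
 have "elementary (subgrp G W)"
  using W.tdlcsc assms(6) by (intro elementary.profinite) (simp_all add: compactin_subspace)
 moreover have "closed_normal {g : carrier (subgrp G W). r g = \<one>\<^bsub>Q\<^esub>} (subgrp G W)"
 proof -
  have e: "{g : carrier (subgrp G W). r g = \<one>\<^bsub>Q\<^esub>} = W \<inter> R" using WG unfolding Q(3)[symmetric] by auto
  have "x \<otimes> h \<otimes> inv\<^bsub>subgrp G W\<^esub> x : W \<inter> R" if "x : W" "h : W \<inter> R" for x h
   using that R assms(4) WG by (auto simp: inv_subgrp[OF G.is_group] G.normal_inv_iff
     intro: subgroup.m_closed subgroup.m_inv_closed)
  moreover have "subgroup (W \<inter> R) G" using assms(4) Rs by (rule G.subgroups_Inter_pair)
  moreover have "closedin (subtopology (gtop G) W) (W \<inter> R)"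
   using assms(2) by (auto simp: closed_normal_def closedin_subtopology)
  ultimately show ?thesis unfolding e closed_normal_def W.normal_inv_iff
   by (simp add: subgroup_subgrp_iff[OF G.is_group assms(4)])
 qed
 ultimately have "elementary Q"
  using elementary.quotient[OF _ _ Q(1) open_quotient_top_iso[OF W.topological_group Q(1) oW]] by blast
 then show ?thesis using open_quotient_top_iso[OF G.topological_group Q(1,2)] unfolding Q(3)
  by (intro elementary.extension[OF G.tdlcsc assms(2,3)])
qed

lemma (in group) normal_mult_subgroup:
 assumes "N \<lhd> G" "subgroup H G" shows "subgroup (H <#> N) G"
proof -
 interpret second_isomorphism_grp N G H
  using assms by (simp add: second_isomorphism_grp_def second_isomorphism_grp_axioms_def)
 show ?thesis using normal_set_mult_subgroup commut_normal[OF assms(2,1)] by simp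
qed

text \<open>
 The idea is due to Caprace and Monod: a compactly generated group whose open normal subgroups
 intersect in \<open>R\<close> has an open normal subgroup \<open>N\<close> that meets a suitable
 compact set of conjugates of the compact open subgroup \<open>V\<close> only inside \<open>V R\<close>; then
 \<open>(N \<inter> V) R\<close> is normalised by a generating set.
\<close>

lemma elementary_of_residual:
 fixes G :: "(nat => nat) tgroup" (structure)
 assumes "tdlc G" "compactly_generated G" "elementary (Res G)" shows "elementary G"
proof -
 interpret G: tdlc G by fact
 define R where "R = discrete_residual G"
 have cR: "closed_normal R G" using G.closed_normal_residual by (simp add: R_def)
 then have R: "R \<lhd> G" "subgroup R G" "R \<subseteq> carrier G"
  by (auto simp: closed_normal_def G.normal_inv_iff dest: subgroup.subset)
 have Rconj: "x \<otimes> h \<otimes> inv x : R" if "x : carrier G" "h : R" for x h using R(1) that by (simp add: G.normal_inv_iff)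
 obtain V where V: "open_subgroup V G" "compactin (gtop G) V" by (rule G.compact_open)
 have Vs: "subgroup V G" "openin (gtop G) V" "V \<subseteq> carrier G"
  using V(1) by (auto simp: open_subgroup_def dest: subgroup.subset)
 obtain D0 where D0: "compactin (gtop G) D0" "generate G D0 = carrier G"
  using assms(2) by (auto simp: compactly_generated_def)
 \<comment> \<open>Inverses are included because the final induction over generated elements meets a
   generator as well as its inverse.\<close>
 define D where "D = D0 \<union> (\<lambda>x. inv x) ` D0"
 have D0G: "D0 \<subseteq> carrier G" using D0 compactin_subset_topspace by fastforce
 have Dinv: "compactin (gtop G) ((\<lambda>x. inv x) ` D0)"
  using D0(1) G.continuous_map_inv[OF continuous_map_id[unfolded id_def]] by (rule image_compactin)
 have D: "compactin (gtop G) D" "D \<subseteq> carrier G" using D0(1) Dinv D0G unfolding D_def by (auto intro: compactin_Un)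
 define VR where "VR = V <#> R"
 define C where "C = V \<union> (\<lambda>(d, v). d \<otimes> v \<otimes> inv d) ` (D \<times> V)"
 have "continuous_map (prod_topology (gtop G) (gtop G)) (gtop G) (\<lambda>p. fst p \<otimes> snd p \<otimes> inv (fst p))"
  by (intro G.continuous_intros_G continuous_map_fst continuous_map_snd)
 then have "compactin (gtop G) ((\<lambda>p. fst p \<otimes> snd p \<otimes> inv (fst p)) ` (D \<times> V))"
  using D(1) V(2) by (intro image_compactin[where X = "prod_topology (gtop G) (gtop G)"]) (auto simp: compactin_Times)
 then have C: "compactin (gtop G) C" using V(2) unfolding C_def by (auto intro: compactin_Un simp: split_def)
 have VVR: "V \<subseteq> VR" using subgroup.one_closed[OF R(2)] Vs by (force simp: VR_def set_mult_def)
 have "subgroup VR G" unfolding VR_def using R(1) Vs(1) by (rule G.normal_mult_subgroup)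
 then have VRo: "openin (gtop G) VR"
  using G.open_subgroupI[OF _ Vs(2) _ VVR] subgroup.one_closed[OF Vs(1)] by (simp add: open_subgroup_def)
 define \<N> where "\<N> = {N. N \<lhd> G \<and> openin (gtop G) N}"
 have \<N>: "N \<lhd> G" "openin (gtop G) N" "closedin (gtop G) N" "subgroup N G" if "N : \<N>" for N
  using that G.closedin_open_subgroup by (auto simp: \<N>_def open_subgroup_def G.normal_inv_iff)
 have "closedin (gtop G) (carrier G - VR)" using VRo by (metis G.topspace closedin_diff closedin_topspace)
 moreover have "(carrier G - VR) \<inter> C = C - VR" using compactin_subset_topspace[OF C] by auto
 ultimately have cC: "compactin (gtop G) (C - VR)" using closed_Int_compactin[OF _ C] by metis
 have "R \<subseteq> VR" using subgroup.one_closed[OF Vs(1)] R(3) by (force simp: VR_def set_mult_def)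
 \<comment> \<open>\<open>R\<close> is the intersection of the open normal subgroups and lies in
   \<open>VR\<close>, so their complements cover the compact set \<open>C - VR\<close>. Finitely
   many suffice, and the intersection of the corresponding subgroups meets \<open>C\<close> only
   inside \<open>VR\<close>.\<close>
 then have "C - VR \<subseteq> (\<Union>N\<in>\<N>. carrier G - N)"
  using compactin_subset_topspace[OF C] by (auto simp: R_def discrete_residual_def \<N>_def)
 then obtain \<M> where M: "finite \<M>" "\<M> \<subseteq> \<N>" "C - VR \<subseteq> (\<Union>N\<in>\<M>. carrier G - N)"
  using compactin_finite_subfamily[OF cC, of \<N> "\<lambda>N. carrier G - N"] \<N>(3) by (auto simp: closedin_def)
 define N where "N = carrier G \<inter> \<Inter>\<M>"
 have No: "openin (gtop G) N" unfolding N_def using M \<N>(2) openin_topspace[of "gtop G"]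
  by (cases "\<M> = {}") (auto intro!: openin_Int openin_Inter)
 have Ns: "subgroup N G"
  unfolding N_def using G.subgroups_Inter[of "insert (carrier G) \<M>"] M \<N>(4) G.subgroup_self by auto
 have Nconj: "x \<otimes> h \<otimes> inv x : N" if "x : carrier G" "h : N" for x h
  using that M \<N>(1) by (auto simp: N_def G.normal_inv_iff subset_iff)
 have RN: "R \<subseteq> N" using M R(3) by (auto simp: N_def R_def discrete_residual_def \<N>_def)
 have NC: "N \<inter> C \<subseteq> VR" using M(3) by (auto simp: N_def)
 define W where "W = N \<inter> V"
 define L where "L = W <#> R"
 have Ws: "subgroup W G" unfolding W_def using Ns Vs by (intro G.subgroups_Inter_pair)
 have WG: "W \<subseteq> carrier G" using Ws by (rule subgroup.subset)
 have LN: "L \<subseteq> N" using RN Ns by (auto simp: L_def W_def set_mult_def subset_iff subgroup.m_closed)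
 have Ls: "subgroup L G" unfolding L_def using R(1) Ws by (rule G.normal_mult_subgroup)
 have LG: "L \<subseteq> carrier G" using Ls by (rule subgroup.subset)
 have WL: "W \<subseteq> L" using subgroup.one_closed[OF R(2)] WG by (force simp: L_def set_mult_def)
 have RL: "R \<subseteq> L" using subgroup.one_closed[OF Ws] R(3) by (force simp: L_def set_mult_def)
 have Wo: "openin (gtop G) W" unfolding W_def using No Vs by auto
 have Lo: "openin (gtop G) L"
  using G.open_subgroupI[OF Ls Wo subgroup.one_closed[OF Ws] WL] by (simp add: open_subgroup_def)
 have gen: "d \<otimes> l \<otimes> inv d : L" if d: "d : D" and l: "l : L" for d l
 proof -
  have dG: "d : carrier G" using d D by auto
  obtain w s where ws: "w : W" "s : R" "l = w \<otimes> s" using l by (auto simp: L_def set_mult_def)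
  have wsG: "w : carrier G" "s : carrier G" using ws WG R by auto
  have "d \<otimes> w \<otimes> inv d : C" using d ws by (force simp: C_def W_def)
  moreover have dwN: "d \<otimes> w \<otimes> inv d : N" using Nconj dG ws by (auto simp: W_def)
  ultimately obtain v s' where vs: "v : V" "s' : R" "d \<otimes> w \<otimes> inv d = v \<otimes> s'"
   using NC by (auto simp: VR_def set_mult_def)
  have vG: "v : carrier G" "s' : carrier G" using vs Vs R by auto
  \<comment> \<open>As \<open>R\<close> lies in \<open>N\<close>, the factor v lies in
    \<open>N\<close> as well, hence in \<open>W\<close>; so the conjugate of w is in
    \<open>L\<close>.\<close>
  have "v = (d \<otimes> w \<otimes> inv d) \<otimes> inv s'" using vG vs(3) by (simp add: G.m_assoc)
  then have "v : N" using dwN vs(2) RN Ns by (auto intro: subgroup.m_closed subgroup.m_inv_closed)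
  then have 1: "d \<otimes> w \<otimes> inv d : L" using vs by (auto simp: L_def W_def set_mult_def)
  have 2: "d \<otimes> s \<otimes> inv d : L" using Rconj dG ws RL by auto
  have "d \<otimes> l \<otimes> inv d = (d \<otimes> w \<otimes> inv d) \<otimes> (d \<otimes> s \<otimes> inv d)" using wsG dG ws(3) by (simp add: G.group_simps)
  then show ?thesis using 1 2 Ls by (auto intro: subgroup.m_closed)
 qed
 have "g : carrier G \<and> (\<forall>l\<in>L. g \<otimes> l \<otimes> inv g : L)" if "g : generate G D0" for g using that
 proof induction
  case one
  then show ?case using LG by auto
 next
  case (incl h)
  then show ?case using gen D by (auto simp: D_def)
 next
  case (inv h)
  then show ?case using gen[of "inv h"] D by (auto simp: D_def)
 next
  case (eng h1 h2)
  have "(h1 \<otimes> h2) \<otimes> l \<otimes> inv (h1 \<otimes> h2) : L" if "l : L" for l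
  proof -
   have "h1 \<otimes> (h2 \<otimes> l \<otimes> inv h2) \<otimes> inv h1 : L" using eng that by auto
   moreover have "l : carrier G" using that LG by auto
   ultimately show ?thesis using eng by (simp add: G.inv_mult_group G.m_assoc)
  qed
  then show ?case using eng by auto
 qed
 then have Ln: "L \<lhd> G" using Ls D0(2) by (simp add: G.normal_inv_iff)
 have clL: "closed_subgroup L G" using Ls Lo by (intro G.closed_open_subgroup) (simp add: open_subgroup_def)
 interpret L: tdlc "subgrp G L" by (rule G.tdlc_subgrp[OF clL])
 \<comment> \<open>The quotient of \<open>L\<close> by the residual is an image of the compact group
   \<open>W\<close>, and the quotient of the whole group by \<open>L\<close> is discrete.\<close>
 have "elementary (subgrp G L)"
 proof (rule elementary_extension_compact[of _ R W])
  show "tdlc (subgrp G L)" by unfold_locales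
  have "subgroup R (subgrp G L)" "subgroup W (subgrp G L)"
   using R(2) RL WL Ws by (simp_all add: subgroup_subgrp_iff[OF G.is_group Ls])
  then show "closed_normal R (subgrp G L)" "subgroup W (subgrp G L)"
   using cR RL Rconj LG unfolding closed_normal_def L.normal_inv_iff
   by (auto simp: inv_subgrp[OF G.is_group Ls] closedin_closed_subtopology subset_iff
     intro: closedin_subset_topspace)
  show "elementary (subgrp (subgrp G L) R)" using assms(3) RL by (simp add: subgrp_subgrp R_def)
  show "openin (gtop (subgrp G L)) W" using Wo WL by (auto simp: openin_subtopology)
  have "closedin (gtop G) W" using Wo Ws by (intro G.closedin_open_subgroup) (simp add: open_subgroup_def)
  then have "compactin (gtop G) W" by (intro closed_compactin[OF V(2)]) (auto simp: W_def)
  then show "compactin (gtop (subgrp G L)) W" using WL by (simp add: compactin_subtopology)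
  show "W <#>\<^bsub>subgrp G L\<^esub> R = carrier (subgrp G L)" by (simp add: L_def set_mult_def)
 qed
 then show ?thesis by (rule elementary_extension_discrete[OF assms(1) Ln Lo])
qed

theorem elementary_of_rank:
 fixes G :: "(nat => nat) tgroup"
 assumes "has_rank G \<alpha>" "tdlc G" shows "elementary G" using assms
proof (induction rule: rank_induct)
 case (trivial G)
 interpret G: tdlc G by fact
 have "compact_space (gtop G)" unfolding compact_space_def using trivial(2) by (intro finite_imp_compactin) auto
 then show ?case using trivial by (intro elementary.profinite)
next
 case (union G S \<rho>)
 interpret G: tdlc G by fact
 have "elementary (subgrp G (S i))" for i
 proof -
  have Si: "open_subgroup (S i) G" "compactly_generated (subgrp G (S i))"
   using union(3) by (auto simp: cg_exhaustion_def)
  interpret S: tdlc "subgrp G (S i)" by (rule G.tdlc_subgrp[OF G.closed_open_subgroup[OF Si(1)]])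
  show ?thesis by (rule elementary_of_residual[OF _ Si(2) union(5)])
    (rule S.tdlc_axioms, rule tdlc_residual[OF union(6) Si(1)])
 qed
 then show ?case using union(3) by (intro elementary.increasing_union[OF union(1)]) (auto simp: cg_exhaustion_def)
qed

section \<open>Powers of \<open>\<omega>\<close>\<close>

lemma ord_add_mono_right: "\<beta> \<le> \<gamma> ==> \<alpha> + \<beta> \<le> \<alpha> + (\<gamma> :: omega1)"
 using ord_add_bounds(2)[of \<beta> \<gamma> \<alpha>] by (cases "\<beta> = \<gamma>") (auto simp: order.order_iff_strict)

lemma less_ord_addE:
 assumes "\<epsilon> < \<beta> + (\<gamma> :: omega1)"
 obtains "\<epsilon> < \<beta>" | \<delta> where "\<delta> < \<gamma>" "\<epsilon> \<le> \<beta> + \<delta>" using assms ord_add_bounds(3)[of \<beta> \<epsilon> \<gamma>] by (meson not_le)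

lemma less_ord_multE:
 assumes "\<epsilon> < \<alpha> * (\<beta> :: omega1)"
 obtains \<gamma> where "\<gamma> < \<beta>" "\<epsilon> < \<alpha> * \<gamma> + \<alpha>" using assms ord_mult_bounds(2)[of \<beta> \<alpha> \<epsilon>] by (meson not_le)

lemma ord_add_mono_left: "\<alpha> \<le> \<beta> ==> \<alpha> + \<gamma> \<le> \<beta> + (\<gamma> :: omega1)"
proof (induction \<gamma> rule: less_induct)
 case (less \<gamma>)
 show ?case
 proof (rule ord_add_bounds(3))
  show "\<alpha> \<le> \<beta> + \<gamma>" using less(2) ord_add_bounds(1)[of \<beta> \<gamma>] by order
  show "\<alpha> + \<delta> < \<beta> + \<gamma>" if "\<delta> < \<gamma>" for \<delta> using less(1)[OF that less(2)] ord_add_bounds(2)[OF that, of \<beta>] by order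
 qed
qed

lemma ord_add_assoc: "(\<alpha> + \<beta>) + \<gamma> = \<alpha> + (\<beta> + (\<gamma> :: omega1))"
proof (induction \<gamma> rule: less_induct)
 case (less \<gamma>)
 show ?case
 proof (rule antisym)
  show "(\<alpha> + \<beta>) + \<gamma> \<le> \<alpha> + (\<beta> + \<gamma>)"
  proof (rule ord_add_bounds(3))
   show "\<alpha> + \<beta> \<le> \<alpha> + (\<beta> + \<gamma>)" by (intro ord_add_mono_right ord_add_bounds(1))
   show "\<alpha> + \<beta> + \<delta> < \<alpha> + (\<beta> + \<gamma>)" if "\<delta> < \<gamma>" for \<delta> unfolding less[OF that] by (intro ord_add_bounds(2) that)
  qed
  show "\<alpha> + (\<beta> + \<gamma>) \<le> (\<alpha> + \<beta>) + \<gamma>"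
  proof (rule ord_add_bounds(3))
   show "\<alpha> \<le> \<alpha> + \<beta> + \<gamma>" by (meson ord_add_bounds(1) order_trans)
   fix \<epsilon> assume "\<epsilon> < \<beta> + \<gamma>"
   then show "\<alpha> + \<epsilon> < \<alpha> + \<beta> + \<gamma>"
   proof (cases rule: less_ord_addE)
    case 1
    then show ?thesis using ord_add_bounds(2)[OF 1, of \<alpha>] ord_add_bounds(1)[of "\<alpha> + \<beta>" \<gamma>] by order
   next
    case (2 \<delta>)
    then show ?thesis
     using ord_add_mono_right[OF 2(2), of \<alpha>] less[OF 2(1)] ord_add_bounds(2)[OF 2(1), of "\<alpha> + \<beta>"] by order
   qed
  qed
 qed
qed

lemma ord_zero_add [simp]: "(0 :: omega1) + \<alpha> = \<alpha>"
proof (induction \<alpha> rule: less_induct)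
 case (less \<alpha>)
 show ?case
 proof (rule antisym)
  show "0 + \<alpha> \<le> \<alpha>" using less by (intro ord_add_bounds(3)) auto
  show "\<alpha> \<le> 0 + \<alpha>"
  proof (rule ccontr)
   assume "\<not> \<alpha> \<le> 0 + \<alpha>"
   then have "0 + \<alpha> < \<alpha>" by simp
   then show False using less[of "0 + \<alpha>"] ord_add_bounds(2)[of "0 + \<alpha>" \<alpha> 0] by simp
  qed
 qed
qed

lemma ord_mult_mono_right: "\<beta> \<le> \<gamma> ==> \<alpha> * \<beta> \<le> \<alpha> * (\<gamma> :: omega1)" by (intro ord_mult_bounds(2) ord_mult_bounds(1)) simp

lemma ord_mult_add_distrib: "\<alpha> * (\<beta> + \<gamma>) = \<alpha> * \<beta> + \<alpha> * (\<gamma> :: omega1)"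
proof (induction \<gamma> rule: less_induct)
 case (less \<gamma>)
 show ?case
 proof (rule antisym)
  show "\<alpha> * (\<beta> + \<gamma>) \<le> \<alpha> * \<beta> + \<alpha> * \<gamma>"
  proof (rule ord_mult_bounds(2))
   fix \<epsilon> assume "\<epsilon> < \<beta> + \<gamma>"
   then show "\<alpha> * \<epsilon> + \<alpha> \<le> \<alpha> * \<beta> + \<alpha> * \<gamma>"
   proof (cases rule: less_ord_addE)
    case 1
    then show ?thesis using ord_mult_bounds(1)[OF 1, of \<alpha>] ord_add_bounds(1)[of "\<alpha> * \<beta>" "\<alpha> * \<gamma>"] by order
   next
    case (2 \<delta>)
    have "\<alpha> * \<epsilon> + \<alpha> \<le> \<alpha> * (\<beta> + \<delta>) + \<alpha>" by (intro ord_add_mono_left ord_mult_mono_right 2)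
    also have "\<dots> = \<alpha> * \<beta> + (\<alpha> * \<delta> + \<alpha>)" unfolding less[OF 2(1)] by (rule ord_add_assoc)
    also have "\<dots> \<le> \<alpha> * \<beta> + \<alpha> * \<gamma>" by (intro ord_add_mono_right ord_mult_bounds(1) 2)
    finally show ?thesis .
   qed
  qed
  show "\<alpha> * \<beta> + \<alpha> * \<gamma> \<le> \<alpha> * (\<beta> + \<gamma>)"
  proof (rule ord_add_bounds(3))
   show "\<alpha> * \<beta> \<le> \<alpha> * (\<beta> + \<gamma>)" by (intro ord_mult_mono_right ord_add_bounds(1))
   fix \<epsilon> assume "\<epsilon> < \<alpha> * \<gamma>"
   then obtain \<delta> where \<delta>: "\<delta> < \<gamma>" "\<epsilon> < \<alpha> * \<delta> + \<alpha>" by (rule less_ord_multE)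
   have "\<alpha> * \<beta> + \<epsilon> < \<alpha> * \<beta> + (\<alpha> * \<delta> + \<alpha>)" by (rule ord_add_bounds(2)[OF \<delta>(2)])
   also have "\<dots> = \<alpha> * (\<beta> + \<delta>) + \<alpha>" unfolding less[OF \<delta>(1)] by (rule ord_add_assoc[symmetric])
   also have "\<dots> \<le> \<alpha> * (\<beta> + \<gamma>)" by (intro ord_mult_bounds(1) ord_add_bounds(2) \<delta>)
   finally show "\<alpha> * \<beta> + \<epsilon> < \<alpha> * (\<beta> + \<gamma>)" .
  qed
 qed
qed

text \<open>The j-fold multiple of \<open>omega ^ n\<close>, written as iterated addition on the
  right: the form in which the contributions of successive levels of the tree accumulate.\<close>

definition omega_power_times :: "nat => nat => omega1" where
 "omega_power_times n j = ((\<lambda>\<alpha>. \<alpha> + omega ^ n) ^^ j) 0"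

lemma omega_power_times_0 [simp]: "omega_power_times n 0 = 0" by (simp add: omega_power_times_def)

lemma omega_power_times_Suc: "omega_power_times n (Suc j) = omega_power_times n j + omega ^ n"
 by (simp add: omega_power_times_def)

lemma omega_power_0: "omega ^ 0 = (1 :: omega1)" by (rule power.power_0)

lemma omega_power_Suc: "omega ^ Suc n = omega * omega ^ n" by (rule power.power_Suc)

text \<open>\<open>omega ^ Suc n\<close> unfolds to \<open>omega * omega ^ n\<close> with the new
  factor on the left, whereas the multiples of \<open>omega ^ n\<close> grow on the right. Left
  distributivity reconciles the two in the induction step.\<close>

lemma omega_power_times_lub:
 "omega_power_times n j \<le> omega ^ Suc n"
 "(!!j. omega_power_times n j \<le> \<alpha>) ==> omega ^ Suc n \<le> \<alpha>"
proof -
 have "(\<forall>j. omega_power_times n j \<le> omega ^ Suc n) \<and>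
  (\<forall>\<alpha>. (\<forall>j. omega_power_times n j \<le> \<alpha>) --> omega ^ Suc n \<le> \<alpha>)"
 proof (induction n)
  case 0
  have "omega * 1 = omega" using ord_mult_add_one[of omega 0] by (simp add: ord_mult_0_right)
  then have "omega ^ Suc 0 = omega" by (simp only: omega_power_Suc omega_power_0)
  moreover have "omega_power_times 0 j = ((\<lambda>\<alpha>. \<alpha> + 1) ^^ j) 0" for j
   by (simp add: omega_power_times_def omega_power_0)
  ultimately show ?case
   using SUP_seq_upper_omega1[of "\<lambda>k. ((\<lambda>\<alpha>. \<alpha> + 1) ^^ k) 0"] SUP_seq_least_omega1[of "\<lambda>k. ((\<lambda>\<alpha>. \<alpha> + 1) ^^ k) 0"]
   by (simp add: omega_def)
 next
  case (Suc n)
  have *: "omega_power_times (Suc n) j = omega * omega_power_times n j" for j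
  proof (induction j)
   case (Suc j)
   then show ?case by (simp only: omega_power_times_Suc ord_mult_add_distrib omega_power_Suc)
  qed (simp add: ord_mult_0_right)
  show ?case
  proof (intro conjI allI impI)
   show "omega_power_times (Suc n) j \<le> omega ^ Suc (Suc n)" for j
    unfolding * omega_power_Suc[of "Suc n"] using Suc by (intro ord_mult_mono_right) blast
   fix \<alpha> assume \<alpha>: "\<forall>j. omega_power_times (Suc n) j \<le> \<alpha>"
   show "omega ^ Suc (Suc n) \<le> \<alpha>" unfolding omega_power_Suc[of "Suc n"]
   proof (rule ord_mult_bounds(2))
    fix \<gamma> assume "\<gamma> < omega ^ Suc n"
    \<comment> \<open>By the induction hypothesis \<gamma> is below a finite multiple of
      \<open>omega ^ n\<close>; multiplication by omega on the left turns this into a finite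
      multiple of \<open>omega ^ Suc n\<close>.\<close>
    then obtain j where "\<gamma> < omega_power_times n j" using Suc by (meson not_le)
    then have "omega * \<gamma> + omega \<le> omega * omega_power_times n j" by (rule ord_mult_bounds(1))
    then show "omega * \<gamma> + omega \<le> \<alpha>" using \<alpha> * by (metis order_trans)
   qed
  qed
 qed
 then show "omega_power_times n j \<le> omega ^ Suc n"
  "(!!j. omega_power_times n j \<le> \<alpha>) ==> omega ^ Suc n \<le> \<alpha>" by blast+
qed

lemma omega_power_times_add: "omega_power_times n (i + j) = omega_power_times n i + omega_power_times n j"
 by (induction j) (simp_all add: omega_power_times_Suc ord_add_assoc)

text \<open>Additive indecomposability: for a positive exponent each summand lies below a finite
  multiple of the previous power, and so does the sum.\<close>

lemma omega_power_add_closed: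
 assumes "\<alpha> < omega ^ n" "\<beta> < omega ^ n" shows "\<alpha> + \<beta> < omega ^ n"
proof (cases n)
 case 0
 then show ?thesis using assms by (simp add: omega_power_0 less_one_iff_omega1)
next
 case (Suc m)
 obtain i j where ij: "\<alpha> < omega_power_times m i" "\<beta> < omega_power_times m j"
  using assms omega_power_times_lub(2)[of m] unfolding Suc by (meson not_le)
 have "\<alpha> + \<beta> \<le> omega_power_times m i + \<beta>" using ij by (intro ord_add_mono_left) simp
 also have "\<dots> < omega_power_times m (i + j)" unfolding omega_power_times_add by (rule ord_add_bounds(2)[OF ij(2)])
 also have "\<dots> \<le> omega ^ n" unfolding Suc by (rule omega_power_times_lub(1))
 finally show ?thesis .
qed

lemma omega_power_pos: "0 < omega ^ n"
proof (induction n)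
 case 0
 then show ?case by (simp add: omega_power_0 less_one_iff_omega1)
next
 case (Suc n)
 have "omega ^ n \<le> omega ^ Suc n"
  using omega_power_times_lub(1)[of n "Suc 0"] by (simp only: omega_power_times_Suc omega_power_times_0 ord_zero_add)
 with Suc show ?case by order
qed

lemma omega_power_less_Suc: "omega ^ n < omega ^ Suc n"
proof -
 have "omega ^ n < omega ^ n + omega ^ n" using ord_add_bounds(2)[OF omega_power_pos[of n], of "omega ^ n"] by simp
 also have "\<dots> \<le> omega ^ Suc n" using omega_power_times_lub(1)[of n "Suc (Suc 0)"]
  by (simp only: omega_power_times_Suc omega_power_times_0 ord_zero_add)
 finally show ?thesis .
qed

lemma one_less_omega_power_Suc: "1 < omega ^ Suc n"
proof -
 have "1 \<le> omega ^ n" using omega_power_pos[of n] add_one_le_iff_less_omega1[of 0] by simp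
 then show ?thesis using omega_power_less_Suc[of n] by order
qed

text \<open>A 1 added on the left of an infinite power is absorbed. The condition 1 + \<beta> <
  \<rho> on ranks of residuals is met in the induction on the exponent because of this.\<close>

lemma one_add_omega_power_Suc: "1 + omega ^ Suc n = omega ^ Suc n"
proof (rule antisym)
 show "1 + omega ^ Suc n \<le> omega ^ Suc n" using one_less_omega_power_Suc[of n]
  by (intro ord_add_bounds(3) omega_power_add_closed) auto
 show "omega ^ Suc n \<le> 1 + omega ^ Suc n" using ord_add_mono_left[of 0 1 "omega ^ Suc n"] by simp
qed

section \<open>Permutation groups with a compact open subgroup\<close>

lemma hom_continuous_at_one:
 fixes G (structure)
 assumes "topological_group G" "topological_group H" "\<pi> : hom G H"
  "!!W. openin (gtop H) W ==> \<one>\<^bsub>H\<^esub> : W ==> \<exists>W'. openin (gtop G) W' \<and> \<one> : W' \<and> \<pi> ` W' \<subseteq> W" shows "\<pi> : cont_hom G H"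
proof -
 interpret G: top_group G using assms(1) by unfold_locales
 interpret H: top_group H using assms(2) by unfold_locales
 interpret h: group_hom G H \<pi> using assms(3) by unfold_locales
 have "openin (gtop G) {x : topspace (gtop G). \<pi> x : S}" if S: "openin (gtop H) S" for S
 proof (subst openin_subopen, intro ballI)
  fix x assume x: "x : {x : topspace (gtop G). \<pi> x : S}"
  then have xG: "x : carrier G" by simp
  have "openin (gtop H) ((\<lambda>y. inv\<^bsub>H\<^esub> (\<pi> x) \<otimes>\<^bsub>H\<^esub> y) ` S)" using xG S by (intro H.openin_lmult) auto
  moreover have "\<one>\<^bsub>H\<^esub> : (\<lambda>y. inv\<^bsub>H\<^esub> (\<pi> x) \<otimes>\<^bsub>H\<^esub> y) ` S" using x by (intro image_eqI[of _ _ "\<pi> x"]) auto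
  ultimately obtain W where W: "openin (gtop G) W" "\<one> : W"
   "\<pi> ` W \<subseteq> (\<lambda>y. inv\<^bsub>H\<^esub> (\<pi> x) \<otimes>\<^bsub>H\<^esub> y) ` S" using assms(4) by meson
  have WG: "W \<subseteq> carrier G" using W(1) by (rule G.open_subset)
  have SH: "S \<subseteq> carrier H" using S by (rule H.open_subset)
  have "\<pi> (x \<otimes> w) : S" if w: "w : W" for w
  proof -
   obtain y where y: "y : S" "\<pi> w = inv\<^bsub>H\<^esub> (\<pi> x) \<otimes>\<^bsub>H\<^esub> y" using W(3) w by auto
   have "\<pi> (x \<otimes> w) = \<pi> x \<otimes>\<^bsub>H\<^esub> (inv\<^bsub>H\<^esub> (\<pi> x) \<otimes>\<^bsub>H\<^esub> y)" using xG w WG y by auto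
   also have "\<dots> = y" using xG y SH by (auto simp: H.m_assoc[symmetric])
   finally show ?thesis using y by simp
  qed
  then have "(\<lambda>w. x \<otimes> w) ` W \<subseteq> {x : topspace (gtop G). \<pi> x : S}" using xG WG by auto
  moreover have "x : (\<lambda>w. x \<otimes> w) ` W" using W(2) xG by (intro image_eqI[of _ _ "\<one>"]) auto
  ultimately show "\<exists>T. openin (gtop G) T \<and> x : T \<and> T \<subseteq> {x : topspace (gtop G). \<pi> x : S}"
   using G.openin_lmult[OF xG W(1)] by blast
 qed
 then show ?thesis using assms(3) by (auto simp: cont_hom_def continuous_map_def)
qed

section \<open>The topology of a permutation group with a distinguished compact subgroup\<close>

abbreviation invp :: "('y => 'y) => 'y => 'y" where
 "invp g \<equiv> inv_into UNIV g"

text \<open>Basic neighbourhoods of g consist of the f in the coset g U that agree with g on a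
  finite set. This refines pointwise convergence just enough to make \<open>U\<close> open; on
  \<open>U\<close> itself the two topologies agree.\<close>

definition perm_topology :: "('y => 'y) set => ('y => 'y) set => ('y => 'y) topology" where
 "perm_topology G U = topology (\<lambda>S. S \<subseteq> G \<and>
   (\<forall>g\<in>S. \<exists>F. finite F \<and> (\<forall>f\<in>G. invp g o f : U \<and> (\<forall>y\<in>F. f y = g y) --> f : S)))"

definition perm_group :: "('y => 'y) set => ('y => 'y) set => ('y => 'y) tgroup" where
 "perm_group G U = \<lparr>carrier = G, mult = (\<circ>), one = id, gtop = perm_topology G U\<rparr>"

lemma perm_group_sel [simp]: "carrier (perm_group G U) = G" "mult (perm_group G U) = (\<circ>)"
 "one (perm_group G U) = id" "gtop (perm_group G U) = perm_topology G U" by (simp_all add: perm_group_def)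

lemma openin_perm_topology:
 "openin (perm_topology G U) S \<longleftrightarrow> S \<subseteq> G \<and>
   (\<forall>g\<in>S. \<exists>F. finite F \<and> (\<forall>f\<in>G. invp g o f : U \<and> (\<forall>y\<in>F. f y = g y) --> f : S))"
proof -
 define P where "P S \<longleftrightarrow> S \<subseteq> G \<and>
   (\<forall>g\<in>S. \<exists>F. finite F \<and> (\<forall>f\<in>G. invp g o f : U \<and> (\<forall>y\<in>F. f y = g y) --> f : S))" for S
 have "P (S \<inter> T)" if "P S" "P T" for S T unfolding P_def
 proof (intro conjI ballI)
  fix g assume "g : S \<inter> T"
  then have g: "g : S" "g : T" by auto
  obtain F where "finite F" "\<forall>f\<in>G. invp g o f : U \<and> (\<forall>y\<in>F. f y = g y) --> f : S"
   using \<open>P S\<close> g(1) unfolding P_def by meson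
  moreover obtain F' where "finite F'" "\<forall>f\<in>G. invp g o f : U \<and> (\<forall>y\<in>F'. f y = g y) --> f : T"
   using \<open>P T\<close> g(2) unfolding P_def by meson
  ultimately show "\<exists>F. finite F \<and> (\<forall>f\<in>G. invp g o f : U \<and> (\<forall>y\<in>F. f y = g y) --> f : S \<inter> T)"
   by (intro exI[of _ "F \<union> F'"]) auto
 qed (use that in \<open>auto simp: P_def\<close>)
 moreover have "P (\<Union>K)" if K: "\<forall>S\<in>K. P S" for K unfolding P_def
 proof (intro conjI ballI)
  fix g assume "g : \<Union>K"
  then obtain S where S: "S : K" "g : S" by auto
  then obtain F where "finite F" "\<forall>f\<in>G. invp g o f : U \<and> (\<forall>y\<in>F. f y = g y) --> f : S" using K unfolding P_def by meson
  then show "\<exists>F. finite F \<and> (\<forall>f\<in>G. invp g o f : U \<and> (\<forall>y\<in>F. f y = g y) --> f : \<Union>K)" using S by blast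
 qed (use that in \<open>auto simp: P_def\<close>)
 ultimately have "istopology P" by (simp add: istopology_def)
 then show ?thesis using topology_inverse'[of P] unfolding P_def perm_topology_def by simp
qed

lemma topspace_perm_topology [simp]: "topspace (perm_topology G U) = G"
proof -
 have "openin (perm_topology G U) G" by (auto simp: openin_perm_topology)
 moreover have "topspace (perm_topology G U) \<subseteq> G"
  using openin_perm_topology[of G U "topspace (perm_topology G U)"] by simp
 ultimately show ?thesis using openin_subset by blast
qed

text \<open>\<open>U_orbits\<close> and \<open>U_closed\<close> make \<open>U\<close> a closed
  subset of a product of finite sets, hence compact. \<open>commensurated\<close> says that
  conjugation carries a small neighbourhood of the identity back into \<open>U\<close>, which gives
  continuity of multiplication. Countably many points and cosets give second countability.\<close>

locale perm_pair =
 fixes G U :: "('y => 'y) set"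
 assumes bij: "g : G ==> bij g" and comp: "[|g : G; h : G|] ==> g o h : G" and invp: "g : G ==> invp g : G"
  and U_sub: "U \<subseteq> G" and U_id: "id : U" and U_comp: "[|g : U; h : U|] ==> g o h : U"
  and U_invp: "g : U ==> invp g : U"
  and commensurated: "h : G ==> \<exists>F. finite F \<and> (\<forall>u\<in>U. (\<forall>y\<in>F. u y = y) --> invp h o u o h : U)"
  and U_orbits: "finite ((\<lambda>u. u y) ` U)" and U_closed: "(!!F. finite F ==> \<exists>u\<in>U. \<forall>y\<in>F. u y = f y) ==> f : U"
  and countable_points: "countable (UNIV :: 'y set)"
  and countable_cosets: "\<exists>D. countable D \<and> D \<subseteq> G \<and> (\<forall>g\<in>G. \<exists>d\<in>D. invp d o g : U)"
begin

abbreviation "PG \<equiv> perm_group G U"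

lemma invp_comp [simp]: "g : G ==> invp g o g = id" "g : G ==> g o invp g = id"
 using bij by (auto simp: bij_def inv_o_cancel surj_iff)

lemma invp_apply [simp]: "g : G ==> invp g (g y) = y" "g : G ==> g (invp g y) = y"
 using bij by (auto simp: bij_def inv_f_f surj_f_inv_f)

lemma id_mem: "id : G" using U_sub U_id by auto

lemma U_mem: "u : U ==> u : G" using U_sub by auto

lemma group_PG: "group PG"
proof (rule groupI)
 fix g assume "g : carrier PG"
 then show "\<exists>h\<in>carrier PG. h \<otimes>\<^bsub>PG\<^esub> g = \<one>\<^bsub>PG\<^esub>" by (intro bexI[of _ "invp g"]) (auto simp: invp)
qed (auto simp: comp id_mem comp_assoc)

lemma m_inv_PG [simp]: "g : G ==> inv\<^bsub>PG\<^esub> g = invp g" by (rule group.inv_equality[OF group_PG]) (auto simp: invp)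

lemma openin_coset:
 assumes "finite F" shows "openin (perm_topology G U) {f : G. invp g o f : U \<and> (\<forall>y\<in>F. f y = h y)}"
 unfolding openin_perm_topology
proof (intro conjI ballI)
 fix f assume f: "f : {f : G. invp g o f : U \<and> (\<forall>y\<in>F. f y = h y)}"
 have "invp g o f' : U" if "f' : G" "invp f o f' : U" for f'
 proof -
  have "(invp g o f) o (invp f o f') : U" by (rule U_comp) (use f that in auto)
  also have "(invp g o f) o (invp f o f') = invp g o f'" using f by (simp add: fun_eq_iff)
  finally show ?thesis .
 qed
 then show "\<exists>F'. finite F' \<and> (\<forall>f'\<in>G. invp f o f' : U \<and> (\<forall>y\<in>F'. f' y = f y) -->
   f' : {f : G. invp g o f : U \<and> (\<forall>y\<in>F. f y = h y)})" using assms f by (intro exI[of _ F]) auto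
qed auto

lemma topological_group_PG: "topological_group PG" unfolding topological_group_def
proof (intro conjI)
 let ?T = "perm_topology G U"
 have "openin (prod_topology ?T ?T) {p : topspace (prod_topology ?T ?T). (\<lambda>(x, y). x o y) p : S}"
  if S: "openin ?T S" for S unfolding openin_prod_topology_alt
 proof (intro allI impI)
  fix g h assume "(g, h) : {p : topspace (prod_topology ?T ?T). (\<lambda>(x, y). x o y) p : S}"
  then have gh: "g : G" "h : G" "g o h : S" by auto
  obtain F where F: "finite F" "!!f. [|f : G; invp (g o h) o f : U; \<forall>y\<in>F. f y = (g o h) y|] ==> f : S"
   using S gh(3) unfolding openin_perm_topology by meson
  \<comment> \<open>For g' near g and h' near h, the element (g h)^-1 (g' h') is the conjugate of
    g^-1 g' by h^-1, times h^-1 h'. Fixing the points of \<open>F'\<close> keeps the first factor in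
    \<open>U\<close>.\<close>
  obtain F' where F': "finite F'" "!!u. u : U ==> \<forall>y\<in>F'. u y = y ==> invp h o u o h : U"
   using commensurated[OF gh(2)] by blast
  let ?A = "{f : G. invp g o f : U \<and> (\<forall>y\<in>F' \<union> h ` F. f y = g y)}"
  let ?B = "{f : G. invp h o f : U \<and> (\<forall>y\<in>F. f y = h y)}"
  have "g' o h' : S" if "g' : ?A" "h' : ?B" for g' h'
  proof (rule F(2))
   show "g' o h' : G" using that by (auto intro: comp)
   have "invp h o (invp g o g') o h : U" using that gh(1) by (intro F'(2)) auto
   then have "(invp h o (invp g o g') o h) o (invp h o h') : U" by (rule U_comp) (use that in auto)
   also have "(invp h o (invp g o g') o h) o (invp h o h') = invp (g o h) o (g' o h')"
    using gh that bij by (simp add: fun_eq_iff o_inv_distrib)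
   finally show "invp (g o h) o (g' o h') : U" .
   show "\<forall>y\<in>F. (g' o h') y = (g o h) y" using that by auto
  qed
  moreover have "openin ?T ?A" "openin ?T ?B" using F(1) F'(1) by (intro openin_coset; simp)+
  moreover have "g : ?A" "h : ?B" using gh U_id by auto
  ultimately show "\<exists>A B. openin ?T A \<and> openin ?T B \<and> g : A \<and> h : B \<and>
    A \<times> B \<subseteq> {p : topspace (prod_topology ?T ?T). (\<lambda>(x, y). x o y) p : S}" by (intro exI[of _ ?A] exI[of _ ?B]) auto
 qed
 then show "continuous_map (prod_topology (gtop PG) (gtop PG)) (gtop PG) (\<lambda>(x, y). x \<otimes>\<^bsub>PG\<^esub> y)"
  unfolding continuous_map_def by (auto intro: comp)
 have "openin ?T {g : topspace ?T. inv\<^bsub>PG\<^esub> g : S}" if S: "openin ?T S" for S unfolding openin_perm_topology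
 proof (intro conjI ballI)
  fix g assume "g : {g : topspace ?T. inv\<^bsub>PG\<^esub> g : S}"
  then have g: "g : G" "invp g : S" by auto
  obtain F where F: "finite F" "!!f. [|f : G; invp (invp g) o f : U; \<forall>y\<in>F. f y = invp g y|] ==> f : S"
   using S g(2) unfolding openin_perm_topology by meson
  obtain F' where F': "finite F'" "!!u. u : U ==> \<forall>y\<in>F'. u y = y ==> invp (invp g) o u o invp g : U"
   using commensurated[OF invp[OF g(1)]] by blast
  have "invp g' : S" if g': "g' : G" "invp g o g' : U" "\<forall>y\<in>F' \<union> invp g ` F. g' y = g y" for g'
  proof (rule F(2))
   show "invp g' : G" using g'(1) by (rule invp)
   have gg: "invp (invp g) = g" using g(1) bij by (simp add: inv_inv_eq)
   have *: "invp (invp g o g') = invp g' o g" using g(1) g'(1) bij invp gg by (simp add: o_inv_distrib)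
   have "invp (invp g) o (invp g' o g) o invp g : U"
   proof (rule F'(2))
    show "invp g' o g : U" using U_invp[OF g'(2)] unfolding * .
    show "\<forall>y\<in>F'. (invp g' o g) y = y" using g'(3) invp_apply(1)[OF g'(1)] by (auto, metis UnCI)
   qed
   also have "invp (invp g) o (invp g' o g) o invp g = invp (invp g) o invp g'" using g(1) by (simp add: fun_eq_iff)
   finally show "invp (invp g) o invp g' : U" .
   show "\<forall>y\<in>F. invp g' y = invp g y"
   proof
    fix y assume "y : F"
    then have "g' (invp g y) = y" using g'(3) g(1) by auto
    then show "invp g' y = invp g y" using invp_apply(1)[OF g'(1), of "invp g y"] by simp
   qed
  qed
  then show "\<exists>F. finite F \<and> (\<forall>f\<in>G. invp g o f : U \<and> (\<forall>y\<in>F. f y = g y) --> f : {g : topspace ?T. inv\<^bsub>PG\<^esub> g : S})"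
   using F(1) F'(1) by (intro exI[of _ "F' \<union> invp g ` F"]) auto
 qed auto
 then show "continuous_map (gtop PG) (gtop PG) (m_inv PG)" unfolding continuous_map_def by (auto intro: invp)
qed (auto simp: group_PG)

definition small :: "'y set => ('y => 'y) set" where
 "small F = {u : U. \<forall>y\<in>F. u y = y}"

lemma subgroup_small: "subgroup (small F) PG"
proof (rule group.subgroupI[OF group_PG])
 show "inv\<^bsub>PG\<^esub> a : small F" if a: "a : small F" for a
 proof -
  have "invp a y = y" if "y : F" for y
  proof -
   have "a y = y" "a : G" using a that U_mem by (auto simp: small_def)
   then show ?thesis using invp_apply(1)[of a y] by simp
  qed
  then show ?thesis using a U_invp U_mem by (auto simp: small_def)
 qed
qed (use U_sub U_id U_comp in \<open>auto simp: small_def\<close>)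

lemma small_eq_coset: "small F = {f : G. invp id o f : U \<and> (\<forall>y\<in>F. f y = id y)}" using U_sub by (auto simp: small_def)

lemma openin_small: "finite F ==> openin (perm_topology G U) (small F)"
 unfolding small_eq_coset by (rule openin_coset)

lemma openin_contains_small:
 assumes "openin (perm_topology G U) W" "id : W"
 obtains F where "finite F" "small F \<subseteq> W"
proof -
 obtain F where "finite F" "\<forall>f\<in>G. invp id o f : U \<and> (\<forall>y\<in>F. f y = id y) --> f : W"
  using assms unfolding openin_perm_topology by meson
 then show thesis using that[of F] unfolding small_eq_coset by blast
qed

text \<open>Tychonoff for the product of the orbits of \<open>U\<close>. Within \<open>U\<close> the
  coset condition of the topology holds automatically, so pointwise convergence on finite sets is
  all that remains.\<close>

lemma compactin_U: "compactin (perm_topology G U) U"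
proof -
 let ?X = "product_topology (\<lambda>y::'y. discrete_topology (UNIV :: 'y set)) UNIV"
 have op: "openin ?X {f. \<forall>y\<in>F. f y = g y}" if "finite F" for F and g :: "'y => 'y"
 proof -
  have "openin ?X {f. f y = g y}" for y
  proof -
   have "continuous_map ?X (discrete_topology (UNIV :: 'y set)) (\<lambda>f. f y)"
    by (rule continuous_map_product_projection) simp
   then have "openin ?X {f : topspace ?X. f y : {g y}}"
    by (intro openin_continuous_map_preimage[where Y = "discrete_topology UNIV"]) auto
   then show ?thesis by simp
  qed
  then have "openin ?X (\<Inter>y\<in>F. {f. f y = g y})" if "F \<noteq> {}" using \<open>finite F\<close> that by (intro openin_INT2) auto
  moreover have "{f. \<forall>y\<in>F. f y = g y} = (\<Inter>y\<in>F. {f. f y = g y})" by auto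
  moreover have "openin ?X UNIV" using openin_topspace[of ?X] by simp
  ultimately show ?thesis by (cases "F = {}") auto
 qed
 have "openin ?X (- U)"
 proof (subst openin_subopen, intro ballI)
  fix f assume "f : - U"
  then obtain F where F: "finite F" "!!u. u : U ==> \<exists>y\<in>F. u y \<noteq> f y" using U_closed[of f] by blast
  then have "{f'. \<forall>y\<in>F. f' y = f y} \<subseteq> - U" by fastforce
  then show "\<exists>T. openin ?X T \<and> f : T \<and> T \<subseteq> - U" using op[OF F(1), of f] by blast
 qed
 then have cl: "closedin ?X U" by (simp add: closedin_def Compl_eq_Diff_UNIV)
 have "compactin ?X (PiE UNIV (\<lambda>y. (\<lambda>u. u y) ` U))"
  unfolding compactin_PiE using U_orbits by (auto intro!: finite_imp_compactin)
 then have "compactin ?X U" by (rule closed_compactin) (use cl in auto)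
 moreover have "continuous_map (subtopology ?X U) (perm_topology G U) id" unfolding continuous_map_def
 proof (intro conjI allI impI)
  show "id : topspace (subtopology ?X U) \<rightarrow> topspace (perm_topology G U)" using U_sub by auto
  fix S assume S: "openin (perm_topology G U) S"
  show "openin (subtopology ?X U) {x : topspace (subtopology ?X U). id x : S}"
  proof (subst openin_subopen, intro ballI)
   fix g assume g: "g : {x : topspace (subtopology ?X U). id x : S}"
   then have gU: "g : U" "g : S" by auto
   obtain F where F: "finite F" "!!f. [|f : G; invp g o f : U; \<forall>y\<in>F. f y = g y|] ==> f : S"
    using S gU(2) unfolding openin_perm_topology by meson
   have "{f. \<forall>y\<in>F. f y = g y} \<inter> U \<subseteq> {x : topspace (subtopology ?X U). id x : S}"
    using F(2) U_mem U_comp U_invp gU by auto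
   moreover have "openin (subtopology ?X U) ({f. \<forall>y\<in>F. f y = g y} \<inter> U)"
    using op[OF F(1)] by (auto simp: openin_subtopology)
   ultimately show "\<exists>T. openin (subtopology ?X U) T \<and> g : T \<and> T \<subseteq> {x : topspace (subtopology ?X U). id x : S}"
    using gU by (intro exI[of _ "{f. \<forall>y\<in>F. f y = g y} \<inter> U"]) auto
  qed
 qed
 ultimately show ?thesis
  using image_compactin[of "subtopology ?X U" U "perm_topology G U" id] by (simp add: compactin_subtopology)
qed

sublocale tdlc PG
proof
 show "topological_group PG" by (rule topological_group_PG)
 interpret T: top_group PG by unfold_locales (rule topological_group_PG)
 let ?T = "perm_topology G U"
 have sm: "\<exists>C. open_subgroup C PG \<and> compactin (gtop PG) C \<and> C \<subseteq> W"
  if W: "openin (gtop PG) W" "\<one>\<^bsub>PG\<^esub> : W" for W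
 proof -
  obtain F where F: "finite F" "small F \<subseteq> W" using openin_contains_small W by auto
  have o: "open_subgroup (small F) PG" using openin_small[OF F(1)] subgroup_small by (simp add: open_subgroup_def)
  have "closedin ?T (small F)" using T.closedin_open_subgroup[OF o] by simp
  then have "compactin ?T (small F)" by (intro closed_compactin[OF compactin_U]) (auto simp: small_def)
  then show ?thesis using o F by auto
 qed
 have "Hausdorff_space ?T" unfolding Hausdorff_space_def
 proof (intro allI impI)
  fix g h assume gh: "g : topspace ?T \<and> h : topspace ?T \<and> g \<noteq> h"
  then obtain y where y: "g y \<noteq> h y" by auto
  have "disjnt {f : G. invp g o f : U \<and> (\<forall>y\<in>{y}. f y = g y)} {f : G. invp h o f : U \<and> (\<forall>y\<in>{y}. f y = h y)}"
   using y by (auto simp: disjnt_def)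
  then show "\<exists>A B. openin ?T A \<and> openin ?T B \<and> g : A \<and> h : B \<and> disjnt A B"
   using gh U_id openin_coset[of "{y}" g g] openin_coset[of "{y}" h h]
   by (intro exI[of _ "{f : G. invp g o f : U \<and> (\<forall>y\<in>{y}. f y = g y)}"]
     exI[of _ "{f : G. invp h o f : U \<and> (\<forall>y\<in>{y}. f y = h y)}"]) auto
 qed
 moreover have "Abstract_Topological_Spaces.second_countable ?T"
 proof -
  obtain D where D: "countable D" "D \<subseteq> G" "!!g. g : G ==> \<exists>d\<in>D. invp d o g : U" using countable_cosets by blast
  let ?b = "\<lambda>(d, P). {f : G. invp d o f : U \<and> (\<forall>(y, z)\<in>P. f y = z)}"
  let ?Ps = "{P :: ('y \<times> 'y) set. finite P}"
  define \<B> where "\<B> = ?b ` (D \<times> ?Ps)"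
  have "countable (UNIV :: ('y \<times> 'y) set)" using countable_points by (simp flip: UNIV_Times_UNIV)
  then have "countable ?Ps" using countable_Collect_finite_subset[of UNIV] by simp
  then have "countable \<B>" unfolding \<B>_def using D(1) by (intro countable_image countable_SIGMA)
  moreover have "openin ?T V" if VB: "V : \<B>" for V
  proof -
   obtain d P where V: "finite P" "V = {f : G. invp d o f : U \<and> (\<forall>(y, z)\<in>P. f y = z)}"
    using VB unfolding \<B>_def by auto
   show ?thesis
   proof (subst openin_subopen, intro ballI)
    fix g assume g: "g : V"
    let ?A = "{f : G. invp d o f : U \<and> (\<forall>y\<in>fst ` P. f y = g y)}"
    have "?A \<subseteq> V" using g unfolding V(2) by fastforce
    then show "\<exists>T. openin ?T T \<and> g : T \<and> T \<subseteq> V"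
     using openin_coset[of "fst ` P" d g] V(1) g unfolding V(2) by (intro exI[of _ ?A]) auto
   qed
  qed
  moreover have "\<exists>V\<in>\<B>. g : V \<and> V \<subseteq> S" if S: "openin ?T S" "g : S" for S g
  proof -
   obtain F where F: "finite F" "!!f. [|f : G; invp g o f : U; \<forall>y\<in>F. f y = g y|] ==> f : S"
    using S unfolding openin_perm_topology by meson
   have gG: "g : G" using S unfolding openin_perm_topology by auto
   obtain d where d: "d : D" "invp d o g : U" using D(3)[OF gG] by auto
   let ?P = "(\<lambda>y. (y, g y)) ` F"
   have dG: "d : G" using d D by auto
   have "invp g o f : U" if "f : G" "invp d o f : U" for f
   proof -
    have "invp (invp d o g) o (invp d o f) : U" by (rule U_comp[OF U_invp]) (use d that in auto)
    also have "invp (invp d o g) = invp g o d" using dG gG bij invp by (simp add: o_inv_distrib inv_inv_eq)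
    finally show ?thesis using dG by (simp add: fun_eq_iff comp_def)
   qed
   then have "?b (d, ?P) \<subseteq> S" using F(2) by auto
   moreover have "g : ?b (d, ?P)" using gG d by auto
   moreover have "?b (d, ?P) : \<B>" unfolding \<B>_def by (rule imageI) (use d F(1) in auto)
   ultimately show ?thesis by (intro bexI[of _ "?b (d, ?P)"] conjI)
  qed
  ultimately show ?thesis unfolding second_countable_def by (intro exI[of _ \<B>]) blast
 qed
 ultimately show "tdlc_group PG" using sm topological_group_PG by (simp add: tdlc_group_def)
qed

lemma tdlc_PG: "tdlc PG" by unfold_locales

lemma closedin_PG:
 assumes "S \<subseteq> G"
  "!!g. [|g : G; !!F. finite F ==> \<exists>f\<in>S. invp g o f : U \<and> (\<forall>y\<in>F. f y = g y)|] ==> g : S"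
 shows "closedin (perm_topology G U) S"
proof -
 have "openin (perm_topology G U) (G - S)" unfolding openin_perm_topology
 proof (intro conjI ballI)
  fix g assume "g : G - S"
  then obtain F where "finite F" "\<forall>f\<in>S. \<not> (invp g o f : U \<and> (\<forall>y\<in>F. f y = g y))"
   using assms(2)[of g] by (meson DiffD1 DiffD2)
  then show "\<exists>F. finite F \<and> (\<forall>f\<in>G. invp g o f : U \<and> (\<forall>y\<in>F. f y = g y) --> f : G - S)" by (intro exI[of _ F]) auto
 qed auto
 then show ?thesis using assms(1) by (simp add: closedin_def)
qed

lemma closedin_PG_D:
 assumes "closedin (perm_topology G U) S" "g : G"
  "!!F. finite F ==> \<exists>f\<in>S. invp g o f : U \<and> (\<forall>y\<in>F. f y = g y)" shows "g : S"
proof (rule ccontr)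
 assume "g \<notin> S"
 have "S \<subseteq> G" "openin (perm_topology G U) (G - S)" using assms(1) by (auto simp: closedin_def)
 then obtain F where F: "finite F" "\<forall>f\<in>G. invp g o f : U \<and> (\<forall>y\<in>F. f y = g y) --> f : G - S"
  using \<open>g \<notin> S\<close> assms(2) unfolding openin_perm_topology by (meson DiffI)
 then show False using assms(3)[OF F(1)] \<open>S \<subseteq> G\<close> by blast
qed

lemma open_subgroup_PG:
 assumes "subgroup N PG" "finite F" "small F \<subseteq> N" shows "open_subgroup N PG"
 using assms openin_small[OF assms(2)] subgroup.one_closed[OF subgroup_small]
 by (intro open_subgroupI[of N "small F"]) auto

end

lemma perm_cont_hom:
 assumes "perm_pair G U" "perm_pair G' U'" "subgroup A (perm_group G U)" "!!g. g : A ==> \<pi> g : G'"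
  "!!g h. g : A ==> h : A ==> \<pi> (g o h) = \<pi> g o \<pi> h"
  "!!F'. finite F' ==> \<exists>F. finite F \<and> (\<forall>u\<in>U \<inter> A. (\<forall>y\<in>F. u y = y) --> \<pi> u : U' \<and> (\<forall>y\<in>F'. \<pi> u y = y))"
 shows "\<pi> : cont_hom (subgrp (perm_group G U) A) (perm_group G' U')"
proof -
 interpret G: perm_pair G U by fact
 interpret G': perm_pair G' U' by fact
 show ?thesis
 proof (rule hom_continuous_at_one)
  show "topological_group (subgrp (perm_group G U) A)" by (rule G.top_group_subgrp[OF assms(3)])
  show "\<pi> : hom (subgrp (perm_group G U) A) (perm_group G' U')" using assms(4,5) by (auto simp: hom_def)
  fix W assume W: "openin (gtop (perm_group G' U')) W" "\<one>\<^bsub>perm_group G' U'\<^esub> : W"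
  obtain F' where F': "finite F'" "G'.small F' \<subseteq> W" using G'.openin_contains_small W by auto
  obtain F where F: "finite F" "!!u. [|u : U \<inter> A; \<forall>y\<in>F. u y = y|] ==> \<pi> u : U' \<and> (\<forall>y\<in>F'. \<pi> u y = y)"
   using assms(6)[OF F'(1)] by blast
  have "\<pi> ` (G.small F \<inter> A) \<subseteq> W" using F(2) F'(2) by (auto simp: G.small_def G'.small_def)
  moreover have "openin (gtop (subgrp (perm_group G U) A)) (G.small F \<inter> A)"
   using G.openin_small[OF F(1)] by (auto simp: openin_subtopology)
  moreover have "id : G.small F \<inter> A" using G.U_id subgroup.one_closed[OF assms(3)] by (auto simp: G.small_def)
  ultimately show "\<exists>W'. openin (gtop (subgrp (perm_group G U) A)) W' \<and>
    \<one>\<^bsub>subgrp (perm_group G U) A\<^esub> : W' \<and> \<pi> ` W' \<subseteq> W" by auto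
 qed (rule G'.topological_group_PG)
qed

section \<open>The action on the cosets of a compact open subgroup\<close>

text \<open>The permutation representation on the left cosets of \<open>V\<close>:
  \<open>core\<close> makes it faithful, \<open>inf\<close> makes the index infinite, and being
  countable the cosets can be numbered by the naturals. It carries a group to the type on which
  \<open>tree\<close> and \<open>elementary\<close> are formulated, with \<open>V\<close> becoming
  the stabiliser of 0.\<close>

lemma (in tdlc) coset_action:
 assumes V: "open_subgroup V G" "compactin (gtop G) V"
  and core: "!!x. [|x : carrier G; !!g. g : carrier G ==> inv g \<otimes> x \<otimes> g : V|] ==> x = \<one>"
  and inf: "!!J. finite J ==> J \<subseteq> carrier G ==> \<exists>x\<in>carrier G. \<forall>g\<in>J. inv g \<otimes> x \<notin> V"
 obtains H :: "(nat => nat) set" and \<rho> where "perm_pair H {h : H. h 0 = 0}"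
  "\<rho> : top_iso G (perm_group H {h : H. h 0 = 0})" "!!n. \<exists>h\<in>H. h 0 = n"
  "!!g. g : carrier G ==> \<rho> g 0 = 0 \<longleftrightarrow> g : V"
proof -
 have Vs: "subgroup V G" "openin (gtop G) V" "V \<subseteq> carrier G" "closedin (gtop G) V"
  using V closedin_open_subgroup by (auto simp: open_subgroup_def dest: subgroup.subset)
 define R where "R g = {x : carrier G. inv g \<otimes> x : V}" for g
 have R_eq: "R g = R h \<longleftrightarrow> inv g \<otimes> h : V" if "g : carrier G" "h : carrier G" for g h
 proof
  assume "R g = R h"
  moreover have "h : R h" using that subgroup.one_closed[OF Vs(1)] by (simp add: R_def)
  ultimately show "inv g \<otimes> h : V" by (auto simp: R_def)
 next
  assume gh: "inv g \<otimes> h : V"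
  have "inv g \<otimes> x : V \<longleftrightarrow> inv h \<otimes> x : V" if "x : carrier G" for x
  proof -
   have "inv g \<otimes> x = (inv g \<otimes> h) \<otimes> (inv h \<otimes> x)" "inv h \<otimes> x = inv (inv g \<otimes> h) \<otimes> (inv g \<otimes> x)"
    using that \<open>g : carrier G\<close> \<open>h : carrier G\<close> by (simp_all add: group_simps)
   then show ?thesis using gh subgroup.m_closed[OF Vs(1)] subgroup.m_inv_closed[OF Vs(1)] by metis
  qed
  then show "R g = R h" by (auto simp: R_def)
 qed
 define \<C> where "\<C> = R ` carrier G"
 have "countable \<C>"
 proof -
  obtain J where J: "countable J" "J \<subseteq> carrier G" "!!x. x : carrier G ==> \<exists>g\<in>J. inv g \<otimes> x : V"
   by (rule countable_coset_cover[OF V(1)], rule that)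
  have "\<C> \<subseteq> R ` J"
  proof
   fix X assume "X : \<C>"
   then obtain x where x: "x : carrier G" "X = R x" by (auto simp: \<C>_def)
   then obtain g where g: "g : J" "inv g \<otimes> x : V" using J(3) by blast
   then have "R g = R x" using R_eq[of g x] J(2) x(1) by blast
   then show "X : R ` J" using g(1) x(2) by (metis imageI)
  qed
  then show ?thesis by (rule countable_subset) (simp add: J(1))
 qed
 moreover have "infinite \<C>"
 proof
  assume "finite \<C>"
  then obtain J where J: "finite J" "J \<subseteq> carrier G" "\<C> = R ` J"
   unfolding \<C>_def by (metis finite_subset_image subset_refl)
  obtain x where x: "x : carrier G" "\<forall>g\<in>J. inv g \<otimes> x \<notin> V" using inf[OF J(1,2)] by blast
  then have "R x : R ` J" unfolding J(3)[symmetric] \<C>_def by blast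
  then show False using x R_eq[of _ x] J(2) by auto
 qed
 ultimately obtain \<beta>0 :: "'a set => nat" where \<beta>0: "bij_betw \<beta>0 \<C> UNIV" by (rule countableE_infinite)
 \<comment> \<open>Composing with a transposition gives the coset \<open>V\<close> the number
   0.\<close>
 define \<beta> where "\<beta> = Transposition.transpose (\<beta>0 (R \<one>)) 0 o \<beta>0"
 have "bij_betw \<beta> \<C> UNIV" unfolding \<beta>_def by (rule bij_betw_trans[OF \<beta>0]) simp
 then have \<beta>: "inj_on \<beta> \<C>" "\<beta> ` \<C> = UNIV" by (auto simp: bij_betw_def)
 define idx where "idx g = \<beta> (R g)" for g
 have idx_eq: "idx g = idx h \<longleftrightarrow> inv g \<otimes> h : V" if "g : carrier G" "h : carrier G" for g h
  unfolding idx_def R_eq[OF that, symmetric] using \<beta>(1) that by (auto simp: inj_on_def \<C>_def)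
 have idx_1: "idx \<one> = 0" by (simp add: idx_def \<beta>_def)
 have "\<exists>g\<in>carrier G. idx g = n" for n
 proof -
  have "n : \<beta> ` R ` carrier G" using \<beta>(2) unfolding \<C>_def by simp
  then show ?thesis unfolding idx_def by blast
 qed
 then obtain c where c: "!!n. c n : carrier G" "!!n. idx (c n) = n" by metis
 have idx_mult: "idx (x \<otimes> g) = idx (x \<otimes> h)" if "idx g = idx h" "g : carrier G" "h : carrier G" "x : carrier G" for g h x
 proof -
  have "inv (x \<otimes> g) \<otimes> (x \<otimes> h) = inv g \<otimes> h" using that by (simp add: group_simps)
  then show ?thesis using that by (simp add: idx_eq)
 qed
 define \<rho> where "\<rho> g n = idx (g \<otimes> c n)" for g n
 have \<rho>_idx: "\<rho> g (idx x) = idx (g \<otimes> x)" if "g : carrier G" "x : carrier G" for g x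
  unfolding \<rho>_def by (rule idx_mult) (use c that in auto)
 have \<rho>_mult: "\<rho> (g \<otimes> h) = \<rho> g o \<rho> h" if "g : carrier G" "h : carrier G" for g h
 proof
  fix n
  have "\<rho> (g \<otimes> h) n = idx (g \<otimes> (h \<otimes> c n))" using that c by (simp add: \<rho>_def m_assoc)
  also have "\<dots> = \<rho> g (idx (h \<otimes> c n))" using that c by (simp add: \<rho>_idx)
  finally show "\<rho> (g \<otimes> h) n = (\<rho> g o \<rho> h) n" by (simp add: \<rho>_def)
 qed
 have \<rho>_1: "\<rho> \<one> = id" using c by (auto simp: \<rho>_def)
 have \<rho>_bij: "bij (\<rho> g)" "invp (\<rho> g) = \<rho> (inv g)" if "g : carrier G" for g
 proof -
  have "\<rho> g o \<rho> (inv g) = id" "\<rho> (inv g) o \<rho> g = id" using \<rho>_mult[of g "inv g"] \<rho>_mult[of "inv g" g] that \<rho>_1 by auto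
  then show "bij (\<rho> g)" "invp (\<rho> g) = \<rho> (inv g)" by (auto intro: o_bij inv_unique_comp)
 qed
 have \<rho>_0: "\<rho> g 0 = idx g" if "g : carrier G" for g using \<rho>_idx[OF that one_closed] idx_1 that by simp
 have \<rho>_V: "\<rho> g 0 = 0 \<longleftrightarrow> g : V" if "g : carrier G" for g
 proof -
  have "\<rho> g 0 = 0 \<longleftrightarrow> idx \<one> = idx g" using \<rho>_0[OF that] idx_1 by auto
  then show ?thesis using that by (simp add: idx_eq)
 qed
 have \<rho>_fix: "\<rho> g n = n \<longleftrightarrow> inv (c n) \<otimes> g \<otimes> c n : V" if "g : carrier G" for g n
 proof -
  have "\<rho> g n = n \<longleftrightarrow> idx (c n) = idx (g \<otimes> c n)" using c by (auto simp: \<rho>_def)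
  also have "\<dots> \<longleftrightarrow> inv (c n) \<otimes> (g \<otimes> c n) : V" by (rule idx_eq) (use c that in auto)
  finally show ?thesis using that c by (simp add: m_assoc)
 qed
 have \<rho>_inj: "inj_on \<rho> (carrier G)"
 proof
  fix g h assume gh: "g : carrier G" "h : carrier G" "\<rho> g = \<rho> h"
  let ?x = "inv g \<otimes> h"
  have x: "?x : carrier G" using gh by simp
  have \<rho>x: "\<rho> ?x = id" using gh \<rho>_mult[of "inv g" g] \<rho>_1 by (simp add: \<rho>_mult)
  have "?x = \<one>"
  proof (rule core[OF x])
   fix a assume a: "a : carrier G"
   have "idx (?x \<otimes> a) = idx a" using \<rho>_idx[OF x a] \<rho>x by simp
   then show "inv a \<otimes> ?x \<otimes> a : V" using idx_eq[of a "?x \<otimes> a"] a x by (simp add: m_assoc)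
  qed
  then have "g \<otimes> (inv g \<otimes> h) = g" using gh by simp
  then show "g = h" using gh by (simp add: m_assoc[symmetric])
 qed
 define H where "H = \<rho> ` carrier G"
 define S where "S = {h : H. h 0 = 0}"
 have SV: "S = \<rho> ` V" unfolding S_def H_def using \<rho>_V Vs(3) by auto
 have clopen: "closedin (gtop G) {g : carrier G. \<rho> g n = m} \<and> openin (gtop G) {g : carrier G. \<rho> g n = m}" for n m
 proof -
  have "\<rho> g n = m \<longleftrightarrow> inv (c m) \<otimes> (g \<otimes> c n) : V" if "g : carrier G" for g
  proof -
   have "\<rho> g n = m \<longleftrightarrow> idx (c m) = idx (g \<otimes> c n)" using c by (auto simp: \<rho>_def)
   also have "\<dots> \<longleftrightarrow> inv (c m) \<otimes> (g \<otimes> c n) : V" by (rule idx_eq) (use c that in auto)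
   finally show ?thesis .
  qed
  then have e: "{g : carrier G. \<rho> g n = m} = {g : carrier G. inv (c m) \<otimes> (g \<otimes> c n) : V}" by auto
  have "continuous_map (gtop G) (gtop G) (\<lambda>g. inv (c m) \<otimes> (g \<otimes> c n))" using c by (intro continuous_intros_G) auto
  then show ?thesis unfolding e
   using continuous_preimage[of "gtop G" "gtop G" _ V] closed_preimage[of "gtop G" "gtop G" _ V] Vs by auto
 qed
 have pp: "perm_pair H S"
 proof
  show "bij g" if "g : H" for g using that \<rho>_bij by (auto simp: H_def)
  show "g o h : H" if "g : H" "h : H" for g h using that by (auto simp: H_def \<rho>_mult[symmetric])
  show "invp g : H" if "g : H" for g using that \<rho>_bij by (auto simp: H_def)
  show "S \<subseteq> H" by (auto simp: S_def)
  show "id : S" using \<rho>_1 by (auto simp: S_def H_def intro!: image_eqI[of _ _ \<one>])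
  show "g o h : S" if "g : S" "h : S" for g h using that by (auto simp: S_def H_def \<rho>_mult[symmetric])
  show "invp g : S" if "g : S" for g using that \<rho>_bij Vs(1,3) unfolding SV by (auto intro!: subgroup.m_inv_closed)
  show "\<exists>F. finite F \<and> (\<forall>u\<in>S. (\<forall>y\<in>F. u y = y) --> invp h o u o h : S)" if h: "h : H" for h
  proof -
   \<comment> \<open>A single point suffices for commensuration: if u fixes h 0, its conjugate fixes
     0.\<close>
   have "invp h o u o h : S" if u: "u : S" "u (h 0) = h 0" for u
   proof -
    have hG: "invp h o u o h : H" using h u \<rho>_bij unfolding S_def H_def by (auto simp: \<rho>_mult[symmetric])
    have "bij h" using h \<rho>_bij by (auto simp: H_def)
    then have "invp h (h 0) = 0" by (simp add: bij_is_inj)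
    then show ?thesis using hG u by (simp add: S_def)
   qed
   then show ?thesis by (intro exI[of _ "{h 0}"]) auto
  qed
  show "finite ((\<lambda>u. u y) ` S)" for y
  proof -
   let ?A = "\<lambda>m. {g : carrier G. \<rho> g y = m}"
   have op: "openin (gtop G) (?A m)" for m using clopen by blast
   have "V \<subseteq> (\<Union>m. ?A m)" using Vs(3) by auto
   then have "\<exists>M. finite M \<and> M \<subseteq> UNIV \<and> V \<subseteq> (\<Union>m\<in>M. ?A m)" by (rule compactin_finite_subfamily[OF V(2) op])
   then obtain M where M: "finite M" "V \<subseteq> (\<Union>m\<in>M. ?A m)" by auto
   have "(\<lambda>u. u y) ` S \<subseteq> M" using M(2) unfolding SV by auto
   then show ?thesis by (rule finite_subset) (rule M(1))
  qed
  show "f : S" if f: "!!F. finite F ==> \<exists>u\<in>S. \<forall>y\<in>F. u y = f y" for f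
  proof -
   let ?A = "\<lambda>y. {g : carrier G. \<rho> g y = f y}"
   \<comment> \<open>Finite intersection property in the compact group \<open>V\<close>: every
     finite part of f is realised by an element of \<open>V\<close>, hence so is all of f.\<close>
   have "V \<inter> (\<Inter>y. ?A y) \<noteq> {}"
   proof
    assume e: "V \<inter> (\<Inter>y. ?A y) = {}"
    have op: "openin (gtop G) (carrier G - ?A y)" for y using clopen by (simp add: closedin_def)
    have "V \<subseteq> (\<Union>y. carrier G - ?A y)" using e Vs(3) by blast
    then have "\<exists>M. finite M \<and> M \<subseteq> UNIV \<and> V \<subseteq> (\<Union>y\<in>M. carrier G - ?A y)"
     by (rule compactin_finite_subfamily[OF V(2) op])
    then obtain M where M: "finite M" "V \<subseteq> (\<Union>y\<in>M. carrier G - ?A y)" by auto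
    obtain u where u: "u : S" "\<forall>y\<in>M. u y = f y" using f[OF M(1)] by blast
    then obtain v where v: "v : V" "u = \<rho> v" unfolding SV by auto
    then show False using M(2) u Vs(3) by auto
   qed
   then obtain v where v: "v : V" "!!y. \<rho> v y = f y" by auto
   then have "f = \<rho> v" by auto
   then show ?thesis using v unfolding SV by auto
  qed
  show "countable (UNIV :: nat set)" by simp
  show "\<exists>D. countable D \<and> D \<subseteq> H \<and> (\<forall>g\<in>H. \<exists>d\<in>D. invp d o g : S)"
  proof (intro exI[of _ "range (\<lambda>n. \<rho> (c n))"] conjI ballI)
   show "range (\<lambda>n. \<rho> (c n)) \<subseteq> H" using c by (auto simp: H_def)
   fix h assume "h : H"
   then obtain g where g: "g : carrier G" "h = \<rho> g" by (auto simp: H_def)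
   have "idx (c (idx g)) = idx g" using c by simp
   then have "inv (c (idx g)) \<otimes> g : V" using idx_eq c g by blast
   then have "invp (\<rho> (c (idx g))) o h : S" using g c unfolding SV by (auto simp: \<rho>_bij \<rho>_mult[symmetric])
   then show "\<exists>d\<in>range (\<lambda>n. \<rho> (c n)). invp d o h : S" by blast
  qed simp
 qed
 interpret H: perm_pair H S by fact
 have hom: "\<rho> : hom G H.PG" by (auto simp: hom_def H_def \<rho>_mult)
 have "bij_betw \<rho> (carrier G) H" using \<rho>_inj by (simp add: bij_betw_def H_def)
 with hom have iso: "\<rho> : iso G H.PG" by (simp add: iso_def)
 have ch: "\<rho> : cont_hom G H.PG"
 proof (rule hom_continuous_at_one[OF topological_group H.topological_group_PG hom])
  fix W assume "openin (gtop H.PG) W" "\<one>\<^bsub>H.PG\<^esub> : W"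
  then obtain F where F: "finite F" "H.small F \<subseteq> W" using H.openin_contains_small by auto
  have "openin (gtop G) (V \<inter> (\<Inter>y\<in>F. {g : carrier G. \<rho> g y = y}))"
   using F(1) clopen Vs by (cases "F = {}") (auto intro!: openin_Int openin_INT)
  moreover have "\<rho> ` (V \<inter> (\<Inter>y\<in>F. {g : carrier G. \<rho> g y = y})) \<subseteq> W"
   using F(2) unfolding H.small_def unfolding SV by auto
  moreover have "\<one> : V \<inter> (\<Inter>y\<in>F. {g : carrier G. \<rho> g y = y})" using \<rho>_1 subgroup.one_closed[OF Vs(1)] by auto
  ultimately show "\<exists>W'. openin (gtop G) W' \<and> \<one> : W' \<and> \<rho> ` W' \<subseteq> W" by blast
 qed
 let ?\<psi> = "inv_into (carrier G) \<rho>"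
 have \<psi>: "?\<psi> (\<rho> g) = g" if "g : carrier G" for g using \<rho>_inj that by (rule inv_into_f_f)
 have "?\<psi> : hom H.PG G" using iso_set_sym[OF iso] by (simp add: iso_def)
 then have ch': "?\<psi> : cont_hom H.PG G"
 proof (rule hom_continuous_at_one[OF H.topological_group_PG topological_group])
  fix W assume W: "openin (gtop G) W" "\<one> : W"
  \<comment> \<open>The inverse is continuous because \<rho> maps the compact set
    \<open>V - W\<close> to a closed set, whose complement in the open group \<open>S\<close> is the
    neighbourhood sought.\<close>
  have "V - W = (carrier G - W) \<inter> V" using Vs(3) by auto
  moreover have "closedin (gtop G) (carrier G - W)" using W(1) by (metis closedin_diff closedin_topspace topspace)
  ultimately have "compactin (gtop G) (V - W)" using closed_Int_compactin V(2) by metis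
  then have "closedin (gtop H.PG) (\<rho> ` (V - W))"
   using compactin_imp_closedin[OF H.Hausdorff image_compactin] ch by (auto simp: cont_hom_def)
  moreover have "openin (gtop H.PG) S" using H.openin_small[of "{}"] by (simp add: H.small_def)
  ultimately have "openin (gtop H.PG) (S - \<rho> ` (V - W))" by (intro openin_diff) simp_all
  moreover have "\<one>\<^bsub>H.PG\<^esub> : S - \<rho> ` (V - W)" using W(2) Vs(3) inj_onD[OF \<rho>_inj, of \<one>] \<rho>_1 H.U_id by auto
  moreover have "?\<psi> ` (S - \<rho> ` (V - W)) \<subseteq> W" using \<psi> Vs(3) unfolding SV by (auto simp: subset_iff image_iff)
  ultimately show "\<exists>W'. openin (gtop H.PG) W' \<and> \<one>\<^bsub>H.PG\<^esub> : W' \<and> ?\<psi> ` W' \<subseteq> W" by blast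
 qed
 have "homeomorphic_maps (gtop G) (gtop H.PG) \<rho> ?\<psi>" using ch ch' \<psi> unfolding homeomorphic_maps_def
  by (auto simp: cont_hom_def H_def)
 then have "\<rho> : top_iso G H.PG" using iso by (auto simp: top_iso_def homeomorphic_map_maps)
 moreover have "\<exists>h\<in>H. h 0 = n" for n using c \<rho>_0 by (intro bexI[of _ "\<rho> (c n)"]) (auto simp: H_def)
 ultimately show thesis using that[of H \<rho>] pp \<rho>_V unfolding S_def by blast
qed

section \<open>Stacking type from a chain of normal subgroups\<close>

lemma closed_normal_iff:
 "group G ==> closed_normal N G \<longleftrightarrow> subgroup N G \<and>
   (\<forall>x\<in>carrier G. \<forall>h\<in>N. x \<otimes>\<^bsub>G\<^esub> h \<otimes>\<^bsub>G\<^esub> inv\<^bsub>G\<^esub> x : N) \<and> closedin (gtop G) N"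
 by (simp add: closed_normal_def group.normal_inv_iff)

lemma (in top_group) closed_normalD:
 assumes "closed_normal N G"
 shows "subgroup N G" "!!x h. x : carrier G ==> h : N ==> x \<otimes> h \<otimes> inv x : N" "closedin (gtop G) N"
  "N \<subseteq> carrier G" "\<one> : N"
 using assms by (auto simp: closed_normal_iff[OF is_group] dest: subgroup.mem_carrier subgroup.one_closed)

lemma top_iso_closed_normal:
 fixes G (structure)
 assumes "topological_group G" "topological_group H" "\<phi> : top_iso G H" "closed_normal N G"
 shows "closed_normal (\<phi> ` N) H"
proof -
 interpret G: top_group G using assms(1) by unfold_locales
 interpret H: top_group H using assms(2) by unfold_locales
 interpret h: group_hom G H \<phi> by (rule cont_hom_group_hom[OF G.is_group H.is_group top_iso_cont_hom[OF assms(3)]])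
 note N = G.closed_normalD[OF assms(4)] and NG = G.closed_normalD(4)[OF assms(4)]
 have "y \<otimes>\<^bsub>H\<^esub> \<phi> h \<otimes>\<^bsub>H\<^esub> inv\<^bsub>H\<^esub> y : \<phi> ` N" if y: "y : carrier H" and h: "h : N" for y h
 proof -
  obtain x where x: "x : carrier G" "y = \<phi> x" using top_iso_bij[OF assms(3)] y by (auto simp: bij_betw_def)
  have "y \<otimes>\<^bsub>H\<^esub> \<phi> h \<otimes>\<^bsub>H\<^esub> inv\<^bsub>H\<^esub> y = \<phi> (x \<otimes> h \<otimes> inv x)" using x h NG by auto
  then show ?thesis using N(2)[OF x(1) h] by auto
 qed
 then show ?thesis using top_iso_open_image(2)[OF assms(3) G.topspace NG] N(3)
   top_iso_subgroup_image[OF G.is_group H.is_group assms(3) N(1)] by (auto simp: closed_normal_iff[OF H.is_group])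
qed

text \<open>Two cosets commute exactly when the commutator of their representatives lies in
  \<open>L\<close>. This turns non-abelian chief factors into statements about commutators in
  \<open>G\<close>.\<close>

lemma comm_factor_group_iff:
 fixes G (structure)
 assumes "group G" "K \<lhd> G" "L \<lhd> G" "L \<subseteq> K" shows "comm_group (factor_group G (K, L)) \<longleftrightarrow>
  (\<forall>a\<in>K. \<forall>b\<in>K. a \<otimes> b \<otimes> inv a \<otimes> inv b : L)"
proof -
 interpret G: group G by fact
 have K: "subgroup K G" and L: "subgroup L G" "!!x h. x : carrier G ==> h : L ==> x \<otimes> h \<otimes> inv x : L"
  using assms(2,3) by (auto simp: G.normal_inv_iff)
 have KG: "K \<subseteq> carrier G" by (rule subgroup.subset[OF K])
 let ?S = "subgrp G K"
 interpret S: group ?S by (rule group_subgrp[OF assms(1) K])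
 have "L \<lhd> ?S" unfolding S.normal_inv_iff using L assms(4) KG
  by (auto simp: subgroup_subgrp_iff[OF assms(1) K] inv_subgrp[OF assms(1) K] subset_iff)
 then interpret N: normal L ?S .
 interpret Q: group "quotient_group ?S L" by (rule group_quotient_group[OF S.is_group \<open>L \<lhd> ?S\<close>])
 have m: "(L #>\<^bsub>?S\<^esub> a) \<otimes>\<^bsub>quotient_group ?S L\<^esub> (L #>\<^bsub>?S\<^esub> b) = L #>\<^bsub>?S\<^esub> (a \<otimes> b)" if "a : K" "b : K" for a b
  using that N.rcos_sum[of a b] by (simp add: quotient_group_def)
 have e: "L #>\<^bsub>?S\<^esub> (a \<otimes> b) = L #>\<^bsub>?S\<^esub> (b \<otimes> a) \<longleftrightarrow> a \<otimes> b \<otimes> inv a \<otimes> inv b : L"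
  if ab: "a : K" "b : K" for a b
 proof -
  have k: "a \<otimes> b : K" "b \<otimes> a : K" using ab K by (auto intro: subgroup.m_closed)
  have "L #>\<^bsub>?S\<^esub> (a \<otimes> b) = L #>\<^bsub>?S\<^esub> (b \<otimes> a) \<longleftrightarrow> a \<otimes> b : L #>\<^bsub>?S\<^esub> (b \<otimes> a)"
   using k S.repr_independence[OF _ _ N.subgroup_axioms, of "a \<otimes> b" "b \<otimes> a"]
    S.rcos_self[OF _ N.subgroup_axioms, of "a \<otimes> b"] by auto
  also have "\<dots> \<longleftrightarrow> a \<otimes> b \<otimes> inv (b \<otimes> a) : L"
   using N.rcos_module[OF S.is_group, of "b \<otimes> a" "a \<otimes> b"] k by (simp add: inv_subgrp[OF assms(1) K])
  finally show ?thesis using ab KG by (simp add: G.group_simps subset_iff)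
 qed
 have c: "carrier (quotient_group ?S L) = (\<lambda>a. L #>\<^bsub>?S\<^esub> a) ` K" by (auto simp: quotient_group_def carrier_FactGroup)
 have "comm_group (quotient_group ?S L) \<longleftrightarrow> (\<forall>x\<in>carrier (quotient_group ?S L). \<forall>y\<in>carrier (quotient_group ?S L).
   x \<otimes>\<^bsub>quotient_group ?S L\<^esub> y = y \<otimes>\<^bsub>quotient_group ?S L\<^esub> x)"
  by (auto intro: Q.group_comm_groupI simp: comm_monoid.m_comm comm_group.axioms(1))
 then show ?thesis unfolding c by (simp add: factor_group_def m e)
qed

text \<open>The dichotomy makes each M k / M' k a chief factor, and it makes \<open>M k\<close> the
  least closed normal subgroup that covers its block. The two limit conditions close the chain at
  both ends: a non-trivial closed normal subgroup contains some \<open>M k\<close>, and one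
  different from \<open>G\<close> lies in some \<open>M k\<close>.\<close>

definition stack_system :: "'a tgroup => (int => 'a set) => (int => 'a set) => bool" where
 "stack_system G M M' \<longleftrightarrow>
   (\<forall>k. closed_normal (M k) G \<and> closed_normal (M' k) G \<and> M' k \<subseteq> M k \<and> M k \<subseteq> M' (k + 1) \<and>
    (\<exists>a\<in>M k. \<exists>b\<in>M k. a \<otimes>\<^bsub>G\<^esub> b \<otimes>\<^bsub>G\<^esub> inv\<^bsub>G\<^esub> a \<otimes>\<^bsub>G\<^esub> inv\<^bsub>G\<^esub> b \<notin> M' k)) \<and>
   (\<forall>N k. closed_normal N G --> N \<subseteq> M' k \<or> M k \<subseteq> N) \<and>
   (\<Inter>k. M k) = {\<one>\<^bsub>G\<^esub>} \<and>
   (\<forall>N. closed_normal N G \<and> (\<forall>k. M k \<subseteq> N) --> N = carrier G)"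

lemma top_iso_stack_system:
 fixes G (structure)
 assumes "topological_group G" "topological_group H" "\<phi> : top_iso G H" "stack_system G M M'"
 shows "stack_system H (\<lambda>k. \<phi> ` M k) (\<lambda>k. \<phi> ` M' k)"
proof -
 interpret G: top_group G using assms(1) by unfold_locales
 interpret H: top_group H using assms(2) by unfold_locales
 interpret h: group_hom G H \<phi> by (rule cont_hom_group_hom[OF G.is_group H.is_group top_iso_cont_hom[OF assms(3)]])
 let ?\<psi> = "inv_into (carrier G) \<phi>"
 have \<psi>: "?\<psi> : top_iso H G" by (rule top_iso_inv[OF assms(1) H.is_group H.topspace assms(3)])
 have inj: "inj_on \<phi> (carrier G)" and sur: "\<phi> ` carrier G = carrier H"
  using top_iso_bij[OF assms(3)] by (auto simp: bij_betw_def)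
 have cn: "closed_normal (M k) G" "closed_normal (M' k) G" "M' k \<subseteq> M k" "M k \<subseteq> M' (k + 1)"
  "\<exists>a\<in>M k. \<exists>b\<in>M k. a \<otimes> b \<otimes> inv a \<otimes> inv b \<notin> M' k" for k using assms(4) by (auto simp: stack_system_def)
 have MG: "M k \<subseteq> carrier G" "M' k \<subseteq> carrier G" for k
  using G.closed_normalD(4)[OF cn(1)] G.closed_normalD(4)[OF cn(2)] .
 have pull: "\<exists>N'. closed_normal N' G \<and> N = \<phi> ` N'" if N: "closed_normal N H" for N
 proof -
  have "N = \<phi> ` ?\<psi> ` N" using sur H.closed_normalD(4)[OF N] by (simp add: image_inv_into_cancel)
  then show ?thesis using top_iso_closed_normal[OF assms(2,1) \<psi> N] by blast
 qed
 show ?thesis unfolding stack_system_def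
 proof (intro conjI allI impI)
  fix k
  show "closed_normal (\<phi> ` M k) H" "closed_normal (\<phi> ` M' k) H"
   by (rule top_iso_closed_normal[OF assms(1-3)], rule cn)+
  show "\<phi> ` M' k \<subseteq> \<phi> ` M k" "\<phi> ` M k \<subseteq> \<phi> ` M' (k + 1)" by (rule image_mono[OF cn(3)], rule image_mono[OF cn(4)])
  obtain a b where ab: "a : M k" "b : M k" "a \<otimes> b \<otimes> inv a \<otimes> inv b \<notin> M' k" using cn(5) by blast
  then have abG: "a : carrier G" "b : carrier G" using MG by auto
  have "\<phi> (a \<otimes> b \<otimes> inv a \<otimes> inv b) \<notin> \<phi> ` M' k" using ab(3) MG(2) inj abG by (subst inj_on_image_mem_iff[OF inj]) auto
  then have "\<phi> a \<otimes>\<^bsub>H\<^esub> \<phi> b \<otimes>\<^bsub>H\<^esub> inv\<^bsub>H\<^esub> \<phi> a \<otimes>\<^bsub>H\<^esub> inv\<^bsub>H\<^esub> \<phi> b \<notin> \<phi> ` M' k" using abG by simp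
  then show "\<exists>a\<in>\<phi> ` M k. \<exists>b\<in>\<phi> ` M k. a \<otimes>\<^bsub>H\<^esub> b \<otimes>\<^bsub>H\<^esub> inv\<^bsub>H\<^esub> a \<otimes>\<^bsub>H\<^esub> inv\<^bsub>H\<^esub> b \<notin> \<phi> ` M' k" using ab by blast
 next
  fix N k assume "closed_normal N H"
  then obtain N' where N': "closed_normal N' G" "N = \<phi> ` N'" using pull by blast
  have "N' \<subseteq> M' k \<or> M k \<subseteq> N'" using assms(4) N'(1) unfolding stack_system_def by blast
  then show "N \<subseteq> \<phi> ` M' k \<or> \<phi> ` M k \<subseteq> N" unfolding N'(2) by (meson image_mono)
 next
  have "(\<Inter>k. \<phi> ` M k) = \<phi> ` (\<Inter>k. M k)" by (rule image_INT[OF inj _ UNIV_I, symmetric]) (use MG(1) in simp)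
  then show "(\<Inter>k. \<phi> ` M k) = {\<one>\<^bsub>H\<^esub>}" using assms(4) by (simp add: stack_system_def)
 next
  fix N assume N: "closed_normal N H \<and> (\<forall>k. \<phi> ` M k \<subseteq> N)"
  obtain N' where N': "closed_normal N' G" "N = \<phi> ` N'" using pull[OF N[THEN conjunct1]] by blast
  have "M k \<subseteq> N'" for k using N N'(2) MG G.closed_normalD(4)[OF N'(1)] inj_on_image_subset_iff[OF inj, of "M k" N'] by auto
  then have "N' = carrier G" using assms(4) N' by (auto simp: stack_system_def)
  then show "N = carrier H" using N' sur by simp
 qed
qed

section \<open>Centralizers of chief factors and the action of automorphisms on blocks\<close>

context top_group
begin

lemma closed_normal_centralizer:
 assumes "closed_normal K G" "closed_normal L G" shows "closed_normal (centralizer G (K, L)) G"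
proof -
 note K = closed_normalD[OF assms(1)] and L = closed_normalD[OF assms(2)]
 note KG = K(4) L(4)
 let ?C = "centralizer G (K, L)"
 have mem: "g : ?C \<longleftrightarrow> g : carrier G \<and> (\<forall>k\<in>K. g \<otimes> k \<otimes> inv g \<otimes> inv k : L)" for g by (simp add: centralizer_def)
 show ?thesis unfolding closed_normal_iff[OF is_group]
 proof (intro conjI ballI)
  show "subgroup ?C G"
  proof (rule subgroupI)
   have "\<one> : ?C" using KG subgroup.one_closed[OF L(1)] by (auto simp: mem subset_iff)
   then show "?C \<noteq> {}" by blast
   show "?C \<subseteq> carrier G" by (auto simp: mem)
   show "inv g : ?C" if g: "g : ?C" for g
   proof -
    have "inv g \<otimes> k \<otimes> inv (inv g) \<otimes> inv k : L" if k: "k : K" for k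
    proof -
     have gk: "g : carrier G" "k : carrier G" using g k KG mem by auto
     have "inv (g \<otimes> k \<otimes> inv g \<otimes> inv k) : L" using g k L(1) mem by (auto intro: subgroup.m_inv_closed)
     then have "inv g \<otimes> inv (g \<otimes> k \<otimes> inv g \<otimes> inv k) \<otimes> inv (inv g) : L" using gk by (intro L(2)) auto
     then show ?thesis using gk by (simp add: group_simps)
    qed
    then show ?thesis using g by (simp add: mem)
   qed
   show "g \<otimes> h : ?C" if g: "g : ?C" and h: "h : ?C" for g h
   proof -
    have "(g \<otimes> h) \<otimes> k \<otimes> inv (g \<otimes> h) \<otimes> inv k : L" if k: "k : K" for k
    proof -
     have gk: "g : carrier G" "h : carrier G" "k : carrier G" using g h k KG mem by auto
     have "g \<otimes> (h \<otimes> k \<otimes> inv h \<otimes> inv k) \<otimes> inv g : L" using h k gk mem by (intro L(2)) auto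
     then have "(g \<otimes> (h \<otimes> k \<otimes> inv h \<otimes> inv k) \<otimes> inv g) \<otimes> (g \<otimes> k \<otimes> inv g \<otimes> inv k) : L"
      using g k L(1) mem by (auto intro: subgroup.m_closed)
     then show ?thesis using gk by (simp add: group_simps)
    qed
    then show ?thesis using g h by (simp add: mem)
   qed
  qed
  show "x \<otimes> g \<otimes> inv x : ?C" if x: "x : carrier G" and g: "g : ?C" for x g
  proof -
   have "(x \<otimes> g \<otimes> inv x) \<otimes> k \<otimes> inv (x \<otimes> g \<otimes> inv x) \<otimes> inv k : L" if k: "k : K" for k
   proof -
    have gk: "g : carrier G" "k : carrier G" using g k KG mem by auto
    have "inv x \<otimes> k \<otimes> inv (inv x) : K" using x k by (intro K(2)) auto
    then have "inv x \<otimes> k \<otimes> x : K" using x by simp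
    then have "g \<otimes> (inv x \<otimes> k \<otimes> x) \<otimes> inv g \<otimes> inv (inv x \<otimes> k \<otimes> x) : L" using g mem by auto
    then have "x \<otimes> (g \<otimes> (inv x \<otimes> k \<otimes> x) \<otimes> inv g \<otimes> inv (inv x \<otimes> k \<otimes> x)) \<otimes> inv x : L" using x by (intro L(2))
    then show ?thesis using gk x by (simp add: group_simps)
   qed
   then show ?thesis using g x by (simp add: mem)
  qed
  have "?C = (\<Inter>k\<in>K. {g : topspace (gtop G). g \<otimes> k \<otimes> inv g \<otimes> inv k : L})"
   using subgroup.one_closed[OF K(1)] by (auto simp: mem)
  moreover have "closedin (gtop G) {g : topspace (gtop G). g \<otimes> k \<otimes> inv g \<otimes> inv k : L}" if "k : K" for k
   using that KG by (intro closed_preimage[OF _ L(3)] continuous_intros_G) auto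
  ultimately show "closedin (gtop G) ?C" using subgroup.one_closed[OF K(1)] by (auto intro!: closedin_INT)
 qed
qed

text \<open>Taking commutators with g is continuous and sends \<open>K1 <#> L2\<close> into
  \<open>L1 <#> L2\<close>, hence the closure of the one into the closure of the other. The first
  closure contains \<open>K2\<close>, and commutators with elements of \<open>K2\<close> stay in
  \<open>K2\<close>, so they land in \<open>L2\<close>.\<close>

lemma associated_centralizer_subset:
 assumes "closed_normal K1 G" "closed_normal L1 G" "closed_normal K2 G" "closed_normal L2 G"
  and cl: "gtop G closure_of (K1 <#> L2) = gtop G closure_of (K2 <#> L1)"
  and L2: "K2 \<inter> gtop G closure_of (L1 <#> L2) = L2" shows "centralizer G (K1, L1) \<subseteq> centralizer G (K2, L2)"
proof
 note n = closed_normalD(1,2,4)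
 fix g assume "g : centralizer G (K1, L1)"
 then have g: "g : carrier G" "!!k. k : K1 ==> g \<otimes> k \<otimes> inv g \<otimes> inv k : L1" by (auto simp: centralizer_def)
 let ?f = "\<lambda>x. g \<otimes> x \<otimes> inv g \<otimes> inv x"
 have "continuous_map (gtop G) (gtop G) ?f" using g by (intro continuous_intros_G) auto
 then have "?f ` (gtop G closure_of (K1 <#> L2)) \<subseteq> gtop G closure_of (?f ` (K1 <#> L2))"
  by (rule continuous_map_image_closure_subset)
 also have "\<dots> \<subseteq> gtop G closure_of (L1 <#> L2)"
 proof (rule closure_of_mono, rule image_subsetI)
  fix x assume "x : K1 <#> L2"
  then obtain k l where kl: "k : K1" "l : L2" "x = k \<otimes> l" by (auto simp: set_mult_def)
  have klG: "k : carrier G" "l : carrier G" using kl n(3)[OF assms(1)] n(3)[OF assms(4)] by auto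
  have "g \<otimes> l \<otimes> inv g \<otimes> inv l : L2"
   using kl g n(1)[OF assms(4)] n(2)[OF assms(4)] by (auto intro: subgroup.m_closed subgroup.m_inv_closed)
  then have "k \<otimes> (g \<otimes> l \<otimes> inv g \<otimes> inv l) \<otimes> inv k : L2" using klG by (intro n(2)[OF assms(4)])
  \<comment> \<open>For x = k l the commutator splits as [g, k] times the conjugate of [g, l] by
    k.\<close>
  moreover have "?f x = (g \<otimes> k \<otimes> inv g \<otimes> inv k) \<otimes> (k \<otimes> (g \<otimes> l \<otimes> inv g \<otimes> inv l) \<otimes> inv k)"
   using klG g kl by (simp add: group_simps)
  ultimately show "?f x : L1 <#> L2" using g(2)[OF kl(1)] by (auto simp: set_mult_def)
 qed
 finally have f: "?f ` (gtop G closure_of (K1 <#> L2)) \<subseteq> gtop G closure_of (L1 <#> L2)" .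
 have "?f k : L2" if k: "k : K2" for k
 proof -
  have kG: "k : carrier G" using k n(3)[OF assms(3)] by auto
  have "k \<otimes> \<one> : K2 <#> L1" using k subgroup.one_closed[OF n(1)[OF assms(2)]] by (auto simp: set_mult_def)
  moreover have "K2 <#> L1 \<subseteq> gtop G closure_of (K2 <#> L1)"
   using n(3)[OF assms(3)] n(3)[OF assms(2)] by (intro closure_of_subset) (auto simp: set_mult_def)
  ultimately have "k : gtop G closure_of (K1 <#> L2)" using cl kG by auto
  then have "?f k : gtop G closure_of (L1 <#> L2)" using f by blast
  moreover have "?f k : K2" using k g n(1,2)[OF assms(3)] by (auto intro: subgroup.m_closed subgroup.m_inv_closed)
  ultimately show ?thesis using L2 by blast
 qed
 then show "g : centralizer G (K2, L2)" using g(1) by (simp add: centralizer_def)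
qed

lemma normal_set_mult_commute:
 assumes "closed_normal K G" "closed_normal L G" shows "K <#> L = L <#> K"
proof -
 have *: "K <#> L \<subseteq> L <#> K" if "closed_normal K G" "closed_normal L G" for K L
 proof
  fix x assume "x : K <#> L"
  then obtain k l where kl: "k : K" "l : L" "x = k \<otimes> l" by (auto simp: set_mult_def)
  have klG: "k : carrier G" "l : carrier G" using kl closed_normalD(4) that by blast+
  then have "k \<otimes> l \<otimes> inv k : L" using kl closed_normalD(2) that by blast
  moreover have "x = (k \<otimes> l \<otimes> inv k) \<otimes> k" using klG kl by (simp add: group_simps)
  ultimately show "x : L <#> K" using kl by (auto simp: set_mult_def)
 qed
 show ?thesis using *[OF assms] *[OF assms(2,1)] by blast
qed

lemma chief_factor_closed_normal:
 assumes "chief_factor G (K, L)" shows "closed_normal K G" "closed_normal L G" "L \<subset> K"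
 using assms by (auto simp: chief_factor_def normal_factor_def)

lemma associated_centralizer_eq:
 assumes "F : nonabelian_chief_factors G" "F' : nonabelian_chief_factors G" "associated G F F'"
 shows "centralizer G F = centralizer G F'"
proof -
 obtain K1 L1 K2 L2 where F: "F = (K1, L1)" "F' = (K2, L2)" by fastforce
 have c: "closed_normal K1 G" "closed_normal L1 G" "closed_normal K2 G" "closed_normal L2 G"
  using assms(1,2) F chief_factor_closed_normal by (auto simp: nonabelian_chief_factors_def)
 have a: "gtop G closure_of (K1 <#> L2) = gtop G closure_of (K2 <#> L1)"
  "K1 \<inter> gtop G closure_of (L1 <#> L2) = L1" "K2 \<inter> gtop G closure_of (L1 <#> L2) = L2"
  using assms(3) F by (auto simp: associated_def)
 have "K1 \<inter> gtop G closure_of (L2 <#> L1) = L1" using a(2) normal_set_mult_commute[OF c(2,4)] by simp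
 then show ?thesis
  using associated_centralizer_subset[OF c(1-4) a(1,3)] associated_centralizer_subset[OF c(3,4,1,2) a(1)[symmetric]] F by blast
qed

lemma associated_refl:
 assumes "F : nonabelian_chief_factors G" shows "associated G F F"
proof -
 obtain K L where F: "F = (K, L)" by fastforce
 then have "chief_factor G (K, L)" using assms by (simp add: nonabelian_chief_factors_def)
 then have c: "closed_normal L G" "L \<subseteq> K" using chief_factor_closed_normal by blast+
 have "L <#> L = L" by (rule subgroup_mult_id[OF closed_normalD(1)[OF c(1)]])
 then have "gtop G closure_of (L <#> L) = L" using closed_normalD(3)[OF c(1)] by (simp add: closure_of_closedin)
 then show ?thesis using c F by (auto simp: associated_def)
qed

lemma nonabelian_chief_factor_iff:
 "(A, B) : nonabelian_chief_factors G \<longleftrightarrow> closed_normal A G \<and> closed_normal B G \<and> B \<subset> A \<and>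
   \<not> (\<exists>M. closed_normal M G \<and> B \<subset> M \<and> M \<subset> A) \<and>
   (\<exists>a\<in>A. \<exists>b\<in>A. a \<otimes> b \<otimes> inv a \<otimes> inv b \<notin> B)" using comm_factor_group_iff[OF is_group, of A B]
 by (auto simp: nonabelian_chief_factors_def chief_factor_def normal_factor_def closed_normal_def)

lemma nonabelian_chief_factor_image:
 assumes \<psi>: "\<psi> : top_iso G G" and F: "(A, B) : nonabelian_chief_factors G"
 shows "(\<psi> ` A, \<psi> ` B) : nonabelian_chief_factors G"
  "centralizer G (\<psi> ` A, \<psi> ` B) \<subseteq> \<psi> ` centralizer G (A, B)"
proof -
 let ?\<chi> = "inv_into (carrier G) \<psi>"
 have \<chi>: "?\<chi> : top_iso G G" by (rule top_iso_inv[OF topological_group is_group topspace \<psi>])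
 have inj: "inj_on \<psi> (carrier G)" and sur: "\<psi> ` carrier G = carrier G"
  using top_iso_bij[OF \<psi>] by (auto simp: bij_betw_def)
 interpret h: group_hom G G \<psi> by (rule cont_hom_group_hom[OF is_group is_group top_iso_cont_hom[OF \<psi>]])
 have F': "closed_normal A G" "closed_normal B G" "B \<subset> A"
  "!!M. closed_normal M G ==> B \<subset> M ==> M \<subset> A ==> False"
  "\<exists>a\<in>A. \<exists>b\<in>A. a \<otimes> b \<otimes> inv a \<otimes> inv b \<notin> B" using F unfolding nonabelian_chief_factor_iff by blast+
 have AG: "A \<subseteq> carrier G" "B \<subseteq> carrier G" using closed_normalD(4)[OF F'(1)] closed_normalD(4)[OF F'(2)] .
 have comm: "\<psi> a \<otimes> \<psi> b \<otimes> inv (\<psi> a) \<otimes> inv (\<psi> b) : \<psi> ` B \<longleftrightarrow> a \<otimes> b \<otimes> inv a \<otimes> inv b : B"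
  if "a : carrier G" "b : carrier G" for a b
 proof -
  have "\<psi> a \<otimes> \<psi> b \<otimes> inv (\<psi> a) \<otimes> inv (\<psi> b) = \<psi> (a \<otimes> b \<otimes> inv a \<otimes> inv b)" using that by simp
  then show ?thesis using inj_on_image_mem_iff[OF inj _ AG(2), of "a \<otimes> b \<otimes> inv a \<otimes> inv b"] that
   by (simp only: m_closed inv_closed)
 qed
 show "(\<psi> ` A, \<psi> ` B) : nonabelian_chief_factors G" unfolding nonabelian_chief_factor_iff
 proof (intro conjI)
  show "closed_normal (\<psi> ` A) G" "closed_normal (\<psi> ` B) G"
   by (rule top_iso_closed_normal[OF topological_group topological_group \<psi>], rule F')+
  show "\<psi> ` B \<subset> \<psi> ` A" using F'(3) inj_on_image_subset_iff[OF inj AG] inj_on_image_subset_iff[OF inj AG(2,1)]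
   by (metis psubsetE psubsetI order_refl)
  show "\<not> (\<exists>M. closed_normal M G \<and> \<psi> ` B \<subset> M \<and> M \<subset> \<psi> ` A)"
  proof (intro notI, elim exE conjE)
   fix M assume M: "closed_normal M G" "\<psi> ` B \<subset> M" "M \<subset> \<psi> ` A"
   have MG: "M \<subseteq> \<psi> ` carrier G" using M(3) AG by blast
   then have e: "\<psi> ` ?\<chi> ` M = M" by (rule image_inv_into_cancel[OF refl])
   have \<chi>G: "?\<chi> ` M \<subseteq> carrier G" using MG by (auto intro: inv_into_into)
   have "closed_normal (?\<chi> ` M) G" by (rule top_iso_closed_normal[OF topological_group topological_group \<chi> M(1)])
   moreover have "B \<subset> ?\<chi> ` M"
    using M(2) e inj_on_image_subset_iff[OF inj AG(2) \<chi>G] by (metis psubsetE psubsetI order_refl)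
   moreover have "?\<chi> ` M \<subset> A"
    using M(3) e inj_on_image_subset_iff[OF inj \<chi>G AG(1)] by (metis psubsetE psubsetI order_refl)
   ultimately show False by (rule F'(4))
  qed
  obtain a b where "a : A" "b : A" "a \<otimes> b \<otimes> inv a \<otimes> inv b \<notin> B" using F'(5) by blast
  then show "\<exists>a\<in>\<psi> ` A. \<exists>b\<in>\<psi> ` A. a \<otimes> b \<otimes> inv a \<otimes> inv b \<notin> \<psi> ` B" using comm[of a b] AG by blast
 qed
 show "centralizer G (\<psi> ` A, \<psi> ` B) \<subseteq> \<psi> ` centralizer G (A, B)"
 proof
  fix y assume y: "y : centralizer G (\<psi> ` A, \<psi> ` B)"
  then have "y : \<psi> ` carrier G" using sur by (simp add: centralizer_def)
  then obtain x where x: "x : carrier G" "y = \<psi> x" by blast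
  have "x \<otimes> k \<otimes> inv x \<otimes> inv k : B" if "k : A" for k using y comm[of x k] x that AG by (auto simp: centralizer_def)
  then show "y : \<psi> ` centralizer G (A, B)" using x by (auto simp: centralizer_def)
 qed
qed

lemma chief_block_facts:
 assumes "\<aa> : chief_blocks G" shows "\<aa> \<noteq> {}" "!!F. F : \<aa> ==> F : nonabelian_chief_factors G"
  "!!F. F : \<aa> ==> block_centralizer G \<aa> = centralizer G F"
proof -
 obtain F0 where F0: "F0 : nonabelian_chief_factors G" "\<aa> = association G `` {F0}"
  using assms by (auto simp: chief_blocks_def quotient_def)
 have m: "F : nonabelian_chief_factors G \<and> centralizer G F = centralizer G F0" if "F : \<aa>" for F
  using that F0 associated_centralizer_eq[of F0 F] by (auto simp: association_def)
 have "F0 : \<aa>" using F0 associated_refl by (auto simp: association_def)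
 then show "\<aa> \<noteq> {}" by blast
 show "F : nonabelian_chief_factors G" if "F : \<aa>" for F using m that by blast
 have "(SOME F. F : \<aa>) : \<aa>" using \<open>F0 : \<aa>\<close> by (rule someI)
 then have "block_centralizer G \<aa> = centralizer G F0" using m unfolding block_centralizer_def by blast
 then show "block_centralizer G \<aa> = centralizer G F" if "F : \<aa>" for F using m that by simp
qed

text \<open>\<open>block_centralizer\<close> evaluates at a chosen representative. Every factor in
  the transported block has the centralizer of some \<psi>(A)/\<psi>(B) with A/B in \<aa>, and that
  centralizer lies in the image of the centralizer of A/B.\<close>

lemma block_centralizer_action:
 assumes \<psi>: "\<psi> : top_iso G G" and \<aa>: "\<aa> : chief_blocks G"
 shows "block_centralizer G (block_action G \<psi> \<aa>) \<subseteq> \<psi> ` block_centralizer G \<aa>"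
proof -
 have "\<exists>A B. (A, B) : \<aa> \<and> centralizer G F = centralizer G (\<psi> ` A, \<psi> ` B)" if F: "F : block_action G \<psi> \<aa>" for F
 proof -
  obtain A B where AB: "(A, B) : \<aa>" "((\<psi> ` A, \<psi> ` B), F) : association G" using F by (auto simp: block_action_def)
  then have "centralizer G (\<psi> ` A, \<psi> ` B) = centralizer G F"
   by (intro associated_centralizer_eq) (auto simp: association_def)
  then show ?thesis using AB by metis
 qed
 moreover obtain A B where AB: "(A, B) : \<aa>" using chief_block_facts(1)[OF \<aa>] by auto
 have "(\<psi> ` A, \<psi> ` B) : nonabelian_chief_factors G"
  by (rule nonabelian_chief_factor_image(1)[OF \<psi> chief_block_facts(2)[OF \<aa> AB]])
 then have "(\<psi> ` A, \<psi> ` B) : block_action G \<psi> \<aa>"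
  using AB associated_refl by (auto simp: block_action_def association_def intro!: bexI[OF _ AB])
 then have "(SOME F. F : block_action G \<psi> \<aa>) : block_action G \<psi> \<aa>" by (rule someI)
 ultimately obtain A B where AB: "(A, B) : \<aa>"
  "block_centralizer G (block_action G \<psi> \<aa>) = centralizer G (\<psi> ` A, \<psi> ` B)" unfolding block_centralizer_def by blast
 show ?thesis unfolding AB(2) chief_block_facts(3)[OF \<aa> AB(1)]
  by (rule nonabelian_chief_factor_image(2)[OF \<psi> chief_block_facts(2)[OF \<aa> AB(1)]])
qed

section \<open>Chief blocks of a group with a doubly infinite chain\<close>

context
 fixes M M' :: "int => 'a set"
 assumes stack: "stack_system G M M'"
begin

lemma stack_level:
 "closed_normal (M k) G" "closed_normal (M' k) G" "M' k \<subseteq> M k" "M k \<subseteq> M' (k + 1)"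
 "\<exists>a\<in>M k. \<exists>b\<in>M k. a \<otimes> b \<otimes> inv a \<otimes> inv b \<notin> M' k"
proof -
 note * = stack[unfolded stack_system_def, THEN conjunct1, THEN spec, of k]
 show "closed_normal (M k) G" "closed_normal (M' k) G" "M' k \<subseteq> M k" "M k \<subseteq> M' (k + 1)"
  "\<exists>a\<in>M k. \<exists>b\<in>M k. a \<otimes> b \<otimes> inv a \<otimes> inv b \<notin> M' k" using * by simp_all
qed

lemma stack_dichotomy: "closed_normal N G ==> N \<subseteq> M' k \<or> M k \<subseteq> N" using stack unfolding stack_system_def by blast

lemma stack_Inter: "(\<Inter>k. M k) = {\<one>}" using stack unfolding stack_system_def by blast

lemma stack_top: "closed_normal N G ==> (!!k. M k \<subseteq> N) ==> N = carrier G"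
 using stack unfolding stack_system_def by blast

lemma stack_strict: "M' k \<subset> M k"
proof -
 obtain a b where ab: "a : M k" "b : M k" "a \<otimes> b \<otimes> inv a \<otimes> inv b \<notin> M' k" using stack_level(5) by blast
 have "subgroup (M k) G" by (rule closed_normalD(1)[OF stack_level(1)])
 then have "a \<otimes> b \<otimes> inv a \<otimes> inv b : M k" using ab by (auto intro: subgroup.m_closed subgroup.m_inv_closed)
 then show ?thesis using ab stack_level(3) by blast
qed

lemma stack_below:
 assumes "closed_normal N G" "N \<noteq> {\<one>}"
 obtains k where "M k \<subseteq> N"
proof -
 have "\<one> : N" by (rule closed_normalD(5)[OF assms(1)])
 then have "\<not> N \<subseteq> (\<Inter>k. M k)" using assms(2) stack_Inter by auto
 then obtain k where "\<not> N \<subseteq> M k" by blast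
 then have "M k \<subseteq> N" using stack_dichotomy[OF assms(1), of k] stack_level(3) by blast
 then show thesis by (rule that)
qed

lemma stack_above:
 assumes "closed_normal N G" "N \<noteq> carrier G"
 obtains k where "N \<subseteq> M k"
 using stack_top[OF assms(1)] stack_dichotomy[OF assms(1)] stack_level(3) assms(2) that by blast

text \<open>For F = (A, B), the centralizer contains \<open>B\<close>, which is non-trivial, so it
  contains a member of the chain. As A/B is non-abelian it is not the whole group, so it lies in a
  member of the chain.\<close>

lemma stack_centralizer:
 assumes "F : nonabelian_chief_factors G"
 obtains k l where "M k \<subseteq> centralizer G F" "centralizer G F \<subseteq> M l"
proof -
 obtain A B where F: "F = (A, B)" by fastforce
 have AB: "closed_normal A G" "closed_normal B G" "B \<subset> A"
  "!!N. closed_normal N G ==> B \<subset> N ==> N \<subset> A ==> False"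
  "\<exists>a\<in>A. \<exists>b\<in>A. a \<otimes> b \<otimes> inv a \<otimes> inv b \<notin> B" using assms unfolding F nonabelian_chief_factor_iff by blast+
 have s: "subgroup A G" "subgroup B G" "!!x h. x : carrier G ==> h : B ==> x \<otimes> h \<otimes> inv x : B"
  using closed_normalD[OF AB(1)] closed_normalD[OF AB(2)] by blast+
 have "B \<noteq> {\<one>}"
 proof
  \<comment> \<open>The chain descends for ever: if \<open>B\<close> were trivial, the predecessor
    of a member inside \<open>A\<close> would lie strictly between \<open>B\<close> and
    \<open>A\<close>.\<close>
  assume B: "B = {\<one>}"
  then have "A \<noteq> {\<one>}" using AB(3) by blast
  then obtain k where k: "M k \<subseteq> A" by (rule stack_below[OF AB(1)])
  have "\<one> : M' (k - 1)" by (rule closed_normalD(5)[OF stack_level(2)])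
  moreover obtain x where "x : M (k - 1)" "x \<notin> M' (k - 1)" using stack_strict[of "k - 1"] by blast
  ultimately have "x \<noteq> \<one>" "\<one> : M (k - 1)" using stack_level(3) by auto
  then have "B \<subset> M (k - 1)" using B \<open>x : M (k - 1)\<close> by auto
  then show False using AB(4)[OF stack_level(1)[of "k - 1"]] k stack_level(4)[of "k - 1"] stack_strict[of k] by auto
 qed
 then obtain k where k: "M k \<subseteq> B" by (rule stack_below[OF AB(2)])
 have "B \<subseteq> centralizer G F"
 proof
  fix g assume g: "g : B"
  have gG: "g : carrier G" using g s(2) by (auto dest: subgroup.mem_carrier)
  have "g \<otimes> k \<otimes> inv g \<otimes> inv k : B" if "k : A" for k
  proof -
   have kG: "k : carrier G" using that s(1) by (auto dest: subgroup.mem_carrier)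
   have "g \<otimes> (k \<otimes> inv g \<otimes> inv k) : B" using g s(2,3) kG by (auto intro: subgroup.m_closed subgroup.m_inv_closed)
   then show ?thesis using gG kG by (simp add: m_assoc)
  qed
  then show "g : centralizer G F" using gG by (simp add: F centralizer_def)
 qed
 moreover have "centralizer G F \<noteq> carrier G"
  using AB(5) s(1) by (auto simp: F centralizer_def dest: subgroup.mem_carrier)
 moreover have "closed_normal (centralizer G F) G" unfolding F by (rule closed_normal_centralizer[OF AB(1,2)])
 ultimately show thesis using that k stack_above by (metis order_trans)
qed

text \<open>By the dichotomy, a subgroup covering the block contains \<open>M k\<close> unless an
  associated factor A/B has \<open>A\<close> inside \<open>M' k\<close>. In that case association
  puts \<open>M k\<close> into the closure of \<open>A <#> M' k\<close>, that is into
  \<open>M' k\<close>.\<close>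

lemma stack_block:
 "association G `` {(M k, M' k)} : minimally_covered_blocks G"
proof -
 let ?F = "(M k, M' k)"
 have F: "?F : nonabelian_chief_factors G" unfolding nonabelian_chief_factor_iff
 proof (intro conjI notI)
  assume "\<exists>N. closed_normal N G \<and> M' k \<subset> N \<and> N \<subset> M k"
  then obtain N where "closed_normal N G" "M' k \<subset> N" "N \<subset> M k" by blast
  then show False using stack_dichotomy[of N k] by auto
 qed (use stack_level[of k] stack_strict[of k] in simp_all)
 have "covers (M k) (association G `` {?F})" using F associated_refl by (auto simp: covers_def association_def)
 moreover have "M k \<subseteq> N" if N: "closed_normal N G" "covers N (association G `` {?F})" for N
 proof -
  obtain A B where AB: "associated G ?F (A, B)" "(A, B) : nonabelian_chief_factors G" "A \<subseteq> N"
   using N(2) by (auto simp: covers_def association_def)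
  have cn: "closed_normal A G" "closed_normal B G" using AB(2) unfolding nonabelian_chief_factor_iff by auto
  note M's = closed_normalD(1,3)[OF stack_level(2)]
  have "\<not> A \<subseteq> M' k"
  proof
   assume "A \<subseteq> M' k"
   then have "gtop G closure_of (A <#> M' k) \<subseteq> M' k"
    using M's by (intro closure_of_minimal) (auto simp: set_mult_def intro: subgroup.m_closed)
   then have *: "gtop G closure_of (M k <#> B) \<subseteq> M' k" using AB(1) by (simp add: associated_def)
   note Mk = closed_normalD(4)[OF stack_level(1)] and B = closed_normalD(4,5)[OF cn(2)]
   have "x : M k <#> B" if "x : M k" for x using set_mult_def[of G "M k" B] that B(2) Mk by force
   then have "M k \<subseteq> M k <#> B" by blast
   moreover have "M k <#> B \<subseteq> carrier G" using setmult_subset_G[OF Mk B(1)] .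
   then have "M k <#> B \<subseteq> gtop G closure_of (M k <#> B)" by (intro closure_of_subset) simp
   ultimately show False using * stack_strict[of k] by blast
  qed
  then show ?thesis using stack_dichotomy[OF cn(1), of k] AB(3) by blast
 qed
 moreover have "association G `` {?F} : chief_blocks G" using F by (auto simp: chief_blocks_def intro: quotientI)
 ultimately show ?thesis using stack_level(1) by (auto simp: minimally_covered_blocks_def)
qed

text \<open>Centralizers of blocks are enclosed by members of the chain, and the automorphisms in
  \<open>aut\<close> push the centralizer of \<aa> arbitrarily far down.\<close>

lemma stack_block_less:
 assumes aut: "!!j. \<exists>\<psi>\<in>top_iso G G. \<forall>k. \<psi> ` M k = M (k + j)" and "\<aa> : chief_blocks G" "\<bb> : chief_blocks G"
 shows "\<exists>\<psi>\<in>top_iso G G. block_less G (block_action G \<psi> \<aa>) \<bb>"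
proof -
 obtain F F' where F: "F : \<aa>" "F' : \<bb>" using assms(2,3) chief_block_facts(1) by blast
 obtain l where l: "centralizer G F \<subseteq> M l" using stack_centralizer[OF chief_block_facts(2)[OF assms(2) F(1)]] .
 obtain k where k: "M k \<subseteq> centralizer G F'" using stack_centralizer[OF chief_block_facts(2)[OF assms(3) F(2)]] .
 \<comment> \<open>The target k - 1 instead of k makes the inclusion of centralizers strict, so that
   the two blocks differ.\<close>
 obtain \<psi> where \<psi>: "\<psi> : top_iso G G" "\<psi> ` M l = M (k - 1)" using aut[of "k - 1 - l"] by force
 have "block_centralizer G (block_action G \<psi> \<aa>) \<subseteq> \<psi> ` centralizer G F"
  using block_centralizer_action[OF \<psi>(1) assms(2)] chief_block_facts(3)[OF assms(2) F(1)] by simp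
 also have "\<dots> \<subseteq> M (k - 1)" using l \<psi>(2) by blast
 also have "\<dots> \<subset> M k" using stack_level(4)[of "k - 1"] stack_strict[of k] by auto
 also have "\<dots> \<subseteq> block_centralizer G \<bb>" using k chief_block_facts(3)[OF assms(3) F(2)] by simp
 finally show ?thesis using \<psi>(1) by (auto simp: block_less_def block_le_def)
qed

end

end

section \<open>Iterated wreath products along the integers\<close>

text \<open>Finite support keeps the set of points countable and makes any two points agree from
  some position on, which ties the rootless tree together at its upper end.\<close>

type_synonym seq = "(int, nat) poly_mapping"

abbreviation entry :: "seq => int => nat" (infixl "\<cdot>" 90) where
 "x \<cdot> i \<equiv> Poly_Mapping.lookup x i"

abbreviation upd :: "seq => int => nat => seq" where
 "upd x i a \<equiv> Poly_Mapping.update i a x"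

lemma entry_upd [simp]: "upd x i a \<cdot> j = (if i = j then a else x \<cdot> j)" by (simp add: lookup_update)

lemma seq_eqI: "(!!i. x \<cdot> i = y \<cdot> i) ==> x = y" by (rule poly_mapping_eqI)

lemma finite_entries [simp]: "finite {i. x \<cdot> i \<noteq> 0}" by (rule finite_lookup)

lemma countable_seq: "countable (UNIV :: seq set)"
proof (rule countable_image_inj_on)
 let ?graph = "\<lambda>x :: seq. (\<lambda>i. (i, x \<cdot> i)) ` {i. x \<cdot> i \<noteq> 0}"
 show "countable (range ?graph)"
  by (rule countable_subset[OF _ countable_Collect_finite_subset[OF countableI_type, of UNIV]]) auto
 show "inj ?graph"
 proof (intro injI seq_eqI)
  fix x y i assume "?graph x = ?graph y"
  then have "(i, a) : ?graph x \<longleftrightarrow> (i, a) : ?graph y" for a by simp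
  then have "a = x \<cdot> i \<and> a \<noteq> 0 \<longleftrightarrow> a = y \<cdot> i \<and> a \<noteq> 0" for a by (auto simp: image_iff)
  then show "x \<cdot> i = y \<cdot> i" by metis
 qed
qed

lemma finite_seq_box:
 assumes "finite S" "!!i. i : S ==> finite (A i)"
 shows "finite {x :: seq. (\<forall>i\<in>S. x \<cdot> i : A i) \<and> (\<forall>i. i \<notin> S --> x \<cdot> i = 0)}" (is "finite ?X")
proof (rule finite_imageD)
 show "finite ((\<lambda>x. restrict (\<lambda>i. x \<cdot> i) S) ` ?X)"
 proof (rule finite_subset)
  show "finite (PiE S A)" using assms by (intro finite_PiE) auto
  show "(\<lambda>x. restrict (\<lambda>i. x \<cdot> i) S) ` ?X \<subseteq> PiE S A" by (rule image_subsetI, rule PiE_I) simp_all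
 qed
 show "inj_on (\<lambda>x. restrict (\<lambda>i. x \<cdot> i) S) ?X"
 proof
  fix x x' assume x: "x : ?X" "x' : ?X" and e: "restrict (\<lambda>i. x \<cdot> i) S = restrict (\<lambda>i. x' \<cdot> i) S"
  show "x = x'"
  proof (rule seq_eqI)
   fix i
   show "x \<cdot> i = x' \<cdot> i" using x fun_cong[OF e, of i] by (cases "i : S") auto
  qed
 qed
qed

text \<open>
 Sequences agreeing in all positions \<open>\<ge> i\<close> lie in the same cone: position \<open>i\<close>
 holds the branch chosen at the vertex given by the positions \<open>> i\<close>.
\<close>

definition agree :: "int => seq => seq => bool" where
 "agree i x y \<longleftrightarrow> (\<forall>j\<ge>i. x \<cdot> j = y \<cdot> j)"

lemma agree_refl [simp]: "agree i x x" by (simp add: agree_def)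
lemma agree_sym: "agree i x y ==> agree i y x" by (simp add: agree_def)
lemma agree_trans: "agree i x y ==> agree i y z ==> agree i x z" by (simp add: agree_def)
lemma agree_mono: "agree i x y ==> i \<le> j ==> agree j x y" by (simp add: agree_def)
lemma agree_entry: "agree i x y ==> i \<le> j ==> x \<cdot> j = y \<cdot> j" by (simp add: agree_def)
lemma agree_upd [simp]: "agree (i + 1) (upd x i a) x" "agree (i + 1) x (upd x i a)" by (simp_all add: agree_def)

lemma agree_step: "agree i x y \<longleftrightarrow> agree (i + 1) x y \<and> x \<cdot> i = y \<cdot> i"
 unfolding agree_def by (metis add1_zle_eq order.order_iff_strict order_refl zless_imp_add1_zle)

lemma agree_all: "(!!i. agree i x y) ==> x = y" by (rule seq_eqI) (auto simp: agree_def)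

lemma agree_eventually: "\<exists>i. agree i x y"
proof -
 have "finite ({i. x \<cdot> i \<noteq> 0} \<union> {i. y \<cdot> i \<noteq> 0})" by simp
 then obtain b where b: "\<forall>i\<in>{i. x \<cdot> i \<noteq> 0} \<union> {i. y \<cdot> i \<noteq> 0}. i \<le> b" by (meson bdd_above_def bdd_above_finite)
 have "x \<cdot> j = y \<cdot> j" if "b < j" for j
 proof -
  have "x \<cdot> j = 0" "y \<cdot> j = 0" using b that by (auto simp flip: not_less)
  then show ?thesis by simp
 qed
 then show ?thesis by (intro exI[of _ "b + 1"]) (auto simp: agree_def)
qed

definition trunc :: "int => seq => seq" where
 "trunc i x = Abs_poly_mapping (\<lambda>j. if j > i then x \<cdot> j else 0)"

lemma entry_trunc [simp]: "trunc i x \<cdot> j = (if j > i then x \<cdot> j else 0)"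
proof -
 have "finite {j. (if j > i then x \<cdot> j else 0) \<noteq> 0}" by (rule finite_subset[OF _ finite_entries[of x]]) auto
 then show ?thesis by (simp add: trunc_def lookup_Abs_poly_mapping)
qed

lemma agree_trunc [simp]: "agree (i + 1) (trunc i x) x" "agree (i + 1) x (trunc i x)" by (simp_all add: agree_def)

lemma trunc_eq_iff: "trunc i x = trunc i y \<longleftrightarrow> agree (i + 1) x y"
proof
 assume "trunc i x = trunc i y"
 then show "agree (i + 1) x y" by (metis agree_trunc agree_trans)
next
 assume "agree (i + 1) x y"
 then show "trunc i x = trunc i y" by (intro seq_eqI) (simp add: agree_def)
qed

text \<open>A vertex of level i is a class of sequences agreeing above position i; the truncated
  member is its canonical representative.\<close>

definition truncated :: "int => seq => bool" where
 "truncated i x \<longleftrightarrow> (\<forall>j\<le>i. x \<cdot> j = 0)"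

lemma truncated_trunc [simp]: "truncated i (trunc i x)" by (simp add: truncated_def)

lemma trunc_truncated: "truncated i x ==> trunc i x = x" by (intro seq_eqI) (auto simp: truncated_def)

lemma truncated_eqI: "truncated i x ==> truncated i y ==> agree (i + 1) x y ==> x = y"
 by (metis trunc_truncated trunc_eq_iff)

text \<open>The local action of g at the vertex of level i above x, read off from the labels in
  position i. It does not record where the vertex itself is moved, which is why composition in
  \<open>loc_comp\<close> is twisted by h x.\<close>

definition loc :: "(seq => seq) => int => seq => nat => nat" where
 "loc g i x = (\<lambda>a. g (upd x i a) \<cdot> i)"

text \<open>A truncated z has entry 0 in position i, so these are the vertices at which the local
  action moves 0; for local actions in \<open>H\<close> this means that they lie outside
  \<open>V\<close>.\<close>

definition bad :: "(seq => seq) => (int \<times> seq) set" where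
 "bad g = {(i, z). truncated i z \<and> g z \<cdot> i \<noteq> 0}"

definition tree_aut :: "(seq => seq) => bool" where
 "tree_aut g \<longleftrightarrow> bij g \<and> (\<forall>i x y. agree i (g x) (g y) \<longleftrightarrow> agree i x y)"

lemma tree_aut_agree: "tree_aut g ==> agree i (g x) (g y) \<longleftrightarrow> agree i x y" by (simp add: tree_aut_def)

lemma tree_aut_comp: "tree_aut g ==> tree_aut h ==> tree_aut (g o h)" by (simp add: tree_aut_def bij_comp)

lemma tree_aut_id [simp]: "tree_aut id" by (simp add: tree_aut_def)

lemma tree_aut_inv: "tree_aut g ==> tree_aut (invp g)"
 by (auto simp: tree_aut_def bij_imp_bij_inv) (metis bij_inv_eq_iff)+

lemma tree_aut_invp [simp]:
 "tree_aut g ==> invp g (g x) = x" "tree_aut g ==> g (invp g x) = x"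
 by (auto simp: tree_aut_def bij_is_inj bij_is_surj surj_f_inv_f)

lemma loc_entry: "tree_aut g ==> agree (i + 1) x y ==> g y \<cdot> i = loc g i x (y \<cdot> i)"
proof -
 assume g: "tree_aut g" and xy: "agree (i + 1) x y"
 have "agree i (upd x i (y \<cdot> i)) y" using xy by (auto simp: agree_def)
 then have "agree i (g (upd x i (y \<cdot> i))) (g y)" using g by (simp add: tree_aut_agree)
 then show "g y \<cdot> i = loc g i x (y \<cdot> i)" by (simp add: loc_def agree_def)
qed

lemma loc_cong: "tree_aut g ==> agree (i + 1) x y ==> loc g i x = loc g i y"
proof
 fix a assume g: "tree_aut g" and "agree (i + 1) x y"
 then have "agree (i + 1) x (upd y i a)" by (metis agree_upd agree_trans)
 then show "loc g i x a = loc g i y a" using loc_entry[OF g, of i x "upd y i a"] by (simp add: loc_def)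
qed

lemma loc_comp:
 assumes "tree_aut g" "tree_aut h" shows "loc (g o h) i x = loc g i (h x) o loc h i x"
proof
 fix a
 have "agree (i + 1) (h x) (h (upd x i a))" using assms by (simp add: tree_aut_agree)
 then have "g (h (upd x i a)) \<cdot> i = loc g i (h x) (h (upd x i a) \<cdot> i)" by (rule loc_entry[OF assms(1)])
 then show "loc (g o h) i x a = (loc g i (h x) o loc h i x) a" by (simp add: loc_def)
qed

lemma loc_id [simp]: "loc id i x = id" by (simp add: loc_def fun_eq_iff)

lemma loc_inv:
 assumes "tree_aut g" shows "loc (invp g) i (g x) = invp (loc g i x)" "loc g i x o loc (invp g) i (g x) = id"
  "loc (invp g) i (g x) o loc g i x = id" "bij (loc g i x)"
proof -
 have c: "g o invp g = id" "invp g o g = id" using assms by (simp_all add: fun_eq_iff)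
 show 1: "loc g i x o loc (invp g) i (g x) = id"
  using loc_comp[OF assms tree_aut_inv[OF assms], of i "g x"] assms c by simp
 show 2: "loc (invp g) i (g x) o loc g i x = id" using loc_comp[OF tree_aut_inv[OF assms] assms, of i x] c by simp
 show "bij (loc g i x)" using 1 2 o_bij by blast
 show "loc (invp g) i (g x) = invp (loc g i x)" using 1 2 by (simp add: inv_unique_comp)
qed

lemma bad_iff_loc:
 assumes "tree_aut g" shows "(i, z) : bad g \<longleftrightarrow> truncated i z \<and> loc g i z 0 \<noteq> 0"
proof -
 have "g z \<cdot> i = loc g i z 0" if "truncated i z"
  using loc_entry[OF assms agree_refl, of z i] that by (simp add: truncated_def)
 then show ?thesis by (auto simp: bad_def)
qed

lemma loc_0_iff_bad:
 assumes "tree_aut g" shows "loc g i x 0 \<noteq> 0 \<longleftrightarrow> (i, trunc i x) : bad g"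
 using loc_cong[OF assms agree_trunc(1)] by (simp add: bad_iff_loc[OF assms])

text \<open>h acts injectively on the vertices of each level, so pulling back along h keeps a set of
  vertices finite. The finiteness condition in the group of finitary automorphisms survives
  composition and inversion for this reason.\<close>

lemma finite_bad_preimage:
 assumes "finite (bad g)" "tree_aut h" shows "finite {(i, z). truncated i z \<and> (i, trunc i (h z)) : bad g}"
proof (rule finite_imageD)
 let ?f = "\<lambda>(i, z). (i, trunc i (h z))"
 show "finite (?f ` {(i, z). truncated i z \<and> (i, trunc i (h z)) : bad g})" by (rule finite_subset[OF _ assms(1)]) auto
 show "inj_on ?f {(i, z). truncated i z \<and> (i, trunc i (h z)) : bad g}"
  using assms(2) by (auto simp: inj_on_def trunc_eq_iff tree_aut_agree intro: truncated_eqI)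
qed

text \<open>Permutes the branches at the vertex of level i above v by h and keeps all labels further
  down; its only non-trivial local action is at that vertex.\<close>

definition rooted :: "int => seq => (nat => nat) => seq => seq" where
 "rooted i v h z = (if agree (i + 1) z v then upd z i (h (z \<cdot> i)) else z)"

lemma root_comp: "rooted i v g o rooted i v h = rooted i v (g o h)"
 by (auto simp: rooted_def fun_eq_iff agree_def intro!: seq_eqI)

lemma root_id [simp]: "rooted i v id = id" by (auto simp: rooted_def fun_eq_iff intro!: seq_eqI)

lemma root_cong: "agree (i + 1) v w ==> rooted i v h = rooted i w h" by (auto simp: rooted_def fun_eq_iff agree_def)

lemma agree_root_above [simp]: "agree (i + 1) (rooted i v h z) z" by (simp add: rooted_def agree_def)

lemma tree_aut_root:
 assumes "bij h" shows "tree_aut (rooted i v h)"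
proof -
 have "rooted i v h o rooted i v (invp h) = id" "rooted i v (invp h) o rooted i v h = id"
  using assms by (simp_all add: root_comp bij_is_surj bij_is_inj surj_iff[THEN iffD1] inv_o_cancel)
 then have "bij (rooted i v h)" using o_bij by blast
 moreover have "agree j (rooted i v h x) (rooted i v h y) \<longleftrightarrow> agree j x y" for j x y
 proof (cases "j > i")
  case True
  have "agree j (rooted i v h z) z" for z using agree_mono[OF agree_root_above] True by simp
  then show ?thesis by (meson agree_sym agree_trans)
 next
  case False
  have "agree j x y" if "agree j (rooted i v h x) (rooted i v h y)"
  proof -
   have "agree (i + 1) (rooted i v h x) (rooted i v h y)" using that False by (auto intro: agree_mono)
   then have *: "agree (i + 1) x y" by (meson agree_root_above agree_sym agree_trans)
   then have "agree (i + 1) x v \<longleftrightarrow> agree (i + 1) y v" by (meson agree_sym agree_trans)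
   then show ?thesis using that assms by (auto simp: rooted_def agree_def bij_def inj_eq split: if_splits)
  qed
  moreover have "agree j (rooted i v h x) (rooted i v h y)" if "agree j x y"
  proof -
   have "agree (i + 1) x y" using that False by (auto intro: agree_mono)
   then have "agree (i + 1) x v \<longleftrightarrow> agree (i + 1) y v" by (meson agree_sym agree_trans)
   then show ?thesis using that False by (auto simp: rooted_def agree_def)
  qed
  ultimately show ?thesis by blast
 qed
 ultimately show ?thesis by (simp add: tree_aut_def)
qed

lemma loc_root: "loc (rooted i v h) j x = (if j = i \<and> agree (i + 1) x v then h else id)"
proof (cases "j = i")
 case True
 then show ?thesis by (auto simp: loc_def rooted_def fun_eq_iff agree_def)
next
 case False
 then show ?thesis by (auto simp: loc_def rooted_def fun_eq_iff)
qed

lemma bad_root: "bad (rooted i v h) \<subseteq> {(i, trunc i v)}"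
proof clarify
 fix j z assume "(j, z) : bad (rooted i v h)"
 then have z: "truncated j z" "rooted i v h z \<cdot> j \<noteq> 0" by (auto simp: bad_def)
 then have "z \<cdot> j = 0" by (simp add: truncated_def)
 with z have "agree (i + 1) z v" "j = i" by (auto simp: rooted_def split: if_splits)
 then show "j = i \<and> z = trunc i v" using z(1) by (metis trunc_truncated trunc_eq_iff)
qed

section \<open>The finitary automorphism group and its compact open subgroup\<close>

locale tree =
 fixes H :: "(nat => nat) set"
 assumes perm_pair_H: "perm_pair H {h : H. h 0 = 0}" and transitive: "\<exists>h\<in>H. h 0 = n"
begin

abbreviation "V \<equiv> {h : H. h 0 = 0}"

sublocale H: perm_pair H V by (rule perm_pair_H)

definition K :: "(seq => seq) set" where
 "K = {g. tree_aut g \<and> (\<forall>i x. loc g i x : H) \<and> finite (bad g)}"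

text \<open>Keeping zero entries amounts to having no bad vertex, that is all local actions in
  \<open>V\<close>; the form with entries makes closure under composition immediate.\<close>

definition U :: "(seq => seq) set" where
 "U = {g : K. \<forall>z i. z \<cdot> i = 0 --> g z \<cdot> i = 0}"

lemma K_aut: "g : K ==> tree_aut g" by (simp add: K_def)
lemma K_loc: "g : K ==> loc g i x : H" by (simp add: K_def)
lemma K_bad: "g : K ==> finite (bad g)" by (simp add: K_def)

lemma K_comp:
 assumes "g : K" "h : K" shows "g o h : K"
proof -
 note a = K_aut[OF assms(1)] K_aut[OF assms(2)]
 have "bad (g o h) \<subseteq> bad h \<union> {(i, z). truncated i z \<and> (i, trunc i (h z)) : bad g}"
 proof clarify
  fix i z assume z: "(i, z) : bad (g o h)" "(i, z) \<notin> bad h"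
  then have "truncated i z" "loc g i (h z) (loc h i z 0) \<noteq> 0"
   using bad_iff_loc[OF tree_aut_comp[OF a]] loc_comp[OF a] by auto
  moreover have "loc h i z 0 = 0" using z bad_iff_loc[OF a(2)] \<open>truncated i z\<close> by auto
  ultimately show "truncated i z \<and> (i, trunc i (h z)) : bad g" using loc_0_iff_bad[OF a(1)] by auto
 qed
 then have "finite (bad (g o h))"
  using K_bad[OF assms(2)] finite_bad_preimage[OF K_bad[OF assms(1)] a(2)] by (meson finite_UnI finite_subset)
 then show ?thesis using a assms by (simp add: K_def tree_aut_comp loc_comp H.comp)
qed

lemma K_inv:
 assumes "g : K" shows "invp g : K"
proof -
 note a = K_aut[OF assms] tree_aut_inv[OF K_aut[OF assms]]
 have l: "loc (invp g) i x = invp (loc g i (invp g x))" for i x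
  using loc_inv(1)[OF a(1), of i "invp g x"] a(1) by simp
 have "bad (invp g) \<subseteq> {(i, z). truncated i z \<and> (i, trunc i (invp g z)) : bad g}"
 proof clarify
  fix i z assume z: "(i, z) : bad (invp g)"
  then have "truncated i z" "invp (loc g i (invp g z)) 0 \<noteq> 0" using bad_iff_loc[OF a(2)] l by auto
  moreover have "loc g i (invp g z) 0 \<noteq> 0"
  proof
   assume "loc g i (invp g z) 0 = 0"
   then have "invp (loc g i (invp g z)) 0 = 0" using H.invp_apply(1)[OF K_loc[OF assms], of i "invp g z" 0] by simp
   with calculation show False by simp
  qed
  ultimately show "truncated i z \<and> (i, trunc i (invp g z)) : bad g" using loc_0_iff_bad[OF a(1)] by auto
 qed
 then have "finite (bad (invp g))" using finite_bad_preimage[OF K_bad[OF assms] a(2)] by (rule finite_subset)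
 then show ?thesis using a assms by (simp add: K_def l H.invp)
qed

lemma K_root: "h : H ==> rooted i v h : K" using tree_aut_root[OF H.bij] finite_subset[OF bad_root, of i v h] H.id_mem
 by (auto simp: K_def loc_root)

lemma K_id: "id : K" using K_root[OF H.id_mem] by simp

lemma U_iff: "g : U \<longleftrightarrow> g : K \<and> bad g = {}"
proof
 assume "g : U"
 then show "g : K \<and> bad g = {}" unfolding U_def bad_def truncated_def by fastforce
next
 assume g: "g : K \<and> bad g = {}"
 have "g z \<cdot> i = 0" if "z \<cdot> i = 0" for z i
 proof -
  have "g z \<cdot> i = loc g i z 0" using loc_entry[OF K_aut agree_refl, of g z i] g that by simp
  then show ?thesis using loc_0_iff_bad[OF K_aut, of g i z] g by auto
 qed
 then show "g : U" using g by (simp add: U_def)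
qed

lemma U_loc: "g : U ==> loc g i x : V" using K_loc loc_0_iff_bad[OF K_aut, of g i x] by (auto simp: U_iff)

lemma U_entry_iff:
 assumes "u : U" shows "u z \<cdot> i = 0 \<longleftrightarrow> z \<cdot> i = 0"
proof -
 have a: "tree_aut u" using assms K_aut by (simp add: U_def)
 have "u z \<cdot> i = loc u i z (z \<cdot> i)" by (rule loc_entry[OF a agree_refl])
 moreover have "loc u i z 0 = 0" using U_loc[OF assms] by simp
 moreover have "inj (loc u i z)" using loc_inv(4)[OF a] by (simp add: bij_is_inj)
 ultimately show ?thesis by (metis injD)
qed

lemma U_comp: "g : U ==> h : U ==> g o h : U" by (simp add: U_def K_comp)

lemma U_inv: "g : U ==> invp g : U" using U_entry_iff[of g "invp g _"] K_inv K_aut by (auto simp: U_def)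

text \<open>Away from its bad vertices h preserves zero entries, in both directions. At the finitely
  many bad ones u fixes the image point, which takes over.\<close>

lemma commensurated_U:
 assumes h: "h : K" and u: "u : U" "!!i v. (i, v) : bad h ==> u (h v) = h v" shows "invp h o u o h : U"
proof -
 have uK: "u : K" using u by (simp add: U_def)
 note ah = K_aut[OF h] and au = K_aut[OF uK]
 have "(invp h o u o h) z \<cdot> i = 0" if z: "z \<cdot> i = 0" for z i
 proof -
  define w where "w = invp h (u (h z))"
  have hw: "h w = u (h z)" using ah by (simp add: w_def)
  have "w \<cdot> i = 0"
  proof (cases "(i, trunc i z) : bad h")
   case True
   have "agree i z (trunc i z)" using z by (auto simp: agree_def)
   then have "agree i (u (h z)) (u (h (trunc i z)))" using ah au by (simp add: tree_aut_agree)
   then have "agree i (h w) (h (trunc i z))" using u(2)[OF True] hw by simp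
   then have "agree i w (trunc i z)" using ah by (simp add: tree_aut_agree)
   then show ?thesis by (simp add: agree_def)
  next
   case False
   have "loc h i z 0 = 0" using loc_0_iff_bad[OF ah] False by auto
   then have "h z \<cdot> i = 0" using loc_entry[OF ah agree_refl, of z i] z by simp
   then have 0: "h w \<cdot> i = 0" using u(1) hw by (simp add: U_entry_iff)
   \<comment> \<open>If the vertex of w were bad, u would fix its image, so z and w would share this
     vertex and it would be bad for z as well.\<close>
   have "(i, trunc i w) \<notin> bad h"
   proof
    assume b: "(i, trunc i w) : bad h"
    have "agree (i + 1) (h w) (h (trunc i w))" using ah by (simp add: tree_aut_agree)
    then have "agree (i + 1) (u (h z)) (u (h (trunc i w)))" using hw u(2)[OF b] by simp
    then have "agree (i + 1) z (trunc i w)" using ah au by (simp add: tree_aut_agree)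
    then have "trunc i z = trunc i w" by (metis trunc_eq_iff agree_trunc(1) agree_trans)
    then show False using False b by simp
   qed
   then have "loc h i w 0 = 0" using loc_0_iff_bad[OF ah] by auto
   moreover have "loc h i w (w \<cdot> i) = 0" using loc_entry[OF ah agree_refl, of w i] 0 by simp
   moreover have "inj (loc h i w)" using loc_inv(4)[OF ah] by (simp add: bij_is_inj)
   ultimately show ?thesis by (metis injD)
  qed
  then show ?thesis by (simp add: w_def)
 qed
 then show ?thesis using K_comp K_inv h uK by (simp add: U_def)
qed

lemma loc_root_comp:
 assumes "tree_aut g" "h : H"
 shows "loc (rooted i (g v) h o g) j x = (if j = i \<and> agree (i + 1) x v then h o loc g i v else loc g j x)"
proof -
 have "loc (rooted i (g v) h o g) j x = loc (rooted i (g v) h) j (g x) o loc g j x"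
  by (rule loc_comp[OF tree_aut_root[OF H.bij[OF assms(2)]] assms(1)])
 then show ?thesis using loc_cong[OF assms(1), of i x v] by (simp add: loc_root tree_aut_agree[OF assms(1)])
qed

text \<open>Vertices are corrected one at a time: a rooted element at the current image of v cancels
  the local action at v and touches no other. The hypothesis \<open>roots\<close> speaks of f (g v)
  because the earlier corrections have moved the vertex.\<close>

lemma reduce_loc:
 assumes g: "g : K" and fin: "finite \<Phi>" and NK: "N \<subseteq> K" and id: "id : N"
  and comp: "!!f f'. f : N ==> f' : N ==> f o f' : N"
  and roots: "!!i v h f. (i, v) : \<Phi> ==> h : H ==> f : N ==> rooted i (f (g v)) h : N"
 obtains f where "f : N" "!!i v. (i, v) : \<Phi> ==> loc (f o g) i v = id"
  "!!j x. loc (f o g) j x = id \<or> loc (f o g) j x = loc g j x"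
proof -
 have "\<exists>f\<in>N. (\<forall>(i, v)\<in>\<Phi>. loc (f o g) i v = id) \<and> (\<forall>j x. loc (f o g) j x = id \<or> loc (f o g) j x = loc g j x)"
  using fin roots
 proof (induction \<Phi> rule: finite_induct)
  case empty
  then show ?case using id by (intro bexI[of _ id]) auto
 next
  case (insert p \<Phi>)
  obtain i v where p: "p = (i, v)" by fastforce
  have "\<exists>f\<in>N. (\<forall>(i, v)\<in>\<Phi>. loc (f o g) i v = id) \<and> (\<forall>j x. loc (f o g) j x = id \<or> loc (f o g) j x = loc g j x)"
   by (rule insert.IH) (use insert.prems in blast)
  then obtain f where f: "f : N" "!!i v. (i, v) : \<Phi> ==> loc (f o g) i v = id"
   "!!j x. loc (f o g) j x = id \<or> loc (f o g) j x = loc g j x" by fast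
  have fg: "f o g : K" using f NK g K_comp by blast
  define h where "h = invp (loc (f o g) i v)"
  have h: "h : H" "h o loc (f o g) i v = id" using K_loc[OF fg] H.invp by (auto simp: h_def)
  let ?f = "rooted i (f (g v)) h o f"
  have "?f : N" using insert.prems[OF _ h(1) f(1), of i v] f(1) p by (intro comp) auto
  moreover have l: "loc (?f o g) j x = (if j = i \<and> agree (i + 1) x v then id else loc (f o g) j x)" for j x
   using loc_root_comp[OF K_aut[OF fg] h(1), of i v j x] h(2) by (simp add: comp_assoc)
  moreover have "\<forall>(j, x)\<in>insert p \<Phi>. loc (?f o g) j x = id" unfolding l p using f(2) by auto
  moreover have "\<forall>j x. loc (?f o g) j x = id \<or> loc (?f o g) j x = loc g j x" unfolding l using f(3) by auto
  ultimately show ?case by blast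
 qed
 then show thesis using that by fast
qed

lemma reduced_U:
 assumes "g : K" "f o g : K" "!!i z. (i, z) : bad g ==> loc (f o g) i z = id"
  "!!j x. loc (f o g) j x = id \<or> loc (f o g) j x = loc g j x" shows "f o g : U"
proof -
 have "(i, z) \<notin> bad (f o g)" for i z
 proof
  assume "(i, z) : bad (f o g)"
  then have z: "truncated i z" "loc (f o g) i z 0 \<noteq> 0" using bad_iff_loc[OF K_aut[OF assms(2)]] by auto
  then have "loc (f o g) i z = loc g i z" using assms(4)[of i z] by auto
  then have "(i, z) : bad g" using z bad_iff_loc[OF K_aut[OF assms(1)]] by auto
  then show False using assms(3) z by simp
 qed
 then show ?thesis using assms(2) by (auto simp: U_iff)
qed

text \<open>Induction on the number of bad vertices. With \<open>R a\<close> carrying 0 to a, a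
  rooted copy of the inverse of \<open>R a\<close> removes one bad vertex, so the representatives
  are words in countably many letters.\<close>

lemma countable_cosets_K: "\<exists>D. countable D \<and> D \<subseteq> K \<and> (\<forall>g\<in>K. \<exists>d\<in>D. invp d o g : U)"
proof -
 obtain R where R: "!!n. R n : H" "!!n. R n 0 = n" using transitive by metis
 define word where "word l = foldr (\<lambda>(a, i, u) f. rooted i u (R a) o f) l id" for l :: "(nat \<times> int \<times> seq) list"
 have word: "word l : K" for l
  by (induction l) (auto simp: word_def intro!: K_id K_id[unfolded id_def] K_comp K_root R)
 have "countable (UNIV :: (nat \<times> int \<times> seq) set)" using countable_seq by (simp flip: UNIV_Times_UNIV)
 then have "countable (lists (UNIV :: (nat \<times> int \<times> seq) set))" by (rule countable_lists)
 then have "countable (range word)" by simp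
 moreover have "\<exists>l. invp (word l) o g : U" if "g : K" for g using that
 proof (induction "card (bad g)" arbitrary: g)
  case 0
  then have "g : U" using K_bad by (auto simp: U_iff)
  then show ?case by (intro exI[of _ "[]"]) (simp add: word_def)
 next
  case (Suc n)
  then have "bad g \<noteq> {}" by auto
  then obtain i v where v: "(i, v) : bad g" by auto
  note ag = K_aut[OF Suc.prems]
  define a where "a = loc g i v 0"
  let ?r = "invp (R a)"
  define g' where "g' = rooted i (g v) ?r o g"
  have r: "?r : H" "?r a = 0" using H.invp[OF R(1)] H.invp_apply(1)[OF R(1), of a 0] R(2) by auto
  have g'K: "g' : K" unfolding g'_def by (intro K_comp K_root r Suc.prems)
  have l: "loc g' j x 0 = (if j = i \<and> agree (i + 1) x v then 0 else loc g j x 0)" for j x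
   unfolding g'_def loc_root_comp[OF ag r(1)] using r(2) by (simp add: a_def)
  have "truncated i v" using v by (simp add: bad_def)
  then have "bad g' = bad g - {(i, v)}" using truncated_eqI[of i _ v]
   by (auto simp: bad_iff_loc[OF K_aut[OF g'K]] bad_iff_loc[OF ag] l split: if_splits)
  then have "card (bad g') = n" using Suc.hyps(2) v K_bad[OF Suc.prems] by simp
  then obtain w where w: "invp (word w) o g' : U" using Suc.hyps(1) g'K by blast
  have "invp (word ((a, i, g v) # w)) = invp (word w) o rooted i (g v) ?r"
  proof -
   have "word ((a, i, g v) # w) = rooted i (g v) (R a) o word w" by (simp add: word_def)
   moreover have "bij (word w)" "bij (rooted i (g v) (R a))"
    using K_aut[OF word] K_aut[OF K_root[OF R(1)]] by (auto simp: tree_aut_def)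
   moreover have "invp (rooted i (g v) (R a)) = rooted i (g v) ?r"
    using R by (intro inv_unique_comp) (simp_all add: root_comp)
   ultimately show ?thesis by (simp add: o_inv_distrib)
  qed
  then show ?case using w by (intro exI[of _ "(a, i, g v) # w"]) (simp add: g'_def comp_assoc)
 qed
 ultimately show ?thesis using word by (intro exI[of _ "range word"]) blast
qed

lemma finite_U_orbit: "finite ((\<lambda>u. u y) ` U)"
proof -
 let ?S = "{i. y \<cdot> i \<noteq> 0}" and ?A = "\<lambda>i. (\<lambda>v. v (y \<cdot> i)) ` V"
 have "(\<lambda>u. u y) ` U \<subseteq> {x. (\<forall>i\<in>?S. x \<cdot> i : ?A i) \<and> (\<forall>i. i \<notin> ?S --> x \<cdot> i = 0)}"
 proof clarify
  fix u assume u: "u : U"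
  have "u y \<cdot> i : ?A i" for i
   using loc_entry[OF K_aut agree_refl, of u y i] u U_loc[OF u, of i y] by (auto simp: U_def)
  then show "(\<forall>i\<in>?S. u y \<cdot> i : ?A i) \<and> (\<forall>i. i \<notin> ?S --> u y \<cdot> i = 0)" using U_entry_iff[OF u] by auto
 qed
 moreover have "finite {x. (\<forall>i\<in>?S. x \<cdot> i : ?A i) \<and> (\<forall>i. i \<notin> ?S --> x \<cdot> i = 0)}"
  by (rule finite_seq_box) (use H.U_orbits in auto)
 ultimately show ?thesis by (rule finite_subset)
qed

lemma U_closed:
 assumes f: "!!F. finite F ==> \<exists>u\<in>U. \<forall>y\<in>F. u y = f y" shows "f : U"
proof -
 have au: "tree_aut u" if "u : U" for u using that K_aut by (simp add: U_def)
 have ag: "agree i (f x) (f y) \<longleftrightarrow> agree i x y" for i x y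
 proof -
  obtain u where "u : U" "u x = f x" "u y = f y" using f[of "{x, y}"] by auto
  then show ?thesis using tree_aut_agree[OF au] by metis
 qed
 have "bij f"
 proof (rule bijI)
  show "inj f"
  proof
   fix x y assume "f x = f y"
   then have "agree i x y" for i using ag[of i x y] by simp
   then show "x = y" by (rule agree_all)
  qed
  have "\<exists>x. f x = y" for y
  proof -
   let ?O = "(\<lambda>u. u y) ` U"
   \<comment> \<open>For surjectivity take u agreeing with f on the finite orbit of y: the preimage
     of y under u lies in that orbit, so f sends it to y.\<close>
   obtain u where u: "u : U" "\<forall>x\<in>?O. u x = f x" using f[OF finite_U_orbit[of y]] by blast
   have "invp u y : ?O" using U_inv[OF u(1)] by (rule imageI)
   then have "u (invp u y) = f (invp u y)" using u(2) by (rule bspec[rotated])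
   then have "f (invp u y) = y" using au[OF u(1)] by simp
   then show ?thesis by blast
  qed
  then show "surj f" unfolding surj_def by metis
 qed
 then have af: "tree_aut f" using ag by (simp add: tree_aut_def)
 have "loc f i x : V" for i x
 proof (rule H.U_closed)
  fix F :: "nat set" assume "finite F"
  then obtain u where u: "u : U" "\<forall>y\<in>(\<lambda>a. upd x i a) ` F. u y = f y" using f by (meson finite_imageI)
  then show "\<exists>v\<in>V. \<forall>a\<in>F. v a = loc f i x a"
   using U_loc[OF u(1)] by (intro bexI[of _ "loc u i x"]) (auto simp: loc_def)
 qed
 moreover from this have "bad f = {}" using bad_iff_loc[OF af] by auto
 ultimately show ?thesis using af by (simp add: U_iff K_def)
qed

sublocale perm_pair K U
proof
 show "bij g" if "g : K" for g using K_aut[OF that] by (simp add: tree_aut_def)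
 show "\<exists>F. finite F \<and> (\<forall>u\<in>U. (\<forall>y\<in>F. u y = y) --> invp h o u o h : U)" if h: "h : K" for h
 proof (intro exI conjI ballI impI)
  show "finite (h ` snd ` bad h)" using K_bad[OF h] by simp
  show "invp h o u o h : U" if "u : U" "\<forall>y\<in>h ` snd ` bad h. u y = y" for u
   by (rule commensurated_U[OF h that(1)]) (use that(2) in force)
 qed
 show "f : U" if "!!F. finite F ==> \<exists>u\<in>U. \<forall>y\<in>F. u y = f y" for f using that by (rule U_closed)
 show "id : U" by (simp add: U_def K_id)
 show "U \<subseteq> K" by (auto simp: U_def)
qed (auto intro: K_comp K_inv U_comp U_inv finite_U_orbit countable_seq countable_cosets_K)

end

lemma tree_aut_root_inv: "bij h ==> invp (rooted i v h) = rooted i v (invp h)"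
 by (intro inv_unique_comp) (simp_all add: root_comp bij_is_surj bij_is_inj surj_iff[THEN iffD1] inv_o_cancel)

lemma loc_conj:
 assumes "tree_aut c" "tree_aut g" "agree (k + 1) (g x) x"
 shows "loc (c o g o invp c) k (c x) = loc c k x o loc g k x o invp (loc c k x)"
proof -
 have "loc (c o g o invp c) k (c x) = loc (c o g) k (invp c (c x)) o loc (invp c) k (c x)"
  by (rule loc_comp[OF tree_aut_comp[OF assms(1,2)] tree_aut_inv[OF assms(1)]])
 also have "\<dots> = loc c k (g x) o loc g k x o invp (loc c k x)" using assms by (simp add: loc_comp loc_inv(1))
 also have "loc c k (g x) = loc c k x" by (rule loc_cong[OF assms(1,3)])
 finally show ?thesis .
qed

context perm_pair
begin

lemma closed_normal_conj:
 assumes "closed_normal N PG" "c : G" "g : N" shows "c o g o invp c : N"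
 using assms by (auto simp: closed_normal_iff[OF group_PG])

lemma PG_subgroupD:
 assumes "subgroup N PG" shows "N \<subseteq> G" "id : N" "!!f g. f : N ==> g : N ==> f o g : N" "!!g. g : N ==> invp g : N"
proof -
 show 1: "N \<subseteq> G" using subgroup.subset[OF assms] by simp
 show "id : N" using subgroup.one_closed[OF assms] by simp
 show "f o g : N" if "f : N" "g : N" for f g using subgroup.m_closed[OF assms that] by simp
 show "invp g : N" if "g : N" for g using subgroup.m_inv_closed[OF assms that] that 1 by auto
qed

lemma subgroup_PGI:
 assumes "S \<subseteq> G" "id : S" "!!f g. f : S ==> g : S ==> f o g : S" "!!g. g : S ==> invp g : S" shows "subgroup S PG"
 by (rule group.subgroupI[OF group_PG]) (use assms in \<open>auto simp: subset_iff\<close>)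

lemma closed_normal_PGI:
 assumes "subgroup S PG" "!!c g. c : G ==> g : S ==> c o g o invp c : S" "closedin (perm_topology G U) S"
 shows "closed_normal S PG" using assms by (auto simp: closed_normal_iff[OF group_PG])

end

section \<open>Density of the rooted elements and the chain of level subgroups\<close>

context tree
begin

lemma invp_comp_cancel: "c : K ==> invp c o (c o r) = r" by (simp add: comp_assoc[symmetric])

lemma root_U_iff: "h : H ==> rooted i v h : U \<longleftrightarrow> h : V"
proof
 assume h: "h : H" "rooted i v h : U"
 then have "loc (rooted i v h) i v : V" by (intro U_loc)
 then show "h : V" by (simp add: loc_root)
next
 assume "h : H" "h : V"
 then show "rooted i v h : U" using K_root by (auto simp: U_def rooted_def)
qed

lemma root_cont_hom: "rooted i v : cont_hom H.PG PG"
proof -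
 have "rooted i v : cont_hom (subgrp H.PG H) PG"
 proof (rule perm_cont_hom[OF H.perm_pair_axioms perm_pair_axioms])
  show "subgroup H H.PG" using H.subgroup_self by simp
  fix F' :: "seq set" assume F': "finite F'"
  have "rooted i v u : U \<and> (\<forall>y\<in>F'. rooted i v u y = y)" if "u : V \<inter> H" "\<forall>y\<in>(\<lambda>z. z \<cdot> i) ` F'. u y = y" for u
   using that root_U_iff[of u i v] by (auto simp: rooted_def intro!: seq_eqI)
  then show "\<exists>F. finite F \<and> (\<forall>u\<in>V \<inter> H. (\<forall>y\<in>F. u y = y) --> rooted i v u : U \<and> (\<forall>y\<in>F'. rooted i v u y = y))"
   using F' by (intro exI[of _ "(\<lambda>z. z \<cdot> i) ` F'"]) blast
 qed (auto simp: K_root root_comp)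
 then show ?thesis using subgrp_self[of H.PG] by simp
qed

text \<open>Descend from a level at which x and y already agree, correcting one entry at a time by
  the transitivity of \<open>H\<close>.\<close>

lemma cone_transitive: "\<exists>c\<in>K. agree k (c x) y"
proof -
 obtain i where i: "agree i x y" using agree_eventually by blast
 show ?thesis
 proof (cases "k \<le> i")
  case True
  then show ?thesis
  proof (induction k rule: int_le_induct)
   case base
   then show ?case using i K_id by (intro bexI[of _ id]) auto
  next
   case (step j)
   then obtain c where c: "c : K" "agree j (c x) y" by blast
   obtain h1 h2 where h: "h1 : H" "h1 0 = c x \<cdot> (j - 1)" "h2 : H" "h2 0 = y \<cdot> (j - 1)" using transitive by metis
   let ?h = "h2 o invp h1"
   have H: "?h : H" "?h (c x \<cdot> (j - 1)) = y \<cdot> (j - 1)" using h H.comp H.invp H.invp_apply(1)[OF h(1), of 0] by auto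
   have "agree (j - 1) (rooted (j - 1) (c x) ?h (c x)) y"
    using c(2) H(2) by (subst agree_step) (auto simp: rooted_def agree_def)
   then show ?case using K_comp[OF K_root[OF H(1)] c(1)] by (intro bexI[of _ "rooted (j - 1) (c x) ?h o c"]) auto
  qed
 next
  case False
  then show ?thesis using i K_id agree_mono by (intro bexI[of _ id]) auto
 qed
qed

text \<open>Given finitely many points, cancel the local actions of g at its bad vertices and along
  the nonzero entries of these points. What is left lies in \<open>U\<close> and fixes the points,
  so the inverse of the correcting element approximates g.\<close>

lemma roots_dense:
 assumes N: "subgroup N PG" "closedin (perm_topology K U) N"
  and roots: "!!i v h. i : I ==> h : H ==> rooted i v h : N" and g: "g : K" "!!i x. i \<notin> I ==> loc g i x = id"
 shows "g : N"
proof (rule closedin_PG_D[OF N(2) g(1)])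
 fix F :: "seq set" assume F: "finite F"
 note N' = PG_subgroupD[OF N(1)]
 \<comment> \<open>Listing only nonzero entries keeps \<Phi> finite; zero entries are kept by every
   element of \<open>U\<close>.\<close>
 define \<Phi> where "\<Phi> = {p : bad g \<union> (\<Union>y\<in>F. (\<lambda>i. (i, y)) ` {i. y \<cdot> i \<noteq> 0}). fst p : I}"
 have "finite \<Phi>" unfolding \<Phi>_def using K_bad[OF g(1)] F by simp
 then obtain f where f: "f : N" "!!i v. (i, v) : \<Phi> ==> loc (f o g) i v = id"
  "!!j x. loc (f o g) j x = id \<or> loc (f o g) j x = loc g j x"
  using roots by (rule_tac reduce_loc[OF g(1) _ N'(1-3), of \<Phi>]) (auto simp: \<Phi>_def)
 have fK: "f : K" using f(1) N'(1) by auto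
 have fg: "f o g : K" by (rule K_comp[OF fK g(1)])
 have fgU: "f o g : U"
 proof (rule reduced_U[OF g(1) fg _ f(3)])
  show "loc (f o g) i z = id" if "(i, z) : bad g" for i z
   using f(2)[of i z] f(3)[of i z] g(2)[of i z] that by (cases "i : I") (auto simp: \<Phi>_def)
 qed
 have fix_y: "f (g y) = y" if "y : F" for y
 proof (rule seq_eqI)
  fix i
  have e: "(f o g) y \<cdot> i = loc (f o g) i y (y \<cdot> i)" by (rule loc_entry[OF K_aut[OF fg] agree_refl])
  show "f (g y) \<cdot> i = y \<cdot> i"
  proof (cases "y \<cdot> i = 0")
   case True
   then show ?thesis using U_entry_iff[OF fgU, of y i] by simp
  next
   case False
   have "loc (f o g) i y = id"
   proof (cases "i : I")
    case True
    then have "(i, y) : \<Phi>" using False that by (auto simp: \<Phi>_def)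
    then show ?thesis by (rule f(2))
   next
    case False
    then show ?thesis using f(3)[of i y] g(2)[of i y] by auto
   qed
   then show ?thesis using e by simp
  qed
 qed
 have "invp f : N" by (rule N'(4)[OF f(1)])
 moreover have "invp g o invp f = invp (f o g)" using bij[OF fK] bij[OF g(1)] by (simp add: o_inv_distrib)
 then have "invp g o invp f : U" using U_inv[OF fgU] by simp
 moreover have "\<forall>y\<in>F. invp f y = g y" using fix_y invp_apply(1)[OF fK] by metis
 ultimately show "\<exists>f\<in>N. invp g o f : U \<and> (\<forall>y\<in>F. f y = g y)" by blast
qed

text \<open>Vertices of level k are given by the entries above k, so this is the fixator of the
  levels from k on; the local actions on level k itself are still free.\<close>

definition M :: "int => (seq => seq) set" where
 "M k = {g : K. \<forall>x. agree (k + 1) (g x) x}"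

lemma M_K: "g : M k ==> g : K" by (simp add: M_def)
lemma M_agree: "g : M k ==> agree (k + 1) (g x) x" by (simp add: M_def)

lemma M_loc_above:
 assumes "g : M k" "k < i" shows "loc g i x = id"
proof
 fix a
 have "agree i (g (upd x i a)) (upd x i a)" using agree_mono[OF M_agree[OF assms(1)]] assms(2) by simp
 then show "loc g i x a = id a" by (simp add: loc_def agree_def)
qed

lemma M_loc_comp: "f : K ==> g : M k ==> loc (f o g) k x = loc f k x o loc g k x"
 using loc_comp[OF K_aut K_aut[OF M_K]] loc_cong[OF K_aut agree_sym[OF M_agree]] by metis

lemma M_comp: "f : M k ==> g : M k ==> f o g : M k" unfolding M_def using K_comp by (auto intro: agree_trans)

lemma M_inv: "g : M k ==> invp g : M k"
proof -
 assume g: "g : M k"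
 have "agree (k + 1) (invp g x) x" for x using agree_sym[OF M_agree[OF g, of "invp g x"]] K_aut[OF M_K[OF g]] by simp
 then show ?thesis using K_inv[OF M_K[OF g]] by (simp add: M_def)
qed

lemma M_loc_inv: "g : M k ==> loc (invp g) k x = invp (loc g k x)"
proof -
 assume g: "g : M k"
 have "loc (invp g) k x = loc (invp g) k (g x)"
  by (rule loc_cong[OF tree_aut_inv[OF K_aut[OF M_K[OF g]]] agree_sym[OF M_agree[OF g]]])
 then show ?thesis using loc_inv(1)[OF K_aut[OF M_K[OF g]]] by simp
qed

lemma M_prev:
 assumes "g : M k" "!!x. loc g k x = id" shows "g : M (k - 1)"
proof -
 have "agree k (g x) x" for x
  using M_agree[OF assms(1)] loc_entry[OF K_aut[OF M_K[OF assms(1)]] agree_refl, of x k] assms(2)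
  by (subst agree_step) simp
 then show ?thesis using assms(1) by (simp add: M_def)
qed

lemma root_M: "h : H ==> i \<le> k ==> rooted i v h : M k"
 using agree_mono[OF agree_root_above] K_root by (auto simp: M_def)

lemma M_conj:
 assumes "g : M k" "c : K" shows "c o g o invp c : M k"
proof -
 have "agree (k + 1) (c (g (invp c x))) (c (invp c x))" for x
  unfolding tree_aut_agree[OF K_aut[OF assms(2)]] by (rule M_agree[OF assms(1)])
 then have "agree (k + 1) (c (g (invp c x))) x" for x using tree_aut_invp(2)[OF K_aut[OF assms(2)]] by metis
 moreover have "c o g o invp c : K" by (intro K_comp K_inv M_K[OF assms(1)] assms(2))
 ultimately show ?thesis by (simp add: M_def)
qed

lemma closed_normal_M: "closed_normal (M k) PG"
proof (rule closed_normal_PGI)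
 show "subgroup (M k) PG" by (rule subgroup_PGI) (auto simp: M_comp M_inv M_K, simp add: M_def K_id)
 show "c o g o invp c : M k" if "c : K" "g : M k" for c g using M_conj that by blast
 show "closedin (perm_topology K U) (M k)"
 proof (rule closedin_PG)
  fix g assume g: "g : K" "!!F. finite F ==> \<exists>f\<in>M k. invp g o f : U \<and> (\<forall>y\<in>F. f y = g y)"
  have "agree (k + 1) (g x) x" for x
  proof -
   obtain f where "f : M k" "f x = g x" using g(2)[of "{x}"] by auto
   then show ?thesis using M_agree[of f k x] by simp
  qed
  then show "g : M k" using g(1) by (simp add: M_def)
 qed (auto simp: M_def)
qed

end

text \<open>\<open>H1_max\<close> makes \<open>H1\<close> the largest proper closed normal subgroup,
  and \<open>H1_comm\<close> says that the quotient by it has trivial centre, so that any given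
  element outside \<open>H1\<close> has a commutator outside \<open>H1\<close>.
  \<open>V_not_H1\<close> provides such elements inside the stabiliser, whose rooted copies lie in
  \<open>U\<close>.\<close>

locale stacked_tree = tree +
 fixes H1
 assumes closed_normal_H1: "closed_normal H1 H.PG" and V_not_H1: "\<not> V \<subseteq> H1"
  and H1_comm: "h : H ==> h \<notin> H1 ==> \<exists>a\<in>H. h o a o invp h o invp a \<notin> H1"
  and H1_max: "closed_normal N H.PG ==> \<not> N \<subseteq> H1 ==> N = H"
begin

lemma H1_conj: "h : H ==> n : H1 ==> h o n o invp h : H1"
 using closed_normal_H1 by (auto simp: closed_normal_iff[OF H.group_PG])

lemma H1_subgroup: "subgroup H1 H.PG" "H1 \<subseteq> H" "id : H1"
proof -
 show "subgroup H1 H.PG" "H1 \<subseteq> H" "id : H1" using H.closed_normalD[OF closed_normal_H1] by simp_all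
qed

lemma H1_conj_iff:
 assumes "h : H" "n : H" shows "h o n o invp h : H1 \<longleftrightarrow> n : H1"
proof
 assume "h o n o invp h : H1"
 then have "invp h o (h o n o invp h) o invp (invp h) : H1" by (rule H1_conj[OF H.invp[OF assms(1)]])
 also have "invp h o (h o n o invp h) o invp (invp h) = n"
  using assms H.bij[OF assms(1)] by (simp add: fun_eq_iff inv_inv_eq)
 finally show "n : H1" .
qed (use assms H1_conj in blast)

text \<open>The elements of \<open>H\<close> whose rooted copy lies in \<open>N\<close> form a
  closed normal subgroup of \<open>H\<close>, which is all of \<open>H\<close> by the maximality of
  \<open>H1\<close>. With \<open>N\<close> normalised just by the rooted elements at v, the lemma
  also serves normal subgroups of groups smaller than \<open>K\<close>.\<close>

lemma root_absorb:
 assumes N: "subgroup N PG" "closedin (perm_topology K U) N"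
  and normalized: "!!h n. h : H ==> n : N ==> rooted i v h o n o rooted i v (invp h) : N"
  and h: "h : H" "h \<notin> H1" "rooted i v h : N" and h': "h' : H" shows "rooted i v h' : N"
proof -
 let ?P = "{h : H. rooted i v h : N}"
 interpret r: group_hom H.PG PG "rooted i v" by (rule cont_hom_group_hom[OF H.group_PG group_PG root_cont_hom])
 have "closed_normal ?P H.PG" unfolding closed_normal_iff[OF H.group_PG]
 proof (intro conjI ballI)
  show "subgroup ?P H.PG" using PG_subgroupD[OF N(1)] H.id_mem by (intro group.subgroupI[OF H.group_PG])
    (auto simp: root_comp[symmetric] H.comp H.invp tree_aut_root_inv[OF H.bij, symmetric])
  show "x \<otimes>\<^bsub>H.PG\<^esub> n \<otimes>\<^bsub>H.PG\<^esub> inv\<^bsub>H.PG\<^esub> x : ?P" if "x : carrier H.PG" "n : ?P" for x n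
   using that normalized[of x "rooted i v n"] by (auto simp: H.comp H.invp root_comp)
  show "closedin (gtop H.PG) ?P" using closed_preimage[of "gtop H.PG" "gtop PG" "rooted i v" N] root_cont_hom[of i v] N(2)
   by (simp add: cont_hom_def)
 qed
 then have "?P = H" using H1_max h by blast
 then show ?thesis using h' by blast
qed

lemma root_absorb_normal:
 assumes "closed_normal N PG" "h : H" "h \<notin> H1" "rooted i v h : N" "h' : H" shows "rooted i v h' : N"
proof (rule root_absorb[OF _ _ _ assms(2-5)])
 show "rooted i v h o n o rooted i v (invp h) : N" if "h : H" "n : N" for h n
  using closed_normal_conj[OF assms(1) K_root[OF that(1)] that(2), of i v]
   tree_aut_root_inv[OF H.bij[OF that(1)]] by simp
qed (use assms(1) in \<open>auto simp: closed_normal_iff[OF group_PG]\<close>)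

text \<open>
 If \<open>g\<close> moves a cone off itself, the double commutators of \<open>g\<close> with elements
 supported in that cone are commutators of these elements.
\<close>

lemma roots_of_moving:
 assumes N: "closed_normal N PG" and g: "g : N" "\<not> agree (k + 1) (g x) x" and "i \<le> k" "h' : H"
 shows "rooted i v h' : N"
proof -
 note sN = closed_normalD(1)[OF N]
 note Ns = PG_subgroupD[OF sN]
 have gK: "g : K" using g Ns(1) by auto
 \<comment> \<open>g moves the cone of x, and cones of one level are permuted transitively, so a
   conjugate of g moves the cone at v.\<close>
 obtain c where c: "c : K" "agree (k + 1) (c x) v" using cone_transitive by blast
 define f where "f = c o g o invp c"
 have fN: "f : N" unfolding f_def by (rule closed_normal_conj[OF N c(1) g(1)])
 have fK: "f : K" using fN Ns(1) by auto
 note af = K_aut[OF fK]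
 have fv: "\<not> agree (k + 1) (f v) v"
 proof
  assume a: "agree (k + 1) (f v) v"
  have "agree (k + 1) (f (c x)) (f v)" using af c(2) by (simp add: tree_aut_agree)
  then have "agree (k + 1) (f (c x)) (c x)" using a c(2) by (meson agree_sym agree_trans)
  moreover have "f (c x) = c (g x)" using K_aut[OF c(1)] by (simp add: f_def)
  ultimately show False using g(2) K_aut[OF c(1)] by (simp add: tree_aut_agree)
 qed
 have disj: "\<not> agree (i + 1) (invp f z) v" if "agree (i + 1) z v" for z
 proof
  assume "agree (i + 1) (invp f z) v"
  then have "agree (k + 1) (invp f z) v" using assms(4) by (auto intro: agree_mono)
  then have "agree (k + 1) z (f v)" using tree_aut_agree[OF af, of "k + 1" "invp f z" v] af by simp
  moreover have "agree (k + 1) z v" using that assms(4) by (auto intro: agree_mono)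
  ultimately show False using fv by (meson agree_sym agree_trans)
 qed
 have comm: "rooted i v (a o b o invp a o invp b) : N" if ab: "a : H" "b : H" for a b
 proof -
  let ?r = "rooted i v"
  \<comment> \<open>\<open>X\<close> is supported in the image under f of the cone at v, which is
    disjoint from that cone; hence it commutes with all rooted elements at v and cancels from the
    second commutator.\<close>
  define X where "X = f o ?r (invp a) o invp f"
  have rK: "?r a : K" "?r (invp a) : K" "?r b : K" using ab K_root H.invp by auto
  have XK: "X : K" unfolding X_def using fK rK K_comp K_inv by simp
  have Xz: "X z = z" if "agree (i + 1) z v" for z using disj[OF that] af by (simp add: X_def rooted_def)
  have Xz': "\<not> agree (i + 1) (X z) v" if "\<not> agree (i + 1) z v" for z
  proof
   assume "agree (i + 1) (X z) v"
   then have "X (X z) = X z" by (rule Xz)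
   then have "X z = z" using bij[OF XK] by (simp add: bij_def inj_eq)
   then show False using that \<open>agree (i + 1) (X z) v\<close> by simp
  qed
  have Xr: "X o ?r d = ?r d o X" for d
  proof
   fix z
   show "(X o ?r d) z = (?r d o X) z"
   proof (cases "agree (i + 1) z v")
    case True
    have "agree (i + 1) (?r d z) v" using True agree_root_above agree_trans by blast
    then show ?thesis using True Xz by simp
   next
    case False
    then show ?thesis using Xz'[OF False] by (simp add: rooted_def)
   qed
  qed
  have "invp (?r (invp a)) = ?r a"
   using tree_aut_root_inv[OF H.bij[OF H.invp[OF ab(1)]]] H.bij[OF ab(1)] by (simp add: inv_inv_eq)
  then have "?r (invp a) o invp f o invp (?r (invp a)) : N" using closed_normal_conj[OF N rK(2) Ns(4)[OF fN]] by simp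
  then have "f o (?r (invp a) o invp f o ?r a) : N" using Ns(3)[OF fN] \<open>invp (?r (invp a)) = ?r a\<close> by simp
  then have 1: "X o ?r a : N" by (simp add: X_def comp_assoc)
  have "?r b o invp (X o ?r a) o invp (?r b) : N" by (rule closed_normal_conj[OF N rK(3) Ns(4)[OF 1]])
  then have "(X o ?r a) o (?r b o invp (X o ?r a) o invp (?r b)) : N" by (rule Ns(3)[OF 1])
  also have "(X o ?r a) o (?r b o invp (X o ?r a) o invp (?r b)) = X o ?r (a o b o invp a) o invp X o ?r (invp b)"
  proof -
   have "invp (X o ?r a) = ?r (invp a) o invp X"
    using bij[OF XK] bij[OF rK(1)] tree_aut_root_inv[OF H.bij[OF ab(1)]] by (simp add: o_inv_distrib)
   moreover have "invp (?r b) = ?r (invp b)" by (rule tree_aut_root_inv[OF H.bij[OF ab(2)]])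
   ultimately show ?thesis by (simp add: comp_assoc root_comp[symmetric])
  qed
  also have "\<dots> = ?r (a o b o invp a) o (X o invp X) o ?r (invp b)" by (simp add: Xr comp_assoc)
  also have "\<dots> = ?r (a o b o invp a o invp b)" using XK by (simp add: root_comp)
  finally show ?thesis .
 qed
 \<comment> \<open>Commutators need not exhaust \<open>H\<close>; a single one outside
   \<open>H1\<close> is enough for the absorption lemma.\<close>
 obtain a where a: "a : H" "a \<notin> H1" using V_not_H1 by auto
 obtain b where b: "b : H" "a o b o invp a o invp b \<notin> H1" using H1_comm[OF a] by blast
 have "a o b o invp a o invp b : H" using a b H.comp H.invp by simp
 then show ?thesis using root_absorb_normal[OF N _ b(2) comm[OF a(1) b(1)] assms(5)] by blast
qed

lemma M_subset_of_roots:
 assumes "closed_normal N PG" "!!i v h. i \<le> k ==> h : H ==> rooted i v h : N" shows "M k \<subseteq> N"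
proof
 fix g assume g: "g : M k"
 show "g : N" by (rule roots_dense[of N "{..k}"])
   (use assms M_K[OF g] M_loc_above[OF g] in \<open>auto simp: closed_normal_iff[OF group_PG]\<close>)
qed

definition M' :: "int => (seq => seq) set" where
 "M' k = {g : M k. \<forall>x. loc g k x : H1}"

text \<open>Levels below k come from \<open>roots_of_moving\<close>, since g changes an entry in
  position k. On level k the commutator of g with a rooted element is, modulo
  \<open>M (k - 1)\<close>, a rooted element whose action is a commutator outside \<open>H1\<close>,
  and absorption does the rest.\<close>

lemma M_subset_of_loc:
 assumes N: "closed_normal N PG" and g: "g : N" "g : M k" "loc g k x \<notin> H1" shows "M k \<subseteq> N"
proof -
 note sN = closed_normalD(1)[OF N]
 note Ns = PG_subgroupD[OF sN]
 have "loc g k x \<noteq> id" using g(3) H1_subgroup(3) by metis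
 then obtain a where a: "loc g k x a \<noteq> a" by (auto simp: fun_eq_iff)
 then have "\<not> agree k (g (upd x k a)) (upd x k a)" by (auto simp: loc_def agree_def)
 then have r: "rooted i v h : N" if "i \<le> k - 1" "h : H" for i v h
  using roots_of_moving[OF N g(1), of "k - 1"] that by simp
 then have M1: "M (k - 1) \<subseteq> N" by (rule M_subset_of_roots[OF N])
 have main: "rooted k y h' : N" if f: "f : N" "f : M k" "loc f k y \<notin> H1" and h': "h' : H" for f y h'
 proof -
  have fK: "f : K" using M_K[OF f(2)] .
  let ?h = "loc f k y"
  obtain b where b: "b : H" "?h o b o invp ?h o invp b \<notin> H1" using H1_comm[OF K_loc[OF fK] f(3)] by blast
  let ?d = "?h o b o invp ?h o invp b" and ?B = "rooted k y b"
  have d: "?d : H" using K_loc[OF fK] b(1) H.comp H.invp by simp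
  have B: "?B : M k" "invp ?B : M k" "invp ?B = rooted k y (invp b)" "?B : K"
  proof -
   show 1: "?B : M k" by (rule root_M[OF b(1) order_refl])
   show "invp ?B : M k" by (rule M_inv[OF 1])
   show "?B : K" by (rule M_K[OF 1])
  qed (rule tree_aut_root_inv[OF H.bij[OF b(1)]])
  \<comment> \<open>On level k the commutator \<open>?c\<close> has a non-trivial local action at
    most at the vertex of y. \<open>?r\<close> inverts that one, so the product drops to
    \<open>M (k - 1)\<close>.\<close>
  let ?c = "f o (?B o (invp f o invp ?B))" and ?r = "rooted k y (invp ?d)"
  have "?B o invp f o invp ?B : N" by (rule closed_normal_conj[OF N B(4) Ns(4)[OF f(1)]])
  then have cN: "?c : N" using Ns(3)[OF f(1)] by (simp add: comp_assoc)
  have r: "?r : M k" "?r : K" using root_M[OF H.invp[OF d], of k k y] M_K by auto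
  have m: "invp f o invp ?B : M k" "?B o (invp f o invp ?B) : M k" "?c : M k" using f(2) B M_inv M_comp by auto
  have lc: "loc ?c k z = loc f k z o (loc ?B k z o (invp (loc f k z) o invp (loc ?B k z)))" for z
   using M_loc_comp[OF fK m(2)] M_loc_comp[OF B(4) m(1)] M_loc_comp[OF K_inv[OF fK] B(2)]
    M_loc_inv[OF f(2)] M_loc_inv[OF B(1)] by simp
  have "loc (?c o ?r) k z = id" for z
  proof (cases "agree (k + 1) z y")
   case True
   then have "loc f k z = ?h" by (rule loc_cong[OF K_aut[OF fK]])
   then have "loc ?c k z = ?d" unfolding lc using True by (simp add: loc_root comp_assoc)
   then have "loc (?c o ?r) k z = ?d o invp ?d"
    using M_loc_comp[OF M_K[OF m(3)] r(1), of z] True by (simp add: loc_root)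
   then show ?thesis using H.invp_comp(2)[OF d] by simp
  next
   case False
   have "loc ?c k z = id" unfolding lc using False H.invp_comp(2)[OF K_loc[OF fK]] by (simp add: loc_root)
   then show ?thesis using M_loc_comp[OF M_K[OF m(3)] r(1), of z] False by (simp add: loc_root)
  qed
  then have "?c o ?r : M (k - 1)" using M_comp[OF m(3) r(1)] by (intro M_prev)
  then have "invp ?c o (?c o ?r) : N" using M1 Ns(3)[OF Ns(4)[OF cN]] by blast
  then have "?r : N" by (simp only: invp_comp_cancel[OF M_K[OF m(3)]])
  then have "invp ?r : N" by (rule Ns(4))
  then have "rooted k y ?d : N"
   using tree_aut_root_inv[OF H.bij[OF H.invp[OF d]]] H.bij[OF d] by (simp add: inv_inv_eq)
  then show ?thesis using root_absorb_normal[OF N d b(2) _ h'] by blast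
 qed
 have "rooted k v h : N" if h: "h : H" for v h
 proof -
  obtain c where c: "c : K" "agree (k + 1) (c x) v" using cone_transitive by blast
  let ?f = "c o g o invp c"
  have "loc ?f k (c x) = loc c k x o loc g k x o invp (loc c k x)"
   by (rule loc_conj[OF K_aut[OF c(1)] K_aut[OF M_K[OF g(2)]] M_agree[OF g(2)]])
  then have "loc ?f k (c x) \<notin> H1" using g(3) H1_conj_iff K_loc[OF c(1)] K_loc[OF M_K[OF g(2)]] by simp
  then have "rooted k (c x) h : N" using main[OF closed_normal_conj[OF N c(1) g(1)] M_conj[OF g(2) c(1)] _ h] by blast
  then show ?thesis using root_cong[OF c(2)] by simp
 qed
 then have "rooted i v h : N" if "i \<le> k" "h : H" for i v h using r[of i h v] that by (cases "i = k") auto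
 then show ?thesis by (rule M_subset_of_roots[OF N])
qed

lemma closed_normal_M': "closed_normal (M' k) PG"
proof (rule closed_normal_PGI)
 have H1_comp: "f o g : H1" if "f : H1" "g : H1" for f g using subgroup.m_closed[OF H1_subgroup(1) that] by simp
 have H1_inv: "invp f : H1" if "f : H1" for f
  using subgroup.m_inv_closed[OF H1_subgroup(1) that] that H1_subgroup(2) by auto
 show "subgroup (M' k) PG"
 proof (rule subgroup_PGI)
  show "f o g : M' k" if "f : M' k" "g : M' k" for f g
   using that M_comp M_loc_comp[OF M_K] H1_comp by (auto simp: M'_def)
  show "invp g : M' k" if "g : M' k" for g using that M_inv M_loc_inv H1_inv by (auto simp: M'_def)
  show "id : M' k" using H1_subgroup(3) by (simp add: M'_def M_def K_id)
 qed (auto simp: M'_def M_def)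
 show "c o g o invp c : M' k" if c: "c : K" "g : M' k" for c g
 proof -
  have g: "g : M k" using c(2) by (simp add: M'_def)
  have "loc (c o g o invp c) k x : H1" for x
  proof -
   have "loc (c o g o invp c) k (c (invp c x)) = loc c k (invp c x) o loc g k (invp c x) o invp (loc c k (invp c x))"
    by (rule loc_conj[OF K_aut[OF c(1)] K_aut[OF M_K[OF g]] M_agree[OF g]])
   then show ?thesis using H1_conj[OF K_loc[OF c(1)]] c K_aut[OF c(1)] by (auto simp: M'_def)
  qed
  then show ?thesis using M_conj[OF g c(1)] by (simp add: M'_def)
 qed
 show "closedin (perm_topology K U) (M' k)"
 proof (rule closedin_PG)
  fix g assume g: "g : K" "!!F. finite F ==> \<exists>f\<in>M' k. invp g o f : U \<and> (\<forall>y\<in>F. f y = g y)"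
  have gM: "g : M k"
   using closed_normal_M[of k] g by (intro closedin_PG_D[of "M k"]) (auto simp: closed_normal_def M'_def, blast)
  have "loc g k x : H1" for x
  proof (rule H.closedin_PG_D)
   show "closedin (perm_topology H V) H1" using closed_normal_H1 by (simp add: closed_normal_def)
   show "loc g k x : H" by (rule K_loc[OF g(1)])
   fix F :: "nat set" assume "finite F"
   \<comment> \<open>f is made to agree with g on the points obtained from x by writing the elements
     of \<open>F\<close> into position k, which turns an approximation of g into one of its local
     action.\<close>
   then have "finite (insert x ((\<lambda>a. upd x k a) ` F))" by simp
   then obtain f where f: "f : M' k" "invp g o f : U" "\<forall>y\<in>insert x ((\<lambda>a. upd x k a) ` F). f y = g y"
    using g(2) by meson
   have fM: "f : M k" using f(1) by (simp add: M'_def)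
   have "loc (invp g o f) k x = invp (loc g k x) o loc f k x"
    using M_loc_comp[OF K_inv[OF g(1)] fM] M_loc_inv[OF gM] by simp
   then have "invp (loc g k x) o loc f k x : V" using U_loc[OF f(2), of k x] by simp
   then show "\<exists>f\<in>H1. invp (loc g k x) o f : V \<and> (\<forall>y\<in>F. f y = loc g k x y)"
    using f(1,3) by (intro bexI[of _ "loc f k x"]) (auto simp: M'_def loc_def)
  qed
  then show "g : M' k" using gM by (simp add: M'_def)
 qed (auto simp: M'_def M_def)
qed

theorem stack_system_K: "stack_system PG M M'" unfolding stack_system_def
proof (intro conjI allI impI)
 fix k
 show "closed_normal (M k) PG" "closed_normal (M' k) PG" by (rule closed_normal_M closed_normal_M')+
 show "M' k \<subseteq> M k" by (auto simp: M'_def)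
 show "M k \<subseteq> M' (k + 1)"
 proof
  fix g assume g: "g : M k"
  then have "g : M (k + 1)" using agree_mono[OF M_agree[OF g]] M_K[OF g] by (simp add: M_def)
  then show "g : M' (k + 1)" using M_loc_above[OF g, of "k + 1"] H1_subgroup(3) by (simp add: M'_def)
 qed
 obtain a where a: "a : H" "a \<notin> H1" using V_not_H1 by auto
 obtain b where b: "b : H" "a o b o invp a o invp b \<notin> H1" using H1_comm[OF a] by blast
 let ?a = "rooted k 0 a" and ?b = "rooted k 0 b"
 have "?a : M k" "?b : M k" using root_M a b by auto
 moreover have "?a \<otimes>\<^bsub>PG\<^esub> ?b \<otimes>\<^bsub>PG\<^esub> inv\<^bsub>PG\<^esub> ?a \<otimes>\<^bsub>PG\<^esub> inv\<^bsub>PG\<^esub> ?b = rooted k 0 (a o b o invp a o invp b)"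
  using K_root a b H.bij by (simp add: tree_aut_root_inv root_comp)
 moreover have "rooted k 0 (a o b o invp a o invp b) \<notin> M' k"
 proof
  assume "rooted k 0 (a o b o invp a o invp b) : M' k"
  then have "loc (rooted k 0 (a o b o invp a o invp b)) k 0 : H1" by (simp add: M'_def)
  then show False using b by (simp add: loc_root)
 qed
 ultimately show "\<exists>a\<in>M k. \<exists>b\<in>M k. a \<otimes>\<^bsub>PG\<^esub> b \<otimes>\<^bsub>PG\<^esub> inv\<^bsub>PG\<^esub> a \<otimes>\<^bsub>PG\<^esub> inv\<^bsub>PG\<^esub> b \<notin> M' k" by metis
next
 fix N k assume N: "closed_normal N PG"
 then have NK: "N \<subseteq> K" using closed_normalD(4) by simp
 show "N \<subseteq> M' k \<or> M k \<subseteq> N"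
 proof (cases "N \<subseteq> M k")
  case True
  then show ?thesis using M_subset_of_loc[OF N] unfolding M'_def by blast
 next
  case False
  then obtain g x where "g : N" "\<not> agree (k + 1) (g x) x" using NK by (auto simp: M_def)
  then have "rooted i v h : N" if "i \<le> k" "h : H" for i v h using roots_of_moving[OF N] that by blast
  then show ?thesis using M_subset_of_roots[OF N] by blast
 qed
next
 have "g = id" if "!!k. g : M k" for g
 proof
  fix x
  have "agree i (g x) x" for i using M_agree[OF that[of "i - 1"], of x] by simp
  then show "g x = id x" using agree_all by auto
 qed
 moreover have "id : M k" for k by (simp add: M_def K_id)
 ultimately show "(\<Inter>k. M k) = {\<one>\<^bsub>PG\<^esub>}" by auto
next
 fix N assume N: "closed_normal N PG \<and> (\<forall>k. M k \<subseteq> N)"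
 have "g : N" if "g : K" for g
 proof (rule roots_dense[of N UNIV])
  show "rooted i v h : N" if "h : H" for i v h using N root_M[OF that order_refl] by blast
 qed (use N that in \<open>auto simp: closed_normal_iff[OF group_PG]\<close>)
 moreover have "N \<subseteq> K" using N closed_normalD(4) by auto
 ultimately show "N = carrier PG" by auto
qed

end

section \<open>The rank of the iterated wreath product\<close>

context tree
begin

lemma open_subgroup_U: "open_subgroup U PG"
 using open_subgroup_PG[of U "{}"] subgroup_small[of "{}"] by (simp add: small_def)

lemma compact_coset_cover_U:
 assumes "compactin (perm_topology K U) C"
 obtains M where "finite M" "M \<subseteq> C" "!!x. x : C ==> \<exists>g\<in>M. invp g o x : U"
proof -
 have CK: "C \<subseteq> K" using compactin_subset_topspace[OF assms] by simp
 obtain M where M: "finite M" "M \<subseteq> C" "!!x. x : C ==> \<exists>g\<in>M. inv\<^bsub>PG\<^esub> g \<otimes>\<^bsub>PG\<^esub> x : U"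
  using compact_coset_cover[OF _ open_subgroup_U, of C] assms by auto
 moreover have "inv\<^bsub>PG\<^esub> g \<otimes>\<^bsub>PG\<^esub> x = invp g o x" if "g : M" for g x using that M(2) CK by auto
 ultimately show thesis using that by metis
qed

definition L :: "int set => (seq => seq) set" where
 "L I = {g : K. \<forall>i\<in>I. \<forall>x. x \<cdot> i = 0 --> g x \<cdot> i = 0}"

lemma L_iff_bad: "g : L I \<longleftrightarrow> g : K \<and> (\<forall>(i, z)\<in>bad g. i \<notin> I)"
proof
 assume "g : L I"
 then show "g : K \<and> (\<forall>(i, z)\<in>bad g. i \<notin> I)" by (auto simp: L_def bad_def truncated_def)
next
 assume g: "g : K \<and> (\<forall>(i, z)\<in>bad g. i \<notin> I)"
 have "g x \<cdot> i = 0" if "i : I" "x \<cdot> i = 0" for i x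
 proof -
  have "loc g i x 0 = 0" using loc_0_iff_bad[OF K_aut, of g i x] g that(1) by auto
  then show ?thesis using loc_entry[OF K_aut agree_refl, of g x i] g that(2) by simp
 qed
 then show "g : L I" using g by (simp add: L_def)
qed

lemma U_sub_L: "U \<subseteq> L I" by (auto simp: U_def L_def)

lemma L_loc: "g : L I ==> i : I ==> loc g i x 0 = 0" by (auto simp: L_def loc_def)

lemma L_inv:
 assumes "g : L I" shows "invp g : L I"
proof -
 have g: "g : K" using assms by (simp add: L_def)
 have "invp g x \<cdot> i = 0" if "i : I" "x \<cdot> i = 0" for i x
 proof -
  let ?w = "invp g x"
  have "loc g i ?w (?w \<cdot> i) = loc g i ?w 0"
   using loc_entry[OF K_aut[OF g] agree_refl, of ?w i] L_loc[OF assms that(1), of ?w] that K_aut[OF g] by simp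
  moreover have "inj (loc g i ?w)" using loc_inv(4)[OF K_aut[OF g]] by (simp add: bij_is_inj)
  ultimately show ?thesis by (metis injD)
 qed
 then show ?thesis using K_inv[OF g] by (simp add: L_def)
qed

lemma subgroup_L: "subgroup (L I) PG" by (rule subgroup_PGI) (use L_inv K_comp in \<open>auto simp: L_def K_id\<close>)

lemma open_subgroup_L: "open_subgroup (L I) PG"
 by (rule open_subgroup_PG[of _ "{}"]) (use U_sub_L subgroup_L in \<open>auto simp: small_def\<close>)

lemma closed_subgroup_L: "closed_subgroup (L I) PG" by (rule closed_open_subgroup[OF open_subgroup_L])

lemma closed_subgroup_Int: "closed_subgroup A PG ==> closed_subgroup B PG ==> closed_subgroup (A \<inter> B) PG"
 by (auto simp: closed_subgroup_def intro: subgroups_Inter_pair)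

lemma closed_subgroup_M: "closed_subgroup (M k) PG"
 using closed_normal_M by (simp add: closed_subgroup_def closed_normal_iff[OF group_PG])

text \<open>
 \<open>Q a j\<close> acts trivially on the levels \<open>\<ge> a + j\<close>, arbitrarily on the
 \<open>j\<close> levels from \<open>a\<close> on, and by \<open>V\<close> below.
\<close>

definition Q :: "int => nat => (seq => seq) set" where
 "Q a j = M (a - 1 + int j) \<inter> L {..<a}"

lemma closed_subgroup_Q: "closed_subgroup (Q a j) PG"
 unfolding Q_def by (intro closed_subgroup_Int closed_subgroup_M closed_subgroup_L)

lemma Q_0_sub_U: "Q a 0 \<subseteq> U"
proof
 fix g assume g: "g : Q a 0"
 have "g x \<cdot> i = 0" if "x \<cdot> i = 0" for x i
 proof (cases "i < a")
  case False
  then show ?thesis using agree_entry[OF M_agree, of g "a - 1" i x] g that by (auto simp: Q_def)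
 qed (use g that in \<open>auto simp: Q_def L_def\<close>)
 then show "g : U" using g by (simp add: U_def Q_def L_def)
qed

lemma tdlc_PG_closed: "closed_subgroup A PG ==> tdlc (subgrp PG A)" by (rule tdlc_subgrp)

lemma rank_compact:
 assumes "closed_subgroup A PG" "A \<subseteq> U" shows "\<exists>\<gamma>\<le>1 + 1. has_rank (subgrp PG A) \<gamma>"
proof -
 have "compactin (gtop PG) A" using assms closed_compactin[OF compactin_U] by (simp add: closed_subgroup_def)
 then have "discrete_residual (subgrp PG A) = {\<one>\<^bsub>subgrp PG A\<^esub>}"
  using residual_trivial_compact_subgroup[of A] assms(1) by (simp add: closed_subgroup_def)
 then show ?thesis by (rule rank_residually_discrete[OF tdlc_PG_closed[OF assms(1)]])
qed

lemma residual_V: "discrete_residual (subgrp H.PG V) = {\<one>\<^bsub>H.PG\<^esub>}"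
 using H.residual_trivial_compact_subgroup[of V] H.compactin_U H.subgroup_small[of "{}"] by (simp add: H.small_def)

text \<open>Elements of \<open>M k\<close> fix the vertices of level k, so taking the local action
  there is multiplicative.\<close>

lemma loc_cont_hom:
 assumes "subgroup A PG" "A \<subseteq> M k" shows "(\<lambda>g. loc g k v) : cont_hom (subgrp PG A) H.PG"
proof (rule perm_cont_hom[OF perm_pair_axioms H.perm_pair_axioms assms(1)])
 show "loc g k v : H" if "g : A" for g using that assms(2) K_loc M_K by blast
 show "loc (g o h) k v = loc g k v o loc h k v" if "g : A" "h : A" for g h
  using that assms(2) by (intro M_loc_comp) (auto simp: M_K)
 fix F' :: "nat set" assume "finite F'"
 moreover have "loc u k v : V \<and> (\<forall>y\<in>F'. loc u k v y = y)"
  if "u : U \<inter> A" "\<forall>y\<in>(\<lambda>a. upd v k a) ` F'. u y = y" for u using that U_loc[of u k v] by (auto simp: loc_def)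
 ultimately show "\<exists>F. finite F \<and> (\<forall>u\<in>U \<inter> A. (\<forall>y\<in>F. u y = y) --> loc u k v : V \<and> (\<forall>y\<in>F'. loc u k v y = y))"
  by (intro exI[of _ "(\<lambda>a. upd v k a) ` F'"]) blast
qed

text \<open>Induction on the number of free levels, by projecting to the local actions at all
  vertices of the top one. A compact set lies in finitely many cosets of \<open>U\<close>, each
  given by an element with finitely many bad vertices, so almost all coordinates fall into the
  residually discrete group \<open>V\<close>. The kernel has one free level less, and the sum of the
  ranks stays below \<open>omega ^ Suc n\<close>.\<close>

lemma rank_Q:
 assumes "has_rank H.PG \<xi>" "\<xi> < omega ^ Suc n" shows "\<exists>\<gamma><omega ^ Suc n. has_rank (subgrp PG (Q a j)) \<gamma>"
proof (induction j)
 case 0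
 obtain \<gamma> where "\<gamma> \<le> 1 + 1" "has_rank (subgrp PG (Q a 0)) \<gamma>"
  using rank_compact[OF closed_subgroup_Q Q_0_sub_U] by blast
 moreover have "1 + 1 < omega ^ Suc n" by (intro omega_power_add_closed one_less_omega_power_Suc)
 ultimately show ?case by (meson le_less_trans)
next
 case (Suc j)
 then obtain \<alpha> where \<alpha>: "\<alpha> < omega ^ Suc n" "has_rank (subgrp PG (Q a j)) \<alpha>" by blast
 obtain \<beta> where \<beta>: "\<xi> = \<beta> + 1" using assms(1) by (rule rank_successor)
 have "\<beta> < \<beta> + 1" by (simp add: less_add_one_iff_omega1)
 then have "\<beta> < omega ^ Suc n" using assms(2) unfolding \<beta> by order
 define k where "k = a + int j"
 let ?A = "Q a (Suc j)"
 have AM: "?A \<subseteq> M k" by (auto simp: Q_def k_def algebra_simps)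
 have As: "subgroup ?A PG" using closed_subgroup_Q by (simp add: closed_subgroup_def)
 note Asub = PG_subgroupD[OF As]
 let ?I = "{v. truncated k v}"
 have kernel: "{g : carrier (subgrp PG ?A). \<forall>v\<in>?I. loc g k v = \<one>\<^bsub>H.PG\<^esub>} = Q a j"
 proof (intro equalityI subsetI)
  fix g assume g: "g : {g : carrier (subgrp PG ?A). \<forall>v\<in>?I. loc g k v = \<one>\<^bsub>H.PG\<^esub>}"
  then have gM: "g : M k" using AM by auto
  have "loc g k x = id" for x using loc_cong[OF K_aut[OF M_K[OF gM]] agree_trunc(2), of k x] g by simp
  then have "g : M (k - 1)" using M_prev[OF gM] by blast
  then show "g : Q a j" using g by (simp add: Q_def k_def algebra_simps)
 next
  fix g assume g: "g : Q a j"
  then have gM: "g : M (k - 1)" by (simp add: Q_def k_def algebra_simps)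
  then have "g : M k" using agree_mono[OF M_agree[OF gM]] M_K[OF gM] by (simp add: M_def)
  then show "g : {g : carrier (subgrp PG ?A). \<forall>v\<in>?I. loc g k v = \<one>\<^bsub>H.PG\<^esub>}"
   using g M_loc_above[OF gM, of k] by (simp add: Q_def k_def algebra_simps)
 qed
 obtain \<gamma> where "\<gamma> \<le> \<alpha> + \<beta> + 1" "has_rank (subgrp PG ?A) \<gamma>"
 proof (rule rank_restricted_family[of "subgrp PG ?A" ?I "\<lambda>v g. loc g k v" "\<lambda>v. H.PG" \<beta> \<alpha> \<alpha>])
  show "tdlc (subgrp PG ?A)" by (rule tdlc_PG_closed[OF closed_subgroup_Q])
  show "(\<lambda>g. loc g k v) : cont_hom (subgrp PG ?A) H.PG" for v by (rule loc_cont_hom[OF As AM])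
  show "\<exists>\<rho>\<le>\<beta> + 1. has_rank H.PG \<rho>" using assms(1) unfolding \<beta> by blast
  show "has_rank (subgrp (subgrp PG ?A)
    {g : carrier (subgrp PG ?A). \<forall>v\<in>?I. loc g k v = \<one>\<^bsub>H.PG\<^esub>}) \<alpha>"
  proof -
   have "Q a j \<subseteq> ?A" unfolding kernel[symmetric] by auto
   then show ?thesis unfolding kernel using \<alpha>(2) by (simp add: subgrp_subgrp)
  qed
  fix C assume "compactin (gtop (subgrp PG ?A)) C"
  then have C: "compactin (perm_topology K U) C" "C \<subseteq> ?A" by (auto simp: compactin_subtopology)
  obtain D where D: "finite D" "D \<subseteq> C" "!!x. x : C ==> \<exists>g\<in>D. invp g o x : U"
   by (rule compact_coset_cover_U[OF C(1)], rule that)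
  have "v : snd ` (\<Union>g\<in>D. bad g)" if v: "truncated k v" and e: "\<not> (\<lambda>g. loc g k v) ` C \<subseteq> V" for v
  proof -
   obtain f where f: "f : C" "loc f k v \<notin> V" using e unfolding image_subset_iff by meson
   obtain g where g: "g : D" "invp g o f : U" using D(3)[OF f(1)] by blast
   have gf: "f : M k" "g : M k" using f(1) g(1) D(2) C(2) AM by auto
   have "loc (invp g o f) k v = invp (loc g k v) o loc f k v"
    using M_loc_comp[OF K_inv[OF M_K[OF gf(2)]] gf(1)] M_loc_inv[OF gf(2)] by simp
   then have "invp (loc g k v) (loc f k v 0) = 0" using U_loc[OF g(2), of k v] by simp
   then have "loc f k v 0 = loc g k v 0" using H.invp_apply(2)[OF K_loc[OF M_K[OF gf(2)]]] by metis
   then have "loc g k v 0 \<noteq> 0" using f(2) K_loc[OF M_K[OF gf(1)]] by auto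
   then have "(k, v) : bad g" using v bad_iff_loc[OF K_aut[OF M_K[OF gf(2)]]] by auto
   then show ?thesis using g(1) by force
  qed
  then have "{v : ?I. \<not> (\<exists>R. subgroup R H.PG \<and> discrete_residual (subgrp H.PG R) = {\<one>\<^bsub>H.PG\<^esub>} \<and> (\<lambda>g. loc g k v) ` C \<subseteq> R)}
    \<subseteq> snd ` (\<Union>g\<in>D. bad g)" using residual_V H.subgroup_small[of "{}"] by (auto simp: H.small_def)
  moreover have "D \<subseteq> K" using D(2) C(2) Asub(1) by blast
  then have "finite (snd ` (\<Union>g\<in>D. bad g))" using D(1) K_bad by (intro finite_imageI finite_UN_I) auto
  ultimately show "finite {v : ?I. \<not> (\<exists>R. subgroup R H.PG \<and>
    discrete_residual (subgrp H.PG R) = {\<one>\<^bsub>H.PG\<^esub>} \<and> (\<lambda>g. loc g k v) ` C \<subseteq> R)}" by (rule finite_subset)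
 qed auto
 moreover have "\<alpha> + \<beta> + 1 < omega ^ Suc n"
  by (intro omega_power_add_closed one_less_omega_power_Suc \<alpha> \<open>\<beta> < omega ^ Suc n\<close>)
 ultimately show ?case by (meson le_less_trans)
qed

lemma residual_sub_Q:
 assumes T: "open_subgroup T PG" "compactly_generated (subgrp PG T)"
 obtains a j where "discrete_residual (subgrp PG T) \<subseteq> Q a j"
proof -
 have Ts: "subgroup T PG" using T by (simp add: open_subgroup_def)
 note T' = PG_subgroupD[OF Ts]
 obtain C where C: "compactin (gtop (subgrp PG T)) C" "generate (subgrp PG T) C = T"
  using T(2) by (auto simp: compactly_generated_def)
 then have CT: "compactin (perm_topology K U) C" "C \<subseteq> T" by (auto simp: compactin_subtopology)
 obtain D where D: "finite D" "D \<subseteq> C" "!!x. x : C ==> \<exists>g\<in>D. invp g o x : U"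
  by (rule compact_coset_cover_U[OF CT(1)], rule that)
 have "D \<subseteq> K" using D(2) CT(2) T'(1) by blast
 then have "finite (fst ` (\<Union>g\<in>D. bad g))" using D(1) K_bad by (intro finite_imageI finite_UN_I) auto
 then have "finite ((\<lambda>i. \<bar>i\<bar>) ` fst ` (\<Union>g\<in>D. bad g))" by simp
 then obtain m where m: "!!i. i : (\<lambda>i. \<bar>i\<bar>) ` fst ` (\<Union>g\<in>D. bad g) ==> i \<le> m" by (meson bdd_above_def bdd_above_finite)
 \<comment> \<open>The bad vertices of the representatives in \<open>D\<close> sit on levels of
   absolute value less than l, so outside this range \<open>T\<close> acts by
   \<open>V\<close>.\<close>
 define l where "l = nat m + 1"
 let ?I = "{i. i < - int l \<or> i \<ge> int l}"
 have DL: "g : L ?I" if "g : D" for g unfolding L_iff_bad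
 proof (intro conjI ballI)
  show "g : K" using that D CT T' by auto
  fix p assume p: "p : bad g"
  then have "\<bar>fst p\<bar> \<le> m" using m that by auto
  then show "case p of (i, z) => i \<notin> ?I" by (auto simp: l_def split: prod.split)
 qed
 note L' = PG_subgroupD[OF subgroup_L]
 have "C \<subseteq> L ?I"
 proof
  fix f assume f: "f : C"
  obtain g where g: "g : D" "invp g o f : U" using D(3)[OF f] by blast
  have "g o (invp g o f) : L ?I" using L'(3)[OF DL[OF g(1)]] g(2) U_sub_L by blast
  moreover have "g : K" using DL[OF g(1)] L'(1) by auto
  ultimately show "f : L ?I" by (simp add: comp_assoc[symmetric])
 qed
 then have "generate PG C \<subseteq> L ?I" by (rule generate_subgroup_incl[OF _ subgroup_L])
 then have TL: "T \<subseteq> L ?I" using C(2) generate_subgrp[OF Ts CT(2)] by simp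
 \<comment> \<open>From level l on the labels of x move in finite orbits of \<open>V\<close>, and
   zero labels not at all, so the upper part of x has a finite orbit under \<open>T\<close>. Its
   stabiliser \<open>N\<close> is open of finite index and therefore contains the residual.\<close>
 have "agree (int l) (r x) x" if r: "r : discrete_residual (subgrp PG T)" for r x
 proof -
  let ?S = "{i. x \<cdot> i \<noteq> 0}" and ?A = "\<lambda>i. (\<lambda>v. v (x \<cdot> i)) ` V"
  let ?tr = "\<lambda>g. trunc (int l - 1) (g x)"
  have "?tr ` T \<subseteq> {y. (\<forall>i\<in>?S. y \<cdot> i : insert 0 (?A i)) \<and> (\<forall>i. i \<notin> ?S --> y \<cdot> i = 0)}"
  proof clarify
   fix g assume g: "g : T"
   then have gL: "g : L ?I" and gK: "g : K" using TL T'(1) by auto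
   have e: "g x \<cdot> i = loc g i x (x \<cdot> i)" for i by (rule loc_entry[OF K_aut[OF gK] agree_refl])
   have v: "loc g i x : V" if "i \<ge> int l" for i using L_loc[OF gL, of i x] that K_loc[OF gK] by simp
   have "?tr g \<cdot> i : insert 0 (?A i)" for i using e[of i] v[of i] by auto
   moreover have "?tr g \<cdot> i = 0" if "i \<notin> ?S" for i using e[of i] v[of i] that by auto
   ultimately show "(\<forall>i\<in>?S. ?tr g \<cdot> i : insert 0 (?A i)) \<and> (\<forall>i. i \<notin> ?S --> ?tr g \<cdot> i = 0)" by blast
  qed
  moreover have "finite {y. (\<forall>i\<in>?S. y \<cdot> i : insert 0 (?A i)) \<and> (\<forall>i. i \<notin> ?S --> y \<cdot> i = 0)}"
   by (rule finite_seq_box) (use H.U_orbits in auto)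
  ultimately have fin: "finite (?tr ` T)" by (rule finite_subset)
  obtain R where R: "finite R" "R \<subseteq> T" "?tr ` T = ?tr ` R" by (metis finite_subset_image[OF fin] subset_refl)
  define N where "N = {g : T. agree (int l) (g x) x}"
  interpret T: top_group "subgrp PG T" by unfold_locales (rule top_group_subgrp[OF Ts])
  have N: "g : N \<longleftrightarrow> g : T \<and> agree (int l) (g x) x" for g by (simp add: N_def)
  have "subgroup N PG"
  proof (rule subgroup_PGI)
   have tN: "agree (int l) (h y) (h z) \<longleftrightarrow> agree (int l) y z" if "h : N" for h y z
    using that T'(1) by (auto simp: N intro!: tree_aut_agree K_aut)
   show "f o g : N" if "f : N" "g : N" for f g
    using that T'(3)[of f g] tN[OF that(1), of "g x" x] agree_trans[of "int l" "f (g x)" "f x" x] by (simp add: N)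
   show "invp g : N" if "g : N" for g
    using that T'(4)[of g] tN[OF that, of "invp g x" x] T'(1) invp_apply(2)[of g x] agree_sym[of "int l" "g x" x] by (auto simp: N)
  qed (use T' in \<open>auto simp: N_def\<close>)
  moreover obtain F where F: "finite F" "small F \<subseteq> T"
   using openin_contains_small[of T] T T'(2) by (auto simp: open_subgroup_def)
  have "small (insert x F) \<subseteq> N" using F(2) by (auto simp: small_def N)
  ultimately have "open_subgroup N PG" using F(1) by (intro open_subgroup_PG) auto
  then have "open_subgroup N (subgrp PG T)"
   by (auto simp: open_subgroup_def openin_subtopology subgroup_subgrp_iff[OF group_PG Ts] N intro!: exI[of _ N])
  moreover have "\<exists>g\<in>R. inv\<^bsub>subgrp PG T\<^esub> g \<otimes>\<^bsub>subgrp PG T\<^esub> h : N" if h: "h : T" for h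
  proof -
   have "?tr h : ?tr ` R" using h R(3) by blast
   then obtain g where g: "g : R" "?tr h = ?tr g" by blast
   then have gT: "g : T" "g : K" using R(2) T'(1) by auto
   have "agree (int l) (h x) (g x)" using g(2) trunc_eq_iff[of "int l - 1"] by simp
   then have "agree (int l) (invp g (h x)) x"
    using tree_aut_agree[OF K_aut[OF gT(2)], of "int l" "invp g (h x)" x] K_aut[OF gT(2)] by simp
   then show ?thesis using g(1) gT h T' inv_subgrp[OF group_PG Ts, of g] by (intro bexI[OF _ g(1)]) (simp add: N)
  qed
  ultimately have "r : N" using T.residual_subset_finite_index[of N R] R(1,2) r by auto
  then show ?thesis by (simp add: N)
 qed
 moreover have "discrete_residual (subgrp PG T) \<subseteq> T" by (rule residual_subgrp_subset[OF topological_group_PG Ts])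
 \<comment> \<open>The 2 l free levels are those from - l to l - 1.\<close>
 ultimately have "discrete_residual (subgrp PG T) \<subseteq> Q (- int l) (2 * l)"
  using TL T'(1) by (auto simp: Q_def M_def L_def)
 then show thesis by (rule that)
qed

lemma rank_K_exists:
 assumes "has_rank H.PG \<xi>" "\<xi> < omega ^ Suc n"
 obtains \<sigma> where "\<sigma> \<le> omega ^ Suc n" "has_rank PG (\<sigma> + 1)"
proof -
 have "\<exists>\<gamma>\<le>omega ^ Suc n + 1. has_rank PG \<gamma>"
 proof (rule rank_exists_le)
  fix T assume T: "open_subgroup T PG" "compactly_generated (subgrp PG T)"
  obtain a l where al: "discrete_residual (subgrp PG T) \<subseteq> Q a l" by (rule residual_sub_Q[OF T])
  obtain \<gamma> where \<gamma>: "\<gamma> < omega ^ Suc n" "has_rank (subgrp PG (Q a l)) \<gamma>" using rank_Q[OF assms(1,2)] by blast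
  show "\<exists>\<rho>\<le>omega ^ Suc n. has_rank (Res (subgrp PG T)) \<rho>"
   using rank_residual_subset[OF T(1) al \<gamma>(2)] \<gamma>(1) by (meson le_less_trans less_imp_le)
 qed
 then show thesis using that rank_successor by (metis add_one_le_iff_omega1)
qed

end

section \<open>Lower bound for the rank: groups supported in one cone\<close>

context tree
begin

text \<open>
 \<open>B j i v\<close> is supported in the cone below the vertex \<open>v\<close> of level \<open>i\<close>, arbitrary on
 the top \<open>j\<close> levels of that cone and by \<open>V\<close> below.
\<close>

definition B :: "nat => int => seq => (seq => seq) set" where
 "B j i v = {g : K. \<forall>z. \<not> agree (i + 1) z v --> g z = z} \<inter> L {..i - int j}"

lemma B_K: "g : B j i v ==> g : K" by (simp add: B_def)

lemma B_outside: "g : B j i v ==> \<not> agree (i + 1) z v ==> g z = z" by (simp add: B_def)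

lemma B_cone:
 assumes "g : B j i v" shows "agree (i + 1) (g z) v \<longleftrightarrow> agree (i + 1) z v"
proof -
 have "g (g z) = g z \<longleftrightarrow> g z = z" using bij[OF B_K[OF assms]] by (simp add: bij_def inj_eq)
 then show ?thesis using B_outside[OF assms] by metis
qed

lemma B_M:
 assumes "g : B j i v" shows "g : M i"
proof -
 have "agree (i + 1) (g z) z" for z
  by (cases "agree (i + 1) z v") (use B_cone[OF assms, of z] B_outside[OF assms, of z] agree_sym agree_trans in \<open>metis agree_refl\<close>)+
 then show ?thesis using B_K[OF assms] by (simp add: M_def)
qed

lemma subgroup_support: "subgroup {g : K. \<forall>z\<in>Z. g z = z} PG"
proof (rule subgroup_PGI)
 show "invp g : {g : K. \<forall>z\<in>Z. g z = z}" if g: "g : {g : K. \<forall>z\<in>Z. g z = z}" for g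
 proof -
  have "invp g z = z" if "z : Z" for z
  proof -
   have "g z = z" "g : K" using g that by auto
   then show ?thesis using invp_apply(1)[of g z] by simp
  qed
  then show ?thesis using g K_inv by auto
 qed
qed (auto simp: K_comp K_id)

lemma closed_subgroup_support: "closed_subgroup {g : K. \<forall>z\<in>Z. g z = z} PG"
proof -
 have "closedin (perm_topology K U) {g : K. \<forall>z\<in>Z. g z = z}"
 proof (rule closedin_PG)
  fix g assume g: "g : K" "!!F. finite F ==> \<exists>f\<in>{g : K. \<forall>z\<in>Z. g z = z}. invp g o f : U \<and> (\<forall>y\<in>F. f y = g y)"
  have "g z = z" if "z : Z" for z
  proof -
   obtain f where "f : {g : K. \<forall>z\<in>Z. g z = z}" "\<forall>y\<in>{z}. f y = g y" using g(2)[of "{z}"] by auto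
   then show ?thesis using that by auto
  qed
  then show "g : {g : K. \<forall>z\<in>Z. g z = z}" using g(1) by simp
 qed auto
 then show ?thesis using subgroup_support by (simp add: closed_subgroup_def)
qed

lemma closed_subgroup_B: "closed_subgroup (B j i v) PG"
proof -
 have "B j i v = {g : K. \<forall>z\<in>{z. \<not> agree (i + 1) z v}. g z = z} \<inter> L {..i - int j}" by (auto simp: B_def)
 then show ?thesis by (simp only: closed_subgroup_Int[OF closed_subgroup_support closed_subgroup_L])
qed

lemma root_B:
 assumes "h : H" "agree (i + 1) z v" "l \<le> i" "i - int j < l" shows "rooted l z h : B j i v"
proof -
 have "rooted l z h y = y" if "\<not> agree (i + 1) y v" for y
 proof -
  have "\<not> agree (l + 1) y z"
  proof
   assume "agree (l + 1) y z"
   then have "agree (i + 1) y z" by (rule agree_mono) (use assms in simp)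
   then show False using that assms(2) agree_trans by blast
  qed
  then show ?thesis by (simp add: rooted_def)
 qed
 moreover have "rooted l z h x \<cdot> k = 0" if "k \<le> i - int j" "x \<cdot> k = 0" for k x
  using that assms(4) by (simp add: rooted_def)
 ultimately show ?thesis using K_root[OF assms(1)] by (simp add: B_def L_def)
qed

text \<open>The bad vertices of an element of \<open>B j i v\<close> lie in the cone and on its free
  levels. Cancelling them by \<open>reduce_loc\<close> within \<open>N \<inter> B j i v\<close>
  leaves an element of \<open>U\<close>.\<close>

lemma B_subset:
 assumes N: "subgroup N PG" and U: "U \<inter> B j i v \<subseteq> N"
  and roots: "!!l z h. [|h : H; agree (i + 1) z v; l \<le> i; i - int j < l|] ==> rooted l z h : N" shows "B j i v \<subseteq> N"
proof
 fix g assume g: "g : B j i v"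
 note gK = B_K[OF g]
 have Bs: "subgroup (B j i v) PG" using closed_subgroup_B by (simp add: closed_subgroup_def)
 have NB: "subgroup (N \<inter> B j i v) PG" by (rule subgroups_Inter_pair[OF N Bs])
 note NB' = PG_subgroupD[OF NB]
 have bad_range: "agree (i + 1) z v" "l \<le> i" "i - int j < l" if b: "(l, z) : bad g" for l z
 proof -
  have z: "truncated l z" "g z \<cdot> l \<noteq> 0" using b by (auto simp: bad_def)
  show "agree (i + 1) z v"
  proof (rule ccontr)
   assume "\<not> agree (i + 1) z v"
   then have "g z = z" by (rule B_outside[OF g])
   then show False using z by (simp add: truncated_def)
  qed
  show "l \<le> i"
  proof (rule ccontr)
   assume "\<not> l \<le> i"
   then have "loc g l z = id" by (intro M_loc_above[OF B_M[OF g]]) simp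
   then show False using b bad_iff_loc[OF K_aut[OF gK]] by simp
  qed
  show "i - int j < l" using g b by (force simp: B_def L_iff_bad)
 qed
 obtain f where f: "f : N \<inter> B j i v" "!!l z. (l, z) : bad g ==> loc (f o g) l z = id"
  "!!k x. loc (f o g) k x = id \<or> loc (f o g) k x = loc g k x"
 proof (rule reduce_loc[OF gK K_bad[OF gK] NB'(1,2)])
  show "f o f' : N \<inter> B j i v" if "f : N \<inter> B j i v" "f' : N \<inter> B j i v" for f f' by (rule NB'(3)[OF that])
 next
  fix l z h f assume b: "(l, z) : bad g" "h : H" "f : N \<inter> B j i v"
  have "agree (i + 1) (f (g z)) v" using bad_range(1)[OF b(1)] B_cone[OF g] B_cone b(3) by blast
  then show "rooted l (f (g z)) h : N \<inter> B j i v" using roots root_B b(2) bad_range(2,3)[OF b(1)] by blast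
 qed blast
 have fB: "f : N" "f : B j i v" using f(1) by auto
 have fg: "f o g : B j i v" using PG_subgroupD(3)[OF Bs fB(2) g] .
 have "f o g : U" by (rule reduced_U[OF gK B_K[OF fg] f(2,3)])
 then have "f o g : N" using U fg by blast
 then have "invp f o (f o g) : N" by (rule PG_subgroupD(3)[OF N PG_subgroupD(4)[OF N fB(1)]])
 then show "g : N" by (simp only: invp_comp_cancel[OF B_K[OF fB(2)]])
qed

lemma root_conj_apply:
 assumes "h : H" shows "l \<noteq> i ==> rooted i v h x \<cdot> l = x \<cdot> l" "invp (rooted i v h) = rooted i v (invp h)"
 using tree_aut_root_inv[OF H.bij[OF assms]] by (auto simp: rooted_def)

text \<open>A rooted element at v carries branch a to branch h a. Membership in \<open>U\<close>
  survives although h may move 0: g changes positions below i only, and the rooted element position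
  i only.\<close>

lemma conj_B:
 assumes h: "h : H" and g: "g : B j (i - 1) (upd v i a)"
 shows "rooted i v h o g o invp (rooted i v h) : B j (i - 1) (upd v i (h a))"
  "g : U ==> rooted i v h o g o invp (rooted i v h) : U"
proof -
 let ?r = "rooted i v h"
 note rK = K_root[OF h, of i v] and ri = root_conj_apply(2)[OF h, of i v]
 have cK: "?r o g o invp ?r : K" by (intro K_comp K_inv rK B_K[OF g])
 have rv: "?r (upd v i a) = upd v i (h a)" by (intro seq_eqI) (simp add: rooted_def)
 have low: "(?r o g o invp ?r) x \<cdot> l = 0"
  if "l \<noteq> i" "x \<cdot> l = 0" "!!y. y \<cdot> l = 0 ==> g y \<cdot> l = 0" for x l
  using that root_conj_apply(1)[OF h that(1)] root_conj_apply(1)[OF H.invp[OF h] that(1)] by (simp add: ri)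
 have "(?r o g o invp ?r) z = z" if z: "\<not> agree i z (upd v i (h a))" for z
 proof -
  have "\<not> agree i (invp ?r z) (upd v i a)"
  proof
   assume "agree i (invp ?r z) (upd v i a)"
   then have "agree i (?r (invp ?r z)) (?r (upd v i a))" using tree_aut_agree[OF K_aut[OF rK]] by blast
   then show False using z rv rK by simp
  qed
  then have "g (invp ?r z) = invp ?r z" using B_outside[OF g] by simp
  then show ?thesis using rK by simp
 qed
 then show "?r o g o invp ?r : B j (i - 1) (upd v i (h a))" using cK low g by (auto simp: B_def L_def)
 assume gU: "g : U"
 have "(?r o g o invp ?r) x \<cdot> l = 0" if "x \<cdot> l = 0" for x l
 proof (cases "l = i")
  case True
  have "?r o g o invp ?r : M (i - 1)" using M_conj[OF B_M[OF g] rK] .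
  then show ?thesis using agree_entry[OF M_agree, of "?r o g o invp ?r" "i - 1" l x] True that by simp
 next
  case False
  then show ?thesis using low that gU by (simp add: U_def)
 qed
 then show "?r o g o invp ?r : U" using cK by (simp add: U_def)
qed

lemma B_mono: shows "B j (i - 1) (upd v i a) \<subseteq> B (Suc j) i v"
proof
 fix g assume g: "g : B j (i - 1) (upd v i a)"
 have "agree (i + 1) z v" if "agree i z (upd v i a)" for z
  using agree_mono[OF that, of "i + 1"] agree_trans agree_upd(1) by auto
 then show "g : B (Suc j) i v" using g by (auto simp: B_def algebra_simps)
qed

lemma compact_U_Int:
 assumes "closed_subgroup A PG" shows "compactin (perm_topology K U) (U \<inter> A)"
 using assms compactin_U by (auto simp: closed_subgroup_def intro: compact_Int_closedin)

lemma compact_root: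
 assumes "compactin (perm_topology H V) C" shows "compactin (perm_topology K U) (rooted i v ` C)"
 using image_compactin[OF assms, of "perm_topology K U" "rooted i v"] root_cont_hom by (simp add: cont_hom_def)

lemma root_generate:
 assumes "subgroup N PG" "rooted i v ` C \<subseteq> N" "C \<subseteq> H" shows "rooted i v ` generate H.PG C \<subseteq> N"
proof -
 interpret r: group_hom H.PG PG "rooted i v" by (rule cont_hom_group_hom[OF H.group_PG group_PG root_cont_hom])
 have "rooted i v ` generate H.PG C = generate PG (rooted i v ` C)" using assms(3) by (simp add: r.generate_img)
 then show ?thesis using generate_subgroup_incl[OF assms(2,1)] by simp
qed

text \<open>By induction on j the generators are the compact part in \<open>U\<close>, a rooted copy
  of a compact generating set of \<open>H\<close>, and generators for the single branch 0. As
  \<open>H\<close> is transitive, conjugation carries this branch to all the others.\<close>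

lemma B_compactly_generated:
 assumes "compactly_generated H.PG"
 obtains C where "compactin (perm_topology K U) C" "generate PG C = B j i v"
proof -
 obtain CH where CH: "compactin (perm_topology H V) CH" "generate H.PG CH = H"
  using assms by (auto simp: compactly_generated_def)
 have CHH: "CH \<subseteq> H" using compactin_subset_topspace[OF CH(1)] by simp
 have "\<exists>C. compactin (perm_topology K U) C \<and> generate PG C = B j i v"
 proof (induction j arbitrary: i v)
  case 0
  let ?C = "U \<inter> B 0 i v"
  have s: "subgroup (B 0 i v) PG" using closed_subgroup_B by (simp add: closed_subgroup_def)
  have C: "?C \<subseteq> carrier PG" using B_K by auto
  have "B 0 i v \<subseteq> generate PG ?C" by (rule B_subset[OF generate_is_subgroup[OF C]]) (auto intro: generate.incl)
  moreover have "generate PG ?C \<subseteq> B 0 i v" by (rule generate_subgroup_incl[OF _ s]) auto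
  ultimately show ?case using compact_U_Int[OF closed_subgroup_B] by blast
 next
  case (Suc j)
  obtain C' where C': "compactin (perm_topology K U) C'" "generate PG C' = B j (i - 1) (upd v i 0)" using Suc by blast
  have s: "subgroup (B (Suc j) i v) PG" using closed_subgroup_B by (simp add: closed_subgroup_def)
  define C where "C = (U \<inter> B (Suc j) i v) \<union> rooted i v ` CH \<union> C'"
  have CB: "C \<subseteq> B (Suc j) i v"
  proof -
   have "C' \<subseteq> B (Suc j) i v" using generate.incl[of _ C' PG] C'(2) B_mono by blast
   then show ?thesis using root_B[of _ i v v i "Suc j"] CHH by (auto simp: C_def)
  qed
  then have CK: "C \<subseteq> carrier PG" using B_K by auto
  let ?N = "generate PG C"
  note N = generate_is_subgroup[OF CK]
  note N' = PG_subgroupD[OF N]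
  have NC: "C \<subseteq> ?N" by (auto intro: generate.incl)
  have r: "rooted i v h : ?N" if "h : H" for h
   using root_generate[OF N _ CHH, of i v] NC CH(2) that by (auto simp: C_def)
  have B0: "B j (i - 1) (upd v i 0) \<subseteq> ?N" unfolding C'(2)[symmetric] by (rule mono_generate) (auto simp: C_def)
  have BN: "B j (i - 1) (upd v i a) \<subseteq> ?N" for a
  proof
   fix g assume g: "g : B j (i - 1) (upd v i a)"
   obtain h where h: "h : H" "h 0 = a" using transitive by blast
   let ?r = "rooted i v (invp h)"
   have "?r o g o invp ?r : ?N" using conj_B(1)[OF H.invp[OF h(1)] g] H.invp_apply(1)[OF h(1), of 0] h(2) B0 by auto
   then have "invp ?r o (?r o g o invp ?r) o ?r : ?N" using N'(3)[OF N'(3)[OF N'(4)]] r[OF H.invp[OF h(1)]] by blast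
   moreover have "invp ?r o (?r o g o invp ?r) o ?r = g"
    using K_root[OF H.invp[OF h(1)], of i v] by (simp add: fun_eq_iff)
   ultimately show "g : ?N" by simp
  qed
  have "B (Suc j) i v \<subseteq> ?N"
  proof (rule B_subset[OF N])
   show "U \<inter> B (Suc j) i v \<subseteq> ?N" using NC by (auto simp: C_def)
   fix l z h assume h: "h : H" "agree (i + 1) z v" "l \<le> i" "i - int (Suc j) < l"
   show "rooted l z h : ?N"
   proof (cases "l = i")
    case True
    then show ?thesis using r[OF h(1)] root_cong[OF h(2)] by simp
   next
    case False
    have "agree i z (upd v i (z \<cdot> i))" using h(2) by (auto simp: agree_def)
    then have "rooted l z h : B j (i - 1) (upd v i (z \<cdot> i))" using h False by (intro root_B) auto
    then show ?thesis using BN by blast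
   qed
  qed
  moreover have "?N \<subseteq> B (Suc j) i v" by (rule generate_subgroup_incl[OF CB s])
  moreover have "compactin (perm_topology K U) C"
   unfolding C_def by (intro compactin_Un compact_U_Int closed_subgroup_B compact_root CH C')
  ultimately show ?case by blast
 qed
 then show thesis using that by blast
qed

text \<open>A finite orbit covers \<open>Ob\<close> by finitely many translates of a conjugate of
  \<open>V\<close>, so that \<open>Ob\<close> is compact. Read contrapositively, a non-trivial
  residual forces infinite orbits.\<close>

lemma infinite_orbit:
 assumes O: "closed_subgroup Ob H.PG" and fin: "finite ((\<lambda>h. h a) ` Ob)"
 shows "discrete_residual (subgrp H.PG Ob) = {id}"
proof -
 have Os: "subgroup Ob H.PG" "closedin (perm_topology H V) Ob" using O by (auto simp: closed_subgroup_def)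
 have OH: "Ob \<subseteq> H" using subgroup.subset[OF Os(1)] by simp
 obtain c where c: "c : H" "c 0 = a" using transitive by blast
 obtain R where R: "finite R" "R \<subseteq> Ob" "(\<lambda>h. h a) ` Ob = (\<lambda>h. h a) ` R"
  by (metis finite_subset_image[OF fin] subset_refl)
 define D where "D = (\<Union>r\<in>R. (\<lambda>x. r o c o x o invp c) ` V)"
 have "compactin (perm_topology H V) ((\<lambda>x. r o c o x o invp c) ` V)" if "r : H" for r
 proof (rule image_compactin[OF H.compactin_U])
  have "continuous_map (gtop H.PG) (gtop H.PG) (\<lambda>x. r \<otimes>\<^bsub>H.PG\<^esub> c \<otimes>\<^bsub>H.PG\<^esub> x \<otimes>\<^bsub>H.PG\<^esub> invp c)"
   using that c H.comp H.invp by (intro H.continuous_intros_G) auto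
  then show "continuous_map (perm_topology H V) (perm_topology H V) (\<lambda>x. r o c o x o invp c)" by simp
 qed
 then have "compactin (perm_topology H V) D" unfolding D_def using R OH by (intro compactin_Union) auto
 moreover have "Ob \<subseteq> D"
 proof
  fix h assume h: "h : Ob"
  then obtain r where r: "r : R" "h a = r a" using R(3) by blast
  have rH: "r : H" "h : H" using r R OH h by auto
  let ?x = "invp c o (invp r o h) o c"
  have "?x : V" using H.comp H.invp rH c r H.invp_apply(1)[OF rH(1), of a] H.invp_apply(1)[OF c(1), of 0] by auto
  moreover have "h = r o c o ?x o invp c" using rH c by (simp add: fun_eq_iff)
  ultimately show "h : D" using r(1) unfolding D_def by blast
 qed
 ultimately have "compactin (perm_topology H V) Ob" using Os(2) by (metis closed_compactin)
 then show ?thesis using H.residual_trivial_compact_subgroup[OF Os(1)] by simp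
qed

end

context stacked_tree
begin

text \<open>An open normal subgroup of \<open>T\<close> contains all elements of \<open>T\<close>
  that lie in \<open>U\<close> and fix a certain finite set of points. As the orbit of branch a is
  infinite, a rooted element of \<open>T\<close> moves this branch away from these points, and
  conjugating back catches the part of the branch group in \<open>U\<close>. It contains rooted
  copies of elements of \<open>V\<close> outside \<open>H1\<close>, and absorption yields the
  remaining generators.\<close>

lemma residual_contains_B:
 assumes Tc: "closed_subgroup T PG" and O: "rooted i v ` Ob \<subseteq> T" "Ob \<subseteq> H" "infinite ((\<lambda>h. h a) ` Ob)"
  and BT: "B j (i - 1) (upd v i a) \<subseteq> T" shows "B j (i - 1) (upd v i a) \<subseteq> discrete_residual (subgrp PG T)"
 unfolding discrete_residual_def
proof (rule Inter_greatest)
 fix N assume "N : {N. N \<lhd> subgrp PG T \<and> openin (gtop (subgrp PG T)) N}"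
 then have N: "N \<lhd> subgrp PG T" "openin (subtopology (perm_topology K U) T) N" by auto
 have T: "subgroup T PG" using Tc by (simp add: closed_subgroup_def)
 note T' = PG_subgroupD[OF T]
 interpret T: group "subgrp PG T" using group_subgrp[OF group_PG T] .
 have Ns: "subgroup N PG" "N \<subseteq> T" using N(1) subgroup_subgrp_iff[OF group_PG T] by (auto simp: normal_def)
 note N' = PG_subgroupD[OF Ns(1)]
 have Nc: "t o n o invp t : N" if "t : T" "n : N" for t n
  using N(1) that inv_subgrp[OF group_PG T that(1)] T'(1) by (auto simp: T.normal_inv_iff subset_iff)
 obtain N0 where N0: "openin (perm_topology K U) N0" "N = N0 \<inter> T" using N(2) by (auto simp: openin_subtopology)
 then have "id : N0" using N'(2) by auto
 then obtain F where F: "finite F" "small F \<subseteq> N0" using openin_contains_small[OF N0(1)] by auto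
 have "infinite ((\<lambda>h. h a) ` Ob - (\<lambda>y. y \<cdot> i) ` F)" using O(3) F(1) by simp
 then have "(\<lambda>h. h a) ` Ob - (\<lambda>y. y \<cdot> i) ` F \<noteq> {}" by (metis finite.emptyI)
 then have "\<not> (\<lambda>h. h a) ` Ob \<subseteq> (\<lambda>y. y \<cdot> i) ` F" by (simp only: Diff_eq_empty_iff not_False_eq_True)
 then have "\<exists>h\<in>Ob. \<forall>y\<in>F. y \<cdot> i \<noteq> h a" unfolding image_subset_iff by (metis imageI)
 then obtain h where h: "h : Ob" "!!y. y : F ==> y \<cdot> i \<noteq> h a" by metis
 then have hH: "h : H" using O(2) by auto
 let ?r = "rooted i v h"
 have rT: "?r : T" using O(1) h(1) by auto
 have low: "g : N" if g: "g : U \<inter> B j (i - 1) (upd v i a)" for g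
 proof -
  have gB: "g : B j (i - 1) (upd v i a)" "g : T" using g BT by auto
  let ?c = "?r o g o invp ?r"
  have c: "?c : U" "?c : B j (i - 1) (upd v i (h a))" using conj_B[OF hH gB(1)] g by auto
  have "?c y = y" if "y : F" for y
  proof (rule B_outside[OF c(2)])
   show "\<not> agree (i - 1 + 1) y (upd v i (h a))" using h(2)[OF that] by (auto simp: agree_def)
  qed
  then have "?c : N0" using c(1) F(2) by (auto simp: small_def)
  moreover have "?c : T" by (intro T'(3) T'(4) rT gB(2))
  ultimately have "invp ?r o ?c o invp (invp ?r) : N" using Nc[OF T'(4)[OF rT]] N0(2) by blast
  moreover have "invp ?r o ?c o invp (invp ?r) = g"
   using K_root[OF hH, of i v] bij[OF K_root[OF hH, of i v]] by (simp add: fun_eq_iff inv_inv_eq)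
  ultimately show ?thesis by simp
 qed
 have "open_subgroup N (subgrp PG T)"
  using Ns N(2) by (simp add: open_subgroup_def subgroup_subgrp_iff[OF group_PG T])
 then have Ncl: "closedin (perm_topology K U) N"
  using closed_subgroup_trans[OF Tc] top_group.closed_open_subgroup[of "subgrp PG T" N] top_group_subgrp[OF T]
  by (simp add: top_group_def closed_subgroup_def)
 show "B j (i - 1) (upd v i a) \<subseteq> N"
 proof (rule B_subset[OF Ns(1)])
  show "U \<inter> B j (i - 1) (upd v i a) \<subseteq> N" using low by blast
  fix l z h assume lz: "h : H" "agree (i - 1 + 1) z (upd v i a)" "l \<le> i - 1" "i - 1 - int j < l"
  have rB: "rooted l z h : B j (i - 1) (upd v i a)" if "h : H" for h using root_B[OF that lz(2-4)] .
  obtain h0 where h0: "h0 : V" "h0 \<notin> H1" using V_not_H1 by blast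
  show "rooted l z h : N"
  proof (rule root_absorb[OF Ns(1) Ncl _ _ h0(2) _ lz(1)])
   show "rooted l z h0 : N" using low rB[of h0] root_U_iff[of h0 l z] h0(1) by blast
   show "rooted l z h o n o rooted l z (invp h) : N" if "h : H" "n : N" for h n
    using Nc[OF _ that(2), of "rooted l z h"] rB[OF that(1)] BT root_conj_apply(2)[OF that(1)] by auto
  qed (use h0(1) in simp)
 qed
qed

context
 fixes \<kappa>
 assumes rank_K: "has_rank PG \<kappa>"
begin

lemma rank_closed_subgroup:
 assumes "closed_subgroup A PG" shows "has_rank (subgrp PG A) (decomposition_rank (subgrp PG A))"
proof -
 have A: "A \<subseteq> K" using assms by (intro PG_subgroupD) (simp add: closed_subgroup_def)
 have "(\<lambda>x. x) : cont_hom (subgrp PG A) PG"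
  using id_cont_hom_subgrp[of A "carrier PG" PG] A subgrp_self[of PG] by simp
 then obtain \<beta> where "has_rank (subgrp PG A) \<beta>" by (rule rank_exists_mono[OF rank_K tdlc_PG_closed[OF assms]]) auto
 then show ?thesis by (simp add: decomposition_rank_eq)
qed

lemma rank_closed_subgroup_mono:
 assumes "closed_subgroup A PG" "closed_subgroup A' PG" "A \<subseteq> A'"
 shows "decomposition_rank (subgrp PG A) \<le> decomposition_rank (subgrp PG A')"
 by (rule rank_mono[OF rank_closed_subgroup[OF assms(2)] rank_closed_subgroup[OF assms(1)]
   id_cont_hom_subgrp[OF assms(3)]]) auto

lemma Res_closed_subgroup:
 assumes "closed_subgroup T PG" shows "closed_subgroup (discrete_residual (subgrp PG T)) PG"
  "Res (subgrp PG T) = subgrp PG (discrete_residual (subgrp PG T))"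
proof -
 have Ts: "subgroup T PG" using assms by (simp add: closed_subgroup_def)
 interpret T: top_group "subgrp PG T" using top_group_subgrp[OF Ts] by unfold_locales
 show "closed_subgroup (discrete_residual (subgrp PG T)) PG"
  by (rule closed_subgroup_trans[OF assms T.closed_subgroup_residual])
 show "Res (subgrp PG T) = subgrp PG (discrete_residual (subgrp PG T))"
  by (rule subgrp_subgrp[OF residual_subgrp_subset[OF topological_group_PG Ts]])
qed

lemma rank_compactly_generated_lower:
 assumes "closed_subgroup T PG" "T \<noteq> {id}" "compactly_generated (subgrp PG T)"
 shows "decomposition_rank (subgrp PG (discrete_residual (subgrp PG T))) + 1 \<le> decomposition_rank (subgrp PG T)"
proof (rule rank_lower_bound[OF rank_closed_subgroup[OF assms(1)], of T])
 have Ts: "subgroup T PG" using assms by (simp add: closed_subgroup_def)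
 show "subgroup T (subgrp PG T)" using subgroup_subgrp_iff[OF group_PG Ts] Ts by simp
 show "compactly_generated (subgrp (subgrp PG T) T)" using assms(3) by (simp add: subgrp_subgrp)
 show "has_rank (Res (subgrp (subgrp PG T) T))
   (decomposition_rank (subgrp PG (discrete_residual (subgrp PG T))))"
  using rank_closed_subgroup[OF Res_closed_subgroup(1)[OF assms(1)]]
  by (simp add: subgrp_subgrp Res_closed_subgroup(2)[OF assms(1)])
qed (use assms(2) in auto)

lemma residual_contains_root:
 assumes "subgroup Ob H.PG" "subgroup T PG" "rooted i v ` Ob \<subseteq> T"
 shows "rooted i v ` discrete_residual (subgrp H.PG Ob) \<subseteq> discrete_residual (subgrp PG T)"
proof (rule residual_hom)
 show "topological_group (subgrp H.PG Ob)" by (rule H.top_group_subgrp[OF assms(1)])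
 show "topological_group (subgrp PG T)" by (rule top_group_subgrp[OF assms(2)])
 show "rooted i v : cont_hom (subgrp H.PG Ob) (subgrp PG T)"
  using root_cont_hom subgroup.subset[OF assms(1)] by (intro cont_hom_subgrp assms(3)) auto
qed

text \<open>For \<gamma> < \<beta> some compactly generated subgroup of \<open>Ob\<close> has a
  residual of rank above 1 + \<gamma>. A compactly generated open subgroup of \<open>W\<close> is
  chosen to contain its rooted copy and the branch group; its residual contains the branch group
  again and a rooted copy of the smaller residual. So the induction hypothesis applies to the
  residual, and returning from it gains one.\<close>

lemma rank_step:
 assumes gen: "compactly_generated H.PG" and low: "\<mu> \<le> decomposition_rank (subgrp PG (B j (i - 1) (upd v i a)))"
 shows "[|closed_subgroup Ob H.PG; \<beta> = 0 \<or> (\<exists>\<rho>. has_rank (subgrp H.PG Ob) \<rho> \<and> 1 + \<beta> < \<rho>);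
   closed_subgroup W PG; rooted i v ` Ob \<subseteq> W; B j (i - 1) (upd v i a) \<subseteq> W|]
  ==> \<mu> + \<beta> \<le> decomposition_rank (subgrp PG W)"
proof (induction \<beta> arbitrary: Ob W rule: less_induct)
 case (less \<beta>)
 let ?B = "B j (i - 1) (upd v i a)"
 have Ws: "subgroup W PG" and WK: "W \<subseteq> K" using less.prems(3) PG_subgroupD(1) by (auto simp: closed_subgroup_def)
 have Os: "subgroup Ob H.PG" using less.prems(1) by (simp add: closed_subgroup_def)
 have OH: "Ob \<subseteq> H" using subgroup.subset[OF Os] by simp
 show ?case
 proof (rule ord_add_bounds(3))
  show "\<mu> \<le> decomposition_rank (subgrp PG W)"
   using low rank_closed_subgroup_mono[OF closed_subgroup_B less.prems(3,5)] by (rule order_trans)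
  fix \<gamma> assume \<gamma>: "\<gamma> < \<beta>"
  then have "\<beta> \<noteq> 0" using zero_le_omega1 leD by blast
  then obtain \<rho> where \<rho>: "has_rank (subgrp H.PG Ob) \<rho>" "1 + \<beta> < \<rho>" using less.prems(2) by blast
  have "1 \<le> 1 + \<beta>" by (rule ord_add_bounds(1))
  then have "1 < \<rho>" using \<rho>(2) by order
  with \<rho>(1) obtain S \<sigma> where S: "cg_exhaustion (subgrp H.PG Ob) S"
   "!!k. has_rank (Res (subgrp (subgrp H.PG Ob) (S k))) (\<sigma> k)" "\<rho> = (SUP k. \<sigma> k) + 1" by (cases rule: rank_cases) auto
  have "1 + \<beta> \<le> (SUP k. \<sigma> k)" using \<rho>(2) S(3) by (simp add: less_add_one_iff_omega1)
  moreover have "1 + \<gamma> < 1 + \<beta>" using \<gamma> by (rule ord_add_bounds(2))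
  ultimately have "\<not> (SUP k. \<sigma> k) \<le> 1 + \<gamma>" by order
  then obtain k where k: "1 + \<gamma> < \<sigma> k" using SUP_seq_least_omega1[of \<sigma>] by (meson not_le)
  have Sk: "open_subgroup (S k) (subgrp H.PG Ob)" "compactly_generated (subgrp (subgrp H.PG Ob) (S k))"
   using S(1) by (auto simp: cg_exhaustion_def)
  then have SO: "S k \<subseteq> Ob" by (auto simp: open_subgroup_def dest!: subgroup.subset)
  interpret O: tdlc "subgrp H.PG Ob" by (rule H.tdlc_subgrp[OF less.prems(1)])
  have Skc: "closed_subgroup (S k) H.PG"
   by (rule H.closed_subgroup_trans[OF less.prems(1) O.closed_open_subgroup[OF Sk(1)]])
  then have Sks: "subgroup (S k) H.PG" by (simp add: closed_subgroup_def)
  define O' where "O' = discrete_residual (subgrp H.PG (S k))"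
  interpret Sk: top_group "subgrp H.PG (S k)" using H.top_group_subgrp[OF Sks] by unfold_locales
  have O': "closed_subgroup O' H.PG" unfolding O'_def
   by (rule H.closed_subgroup_trans[OF Skc Sk.closed_subgroup_residual])
  have O'S: "O' \<subseteq> S k" unfolding O'_def by (rule residual_subgrp_subset[OF H.topological_group_PG Sks])
  have rO': "has_rank (subgrp H.PG O') (\<sigma> k)"
   using S(2)[of k] subgrp_subgrp[OF O'S, of H.PG] by (simp add: subgrp_subgrp[OF SO] O'_def)
  \<comment> \<open>The summand 1 in 1 + \<gamma> excludes rank 1 even for \<gamma> = 0; a
    non-trivial residual is what makes the orbit of branch a infinite.\<close>
  have ntriv: "O' \<noteq> {id}"
  proof
   assume "O' = {id}"
   then have "has_rank (subgrp H.PG O') 1" using rank_tdlcsc[OF rO'] by (intro has_decomposition_rank.trivial) auto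
   then have "\<sigma> k = 1" using rO' rank_unique by blast
   then show False using k ord_add_bounds(1)[of 1 \<gamma>] by order
  qed
  have inf: "infinite ((\<lambda>h. h a) ` S k)" using infinite_orbit[OF Skc] ntriv unfolding O'_def by blast
  obtain C1 where C1: "compactin (gtop (subgrp H.PG (S k))) C1" "generate (subgrp H.PG (S k)) C1 = S k"
   using Sk(2) by (auto simp: compactly_generated_def subgrp_subgrp[OF SO])
  then have C1': "compactin (perm_topology H V) C1" "C1 \<subseteq> S k" by (auto simp: compactin_subtopology)
  have C1g: "generate H.PG C1 = S k" using C1(2) H.generate_subgrp[OF Sks C1'(2)] by simp
  obtain C2 where C2: "compactin (perm_topology K U) C2" "generate PG C2 = ?B" by (rule B_compactly_generated[OF gen])
  define D where "D = rooted i v ` C1 \<union> C2"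
  have DW: "D \<subseteq> W" using less.prems(4,5) C1'(2) SO C2(2) generate.incl[of _ C2 PG] by (auto simp: D_def) blast
  have "compactin (perm_topology K U) D" unfolding D_def by (intro compactin_Un compact_root C1' C2)
  then have Dc: "compactin (gtop (subgrp PG W)) D" using DW by (simp add: compactin_subtopology)
  interpret W: tdlc "subgrp PG W" by (rule tdlc_PG_closed[OF less.prems(3)])
  from Dc obtain TS :: "nat => (seq => seq) set" where TS: "!!i. open_subgroup (TS i) (subgrp PG W)"
   "!!i. compactly_generated (subgrp (subgrp PG W) (TS i))" "!!i. D \<subseteq> TS i"
   using W.compactly_generated_exhaustion by metis
  define T where "T = TS 0"
  have T: "open_subgroup T (subgrp PG W)" "compactly_generated (subgrp (subgrp PG W) T)" "D \<subseteq> T"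
   unfolding T_def by (rule TS)+
  have TW: "T \<subseteq> W" using T(1) by (auto simp: open_subgroup_def dest!: subgroup.subset)
  have Tc: "closed_subgroup T PG" by (rule closed_subgroup_trans[OF less.prems(3) W.closed_open_subgroup[OF T(1)]])
  then have Ts: "subgroup T PG" by (simp add: closed_subgroup_def)
  have rT: "rooted i v ` S k \<subseteq> T"
   unfolding C1g[symmetric] using T(3) C1'(2) SO OH by (intro root_generate[OF Ts]) (auto simp: D_def)
  have BT: "?B \<subseteq> T" unfolding C2(2)[symmetric] using T(3) by (intro generate_subgroup_incl[OF _ Ts]) (simp add: D_def)
  let ?R = "discrete_residual (subgrp PG T)"
  have "\<mu> + \<gamma> \<le> decomposition_rank (subgrp PG ?R)"
  proof (rule less.IH[OF \<gamma> O'])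
   show "\<gamma> = 0 \<or> (\<exists>\<rho>. has_rank (subgrp H.PG O') \<rho> \<and> 1 + \<gamma> < \<rho>)" using rO' k by blast
   show "closed_subgroup ?R PG" by (rule Res_closed_subgroup[OF Tc])
   show "rooted i v ` O' \<subseteq> ?R" unfolding O'_def by (rule residual_contains_root[OF Sks Ts rT])
   show "?B \<subseteq> ?R" using SO OH by (intro residual_contains_B[OF Tc rT _ inf BT]) auto
  qed
  moreover have "decomposition_rank (subgrp PG ?R) + 1 \<le> decomposition_rank (subgrp PG T)"
  proof (rule rank_compactly_generated_lower[OF Tc])
   show "compactly_generated (subgrp PG T)" using T(2) by (simp add: subgrp_subgrp[OF TW])
   show "T \<noteq> {id}"
   proof
    assume "T = {id}"
    then have "rooted i v h = id" if "h : S k" for h using rT that by auto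
    then have "h = id" if "h : S k" for h using that loc_root[of i v h i v] by simp
    then have "S k \<subseteq> {id}" by blast
    then have "finite (S k)" by (rule finite_subset) simp
    then show False using inf by simp
   qed
  qed
  moreover have "decomposition_rank (subgrp PG T) \<le> decomposition_rank (subgrp PG W)"
   by (rule rank_closed_subgroup_mono[OF Tc less.prems(3) TW])
  ultimately show "\<mu> + \<gamma> < decomposition_rank (subgrp PG W)"
   using add_one_le_iff_less_omega1[of "\<mu> + \<gamma>"] add_one_le_iff_omega1[of "\<mu> + \<gamma>"] by (meson order_trans le_less_trans less_le_trans)
 qed
qed

text \<open>\<open>H\<close> is compactly generated with an infinite orbit, so the residual of the
  bigger group contains a branch group and a rooted copy of the residual of \<open>H\<close>. The
  latter gives \<beta>, and the passage to the residual one more.\<close>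

lemma rank_B_Suc:
 assumes gen: "compactly_generated H.PG" and \<beta>: "\<beta> = 0 \<or> (\<exists>\<rho>. has_rank (Res H.PG) \<rho> \<and> 1 + \<beta> < \<rho>)"
  and low: "\<mu> \<le> decomposition_rank (subgrp PG (B j (i - 1) (upd v i 0)))"
 shows "\<mu> + (\<beta> + 1) \<le> decomposition_rank (subgrp PG (B (Suc j) i v))"
proof -
 let ?T = "B (Suc j) i v"
 have Tc: "closed_subgroup ?T PG" by (rule closed_subgroup_B)
 then have Ts: "subgroup ?T PG" by (simp add: closed_subgroup_def)
 obtain C where C: "compactin (perm_topology K U) C" "generate PG C = ?T" by (rule B_compactly_generated[OF gen])
 have cgT: "compactly_generated (subgrp PG ?T)" using compactly_generated_subgrp[of C] C by simp
 have rH: "rooted i v ` H \<subseteq> ?T" using root_B by auto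
 have "(\<lambda>h. h 0) ` H = UNIV" using transitive by (auto simp: image_iff) metis
 then have infH: "infinite ((\<lambda>h. h 0) ` H)" by simp
 let ?R = "discrete_residual (subgrp PG ?T)"
 have "\<mu> + \<beta> \<le> decomposition_rank (subgrp PG ?R)"
 proof (rule rank_step[OF gen low])
  show "closed_subgroup (discrete_residual H.PG) H.PG" by (rule H.closed_subgroup_residual)
  show "closed_subgroup ?R PG" by (rule Res_closed_subgroup[OF Tc])
  show "rooted i v ` discrete_residual H.PG \<subseteq> ?R"
   using residual_contains_root[OF _ Ts rH] H.subgroup_self subgrp_self[of H.PG] by simp
  show "B j (i - 1) (upd v i 0) \<subseteq> ?R" by (rule residual_contains_B[OF Tc rH _ infH B_mono]) simp
 qed (rule \<beta>)
 moreover have "decomposition_rank (subgrp PG ?R) + 1 \<le> decomposition_rank (subgrp PG ?T)"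
 proof (rule rank_compactly_generated_lower[OF Tc _ cgT])
  show "?T \<noteq> {id}"
  proof
   assume "?T = {id}"
   then have "rooted i v h = id" if "h : H" for h using rH that by auto
   moreover obtain h where "h : H" "h 0 = 1" using transitive by blast
   ultimately show False using loc_root[of i v h i v] by fastforce
  qed
 qed
 ultimately show ?thesis unfolding ord_add_add_one using add_one_le_iff_omega1 order_trans by blast
qed

text \<open>Each free level adds at least \<open>omega ^ n\<close>, and the finite multiples of this
  ordinal have supremum \<open>omega ^ Suc n\<close>.\<close>

theorem rank_K_lower:
 assumes "compactly_generated H.PG" and "\<beta> = 0 \<or> (\<exists>\<rho>. has_rank (Res H.PG) \<rho> \<and> 1 + \<beta> < \<rho>)" and n: "omega ^ n \<le> \<beta> + 1"
 shows "omega ^ Suc n \<le> \<kappa>"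
proof (rule omega_power_times_lub(2))
 have *: "omega_power_times n j \<le> decomposition_rank (subgrp PG (B j i v))" for j i v
 proof (induction j arbitrary: i v)
  case 0
  then show ?case by simp
 next
  case (Suc j)
  have "omega_power_times n (Suc j) \<le> omega_power_times n j + (\<beta> + 1)"
   unfolding omega_power_times_Suc by (rule ord_add_mono_right[OF n])
  then show ?case using rank_B_Suc[OF assms(1,2) Suc] by (simp add: order_trans)
 qed
 show "omega_power_times n j \<le> \<kappa>" for j
 proof -
  have "(\<lambda>x. x) : cont_hom (subgrp PG (B j 0 0)) PG"
   using id_cont_hom_subgrp[of "B j 0 0" "carrier PG" PG] B_K subgrp_self[of PG] by auto
  then have "decomposition_rank (subgrp PG (B j 0 0)) \<le> \<kappa>"
   by (rule rank_mono[OF rank_K rank_closed_subgroup[OF closed_subgroup_B]]) auto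
  then show ?thesis using * order_trans by blast
 qed
qed

end

text \<open>The rank is a successor, and the lower bound is a limit ordinal, so the predecessor
  already reaches the lower bound; the upper bound makes it exact.\<close>

theorem rank_K:
 assumes "compactly_generated H.PG" "has_rank H.PG \<xi>" "\<xi> < omega ^ Suc n"
  and "\<beta> = 0 \<or> (\<exists>\<rho>. has_rank (Res H.PG) \<rho> \<and> 1 + \<beta> < \<rho>)" and "omega ^ n \<le> \<beta> + 1"
 shows "has_rank PG (omega ^ Suc n + 1)"
proof -
 obtain \<sigma> where \<sigma>: "\<sigma> \<le> omega ^ Suc n" "has_rank PG (\<sigma> + 1)" by (rule rank_K_exists[OF assms(2,3)])
 have "omega ^ Suc n \<le> \<sigma> + 1" by (rule rank_K_lower[OF \<sigma>(2) assms(1,4,5)])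
 then have "\<not> \<sigma> < omega ^ Suc n" using omega_power_add_closed[OF _ one_less_omega_power_Suc, of \<sigma> n] by (meson leD)
 then show ?thesis using \<sigma> by (simp add: order.order_iff_strict)
qed

end

section \<open>The alternating group on five points\<close>

type_synonym five = 5

abbreviation swap :: "'a => 'a => 'a => 'a" where
 "swap \<equiv> Transposition.transpose"

definition cyc :: "'a => 'a => 'a => 'a => 'a" where
 "cyc a b c = swap a b o swap b c"

definition Alt :: "('a => 'a) set" where
 "Alt = {p. permutation p \<and> evenperm p}"

lemma ex_five_notin: "length xs < 5 ==> \<exists>x :: five. x \<notin> set xs"
proof (rule ccontr)
 assume xs: "length xs < 5" "\<not> (\<exists>x :: five. x \<notin> set xs)"
 then have "set xs = UNIV" by auto
 then have "CARD(five) \<le> length xs" using card_length[of xs] by simp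
 then show False using xs(1) by simp
qed

lemma cyc_eq: "distinct [a, b, c] ==> cyc a b c x = (if x = a then b else if x = b then c else if x = c then a else x)"
 by (auto simp: cyc_def Transposition.transpose_def)

lemma cyc_comp:
 "distinct [a, b, c, d] ==> cyc b c d o cyc c b a = cyc a d b"
 "distinct [a, b, c] ==> cyc b a c o cyc c b a = cyc a b c"
 by (auto simp: fun_eq_iff cyc_def Transposition.transpose_def)

lemma cyc_Alt: "distinct [a, b, c] ==> cyc a b c : Alt"
 by (simp add: Alt_def cyc_def evenperm_comp evenperm_swap permutation_compose permutation_swap_id)

lemma cyc_cancel: "cyc c b a o cyc a b c = id" by (simp add: cyc_def fun_eq_iff Transposition.transpose_commute)

lemma cyc_inv: "distinct [a, b, c] ==> invp (cyc a b c) = cyc c b a"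
 by (rule inv_unique_comp) (simp_all add: cyc_cancel)

lemma cyc_conj: "bij s ==> distinct [a, b, c] ==> s o cyc a b c o invp s = cyc (s a) (s b) (s c)"
proof
 fix x assume s: "bij s" and d: "distinct [a, b, c]"
 obtain y where "x = s y" using s by (metis bij_pointE)
 then show "(s o cyc a b c o invp s) x = cyc (s a) (s b) (s c) x" using s d by (simp add: cyc_eq bij_is_inj inj_eq)
qed

lemma Alt_bij: "p : Alt ==> bij p" by (simp add: Alt_def permutation_bijective)
lemma Alt_comp: "p : Alt ==> q : Alt ==> p o q : Alt" by (simp add: Alt_def evenperm_comp permutation_compose)
lemma Alt_inv: "p : Alt ==> invp p : Alt" by (simp add: Alt_def evenperm_inv permutation_inverse)
lemma Alt_id: "id : Alt" by (simp add: Alt_def permutation_id)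

text \<open>Even permutations are products of pairs of transpositions. A pair sharing a point is the
  identity or a 3-cycle, and any other pair splits into two that share a point by inserting a
  transposition twice.\<close>

lemma Alt_from_cyc:
 assumes comp: "!!p q. p : N ==> q : N ==> p o q : N" and id: "id : N"
  and cyc: "!!a b c. distinct [a, b, c] ==> cyc a b c : N" shows "Alt \<subseteq> N"
proof
 have two: "swap a b o swap c d : N" if "a \<noteq> b" "c \<noteq> d" for a b c d
 proof -
  have "swap a b o swap b d : N" if "a \<noteq> b" "b \<noteq> d" for a b d
   using cyc[of a b d] that id unfolding cyc_def by (cases "a = d") (auto simp: Transposition.transpose_commute)
  note 1 = this
  show ?thesis
  proof (cases "b = c")
   case False
   have "(swap a b o swap b c) o (swap b c o swap c d) : N"
    by (rule comp[OF 1[of a b c] 1[of b c d]]) (use \<open>a \<noteq> b\<close> \<open>c \<noteq> d\<close> False in auto)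
   also have "(swap a b o swap b c) o (swap b c o swap c d) = swap a b o swap c d" by (simp add: fun_eq_iff)
   finally show ?thesis .
  qed (use 1 that in auto)
 qed
 have "(even n --> p : N) \<and> (odd n --> (\<forall>a b. a \<noteq> b --> swap a b o p : N))" if "swapidseq n p" for n p using that
 proof (induction rule: swapidseq.induct)
  case id
  then show ?case using assms(2) by (simp add: id_def)
 next
  case (comp_Suc n p a b)
  have "swap c d o (swap a b o p) : N" if "even n" "c \<noteq> d" for c d
   using comp[OF two[OF that(2) comp_Suc.hyps(2)]] comp_Suc.IH that by (auto simp: comp_assoc)
  note * = this
  show ?case
  proof (intro conjI impI allI)
   show "swap a b o p : N" if "even (Suc n)" using that comp_Suc by (metis even_Suc)
   show "swap c d o (swap a b o p) : N" if "odd (Suc n)" "c \<noteq> d" for c d using that * by simp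
  qed
 qed
 then show "p : N" if "p : Alt" for p
  using that evenperm_unique by (metis (mono_tags, lifting) Alt_def mem_Collect_eq permutation_def)
qed

text \<open>Swaps produce a permutation with the prescribed values; if it is odd, transposing the
  two points besides a, b, c corrects the parity.\<close>

lemma Alt_3_transitive:
 fixes a b c a' b' c' :: five
 assumes "distinct [a, b, c]" "distinct [a', b', c']"
 obtains p where "p : Alt" "p a = a'" "p b = b'" "p c = c'"
proof -
 define p1 where "p1 = swap a a'"
 define p2 where "p2 = swap (p1 b) b' o p1"
 define p where "p = swap (p2 c) c' o p2"
 have inj: "p1 x = p1 y \<longleftrightarrow> x = y" "p2 x = p2 y \<longleftrightarrow> x = y" for x y 
  by (metis p1_def transpose_involutory, metis p1_def p2_def comp_apply transpose_involutory)
 have 1: "p1 a = a'" by (simp add: p1_def)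
 then have "p1 b \<noteq> a'" using inj(1)[of b a] assms by auto
 then have 2: "p2 a = a'" "p2 b = b'" using 1 assms by (auto simp: p2_def)
 then have "p2 c \<noteq> a'" "p2 c \<noteq> b'" using inj(2)[of c a] inj(2)[of c b] assms by auto
 then have 3: "p a = a'" "p b = b'" "p c = c'" using 2 assms by (auto simp: p_def)
 have perm: "permutation p" by (simp add: p_def p2_def p1_def permutation_compose permutation_swap_id)
 obtain x where x: "x \<notin> {a, b, c}" using ex_five_notin[of "[a, b, c]"] by auto
 obtain y where y: "y \<notin> {a, b, c, x}" using ex_five_notin[of "[a, b, c, x]"] by auto
 show thesis
 proof (cases "evenperm p")
  case True
  then show thesis using that[of p] 3 perm by (simp add: Alt_def)
 next
  case False
  have "p o swap x y : Alt"
   using perm False x y by (auto simp: Alt_def evenperm_comp evenperm_swap permutation_compose permutation_swap_id)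
  then show thesis using that[of "p o swap x y"] 3 x y by auto
 qed
qed

text \<open>Commutators of s with 3-cycles stay in \<open>N\<close>. Either a suitable one is again
  a 3-cycle or s is one, and all 3-cycles are conjugate in \<open>Alt\<close>.\<close>

lemma Alt_five_simple:
 fixes N :: "(five => five) set"
 assumes comp: "!!p q. p : N ==> q : N ==> p o q : N" and conj: "!!p q. p : Alt ==> q : N ==> p o q o invp p : N"
  and inv: "!!p. p : N ==> invp p : N" and sub: "N \<subseteq> Alt" and s: "s : N" "s \<noteq> id" shows "N = Alt"
proof -
 have inj: "p x = p y \<longleftrightarrow> x = y" if "p : N" for p x y using that sub by (metis Alt_bij bij_is_inj inj_eq subsetD)
 have bs: "bij s" using s(1) sub Alt_bij by blast
 have comm: "s o cyc a b c o invp s o cyc c b a : N" if "distinct [a, b, c]" for a b c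
 proof -
  have "s o (cyc a b c o invp s o invp (cyc a b c)) : N"
   by (rule comp[OF s(1) conj[OF cyc_Alt[OF that] inv[OF s(1)]]])
  then show ?thesis using cyc_inv[OF that] by (simp add: comp_assoc)
 qed
 have comm': "cyc (s a) (s b) (s c) o cyc c b a : N" if "distinct [a, b, c]" for a b c
  using comm[OF that] unfolding cyc_conj[OF bs that] .
 have case1: "\<exists>a b c. distinct [a, b, c] \<and> cyc a b c : N" if s2: "s a \<noteq> a" "s (s a) \<noteq> a" for a
 proof -
  define b c d where bcd: "b = s a" "c = s b" "d = s c"
  have dist: "distinct [a, b, c]" "d \<noteq> b" "d \<noteq> c" using s2 inj[OF s(1)] by (auto simp: bcd)
  have *: "cyc b c d o cyc c b a : N" using comm'[OF dist(1)] by (simp flip: bcd)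
  show ?thesis
  proof (cases "d = a")
   case False
   have "cyc b c d o cyc c b a = cyc a d b" using dist False by (intro cyc_comp(1)) auto
   then show ?thesis using * dist False by (intro exI[of _ a] exI[of _ d] exI[of _ b]) auto
  next
   case True
   \<comment> \<open>Here s permutes a, b, c cyclically. Cancelling this cycle leaves an even
     permutation that fixes three of the five points, hence the identity, so s is itself a
     3-cycle.\<close>
   let ?r = "s o cyc c b a"
   have r: "?r : Alt" using s(1) sub cyc_Alt[of c b a] dist by (intro Alt_comp) auto
   have fixed: "?r a = a" "?r b = b" "?r c = c" using dist True by (auto simp: cyc_eq simp flip: bcd)
   have "?r = id"
   proof (rule ccontr)
    assume "?r \<noteq> id"
    then obtain x where x: "?r x \<noteq> x" by (auto simp: fun_eq_iff)
    define y where "y = ?r x"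
    have ir: "?r u = ?r w \<longleftrightarrow> u = w" for u w using Alt_bij[OF r] by (metis bij_is_inj inj_eq)
    have xy: "distinct [a, b, c, x, y]" using x fixed dist ir[of x a] ir[of x b] ir[of x c] unfolding y_def by auto
    then have U: "UNIV = {a, b, c, x, y}" by (intro card_subset_eq[symmetric]) auto
    have "?r y \<noteq> a" "?r y \<noteq> b" "?r y \<noteq> c" "?r y \<noteq> y"
     using xy fixed ir[of y a] ir[of y b] ir[of y c] ir[of y x] unfolding y_def by auto
    then have "?r y = x" using U by auto
    then have "?r z = swap x y z" for z
     using U fixed xy y_def by (cases "z : {a, b, c}") (auto simp: Transposition.transpose_def)
    then have "?r = swap x y" by blast
    then show False using r xy by (auto simp: Alt_def evenperm_swap)
   qed
   then have "?r o cyc a b c = cyc a b c" by simp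
   then have "s = cyc a b c" by (simp only: comp_assoc cyc_cancel comp_id)
   then show ?thesis using s(1) dist by blast
  qed
 qed
 obtain a where a: "s a \<noteq> a" using s(2) by (auto simp: fun_eq_iff)
 have "\<exists>a b c. distinct [a, b, c] \<and> cyc a b c : N"
 proof (cases "s (s a) = a")
  case False
  then show ?thesis using case1 a by blast
 next
  case True
  \<comment> \<open>With s exchanging a and s a, a fixed point e makes the commutator with the
    3-cycle on a, s a, e a 3-cycle. If s has no orbit of length above two, a fixed point exists
    because five is odd.\<close>
  have fix_case: ?thesis if "s e = e" for e
  proof -
   have d: "distinct [a, s a, e]" using a that True by auto
   then have "cyc (s a) a e o cyc e (s a) a = cyc a (s a) e" by (rule cyc_comp(2))
   moreover have "cyc (s a) a e o cyc e (s a) a : N" using comm'[OF d] True that by simp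
   ultimately show ?thesis using d by metis
  qed
  obtain x where x: "x \<notin> {a, s a}" using ex_five_notin[of "[a, s a]"] by auto
  show ?thesis
  proof (cases "s x = x \<or> s (s x) \<noteq> x")
   case True
   then show ?thesis using fix_case case1 by blast
  next
   case False
   have "s x \<noteq> a" "s x \<noteq> s a" using x inj[OF s(1)] \<open>s (s a) = a\<close> by auto
   then have d: "distinct [a, s a, x, s x]" using a x False by auto
   obtain e where e: "e \<notin> {a, s a, x, s x}" using ex_five_notin[of "[a, s a, x, s x]"] by auto
   then have "UNIV = {a, s a, x, s x, e}" using d by (intro card_subset_eq[symmetric]) auto
   moreover have "s e \<notin> {a, s a, x, s x}" using e inj[OF s(1)] True False by auto
   ultimately have "s e = e" by auto
   then show ?thesis by (rule fix_case)
  qed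
 qed
 then obtain a b c where abc: "distinct [a, b, c]" "cyc a b c : N" by blast
 have "cyc a' b' c' : N" if d: "distinct [a', b', c']" for a' b' c'
 proof -
  obtain p where p: "p : Alt" "p a = a'" "p b = b'" "p c = c'" by (rule Alt_3_transitive[OF abc(1) d])
  then show ?thesis using conj[OF p(1) abc(2)] cyc_conj[OF Alt_bij[OF p(1)] abc(1)] by simp
 qed
 moreover have "id : N" using comp[OF s(1) inv[OF s(1)]] s(1) sub Alt_bij by (metis bij_is_surj subsetD surj_iff)
 ultimately have "Alt \<subseteq> N" using comp by (intro Alt_from_cyc)
 then show ?thesis using sub by blast
qed

text \<open>A 3-cycle that moves y and fixes s y cannot commute with s.\<close>

lemma Alt_five_centerless:
 fixes s :: "five => five"
 assumes "s : Alt" "s \<noteq> id"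
 obtains t where "t : Alt" "s o t o invp s o invp t \<noteq> id"
proof -
 obtain y where y: "s y \<noteq> y" using assms(2) by (auto simp: fun_eq_iff)
 obtain u where u: "u \<notin> {y, s y}" using ex_five_notin[of "[y, s y]"] by auto
 obtain w where w: "w \<notin> {y, s y, u}" using ex_five_notin[of "[y, s y, u]"] by auto
 have d: "distinct [y, u, w]" using u w by auto
 have "s o cyc y u w o invp s o invp (cyc y u w) \<noteq> id"
 proof
  assume e: "s o cyc y u w o invp s o invp (cyc y u w) = id"
  have bs: "bij s" "bij (cyc y u w)" using Alt_bij[OF assms(1)] Alt_bij[OF cyc_Alt[OF d]] .
  have "(s o cyc y u w o invp s o invp (cyc y u w)) (cyc y u w (s y)) = cyc y u w (s y)" unfolding e by simp
  then have "s (cyc y u w y) = cyc y u w (s y)" using bs by (simp add: bij_is_inj)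
  then have "s u = s y" using d u w y by (auto simp: cyc_eq split: if_splits)
  then show False using bs(1) u by (auto simp: bij_is_inj inj_eq)
 qed
 then show thesis by (rule that[OF cyc_Alt[OF d]])
qed

section \<open>Gluing five copies of a group along its degree map\<close>

text \<open>The residual of any open subgroup lies in the residual of the group and hence in
  \<open>N\<close>, so one step of the recursion ends inside \<open>N\<close>.\<close>

lemma (in tdlc) rank_open_normal:
 assumes "N \<lhd> G" "openin (gtop G) N" "has_rank (subgrp G N) \<alpha>"
 obtains \<gamma> where "\<gamma> \<le> \<alpha> + 1" "has_rank G \<gamma>"
proof -
 have "discrete_residual G \<subseteq> N" using assms(1,2) by (auto simp: discrete_residual_def)
 then have "\<exists>\<gamma>\<le>\<alpha> + 1. has_rank G \<gamma>"
  using residual_mono by (intro rank_exists_le rank_residual_subset[OF _ _ assms(3)]) blast+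
 then show thesis using that by blast
qed

text \<open>Neighbourhoods are formed inside cosets of \<open>U\<close>, so for a subgroup
  containing \<open>U\<close> the subspace topology is the one formed from the subgroup
  itself.\<close>

lemma (in perm_pair) subgroup_above_U:
 assumes "subgroup K PG" "U \<subseteq> K" shows "open_subgroup K PG" "subgrp PG K = perm_group K U"
proof -
 show o: "open_subgroup K PG" by (rule open_subgroup_PG[OF assms(1), of "{}"]) (use assms in \<open>auto simp: small_def\<close>)
 note K = PG_subgroupD[OF assms(1)]
 have "subtopology (perm_topology G U) K = perm_topology K U" unfolding topology_eq
 proof
  fix S
  have "openin (subtopology (perm_topology G U) K) S \<longleftrightarrow> openin (perm_topology G U) S \<and> S \<subseteq> K"
   using o by (simp add: open_subgroup_def openin_open_subtopology)
  also have "\<dots> \<longleftrightarrow> openin (perm_topology K U) S"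
  proof -
   have "f : K" if "g : K" "f : G" "invp g o f : U" for f g
   proof -
    have "g o (invp g o f) : K" using K(3) that assms(2) by blast
    then show ?thesis using that(1) K(1) by (simp add: comp_assoc[symmetric] subset_iff)
   qed
   then show ?thesis unfolding openin_perm_topology using K(1) by (metis (no_types, lifting) subset_iff)
  qed
  finally show "openin (subtopology (perm_topology G U) K) S = openin (perm_topology K U) S" .
 qed
 then show "subgrp PG K = perm_group K U" by (simp add: subgrp_def perm_group_def)
qed

definition wr :: "('i => 'y => 'y) => ('i => 'i) => 'y \<times> 'i => 'y \<times> 'i" where
 "wr g p = (\<lambda>(x, i). (g i x, p i))"

lemma wr_apply [simp]: "wr g p (x, i) = (g i x, p i)" by (simp add: wr_def)

lemma wr_comp: "wr g p o wr h q = wr (\<lambda>i. g (q i) o h i) (p o q)" by (simp add: wr_def fun_eq_iff)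

lemma wr_id: "wr (\<lambda>_. id) id = id" by (simp add: wr_def fun_eq_iff)

lemma wr_eq_iff: "wr g p = wr h q \<longleftrightarrow> g = h \<and> p = q"
proof
 assume e: "wr g p = wr h q"
 then have "g i x = h i x \<and> p i = q i" for i x using fun_cong[OF e, of "(x, i)"] by (metis wr_apply prod.inject)
 then show "g = h \<and> p = q" by (auto simp: fun_eq_iff)
qed auto

lemma wr_inv:
 assumes "bij p" "!!i. bij (g i)" shows "bij (wr g p)" "invp (wr g p) = wr (\<lambda>i. invp (g (invp p i))) (invp p)"
proof -
 have "p (invp p i) = i" "invp p (p i) = i" "g j (invp (g j) x) = x" "invp (g j) (g j x) = x" for i j x
  using assms by (simp_all add: bij_is_surj bij_is_inj surj_f_inv_f)
 then have "wr g p o wr (\<lambda>i. invp (g (invp p i))) (invp p) = id"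
  "wr (\<lambda>i. invp (g (invp p i))) (invp p) o wr g p = id" by (simp_all add: wr_def fun_eq_iff)
 then show "bij (wr g p)" "invp (wr g p) = wr (\<lambda>i. invp (g (invp p i))) (invp p)"
  using o_bij inv_unique_comp by blast+
qed

text \<open>Mutually inverse entries in two coordinates have opposite degrees, which makes these the
  basic elements of total degree 0.\<close>

definition pair :: "'i => 'i => ('y => 'y) => 'i => 'y => 'y" where
 "pair j z g = (\<lambda>i. if i = j then g else if i = z then invp g else id)"

definition single :: "'i => ('y => 'y) => 'i => 'y => 'y" where
 "single j g = (\<lambda>i. if i = j then g else id)"

text \<open>An abstraction of the extension by the shift that also covers the integers. The part of
  degree 0 is contained in every closed normal subgroup with abelian quotient
  (\<open>commutators\<close>) and in every open normal subgroup (\<open>open_normalized\<close>);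
  \<open>C_generates\<close> produces it from a compact set by conjugation with powers of t.\<close>

locale glue = perm_pair \<G> U for \<G> U :: "('y => 'y) set" +
 fixes deg :: "('y => 'y) => int" and t :: "'y => 'y" and C :: "('y => 'y) set"
 assumes deg_comp: "[|g : \<G>; h : \<G>|] ==> deg (g o h) = deg g + deg h" and t: "t : \<G>" "deg t = 1"
  and deg_U: "u : U ==> deg u = 0" and core: "[|g : \<G>; !!h. h : \<G> ==> invp h o g o h : U|] ==> g = id"
  and commutators: "[|subgroup N (perm_group \<G> U); closedin (perm_topology \<G> U) N;
    !!g n. g : \<G> ==> n : N ==> g o n o invp g : N;
    !!g h. g : \<G> ==> h : \<G> ==> g o h o invp g o invp h : N|] ==> {g : \<G>. deg g = 0} \<subseteq> N"
  and C: "compactin (perm_topology \<G> U) C" "C \<subseteq> {g : \<G>. deg g = 0}"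
  and C_generates: "[|subgroup N (perm_group \<G> U); C \<subseteq> N;
    !!n. n : N ==> t o n o invp t : N; !!n. n : N ==> invp t o n o t : N|] ==> {g : \<G>. deg g = 0} \<subseteq> N"
  and open_normalized: "[|open_subgroup N (perm_group \<G> U);
    !!g n. g : \<G> ==> n : N ==> g o n o invp g : N|] ==> {g : \<G>. deg g = 0} \<subseteq> N"
begin

abbreviation "K \<equiv> {g : \<G>. deg g = 0}"

definition W :: "('y \<times> five => 'y \<times> five) set" where
 "W = {wr g p |g p. p : Alt \<and> (\<forall>i. g i : \<G>) \<and> (\<Sum>i\<in>UNIV. deg (g i)) = 0}"

definition WU :: "('y \<times> five => 'y \<times> five) set" where
 "WU = {wr g p |g p. p : Alt \<and> (\<forall>i. g i : U)}"

lemma wr_W_iff [simp]: "wr g p : W \<longleftrightarrow> p : Alt \<and> (\<forall>i. g i : \<G>) \<and> (\<Sum>i\<in>UNIV. deg (g i)) = 0"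
 by (auto simp: W_def wr_eq_iff)

lemma wr_WU_iff [simp]: "wr g p : WU \<longleftrightarrow> p : Alt \<and> (\<forall>i. g i : U)" by (auto simp: WU_def wr_eq_iff)

lemma W_cases: "x : W ==> (!!g p. [|x = wr g p; p : Alt; !!i. g i : \<G>; (\<Sum>i\<in>UNIV. deg (g i)) = 0|] ==> thesis) ==> thesis"
 by (auto simp: W_def)

lemma WU_cases: "x : WU ==> (!!g p. [|x = wr g p; p : Alt; !!i. g i : U|] ==> thesis) ==> thesis"
 by (auto simp: WU_def)

lemma deg_id [simp]: "deg id = 0" using deg_U U_id by simp

lemma deg_inv: "g : \<G> ==> deg (invp g) = - deg g" using deg_comp[of "invp g" g] invp by simp

lemma sum_Alt: "p : Alt ==> (\<Sum>i\<in>UNIV. f (p i)) = (\<Sum>i\<in>UNIV. f i :: int)" for p :: "five => five"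
 by (rule sum.reindex_bij_betw) (rule Alt_bij)

lemma W_comp:
 assumes "x : W" "y : W" shows "x o y : W"
proof -
 obtain g p where g: "x = wr g p" "p : Alt" "!!i. g i : \<G>" "(\<Sum>i\<in>UNIV. deg (g i)) = 0" by (rule W_cases[OF assms(1)]) (rule that)
 obtain h q where h: "y = wr h q" "q : Alt" "!!i. h i : \<G>" "(\<Sum>i\<in>UNIV. deg (h i)) = 0" by (rule W_cases[OF assms(2)]) (rule that)
 have "(\<Sum>i\<in>UNIV. deg (g (q i) o h i)) = (\<Sum>i\<in>UNIV. deg (g (q i))) + (\<Sum>i\<in>UNIV. deg (h i))"
  using g h by (simp add: deg_comp sum.distrib)
 also have "(\<Sum>i\<in>UNIV. deg (g (q i))) = 0" using sum_Alt[OF h(2), of "\<lambda>i. deg (g i)"] g(4) by simp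
 finally have "(\<Sum>i\<in>UNIV. deg (g (q i) o h i)) = 0" unfolding h(4) by (simp only: add_0_left)
 then show ?thesis unfolding g(1) h(1) wr_comp wr_W_iff by (intro conjI allI Alt_comp g(2) h(2) comp g(3) h(3))
qed

lemma W_wr_inv:
 assumes "p : Alt" "!!i. g i : \<G>" shows "invp (wr g p) = wr (\<lambda>i. invp (g (invp p i))) (invp p)"
 by (rule wr_inv(2)) (use assms Alt_bij bij in auto)

lemma W_inv:
 assumes "x : W" shows "invp x : W"
proof -
 obtain g p where g: "x = wr g p" "p : Alt" "!!i. g i : \<G>" "(\<Sum>i\<in>UNIV. deg (g i)) = 0" by (rule W_cases[OF assms(1)]) (rule that)
 have "(\<Sum>i\<in>UNIV. deg (invp (g (invp p i)))) = - (\<Sum>i\<in>UNIV. deg (g (invp p i)))" using g by (simp add: deg_inv sum_negf)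
 also have "\<dots> = 0" using sum_Alt[OF Alt_inv[OF g(2)], of "\<lambda>i. deg (g i)"] g(4) by simp
 finally show ?thesis using g by (simp add: W_wr_inv invp Alt_inv)
qed

lemma W_bij: "x : W ==> bij x" by (elim W_cases) (simp add: wr_inv(1) Alt_bij bij)

lemma WU_sub: "WU \<subseteq> W" by (auto simp: WU_def U_mem deg_U)

lemma WU_comp: "x : WU ==> y : WU ==> x o y : WU" by (elim WU_cases) (simp add: wr_comp U_comp Alt_comp)

lemma WU_inv: "x : WU ==> invp x : WU" by (elim WU_cases) (simp add: W_wr_inv U_mem U_invp Alt_inv)

lemma perm_pair_W: "perm_pair W WU"
proof
 show "bij x" if "x : W" for x by (rule W_bij[OF that])
 show "x o y : W" if "x : W" "y : W" for x y by (rule W_comp[OF that])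
 show "invp x : W" if "x : W" for x by (rule W_inv[OF that])
 show "WU \<subseteq> W" by (rule WU_sub)
 show "id : WU" using wr_WU_iff[of "\<lambda>_. id" id] by (simp add: wr_id Alt_id U_id)
 show "x o y : WU" if "x : WU" "y : WU" for x y by (rule WU_comp[OF that])
 show "invp x : WU" if "x : WU" for x by (rule WU_inv[OF that])
 show "\<exists>F. finite F \<and> (\<forall>u\<in>WU. (\<forall>y\<in>F. u y = y) --> invp x o u o x : WU)" if x: "x : W" for x
 proof -
  obtain g p where g: "x = wr g p" "p : Alt" "!!i. g i : \<G>" by (rule W_cases[OF x]) (rule that)
  have "\<exists>F. finite F \<and> (\<forall>u\<in>U. (\<forall>y\<in>F. u y = y) --> invp (g i) o u o g i : U)" for i by (rule commensurated[OF g(3)])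
  then obtain F where F: "!!i. finite (F i)" "!!i u. u : U ==> \<forall>y\<in>F i. u y = y ==> invp (g i) o u o g i : U" by metis
  \<comment> \<open>Fixing one point in each of the five copies forces the permutation part to be
    trivial.\<close>
  let ?F = "(\<Union>i. F i \<times> {p i}) \<union> {undefined} \<times> UNIV"
  have "invp x o v o x : WU" if v: "v : WU" "\<forall>y\<in>?F. v y = y" for v
  proof -
   obtain u q where u: "v = wr u q" "q : Alt" "!!i. u i : U" by (rule WU_cases[OF v(1)]) (rule that)
   have "v (undefined, i) = (undefined, i)" for i using v(2) by blast
   then have q: "q = id" using u(1) by (simp add: fun_eq_iff)
   have "invp (g i) o u (p i) o g i : U" for i
   proof (rule F(2)[OF u(3)], rule ballI)
    fix y assume "y : F i"
    then have "v (y, p i) = (y, p i)" using v(2) by blast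
    then show "u (p i) y = y" using u(1) by simp
   qed
   moreover have "invp p (p i) = i" for i using Alt_bij[OF g(2)] by (simp add: bij_is_inj)
   ultimately show ?thesis using g u q Alt_comp[OF Alt_inv[OF g(2)] g(2)] by (simp add: W_wr_inv wr_comp)
  qed
  moreover have "finite ?F" using F(1) by auto
  ultimately show ?thesis by (intro exI[of _ ?F]) simp
 qed
 show "finite ((\<lambda>u. u y) ` WU)" for y
 proof -
  have "(\<lambda>u. u y) ` WU \<subseteq> (\<lambda>u. u (fst y)) ` U \<times> UNIV" by (cases y) (auto simp: WU_def)
  then show ?thesis using U_orbits finite_subset by (metis finite finite_cartesian_product)
 qed
 show "f : WU" if f: "!!F. finite F ==> \<exists>u\<in>WU. \<forall>y\<in>F. u y = f y" for f
 proof -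
  define p where "p i = snd (f (undefined, i))" for i
  define g where "g i x = fst (f (x, i))" for i x
  have app: "\<exists>u. (\<forall>i. u i : U) \<and> p : Alt \<and> (\<forall>i. \<forall>x\<in>F. f (x, i) = (u i x, p i))" if F: "finite F" for F
  proof -
   obtain v where v: "v : WU" "\<forall>y\<in>insert undefined F \<times> UNIV. v y = f y" using f[of "insert undefined F \<times> UNIV"] F by auto
   obtain u q where u: "v = wr u q" "q : Alt" "!!i. u i : U" by (rule WU_cases[OF v(1)]) (rule that)
   have *: "f (x, i) = (u i x, q i)" if "x : insert undefined F" for x i
    using v(2) u(1) that by (metis SigmaI UNIV_I wr_apply)
   have "q = p" using *[of undefined] by (simp add: p_def fun_eq_iff)
   then show ?thesis using * u by (intro exI[of _ u]) auto
  qed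
  have "g i : U" for i
  proof (rule U_closed)
   show "\<exists>u\<in>U. \<forall>y\<in>F. u y = g i y" if "finite F" for F using app[OF that] unfolding g_def by (metis fst_conv)
  qed
  moreover have "p : Alt" using app[of "{}"] by auto
  moreover have "f = wr g p"
  proof
   fix y :: "'y \<times> five"
   obtain x i where y: "y = (x, i)" by (cases y)
   show "f y = wr g p y" using app[of "{x}"] by (auto simp: y g_def)
  qed
  ultimately show ?thesis by simp
 qed
 show "countable (UNIV :: ('y \<times> five) set)"
  using countable_points by (simp flip: UNIV_Times_UNIV add: countable_finite)
 obtain D where D: "countable D" "D \<subseteq> \<G>" "!!g. g : \<G> ==> \<exists>d\<in>D. invp d o g : U" using countable_cosets by blast
 let ?D = "W \<inter> (\<lambda>g. wr g id) ` (Pi\<^sub>E UNIV (\<lambda>_. D))"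
 have "countable ?D" using countable_PiE[of UNIV "\<lambda>_ :: five. D"] D(1) by auto
 moreover have "\<exists>d\<in>?D. invp d o x : WU" if x: "x : W" for x
 proof -
  obtain g p where g: "x = wr g p" "p : Alt" "!!i. g i : \<G>" "(\<Sum>i\<in>UNIV. deg (g i)) = 0" by (rule W_cases[OF x]) (rule that)
  obtain d where d: "!!i. d i : D" "!!i. invp (d i) o g (invp p i) : U" using D(3)[OF g(3)[of "invp p _"]] by metis
  have dG: "d i : \<G>" for i using d D(2) by auto
  have "deg (invp (d i) o g (invp p i)) = 0" for i using deg_U d(2) .
  then have "deg (d i) = deg (g (invp p i))" for i using deg_comp[OF invp[OF dG] g(3)] deg_inv[OF dG] by (metis add.commute add.right_neutral diff_add_cancel minus_add_cancel)
  then have "(\<Sum>i\<in>UNIV. deg (d i)) = 0" using sum_Alt[OF Alt_inv[OF g(2)], of "\<lambda>i. deg (g i)"] g(4) by simp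
  then have "wr d id : ?D" using d(1) dG Alt_id by auto
  moreover have "invp (d (p i)) o g i : U" for i using d(2)[of "p i"] Alt_bij[OF g(2)] by (simp add: bij_is_inj)
  then have "invp (wr d id) o x : WU" using g dG by (simp add: W_wr_inv[OF Alt_id] wr_comp)
  ultimately show ?thesis by blast
 qed
 ultimately show "\<exists>D. countable D \<and> D \<subseteq> W \<and> (\<forall>g\<in>W. \<exists>d\<in>D. invp d o g : WU)" by (intro exI[of _ ?D]) auto
qed

sublocale W: perm_pair W WU by (rule perm_pair_W)

end

lemma Alt_2_transitive:
 fixes a b a' b' :: five
 assumes "a \<noteq> b" "a' \<noteq> b'"
 obtains p where "p : Alt" "p a = a'" "p b = b'"
proof -
 obtain c where c: "c \<notin> {a, b}" using ex_five_notin[of "[a, b]"] by auto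
 obtain c' where c': "c' \<notin> {a', b'}" using ex_five_notin[of "[a', b']"] by auto
 have "distinct [a, b, c]" "distinct [a', b', c']" using assms c c' by auto
 from Alt_3_transitive[OF this] show thesis using that by metis
qed

section \<open>Generation of the glued group\<close>

context glue
begin

lemma subgroup_K: "subgroup K PG" by (rule subgroup_PGI) (auto simp: deg_comp deg_inv comp invp id_mem)

lemma U_K: "U \<subseteq> K" using U_mem deg_U by auto

lemmas K_open = subgroup_above_U[OF subgroup_K U_K]

lemma perm_pair_K: "perm_pair K U"
proof
 note K' = PG_subgroupD[OF subgroup_K]
 show "bij g" if "g : K" for g using that bij by simp
 show "g o h : K" if "g : K" "h : K" for g h by (rule K'(3)[OF that])
 show "invp g : K" if "g : K" for g by (rule K'(4)[OF that])
 show "\<exists>F. finite F \<and> (\<forall>u\<in>U. (\<forall>y\<in>F. u y = y) --> invp h o u o h : U)" if "h : K" for h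
  using commensurated[of h] that by simp
 obtain D where D: "countable D" "D \<subseteq> \<G>" "\<forall>g\<in>\<G>. \<exists>d\<in>D. invp d o g : U" using countable_cosets by blast
 have "\<exists>d\<in>D \<inter> K. invp d o g : U" if g: "g : K" for g
 proof -
  obtain d where d: "d : D" "invp d o g : U" using D(3) g by auto
  have dG: "d : \<G>" using d(1) D(2) by auto
  have "deg (invp d o g) = 0" by (rule deg_U[OF d(2)])
  then have "deg d = 0" using g deg_comp[OF invp[OF dG], of g] deg_inv[OF dG] by simp
  then show ?thesis using d dG by (intro bexI[of _ d]) auto
 qed
 then show "\<exists>D. countable D \<and> D \<subseteq> K \<and> (\<forall>g\<in>K. \<exists>d\<in>D. invp d o g : U)" using D(1) by (intro exI[of _ "D \<inter> K"]) auto
qed (use U_K U_id U_comp U_invp U_orbits U_closed countable_points in auto)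

text \<open>Multiplication by t or its inverse moves every degree step by step to 0.\<close>

lemma deg_total:
 assumes "K \<subseteq> S" "t : S" "invp t : S" "!!g h. g : S ==> h : S ==> g o h : S" shows "\<G> \<subseteq> S"
proof -
 have "\<forall>x\<in>\<G>. deg x = m --> x : S" for m
 proof (induction m rule: int_induct[of _ 0])
  case base
  then show ?case using assms(1) by auto
 next
  case (step1 m)
  have "x : S" if x: "x : \<G>" "deg x = m + 1" for x
  proof -
   have "deg (invp t o x) = m" using deg_comp[OF invp[OF t(1)] x(1)] deg_inv[OF t(1)] t(2) x(2) by simp
   then have "invp t o x : S" using step1.IH comp[OF invp[OF t(1)] x(1)] by blast
   then have "t o (invp t o x) : S" by (rule assms(4)[OF assms(2)])
   then show ?thesis using t by (simp add: comp_assoc[symmetric])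
  qed
  then show ?case by blast
 next
  case (step2 m)
  have "x : S" if x: "x : \<G>" "deg x = m - 1" for x
  proof -
   have "deg (t o x) = m" using deg_comp[OF t(1) x(1)] t(2) x(2) by simp
   then have "t o x : S" using step2.IH comp[OF t(1) x(1)] by blast
   then have "invp t o (t o x) : S" by (rule assms(4)[OF assms(3)])
   then show ?thesis using t by (simp add: comp_assoc[symmetric])
  qed
  then show ?case by blast
 qed
 then show ?thesis by blast
qed

abbreviation "sg j k \<equiv> wr (single j k) (id :: five => five)"
abbreviation "pr j z k \<equiv> wr (pair j z k) (id :: five => five)"
abbreviation "pm p \<equiv> wr (\<lambda>_. id :: 'y => 'y) (p :: five => five)"

lemma pm_id: "pm id = id" by (rule wr_id)

lemma invp_invp [simp]: "g : \<G> ==> invp (invp g) = g" using bij by (simp add: inv_inv_eq)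

lemma invp_id [simp]: "invp id = id" by (rule inv_id)

lemma inv_wr_id: "(!!i. g i : \<G>) ==> invp (wr g (id :: five => five)) = wr (\<lambda>i. invp (g i)) id"
 using W_wr_inv[OF Alt_id, of g] by simp

lemma sg_W: "k : K ==> sg j k : W"
proof -
 assume "k : K"
 then have "deg (single j k i) = 0" for i :: five by (simp add: single_def)
 then show ?thesis using \<open>k : K\<close> id_mem by (simp add: Alt_id single_def)
qed

lemma pr_W: "g : \<G> ==> j \<noteq> z ==> pr j z g : W"
proof -
 assume g: "g : \<G>" "j \<noteq> z"
 have "deg (pair j z g i) = (if i = j then deg g else 0) + (if i = z then - deg g else 0)" for i :: five
  using g by (simp add: pair_def deg_inv)
 then have "(\<Sum>i\<in>UNIV. deg (pair j z g i)) = 0" by (simp add: sum.distrib)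
 then show ?thesis using g id_mem invp by (simp add: Alt_id pair_def)
qed

lemma pm_W: "p : Alt ==> pm p : W" by (simp add: id_mem)

lemma inv_pr: "g : \<G> ==> invp (pr j z g) = pr j z (invp g)"
proof -
 assume g: "g : \<G>"
 then have "invp (pr j z g) = wr (\<lambda>i. invp (pair j z g i)) id" using id_mem invp by (intro inv_wr_id) (simp add: pair_def)
 also have "(\<lambda>i. invp (pair j z g i)) = pair j z (invp g)" using g by (auto simp: pair_def fun_eq_iff)
 finally show ?thesis .
qed

lemma inv_sg: "g : \<G> ==> invp (sg j g) = sg j (invp g)"
proof -
 assume g: "g : \<G>"
 then have "invp (sg j g) = wr (\<lambda>i. invp (single j g i)) id" using id_mem by (intro inv_wr_id) (simp add: single_def)
 also have "(\<lambda>i. invp (single j g i)) = single j (invp g)" by (auto simp: single_def fun_eq_iff)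
 finally show ?thesis .
qed

lemma sg_comp: "sg j g o sg j h = sg j (g o h)" by (simp add: wr_comp wr_eq_iff) (auto simp: single_def fun_eq_iff)

lemma pr_conj_sg: "g : \<G> ==> j \<noteq> z ==> pr j z g o sg j k o invp (pr j z g) = sg j (g o k o invp g)"
 by (simp add: inv_pr wr_comp wr_eq_iff) (auto simp: single_def pair_def fun_eq_iff)

lemma pm_conj:
 assumes "p : Alt" shows "pm p o wr g id o invp (pm p) = wr (\<lambda>i. g (invp p i)) id"
proof -
 have "invp (pm p) = wr (\<lambda>i. id) (invp p)" using W_wr_inv[OF assms, of "\<lambda>_. id"] id_mem by simp
 moreover have "p o invp p = id" using Alt_bij[OF assms] by (simp add: bij_is_surj surj_iff[THEN iffD1])
 ultimately show ?thesis by (simp add: wr_comp)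
qed

lemma pm_conj_sg: "p : Alt ==> pm p o sg j k o invp (pm p) = sg (p j) k"
proof -
 assume p: "p : Alt"
 have "invp p i = j \<longleftrightarrow> i = p j" for i using Alt_bij[OF p] by (metis bij_inv_eq_iff)
 then show ?thesis unfolding pm_conj[OF p] by (simp add: single_def cong: if_cong)
qed

lemma pm_conj_pr: "p : Alt ==> pm p o pr j z k o invp (pm p) = pr (p j) (p z) k"
proof -
 assume p: "p : Alt"
 have "invp p i = j \<longleftrightarrow> i = p j" for i j using Alt_bij[OF p] by (metis bij_inv_eq_iff)
 then show ?thesis unfolding pm_conj[OF p] by (simp add: pair_def cong: if_cong)
qed

lemma base_subset:
 assumes N: "subgroup N W.PG" and sg: "!!j k. k : K ==> sg j k : N" and r: "!!i. r i : K"
 shows "wr r (id :: five => five) : N"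
proof -
 have "\<forall>r. (\<forall>i. r i : K) --> (\<forall>i. i \<notin> S --> r i = id) --> wr r (id :: five => five) : N" if "finite S" for S :: "five set"
  using that
 proof (induction S rule: finite_induct)
  case empty
  have "wr r id : N" if "\<forall>i. i \<notin> {} --> r i = id" for r :: "five => 'y => 'y"
  proof -
   have "r = (\<lambda>_. id)" using that by blast
   then show ?thesis using W.PG_subgroupD(2)[OF N] pm_id by metis
  qed
  then show ?case by blast
 next
  case (insert j S)
  show ?case
  proof (intro allI impI)
   fix r :: "five => 'y => 'y" assume r: "\<forall>i. r i : K" "\<forall>i. i \<notin> insert j S --> r i = id"
   have "\<forall>i. (r(j := id)) i : K" "\<forall>i. i \<notin> S --> (r(j := id)) i = id" using r id_mem by auto
   then have "wr (r(j := id)) (id :: five => five) : N" using insert.IH by blast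
   then have "wr (r(j := id)) (id :: five => five) o sg j (r j) : N" using sg r(1) W.PG_subgroupD(3)[OF N] by blast
   also have "wr (r(j := id)) (id :: five => five) o sg j (r j) = wr r id"
    by (simp add: wr_comp wr_eq_iff) (auto simp: single_def fun_eq_iff)
   finally show "wr r (id :: five => five) : N" .
  qed
 qed
 from this[of UNIV] show ?thesis using r by simp
qed

text \<open>After division by an element of \<open>N\<close> with the same permutation part,
  elements \<open>pr j 0 x\<close> clear the coordinates other than 0 one at a time. The last
  coordinate then has degree 0 because the total degree is 0.\<close>

lemma subgroup_total:
 assumes N: "subgroup N W.PG" and sg: "!!j k. k : K ==> sg j k : N"
  and pr: "!!j z. j \<noteq> z ==> pr j z t : N" and onto: "!!p. p : Alt ==> \<exists>g. wr g p : N" shows "N = W"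
proof
 note N' = W.PG_subgroupD[OF N]
 show "N \<subseteq> W" by (rule N')
 have all_pr: "pr j z x : N" if "x : \<G>" "j \<noteq> z" for j z x
 proof -
  have "\<G> \<subseteq> {x : \<G>. pr j z x : N}"
  proof (rule deg_total)
   show "K \<subseteq> {x : \<G>. pr j z x : N}"
   proof
    fix k assume k: "k : K"
    then have "sg j k o sg z (invp k) : N" using deg_inv invp by (intro N'(3) sg) auto
    moreover have "sg j k o sg z (invp k) = pr j z k" using \<open>j \<noteq> z\<close>
     by (simp add: wr_comp wr_eq_iff) (auto simp: single_def pair_def fun_eq_iff)
    ultimately show "k : {x : \<G>. pr j z x : N}" using k by simp
   qed
   show "t : {x : \<G>. pr j z x : N}" using pr t \<open>j \<noteq> z\<close> by simp
   then show "invp t : {x : \<G>. pr j z x : N}" using N'(4)[of "pr j z t"] t inv_pr invp by auto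
   fix g h assume gh: "g : {x : \<G>. pr j z x : N}" "h : {x : \<G>. pr j z x : N}"
   \<comment> \<open>\<open>pr j z\<close> is not multiplicative, since inversion in coordinate z
     reverses the order of factors. The defect is a commutator, hence of degree 0, and is corrected
     in the single coordinate z.\<close>
   let ?k = "h o g o invp h o invp g"
   have "?k : K" using gh comp invp by (auto simp: deg_comp deg_inv)
   then have "pr j z g o pr j z h o sg z ?k : N" using gh by (intro N'(3) sg) auto
   also have "pr j z g o pr j z h o sg z ?k = pr j z (g o h)"
   proof -
    have "invp g o invp h o ?k = invp (g o h)" using gh bij by (simp add: o_inv_distrib fun_eq_iff)
    then show ?thesis using \<open>j \<noteq> z\<close> by (simp only: wr_comp wr_eq_iff) (auto simp: single_def pair_def fun_eq_iff)
   qed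
   finally show "g o h : {x : \<G>. pr j z x : N}" using gh comp by simp
  qed
  then show ?thesis using that by blast
 qed
 have base: "\<forall>g. wr g (id :: five => five) : W --> (\<forall>i. i \<notin> insert 0 S --> g i : K) --> wr g (id :: five => five) : N"
  if "finite S" "0 \<notin> S" for S :: "five set" using that
 proof (induction S rule: finite_induct)
  case empty
  have "wr g (id :: five => five) : N" if g: "wr g (id :: five => five) : W" "\<forall>i. i \<notin> {0} --> g i : K" for g
  proof (rule base_subset[OF N sg])
   have "deg (g 0) = 0" using g by (simp add: sum.remove[of UNIV "0 :: five"])
   then show "g i : K" for i using g by (cases "i = 0") auto
  qed
  then show ?case by blast
 next
  case (insert j S)
  have j: "j \<noteq> 0" "0 \<notin> S" using insert.prems by auto
  show ?case
  proof (intro allI impI)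
   fix g :: "five => 'y => 'y" assume g: "wr g (id :: five => five) : W" "\<forall>i. i \<notin> insert 0 (insert j S) --> g i : K"
   then have gG: "g i : \<G>" for i by simp
   let ?p = "pr j 0 (invp (g j))" and ?g = "\<lambda>i. g i o pair j 0 (invp (g j)) i"
   have e: "wr g (id :: five => five) o ?p = wr ?g id" by (simp add: wr_comp)
   note p = pr_W[OF invp[OF gG] j(1)]
   have "wr ?g (id :: five => five) : W" unfolding e[symmetric] by (rule W_comp[OF g(1) p])
   moreover have "\<forall>i. i \<notin> insert 0 S --> ?g i : K" using g(2) gG[of j] id_mem by (auto simp: pair_def)
   ultimately have "wr ?g (id :: five => five) : N" using insert.IH[OF j(2)] by blast
   then have "wr g id o ?p o invp ?p : N"
    unfolding e[symmetric] by (rule N'(3)[OF _ N'(4)[OF all_pr[OF invp[OF gG] j(1)]]])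
   then show "wr g (id :: five => five) : N" unfolding comp_assoc W.invp_comp(2)[OF p] comp_id .
  qed
 qed
 show "W \<subseteq> N"
 proof
  fix x assume x: "x : W"
  obtain g p where g: "x = wr g p" "p : Alt" "!!i. g i : \<G>" by (rule W_cases[OF x]) (rule that)
  obtain h where h: "wr h p : N" using onto[OF g(2)] by blast
  have hW: "wr h p : W" using h N'(1) by blast
  have "x o invp (wr h p) = wr (\<lambda>i. g (invp p i) o invp (h (invp p i))) id"
  proof -
   have "p o invp p = id" using Alt_bij[OF g(2)] by (simp add: bij_is_surj surj_iff[THEN iffD1])
   then show ?thesis using hW g(1) by (simp add: W_wr_inv wr_comp)
  qed
  moreover have "x o invp (wr h p) : W" by (rule W_comp[OF x W_inv[OF hW]])
  ultimately have "x o invp (wr h p) : N" using base[of "- {0}"] by auto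
  then have "x o invp (wr h p) o wr h p : N" by (rule N'(3)[OF _ h])
  then show "x : N" using hW by (simp add: comp_assoc)
 qed
qed

lemma sg_cont_hom: "sg j : cont_hom (subgrp PG K) W.PG"
proof (rule perm_cont_hom[OF perm_pair_axioms perm_pair_W subgroup_K])
 show "sg j g : W" if "g : K" for g by (rule sg_W[OF that])
 fix F' :: "('y \<times> five) set" assume F': "finite F'"
 have "sg j u : WU \<and> (\<forall>y\<in>F'. sg j u y = y)" if "u : U \<inter> K" "\<forall>y\<in>fst ` F'. u y = y" for u
  using that U_id by (auto simp: Alt_id single_def)
 then show "\<exists>F. finite F \<and> (\<forall>u\<in>U \<inter> K. (\<forall>y\<in>F. u y = y) --> sg j u : WU \<and> (\<forall>y\<in>F'. sg j u y = y))"
  using F' by (intro exI[of _ "fst ` F'"]) blast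
qed (simp add: sg_comp)

lemma sg_inj: "inj (sg j)" by (auto simp: inj_def wr_eq_iff single_def fun_eq_iff)

text \<open>Conjugating \<open>sg j n\<close> by \<open>pr j z g\<close> conjugates n by g. So the
  trace of a normal subgroup on one coordinate is normalised by all of \<G>, including the elements
  of nonzero degree, as the axioms of \<open>glue\<close> demand.\<close>

lemma sg_preimage:
 assumes N: "subgroup N W.PG" shows "subgroup {k : K. sg j k : N} PG"
  "(!!x n. x : W ==> n : N ==> x o n o invp x : N) ==> g : \<G> ==> n : {k : K. sg j k : N} ==>
   g o n o invp g : {k : K. sg j k : N}"
  "closedin (gtop W.PG) N ==> closedin (gtop PG) {k : K. sg j k : N}"
  "openin (gtop W.PG) N ==> openin (gtop PG) {k : K. sg j k : N}"
proof -
 note N' = W.PG_subgroupD[OF N] and K' = PG_subgroupD[OF subgroup_K]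
 show "subgroup {k : K. sg j k : N} PG"
 proof (rule subgroup_PGI)
  show "id : {k : K. sg j k : N}"
  proof -
   have "single j id = (\<lambda>_ :: five. id :: 'y => 'y)" by (auto simp: single_def)
   then show ?thesis using N'(2) id_mem pm_id by simp
  qed
  show "f o g : {k : K. sg j k : N}" if "f : {k : K. sg j k : N}" "g : {k : K. sg j k : N}" for f g
   using that K'(3)[of f g] N'(3)[of "sg j f" "sg j g"] by (simp add: sg_comp)
  show "invp g : {k : K. sg j k : N}" if "g : {k : K. sg j k : N}" for g
   using that K'(4)[of g] N'(4)[of "sg j g"] by (simp add: inv_sg)
 qed auto
 obtain z where z: "j \<noteq> z" using ex_five_notin[of "[j]"] by force
 show "g o n o invp g : {k : K. sg j k : N}"
  if "!!x n. x : W ==> n : N ==> x o n o invp x : N" "g : \<G>" "n : {k : K. sg j k : N}"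
  using that(1)[OF pr_W[OF that(2) z], of "sg j n"] that(2,3) comp invp
  by (simp add: pr_conj_sg[OF that(2) z] deg_comp deg_inv)
 have c: "continuous_map (gtop (subgrp PG K)) (gtop W.PG) (sg j)" using sg_cont_hom by (simp add: cont_hom_def)
 have e: "{k : topspace (gtop (subgrp PG K)). sg j k : N} = {k : K. sg j k : N}" by auto
 have Kc: "closedin (gtop PG) K" "openin (gtop PG) K"
  using K_open(1) closed_open_subgroup[OF K_open(1)] by (auto simp: open_subgroup_def closed_subgroup_def)
 show "closedin (gtop PG) {k : K. sg j k : N}" if "closedin (gtop W.PG) N"
  using closed_preimage[OF c that] Kc(1) unfolding e by (auto intro: closedin_trans_full)
 show "openin (gtop PG) {k : K. sg j k : N}" if "openin (gtop W.PG) N"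
  using continuous_preimage[OF c that] Kc(2) unfolding e by (auto intro: openin_trans_full)
qed

lemma residual_contains_sg: "sg j ` K \<subseteq> discrete_residual W.PG" unfolding discrete_residual_def
proof (rule Inter_greatest)
 fix N assume "N : {N. N \<lhd> W.PG \<and> openin (gtop W.PG) N}"
 then have N: "subgroup N W.PG" "openin (gtop W.PG) N" "!!x n. x : W ==> n : N ==> x o n o invp x : N"
  by (auto simp: W.normal_inv_iff)
 have "K \<subseteq> {k : K. sg j k : N}"
  by (rule open_normalized) (use sg_preimage[OF N(1)] N in \<open>auto simp: open_subgroup_def\<close>)
 then show "sg j ` K \<subseteq> N" by auto
qed

text \<open>The compact set consists of \<open>WU\<close>, which contains all permutations in
  \<open>Alt\<close>, a copy of \<open>C\<close> in one coordinate and one element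
  \<open>pr a b t\<close>. Double transitivity of \<open>Alt\<close> spreads the last two over all
  coordinates.\<close>

lemma W_compactly_generated: "compactly_generated W.PG"
proof -
 define a :: five where "a = 0"
 obtain b where b: "a \<noteq> b" using ex_five_notin[of "[a]"] by force
 define D where "D = WU \<union> sg a ` C \<union> {pr a b t}"
 have "compactin (gtop (subgrp PG K)) C" using C by (simp add: compactin_subtopology)
 then have "compactin (gtop W.PG) (sg a ` C)" using sg_cont_hom by (auto simp: cont_hom_def intro: image_compactin)
 then have "compactin (gtop W.PG) D" unfolding D_def
  using W.compactin_U pr_W[OF t(1) b] by (intro compactin_Un) (auto intro: finite_imp_compactin)
 moreover have "generate W.PG D = W"
 proof (rule subgroup_total)
  have DW: "D \<subseteq> carrier W.PG" using WU_sub sg_W C(2) pr_W[OF t(1) b] by (auto simp: D_def)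
  show N: "subgroup (generate W.PG D) W.PG" by (rule W.generate_is_subgroup[OF DW])
  note N' = W.PG_subgroupD[OF N]
  have DN: "D \<subseteq> generate W.PG D" by (auto intro: generate.incl)
  have pm: "pm p : generate W.PG D" if "p : Alt" for p using DN that U_id by (auto simp: D_def)
  then show "\<exists>g. wr g p : generate W.PG D" if "p : Alt" for p using that by blast
  show pr: "pr j z t : generate W.PG D" if jz: "j \<noteq> z" for j z
  proof -
   obtain p where p: "p : Alt" "p a = j" "p b = z" by (rule Alt_2_transitive[OF b jz])
   have "pm p o pr a b t o invp (pm p) : generate W.PG D" using DN by (intro N'(3) N'(4) pm p(1)) (auto simp: D_def)
   then show ?thesis unfolding pm_conj_pr[OF p(1)] p(2,3) .
  qed
  let ?S = "{k : K. sg a k : generate W.PG D}"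
  have "K \<subseteq> ?S"
  proof (rule C_generates)
   show "subgroup ?S PG" by (rule sg_preimage(1)[OF N])
   show "C \<subseteq> ?S" using C(2) DN by (auto simp: D_def)
   fix n assume n: "n : ?S"
   have tn: "t o n o invp t : K" "invp t o n o t : K" using n t comp invp by (auto simp: deg_comp deg_inv)
   have "pr a b t o sg a n o invp (pr a b t) : generate W.PG D" by (intro N'(3) N'(4) pr b) (use n in simp)
   then show "t o n o invp t : ?S" using tn pr_conj_sg[OF t(1) b] by simp
   have "pr a b (invp t) o sg a n o invp (pr a b (invp t)) : generate W.PG D"
    using n unfolding inv_pr[OF t(1), symmetric] by (intro N'(3) N'(4) pr b) simp
   then show "invp t o n o t : ?S" using tn pr_conj_sg[OF invp[OF t(1)] b] t(1) by simp
  qed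
  then show "sg j k : generate W.PG D" if k: "k : K" for j k
  proof -
   obtain z where z: "j \<noteq> z" using ex_five_notin[of "[j]"] by force
   obtain p where p: "p : Alt" "p a = j" "p b = z" by (rule Alt_2_transitive[OF b z])
   have "pm p o sg a k o invp (pm p) : generate W.PG D" using \<open>K \<subseteq> ?S\<close> k by (intro N'(3) N'(4) pm p(1)) auto
   then show ?thesis unfolding pm_conj_sg[OF p(1)] p(2) .
  qed
 qed
 ultimately show ?thesis by (auto simp: compactly_generated_def)
qed

section \<open>Normal structure of the glued group\<close>

lemma subgroup_base:
 assumes "!!g. P g ==> wr g (id :: five => five) : W" "P (\<lambda>_. id)" "!!g h. P g ==> P h ==> P (\<lambda>i. g i o h i)"
  "!!g. P g ==> P (\<lambda>i. invp (g i))" shows "subgroup {wr g (id :: five => five) |g. P g} W.PG"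
proof (rule W.subgroup_PGI)
 show "id : {wr g (id :: five => five) |g. P g}" using assms(2) wr_id[symmetric] by blast
 show "f o f' : {wr g (id :: five => five) |g. P g}"
  if "f : {wr g (id :: five => five) |g. P g}" "f' : {wr g (id :: five => five) |g. P g}" for f f'
  using that assms(3) by (force simp: wr_comp)
 show "invp f : {wr g (id :: five => five) |g. P g}" if f: "f : {wr g (id :: five => five) |g. P g}" for f
 proof -
  obtain g where g: "f = wr g id" "P g" using f by blast
  then have "invp f = wr (\<lambda>i. invp (g i)) id" using assms(1)[OF g(2)] by (simp add: inv_wr_id)
  then show ?thesis using assms(4)[OF g(2)] by blast
 qed
qed (use assms(1) in blast)

lemma conj_base:
 assumes "c : W"
 obtains g p where "!!i. g i : \<G>"
  "!!h. c o wr h id o invp c = wr (\<lambda>i. g (invp p i) o h (invp p i) o invp (g (invp p i))) id"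
proof -
 obtain g p where g: "c = wr g p" "p : Alt" "!!i. g i : \<G>" by (rule W_cases[OF assms]) (rule that)
 have "p o invp p = id" using Alt_bij[OF g(2)] by (simp add: bij_is_surj surj_iff[THEN iffD1])
 then have "c o wr h id o invp c = wr (\<lambda>i. g (invp p i) o h (invp p i) o invp (g (invp p i))) id" for h
  using g by (simp add: W_wr_inv wr_comp)
 then show thesis using that g(3) by blast
qed

text \<open>A product of five copies of \<open>K\<close>, open and normal; the rank of the glued
  group is estimated through it.\<close>

definition K5 :: "('y \<times> five => 'y \<times> five) set" where
 "K5 = {wr g id |g. \<forall>i. g i : K}"

lemma subgroup_K5: "subgroup K5 W.PG"
 unfolding K5_def by (rule subgroup_base) (use PG_subgroupD[OF subgroup_K] in \<open>auto simp: Alt_id\<close>)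

lemma normal_K5: "K5 \<lhd> W.PG" unfolding W.normal_inv_iff
proof (intro conjI ballI subgroup_K5)
 fix x y assume "x : carrier W.PG" "y : K5"
 then have x: "x : W" and y: "y : K5" by auto
 obtain g p where g: "!!i. g i : \<G>"
  "!!h. x o wr h id o invp x = wr (\<lambda>i. g (invp p i) o h (invp p i) o invp (g (invp p i))) id"
  by (rule conj_base[OF x]) (rule that)
 obtain h where h: "y = wr h id" "!!i. h i : K" using y by (auto simp: K5_def)
 have "g (invp p i) o h (invp p i) o invp (g (invp p i)) : K" for i
  using g(1) h(2) comp invp by (simp add: deg_comp deg_inv)
 then show "x \<otimes>\<^bsub>W.PG\<^esub> y \<otimes>\<^bsub>W.PG\<^esub> inv\<^bsub>W.PG\<^esub> x : K5" using x g(2) by (auto simp: K5_def h(1))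
qed

lemma small_K5: "W.small ({undefined} \<times> UNIV) \<subseteq> K5"
proof
 fix x assume x: "x : W.small ({undefined} \<times> UNIV)"
 then have "x : WU" by (simp add: W.small_def)
 then obtain g p where g: "x = wr g p" "p : Alt" "!!i. g i : U" by (rule WU_cases) (rule that)
 have "x (undefined, i) = (undefined, i)" for i using x unfolding W.small_def by blast
 then have "p = id" using g(1) by (simp add: fun_eq_iff)
 then show "x : K5" using g U_K by (auto simp: K5_def)
qed

lemma open_subgroup_K5: "open_subgroup K5 W.PG" by (rule W.open_subgroup_PG[OF subgroup_K5 _ small_K5]) simp

text \<open>The kernel of the map onto \<open>Alt\<close>; it becomes the subgroup \<open>H1\<close>
  of the next stage.\<close>

definition W1 :: "('y \<times> five => 'y \<times> five) set" where
 "W1 = {x : W. \<exists>g. x = wr g id}"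

lemma closed_normal_W1: "closed_normal W1 W.PG"
proof (rule W.closed_normal_PGI)
 have "W1 = {wr g id |g. wr g (id :: five => five) : W}" by (auto simp: W1_def)
 moreover have "subgroup {wr g id |g. wr g (id :: five => five) : W} W.PG"
  by (rule subgroup_base) (auto simp: comp invp id_mem deg_comp deg_inv sum.distrib sum_negf Alt_id)
 ultimately show *: "subgroup W1 W.PG" by simp
 show "c o x o invp c : W1" if c: "c : W" "x : W1" for c x
 proof -
  obtain h where h: "x = wr h id" "x : W" using c(2) by (auto simp: W1_def)
  have "\<exists>f. c o x o invp c = wr f id" unfolding h(1) by (rule conj_base[OF c(1)]) blast
  then show ?thesis using W_comp[OF W_comp[OF c(1) h(2)] W_inv[OF c(1)]] by (auto simp: W1_def)
 qed
 have "K5 \<subseteq> W1" by (auto simp: K5_def W1_def Alt_id)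
 then have "open_subgroup W1 W.PG" using small_K5 by (intro W.open_subgroup_PG[OF * _ order_trans]) auto
 then show "closedin (perm_topology W WU) W1" using W.closed_open_subgroup by (auto simp: closed_subgroup_def)
qed

lemma WU_not_W1: "\<not> WU \<subseteq> W1"
proof -
 obtain b :: five where b: "b \<notin> {0}" using ex_five_notin[of "[0]"] by auto
 obtain c :: five where c: "c \<notin> {0, b}" using ex_five_notin[of "[0, b]"] by auto
 have d: "distinct [0, b, c]" using b c by auto
 have "pm (cyc 0 b c) : WU" using cyc_Alt[OF d] U_id by simp
 moreover have "pm (cyc 0 b c) \<notin> W1"
 proof
  assume "pm (cyc 0 b c) : W1"
  then have "cyc 0 b c = id" by (auto simp: W1_def wr_eq_iff)
  then show False using cyc_eq[OF d, of 0] b by auto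
 qed
 ultimately show ?thesis by blast
qed

lemma W1_comm:
 assumes "x : W" "x \<notin> W1" shows "\<exists>a\<in>W. x o a o invp x o invp a \<notin> W1"
proof -
 obtain g p where g: "x = wr g p" "p : Alt" "!!i. g i : \<G>" by (rule W_cases[OF assms(1)]) (rule that)
 have "p \<noteq> id" using assms g by (auto simp: W1_def)
 with g(2) obtain q where q: "q : Alt" "p o q o invp p o invp q \<noteq> id" by (rule Alt_five_centerless)
 have "\<exists>h. x o pm q o invp x o invp (pm q) = wr h (p o q o invp p o invp q)"
  using g q(1) id_mem by (simp add: W_wr_inv wr_comp) blast
 then have "x o pm q o invp x o invp (pm q) \<notin> W1" using q(2) by (auto simp: W1_def wr_eq_iff)
 then show ?thesis using pm_W[OF q(1)] by blast
qed

text \<open>The commutator has trivial permutation part and lives on the coordinates a, z, s a, s z.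
  As s sends neither a nor z to a, coordinate a receives exactly g.\<close>

lemma comm_pr:
 assumes c: "wr c s : W" "s a \<noteq> a" "s z \<noteq> a" "a \<noteq> z" and g: "g : \<G>"
 obtains x where "pr a z g o wr c s o invp (pr a z g) o invp (wr c s) = wr x id" "x a = g"
  "!!i. i \<notin> {a, z, s a, s z} ==> x i = id" "!!i. x i : \<G>"
  "s z = z ==> deg (x z) = 0" "s a \<noteq> z ==> deg (x (s a)) = - deg g"
proof -
 have cs: "s : Alt" "!!i. c i : \<G>" using c(1) by auto
 have sb: "invp s (s i) = i" "s (invp s i) = i" "invp s i = j \<longleftrightarrow> i = s j" for i j
  using Alt_bij[OF cs(1)] by (simp_all add: bij_is_inj bij_is_surj surj_f_inv_f bij_inv_eq_iff eq_commute)
 let ?x = "\<lambda>i. pair a z g i o (c (invp s i) o (pair a z (invp g) (invp s i) o invp (c (invp s i))))"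
 have pG: "pair a z g i : \<G>" "pair a z (invp g) i : \<G>" for i using g invp id_mem by (auto simp: pair_def)
 have "pr a z g o wr c s o invp (pr a z g) o invp (wr c s) = wr ?x id"
  using sb g by (simp add: inv_pr W_wr_inv[OF cs] wr_comp comp_assoc wr_eq_iff fun_eq_iff)
 moreover have "?x a = g"
 proof -
  have "invp s a \<notin> {a, z}" using sb(3) c(2,3) by auto
  then show ?thesis using cs(2) by (simp add: pair_def)
 qed
 moreover have "?x i = id" if "i \<notin> {a, z, s a, s z}" for i
 proof -
  have "invp s i \<notin> {a, z}" using sb(3) that by auto
  then show ?thesis using cs(2) that by (simp add: pair_def)
 qed
 moreover have "?x i : \<G>" for i by (intro comp pG cs(2) invp)
 moreover have degx: "deg (?x i) = deg (pair a z g i) + deg (pair a z (invp g) (invp s i))" for i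
  using pG cs(2) comp invp by (simp add: deg_comp deg_inv)
 moreover have "deg (?x z) = 0" if "s z = z"
 proof -
  have "invp s z = z" using sb(3) that by simp
  then show ?thesis using degx[of z] c(4) g by (simp add: pair_def deg_inv)
 qed
 moreover have "deg (?x (s a)) = - deg g" if "s a \<noteq> z"
  using degx[of "s a"] that c(2) g by (simp add: sb pair_def deg_inv)
 ultimately show thesis using that by blast
qed

text \<open>An element with non-trivial permutation part gives, by two commutators, all commutators
  of \<G> in one coordinate, hence all of \<open>K\<close> there. Simplicity of \<open>Alt\<close>
  then gives every permutation part, and one more commutator gives the elements
  \<open>pr a b t\<close> up to coordinates in \<open>K\<close>.\<close>

lemma W1_max:
 assumes N: "closed_normal N W.PG" and nt: "\<not> N \<subseteq> W1" shows "N = W"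
proof -
 have Ns: "subgroup N W.PG" and Nc: "closedin (gtop W.PG) N" using N by (auto simp: closed_normal_iff[OF W.group_PG])
 note N' = W.PG_subgroupD[OF Ns] and conj = W.closed_normal_conj[OF N]
 have in_comm: "e o n o invp e o invp n : N" "n o e o invp n o invp e : N" if "e : W" "n : N" for e n
 proof -
  show "e o n o invp e o invp n : N" by (rule N'(3)[OF conj[OF that] N'(4)[OF that(2)]])
  have "n o (e o invp n o invp e) : N" by (rule N'(3)[OF that(2) conj[OF that(1) N'(4)[OF that(2)]]])
  then show "n o e o invp n o invp e : N" by (simp add: comp_assoc)
 qed
 obtain n where n: "n : N" "n \<notin> W1" using nt by blast
 obtain c s where cs: "n = wr c s" "s : Alt" using N'(1) n(1) by (auto simp: W_def)
 have sid: "s \<noteq> id" using n cs N'(1) by (auto simp: W1_def)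
 obtain y where y: "s y \<noteq> y" using sid by (auto simp: fun_eq_iff)
 obtain z where z: "z \<notin> {y, invp s y}" using ex_five_notin[of "[y, invp s y]"] by auto
 have sz: "s z \<noteq> y" using z Alt_bij[OF cs(2)] by (auto simp: bij_is_inj)
 \<comment> \<open>The first commutator is trivial in coordinate v, since its support avoids v. So
   the commutator with \<open>pr y v h\<close> is concentrated in coordinate y.\<close>
 obtain v where v: "v \<notin> {y, z, s y, s z}" using ex_five_notin[of "[y, z, s y, s z]"] by auto
 have nW: "wr c s : W" using n(1) cs(1) N'(1) by auto
 have single_comm: "sg y (g o h o invp g o invp h) : N" if gh: "g : \<G>" "h : \<G>" for g h
 proof -
  have yz: "y \<noteq> z" and yv: "y \<noteq> v" using z v by auto
  obtain x where x: "pr y z g o wr c s o invp (pr y z g) o invp (wr c s) = wr x id" "x y = g"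
   "!!i. i \<notin> {y, z, s y, s z} ==> x i = id" "!!i. x i : \<G>" by (rule comm_pr[OF nW y sz yz gh(1)]) (rule that)
  have xN: "wr x id : N" unfolding x(1)[symmetric] using in_comm(1)[OF pr_W[OF gh(1) yz] n(1)] cs(1) by simp
  have xi: "invp (wr x (id :: five => five)) = wr (\<lambda>i. invp (x i)) id" by (rule inv_wr_id[OF x(4)])
  have "wr x id o pr y v h o invp (wr x id) o invp (pr y v h) = sg y (g o h o invp g o invp h)"
  proof -
   have "x i o pair y v h i o invp (x i) o pair y v (invp h) i = single y (g o h o invp g o invp h) i" for i
    using x(2) x(3)[OF v] x(4)[of i] gh(2) by (auto simp: pair_def single_def)
   then show ?thesis by (simp add: xi inv_pr[OF gh(2)] wr_comp wr_eq_iff fun_eq_iff)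
  qed
  then show ?thesis using in_comm(2)[OF pr_W[OF gh(2) yv] xN] by simp
 qed
 have "K \<subseteq> {k : K. sg y k : N}"
 proof (rule commutators)
  fix g h assume gh: "g : \<G>" "h : \<G>"
  then have "g o h o invp g o invp h : K" using comp invp by (simp add: deg_comp deg_inv)
  then show "g o h o invp g o invp h : {k : K. sg y k : N}" using single_comm[OF gh] by simp
 qed (use sg_preimage[OF Ns] conj Nc in auto)
 then have sgN: "sg j k : N" if k: "k : K" for j k
 proof -
  obtain w where w: "j \<noteq> w" using ex_five_notin[of "[j]"] by force
  have yz: "y \<noteq> z" using z by auto
  obtain p where p: "p : Alt" "p y = j" "p z = w" by (rule Alt_2_transitive[OF yz w])
  have "pm p o sg y k o invp (pm p) : N" using \<open>K \<subseteq> _\<close> k by (intro conj pm_W p(1)) auto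
  then show ?thesis unfolding pm_conj_sg[OF p(1)] p(2) .
 qed
 let ?P = "{p. \<exists>g. wr g p : N}"
 have "?P = Alt"
 proof (rule Alt_five_simple)
  show "s : ?P" "s \<noteq> id" using n(1) cs sid by auto
  show PA: "?P \<subseteq> Alt" using N'(1) by auto
  show "p o q : ?P" if pq: "p : ?P" "q : ?P" for p q
  proof -
   obtain g h where "wr g p : N" "wr h q : N" using pq by blast
   then have "wr g p o wr h q : N" by (rule N'(3))
   then show ?thesis unfolding wr_comp by blast
  qed
  have inv_wr: "invp (wr g p) = wr (\<lambda>i. invp (g (invp p i))) (invp p)" if "wr g p : W" for g p
   using that by (intro W_wr_inv) auto
  show "invp p : ?P" if p: "p : ?P" for p
  proof -
   obtain g where g: "wr g p : N" using p by blast
   then have "wr g p : W" using N'(1) by blast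
   then show ?thesis using N'(4)[OF g] unfolding inv_wr[OF \<open>wr g p : W\<close>] by blast
  qed
  show "p o q o invp p : ?P" if p: "p : Alt" and q: "q : ?P" for p q
  proof -
   obtain g where g: "wr g q : N" using q by blast
   have "pm p o wr g q o invp (pm p) : N" by (rule conj[OF pm_W[OF p] g])
   then show ?thesis unfolding inv_wr[OF pm_W[OF p]] wr_comp by blast
  qed
 qed
 show ?thesis
 proof (rule subgroup_total[OF Ns sgN])
  show "\<exists>g. wr g p : N" if "p : Alt" for p using that \<open>?P = Alt\<close> by blast
  show "pr a b t : N" if ab: "a \<noteq> b" for a b
  proof -
   obtain e where e: "e \<notin> {a, b}" using ex_five_notin[of "[a, b]"] by auto
   obtain u where u: "u \<notin> {a, b, e}" using ex_five_notin[of "[a, b, e]"] by auto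
   have d: "distinct [a, b, u]" using ab u by auto
   \<comment> \<open>For this 3-cycle, which fixes e, the commutator with \<open>pr a e t\<close>
     has degree 1 at a, degree - 1 at b and degree 0 elsewhere, just as
     \<open>pr a b t\<close>.\<close>
   let ?s = "cyc a b u"
   have s: "?s a = b" "?s e = e" using cyc_eq[OF d] e u ab by auto
   obtain c where c: "wr c ?s : N" using \<open>?P = Alt\<close> cyc_Alt[OF d] by blast
   then have cW: "wr c ?s : W" using N'(1) by blast
   have ae: "a \<noteq> e" using e by auto
   obtain x where x: "pr a e t o wr c ?s o invp (pr a e t) o invp (wr c ?s) = wr x id" "x a = t"
    "!!i. i \<notin> {a, e, ?s a, ?s e} ==> x i = id" "!!i. x i : \<G>" "?s e = e ==> deg (x e) = 0"
    "?s a \<noteq> e ==> deg (x (?s a)) = - deg t"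
    by (rule comm_pr[OF cW _ _ ae t(1)]) (use s ab ae in simp, use s ae in simp, rule that)
   have xN: "wr x id : N" unfolding x(1)[symmetric] using in_comm(1)[OF pr_W[OF t(1) ae] c] .
   have pG: "pair a b t i : \<G>" for i using t invp id_mem by (simp add: pair_def)
   have "deg (x i) = deg (pair a b t i)" for i
    using x(2) x(3)[of i] x(5,6) s e ab t by (cases "i : {a, b, e}") (auto simp: pair_def deg_inv)
   then have rK: "invp (x i) o pair a b t i : K" for i using x(4) pG comp invp by (simp add: deg_comp deg_inv)
   have "wr (\<lambda>i. invp (x i) o pair a b t i) id : N" by (rule base_subset[OF Ns _ rK]) (rule sgN)
   then have "wr x id o wr (\<lambda>i. invp (x i) o pair a b t i) id : N" by (rule N'(3)[OF xN])
   also have "wr x id o wr (\<lambda>i. invp (x i) o pair a b t i) id = pr a b t"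
    using x(4) by (simp add: wr_comp wr_eq_iff fun_eq_iff)
   finally show ?thesis .
  qed
 qed
qed

end

lemma cont_hom_comp: "f : cont_hom G H ==> g : cont_hom H Q ==> g o f : cont_hom G Q"
 by (auto simp: cont_hom_def hom_def Pi_iff intro: continuous_map_compose)

lemma rank_residual_lower:
 assumes "tdlc G" "has_rank G \<gamma>" "has_rank Q \<kappa>" "topspace (gtop Q) = carrier Q"
  "\<pi> : cont_hom Q G" "inj_on \<pi> (carrier Q)" "\<pi> ` carrier Q \<subseteq> discrete_residual G"
 obtains \<rho> where "\<kappa> \<le> \<rho>" "has_rank (Res G) \<rho>"
proof -
 interpret G: tdlc G by fact
 have "(\<lambda>x. x) : cont_hom (Res G) G" using id_cont_hom_subgrp[OF G.residual_subset, of G] subgrp_self[of G] by simp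
 then obtain \<rho> where \<rho>: "has_rank (Res G) \<rho>"
  by (rule rank_exists_mono[OF assms(2) G.tdlc_subgrp[OF G.closed_subgroup_residual]]) auto
 have "\<pi> : cont_hom (subgrp Q (carrier Q)) (Res G)" by (rule cont_hom_subgrp[OF assms(5) order_refl assms(7)])
 then have "\<kappa> \<le> \<rho>" using rank_mono[OF \<rho> assms(3) _ assms(6)] by (simp add: subgrp_self assms(4))
 then show thesis using \<rho> that by blast
qed

lemma top_iso_compactly_generated:
 assumes "group G" "group H" "\<phi> : top_iso G H" "topspace (gtop G) = carrier G" "compactly_generated G"
 shows "compactly_generated H"
proof -
 interpret h: group_hom G H \<phi> by (rule cont_hom_group_hom[OF assms(1,2) top_iso_cont_hom[OF assms(3)]])
 obtain C where C: "compactin (gtop G) C" "generate G C = carrier G" using assms(5) by (auto simp: compactly_generated_def)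
 have CG: "C \<subseteq> carrier G" using compactin_subset_topspace[OF C(1)] assms(4) by simp
 have "generate H (\<phi> ` C) = carrier H"
  using h.generate_img[OF CG] C(2) top_iso_bij[OF assms(3)] by (simp add: bij_betw_def)
 moreover have "compactin (gtop H) (\<phi> ` C)" using top_iso_open_image(3)[OF assms(3,4) CG] C(1) by simp
 ultimately show ?thesis by (auto simp: compactly_generated_def)
qed

lemma (in tdlc) closed_subgroup_one: "closed_subgroup {\<one>} G"
 using closedin_Hausdorff_singleton[OF Hausdorff, of \<one>] triv_subgroup by (simp add: closed_subgroup_def)

text \<open>The induction hypothesis for exponent n: \<beta> measures what the residual of
  \<open>H\<close> contributes to each level, so a level adds at least \<open>omega ^ n\<close>,
  while the bound on \<xi> keeps finitely many levels below \<open>omega ^ Suc n\<close>. The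
  alternative \<beta> = 0 serves the start of the induction.\<close>

definition branching :: "nat => (nat => nat) set => bool" where
 "branching n H \<longleftrightarrow> (\<exists>H1 \<xi> \<beta>. stacked_tree H H1 \<and> compactly_generated (perm_group H {h : H. h 0 = 0}) \<and>
   has_rank (perm_group H {h : H. h 0 = 0}) \<xi> \<and> \<xi> < omega ^ Suc n \<and>
   (\<beta> = 0 \<or> (\<exists>\<rho>. has_rank (Res (perm_group H {h : H. h 0 = 0})) \<rho> \<and> 1 + \<beta> < \<rho>)) \<and>
   omega ^ n \<le> \<beta> + 1)"

section \<open>The glued group as input for the next tree\<close>

context glue
begin

lemma deg_t_power: "t ^^ m : \<G> \<and> deg (t ^^ m) = int m"
proof (induction m)
 case 0
 show ?case using id_mem deg_id unfolding funpow.simps int_ops(1) by blast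
next
 case (Suc m)
 then show ?case using comp[OF t(1)] deg_comp[OF t(1)] t(2) unfolding funpow.simps by (metis of_nat_Suc add.commute)
qed

text \<open>Coordinates of elements of \<open>WU\<close> have degree 0. If the permutation part
  moved y, conjugation by a suitable \<open>pr y z t\<close> would change the degree of coordinate y
  by 1.\<close>

lemma core_W:
 assumes x: "x : W" and c: "!!g. g : W ==> invp g o x o g : WU" shows "x = id"
proof -
 obtain g p where g: "x = wr g p" "p : Alt" "!!i. g i : \<G>" by (rule W_cases[OF x]) (rule that)
 have e: "invp (pr a b h) o x o pr a b h = wr (\<lambda>i. pair a b (invp h) (p i) o g i o pair a b h i) p"
  if "h : \<G>" for a b h using that g by (simp add: inv_pr wr_comp)
 have inU: "pair a b (invp h) (p i) o g i o pair a b h i : U" if h: "h : \<G>" "a \<noteq> b" for a b h i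
  using c[OF pr_W[OF h]] unfolding e[OF h(1)] by simp
 have "p y = y" for y
 proof (rule ccontr)
  assume y: "p y \<noteq> y"
  obtain z where z: "z \<notin> {y, p y}" using ex_five_notin[of "[y, p y]"] by auto
  then have yz: "y \<noteq> z" by auto
  have "pair y z (invp t) (p y) o g y o pair y z t y = g y o t" using y z by (auto simp: pair_def)
  then have "g y o t : U" using inU[OF t(1) yz, of y] by simp
  then have "deg (g y) = - 1" using deg_U[of "g y o t"] deg_comp[OF g(3) t(1)] t(2) by simp
  moreover have "deg (g y) = 0"
  proof -
   have "invp id o x o id : WU" by (rule c) (rule W.id_mem)
   then have "g y : U" using g(1) by simp
   then show ?thesis by (rule deg_U)
  qed
  ultimately show False by simp
 qed
 then have p: "p = id" by auto
 have "g y = id" for y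
 proof (rule core[OF g(3)])
  fix h assume h: "h : \<G>"
  obtain z where z: "y \<noteq> z" using ex_five_notin[of "[y]"] by force
  show "invp h o g y o h : U" using inU[OF h z, of y] p by (simp add: pair_def)
 qed
 then have "g = (\<lambda>_. id)" by blast
 then show ?thesis unfolding g(1) p by (simp only: pm_id)
qed

text \<open>Elements \<open>pr 0 z h\<close> lying in one coset of \<open>WU\<close> share the
  degree of h, and infinitely many degrees occur.\<close>

lemma index_W:
 assumes "finite J" "J \<subseteq> W" shows "\<exists>x\<in>W. \<forall>g\<in>J. invp g o x \<notin> WU"
proof -
 have "\<forall>x\<in>J. \<exists>d. \<forall>h\<in>\<G>. \<forall>z. z \<noteq> 0 --> invp x o pr 0 z h : WU --> deg h = d"
 proof
  fix x assume "x : J"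
  then have x: "x : W" using assms(2) by blast
  obtain g p where g: "x = wr g p" "p : Alt" "!!i. g i : \<G>" by (rule W_cases[OF x]) (rule that)
  have "deg h = deg (g (invp p 0))" if h: "h : \<G>" "z \<noteq> 0" "invp x o pr 0 z h : WU" for h z
  proof -
   have "invp (g (invp p 0)) o pair 0 z h 0 : U" using h(3) g by (simp add: W_wr_inv wr_comp)
   then have "deg (invp (g (invp p 0)) o h) = 0" by (intro deg_U) (simp add: pair_def)
   then show ?thesis using deg_comp[OF invp[OF g(3)] h(1)] deg_inv[OF g(3)] by simp
  qed
  then show "\<exists>d. \<forall>h\<in>\<G>. \<forall>z. z \<noteq> 0 --> invp x o pr 0 z h : WU --> deg h = d" by blast
 qed
 then obtain d where d: "!!x h z. [|x : J; h : \<G>; z \<noteq> 0; invp x o pr 0 z h : WU|] ==> deg h = d x" by metis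
 obtain m where m: "m \<notin> nat ` d ` J" by (metis ex_new_if_finite infinite_UNIV_nat finite_imageI assms(1))
 define h where "h = t ^^ m"
 have h: "h : \<G>" "nat (deg h) = m" using deg_t_power[of m] by (simp_all add: h_def)
 obtain z :: five where z: "0 \<noteq> z" using ex_five_notin[of "[0]"] by force
 have "pr 0 z h : W" by (rule pr_W[OF h(1) z])
 moreover have "invp x o pr 0 z h \<notin> WU" if "x : J" for x using d[OF that h(1) z[symmetric]] h(2) m that by (metis imageI)
 ultimately show ?thesis by blast
qed

definition coord :: "five => ('y \<times> five => 'y \<times> five) => 'y => 'y" where
 "coord i x = (\<lambda>y. fst (x (y, i)))"

lemma coord_wr [simp]: "coord i (wr g p) = g i" by (simp add: coord_def)

lemma coord_cont_hom: "coord i : cont_hom (subgrp W.PG K5) (perm_group K U)"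
proof (rule perm_cont_hom[OF perm_pair_W perm_pair_K subgroup_K5])
 show "coord i x : K" if "x : K5" for x using that by (auto simp: K5_def)
 show "coord i (x o y) = coord i x o coord i y" if "x : K5" "y : K5" for x y using that by (auto simp: K5_def wr_comp)
 fix F' :: "'y set" assume F': "finite F'"
 have "coord i u : U \<and> (\<forall>y\<in>F'. coord i u y = y)" if u: "u : WU \<inter> K5" "\<forall>y\<in>F' \<times> {i}. u y = y" for u
 proof -
  obtain g p where g: "u = wr g p" "!!i. g i : U" using u(1) by (auto simp: WU_def)
  then show ?thesis using u(2) by auto
 qed
 then show "\<exists>F. finite F \<and> (\<forall>u\<in>WU \<inter> K5. (\<forall>y\<in>F. u y = y) --> coord i u : U \<and> (\<forall>y\<in>F'. coord i u y = y))"
  using F' by (intro exI[of _ "F' \<times> {i}"]) blast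
qed

text \<open>The five coordinates on \<open>K5\<close> have rank \<beta> + 1 and a trivial common
  kernel of rank 1. The last summand pays for passing from the open normal subgroup
  \<open>K5\<close> to the whole group.\<close>

lemma rank_W:
 assumes "has_rank (perm_group K U) (\<beta> + 1)"
 obtains \<xi> where "\<xi> \<le> 1 + \<beta> + 1 + 1" "has_rank W.PG \<xi>"
proof -
 have t5: "tdlc (subgrp W.PG K5)" by (rule W.tdlc_subgrp[OF W.closed_open_subgroup[OF open_subgroup_K5]])
 interpret K5: tdlc "subgrp W.PG K5" by (rule t5)
 obtain \<gamma> where \<gamma>: "\<gamma> \<le> 1 + \<beta> + 1" "has_rank (subgrp W.PG K5) \<gamma>"
 proof (rule rank_restricted_family[of "subgrp W.PG K5" UNIV coord "\<lambda>_. perm_group K U" \<beta> 1 1])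
  show "coord i : cont_hom (subgrp W.PG K5) (perm_group K U)" for i by (rule coord_cont_hom)
  show "\<exists>\<rho>\<le>\<beta> + 1. has_rank (perm_group K U) \<rho>" using assms by blast
  have "{g : carrier (subgrp W.PG K5). \<forall>i\<in>UNIV. coord i g = \<one>\<^bsub>perm_group K U\<^esub>} = {id}"
  proof (intro equalityI subsetI)
   fix x assume x: "x : {g : carrier (subgrp W.PG K5). \<forall>i\<in>UNIV. coord i g = \<one>\<^bsub>perm_group K U\<^esub>}"
   then obtain g where g: "x = wr g id" "\<forall>i. g i = id" by (auto simp: K5_def)
   then have "g = (\<lambda>_. id)" by blast
   then have "x = id" using g(1) pm_id by metis
   then show "x : {id}" by simp
  next
   fix x assume "x : {id :: 'y \<times> five => 'y \<times> five}"
   then have "x = id" by simp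
   moreover have "coord i id = id" for i by (auto simp: coord_def)
   moreover have "id : K5" using W.PG_subgroupD(2)[OF subgroup_K5] .
   ultimately show "x : {g : carrier (subgrp W.PG K5). \<forall>i\<in>UNIV. coord i g = \<one>\<^bsub>perm_group K U\<^esub>}" by simp
  qed
  moreover have "has_rank (subgrp (subgrp W.PG K5) {id}) 1"
   using tdlc.tdlcsc[OF K5.tdlc_subgrp[OF K5.closed_subgroup_one]] by (intro has_decomposition_rank.trivial) auto
  ultimately show "has_rank (subgrp (subgrp W.PG K5)
    {g : carrier (subgrp W.PG K5). \<forall>i\<in>UNIV. coord i g = \<one>\<^bsub>perm_group K U\<^esub>}) 1" by simp
 qed (use t5 in auto)
 obtain \<xi> where \<xi>: "\<xi> \<le> \<gamma> + 1" "has_rank W.PG \<xi>"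
  using W.rank_open_normal[OF normal_K5 _ \<gamma>(2)] open_subgroup_K5 by (auto simp: open_subgroup_def)
 have "\<gamma> + 1 \<le> 1 + \<beta> + 1 + 1" using \<gamma>(1) by simp
 then show thesis using that \<xi> by (meson order_trans)
qed

text \<open>The glued group is transported to the naturals by its action on the cosets of
  \<open>WU\<close>. Its residual contains a copy of \<open>K\<close>, so the rank \<kappa> of
  \<open>K\<close> bounds the rank of that residual from below.\<close>

theorem ex_branching:
 assumes \<kappa>: "has_rank (perm_group K U) \<kappa>" "\<kappa> < omega ^ Suc n" and \<beta>: "\<beta> = 0 \<or> 1 + \<beta> < \<kappa>" "omega ^ n \<le> \<beta> + 1"
 shows "\<exists>H. branching n H"
proof -
 have "subgroup WU W.PG" using W.subgroup_small[of "{}"] by (simp add: W.small_def)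
 then have o: "open_subgroup WU W.PG" by (rule W.open_subgroup_PG[of _ "{}"]) (auto simp: W.small_def)
 have c: "compactin (gtop W.PG) WU" using W.compactin_U by simp
 have core: "x = \<one>\<^bsub>W.PG\<^esub>" if "x : carrier W.PG"
  "!!g. g : carrier W.PG ==> inv\<^bsub>W.PG\<^esub> g \<otimes>\<^bsub>W.PG\<^esub> x \<otimes>\<^bsub>W.PG\<^esub> g : WU" for x using core_W[of x] that by simp
 have index: "\<exists>x\<in>carrier W.PG. \<forall>g\<in>J. inv\<^bsub>W.PG\<^esub> g \<otimes>\<^bsub>W.PG\<^esub> x \<notin> WU" if J: "finite J" "J \<subseteq> carrier W.PG" for J
 proof -
  obtain x where "x : W" "\<forall>g\<in>J. invp g o x \<notin> WU" using index_W[of J] J by auto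
  then show ?thesis using J(2) by (intro bexI[of _ x]) auto
 qed
 obtain H :: "(nat => nat) set" and \<rho> where H: "perm_pair H {h : H. h 0 = 0}"
  "\<rho> : top_iso W.PG (perm_group H {h : H. h 0 = 0})"
  "!!n. \<exists>h\<in>H. h 0 = n" "!!g. g : carrier W.PG ==> \<rho> g 0 = 0 \<longleftrightarrow> g : WU"
  by (rule W.coset_action[OF o c core index], assumption, assumption, assumption, assumption, rule that)
 define V where "V = {h : H. h 0 = 0}"
 interpret H: perm_pair H V unfolding V_def by (rule H(1))
 have \<rho>: "\<rho> : top_iso W.PG H.PG" unfolding V_def by (rule H(2))
 interpret r: group_hom W.PG H.PG \<rho> by (rule cont_hom_group_hom[OF W.group_PG H.group_PG top_iso_cont_hom[OF \<rho>]])
 have inj: "inj_on \<rho> W" and img: "\<rho> ` W = H" using top_iso_bij[OF \<rho>] by (auto simp: bij_betw_def)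
 have W1W: "W1 \<subseteq> W" by (auto simp: W1_def)
 have mem: "\<rho> x : \<rho> ` S \<longleftrightarrow> x : S" if "x : W" "S \<subseteq> W" for x S using inj_on_image_mem_iff[OF inj that] .
 have "stacked_tree H (\<rho> ` W1)"
 proof (intro stacked_tree.intro tree.intro stacked_tree_axioms.intro, fold V_def)
  show "perm_pair H V" by (rule H.perm_pair_axioms)
  show "\<exists>h\<in>H. h 0 = n" for n by (rule H(3))
  show "closed_normal (\<rho> ` W1) H.PG"
   by (rule top_iso_closed_normal[OF W.topological_group_PG H.topological_group_PG \<rho> closed_normal_W1])
  obtain x where x: "x : WU" "x \<notin> W1" using WU_not_W1 by blast
  then have "\<rho> x : V" "\<rho> x \<notin> \<rho> ` W1" using H(4)[of x] mem[OF _ W1W, of x] WU_sub img by (auto simp: V_def)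
  then show "\<not> V \<subseteq> \<rho> ` W1" by blast
  show "\<exists>a\<in>H. h o a o invp h o invp a \<notin> \<rho> ` W1" if h: "h : H" "h \<notin> \<rho> ` W1" for h
  proof -
   obtain x where x: "x : W" "h = \<rho> x" "x \<notin> W1" using h img by blast
   obtain a where a: "a : W" "x o a o invp x o invp a \<notin> W1" using W1_comm[OF x(1,3)] by blast
   have inv: "invp (\<rho> y) = \<rho> (invp y)" if y: "y : W" for y
   proof -
    have "\<rho> y : H" using img y by blast
    then show ?thesis using r.hom_inv[of y] y by simp
   qed
   have mult: "\<rho> y o \<rho> z = \<rho> (y o z)" if "y : W" "z : W" for y z using r.hom_mult[of y z] that by simp
   have "\<rho> x o \<rho> a o invp (\<rho> x) o invp (\<rho> a) = \<rho> (x o a o invp x o invp a)"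
    using x(1) a(1) by (simp add: inv mult W_comp W_inv)
   moreover have "x o a o invp x o invp a : W" using x(1) a(1) W_comp W_inv by simp
   ultimately have "\<rho> x o \<rho> a o invp (\<rho> x) o invp (\<rho> a) \<notin> \<rho> ` W1" using mem[OF _ W1W] a(2) by simp
   then show ?thesis using x(2) a(1) img by blast
  qed
  show "N = H" if N: "closed_normal N H.PG" "\<not> N \<subseteq> \<rho> ` W1" for N
  proof -
   let ?\<psi> = "inv_into (carrier W.PG) \<rho>"
   have \<psi>: "?\<psi> : top_iso H.PG W.PG" by (rule top_iso_inv[OF W.topological_group_PG H.group_PG _ \<rho>]) simp
   have NH: "N \<subseteq> H" using N(1) by (intro H.PG_subgroupD) (simp add: closed_normal_iff[OF H.group_PG])
   have "\<rho> ` ?\<psi> ` N = N" using NH img by (simp add: image_inv_into_cancel)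
   moreover have "?\<psi> ` N = W"
   proof (rule W1_max)
    show "closed_normal (?\<psi> ` N) W.PG"
     by (rule top_iso_closed_normal[OF H.topological_group_PG W.topological_group_PG \<psi> N(1)])
    show "\<not> ?\<psi> ` N \<subseteq> W1" using N(2) \<open>\<rho> ` ?\<psi> ` N = N\<close> by (metis image_mono)
   qed
   ultimately show ?thesis using img by simp
  qed
 qed
 moreover have "compactly_generated H.PG"
  by (rule top_iso_compactly_generated[OF W.group_PG H.group_PG \<rho> _ W_compactly_generated]) simp
 moreover have "\<exists>\<xi><omega ^ Suc n. has_rank H.PG \<xi>"
 proof -
  obtain \<gamma> where \<gamma>: "\<kappa> = \<gamma> + 1" using \<kappa>(1) by (rule rank_successor)
  have "\<gamma> < \<gamma> + 1" by (simp add: less_add_one_iff_omega1)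
  then have "\<gamma> < omega ^ Suc n" using \<kappa>(2) unfolding \<gamma> by order
  obtain \<xi> where \<xi>: "\<xi> \<le> 1 + \<gamma> + 1 + 1" "has_rank W.PG \<xi>" using \<kappa>(1) unfolding \<gamma> by (rule rank_W)
  have "1 + \<gamma> + 1 + 1 < omega ^ Suc n" by (intro omega_power_add_closed one_less_omega_power_Suc \<open>\<gamma> < omega ^ Suc n\<close>)
  then have "\<xi> < omega ^ Suc n" using \<xi>(1) by order
  then show ?thesis using top_iso_rank[OF W.tdlc_PG H.group_PG _ \<rho> \<xi>(2)] by auto
 qed
 then obtain \<xi> where \<xi>: "\<xi> < omega ^ Suc n" "has_rank H.PG \<xi>" by blast
 moreover have "\<beta> = 0 \<or> (\<exists>\<rho>. has_rank (Res H.PG) \<rho> \<and> 1 + \<beta> < \<rho>)"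
 proof -
  interpret Kp: perm_pair K U by (rule perm_pair_K)
  have sgc: "sg 0 : cont_hom Kp.PG W.PG" using sg_cont_hom K_open(2) by simp
  obtain \<sigma> where \<sigma>: "\<kappa> \<le> \<sigma>" "has_rank (Res H.PG) \<sigma>"
  proof (rule rank_residual_lower[OF H.tdlc_PG \<xi>(2) \<kappa>(1)])
   show "\<rho> o sg 0 : cont_hom Kp.PG H.PG" by (rule cont_hom_comp[OF sgc top_iso_cont_hom[OF \<rho>]])
   show "inj_on (\<rho> o sg 0) (carrier Kp.PG)"
   proof (rule comp_inj_on)
    show "inj_on (sg 0) (carrier Kp.PG)" using sg_inj by (rule inj_on_subset) simp
    show "inj_on \<rho> (sg 0 ` carrier Kp.PG)" using inj sg_W by (auto intro: inj_on_subset)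
   qed
   have "\<rho> ` discrete_residual W.PG \<subseteq> discrete_residual H.PG"
    by (rule residual_hom[OF W.topological_group_PG H.topological_group_PG top_iso_cont_hom[OF \<rho>]])
   then show "(\<rho> o sg 0) ` carrier Kp.PG \<subseteq> discrete_residual H.PG" using residual_contains_sg[of 0] by auto
  qed auto
  then show ?thesis using \<beta>(1) by (meson less_le_trans)
 qed
 ultimately show ?thesis unfolding branching_def V_def using \<beta>(2) by blast
qed

end

section \<open>Extending by the shift\<close>

definition shift :: "int => seq => seq" where
 "shift m x = Abs_poly_mapping (\<lambda>i. x \<cdot> (i - m))"

lemma entry_shift [simp]: "shift m x \<cdot> i = x \<cdot> (i - m)"
proof -
 have "finite ((\<lambda>i. i + m) ` {i. x \<cdot> i \<noteq> 0})" by simp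
 moreover have "{i. x \<cdot> (i - m) \<noteq> 0} \<subseteq> (\<lambda>i. i + m) ` {i. x \<cdot> i \<noteq> 0}" by (auto intro!: image_eqI[of _ _ "_ - m"])
 ultimately have "finite {i. x \<cdot> (i - m) \<noteq> 0}" by (rule finite_subset[rotated])
 then show ?thesis by (simp add: shift_def lookup_Abs_poly_mapping)
qed

lemma shift_shift [simp]: "shift m (shift n x) = shift (m + n) x" by (rule seq_eqI) (simp add: algebra_simps)

lemma shift_0 [simp]: "shift 0 x = x" by (rule seq_eqI) simp

lemma shift_comp: "shift m o shift n = shift (m + n)" by (simp add: fun_eq_iff)

lemma bij_shift: "bij (shift m)" by (rule o_bij[of "shift (- m)"]) (simp_all add: fun_eq_iff)

lemma invp_shift: "invp (shift m) = shift (- m)" by (rule inv_unique_comp) (simp_all add: fun_eq_iff)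

lemma agree_shift: "agree i (shift m x) (shift m y) \<longleftrightarrow> agree (i - m) x y"
proof
 assume a: "agree i (shift m x) (shift m y)"
 show "agree (i - m) x y" unfolding agree_def
 proof (intro allI impI)
  fix j assume "i - m \<le> j"
  then show "x \<cdot> j = y \<cdot> j" using agree_entry[OF a, of "j + m"] by simp
 qed
qed (simp add: agree_def)

lemma shift_upd: "shift m (upd x i a) = upd (shift m x) (i + m) a" by (rule seq_eqI) (auto simp: algebra_simps)

definition sconj :: "int => (seq => seq) => seq => seq" where
 "sconj m g = shift m o g o shift (- m)"

lemma sconj_sconj [simp]: "sconj m (sconj n g) = sconj (m + n) g" "sconj 0 g = g"
 by (auto simp: sconj_def fun_eq_iff algebra_simps)

lemma sconj_comp: "sconj m (g o h) = sconj m g o sconj m h" by (simp add: sconj_def fun_eq_iff)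

lemma sconj_root: "sconj m (rooted i v h) = rooted (i + m) (shift m v) h"
proof
 fix z
 have "agree (i + 1) (shift (- m) z) v \<longleftrightarrow> agree (i + m + 1) z (shift m v)"
  using agree_shift[of "i + m + 1" m "shift (- m) z" v] by (simp add: algebra_simps)
 then show "sconj m (rooted i v h) z = rooted (i + m) (shift m v) h z" by (simp add: sconj_def rooted_def shift_upd)
qed

section \<open>The semidirect product with the shift\<close>

context tree
begin

lemma sconj_K:
 assumes "g : K" shows "sconj m g : K"
proof -
 note a = K_aut[OF assms]
 have bij: "bij (sconj m g)" unfolding sconj_def using a by (intro bij_comp bij_shift) (simp add: tree_aut_def)
 have l: "loc (sconj m g) i x = loc g (i - m) (shift (- m) x)" for i x
  by (simp add: loc_def sconj_def shift_upd fun_eq_iff)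
 have "bad (sconj m g) \<subseteq> (\<lambda>(j, w). (j + m, shift m w)) ` bad g"
 proof clarify
  fix i z assume b: "(i, z) : bad (sconj m g)"
  have "(i - m, shift (- m) z) : bad g" using b by (auto simp: bad_def truncated_def sconj_def)
  then show "(i, z) : (\<lambda>(j, w). (j + m, shift m w)) ` bad g" by (intro image_eqI[of _ _ "(i - m, shift (- m) z)"]) auto
 qed
 then have "finite (bad (sconj m g))" using K_bad[OF assms] by (meson finite_imageI finite_subset)
 moreover have "tree_aut (sconj m g)" using bij a by (simp add: tree_aut_def sconj_def agree_shift)
 ultimately show ?thesis using assms by (simp add: K_def l)
qed

lemma sconj_U: "u : U ==> sconj m u : U" using sconj_K by (auto simp: U_def sconj_def)

lemma sconj_M: "sconj m ` M k = M (k + m)"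
proof -
 have sub: "sconj m g : M (k + m)" if "g : M k" for g m k
 proof -
  have "agree (k + m + 1) (sconj m g x) x" for x
   using M_agree[OF that, of "shift (- m) x"] agree_shift[of "k + m + 1" m "g (shift (- m) x)" "shift (- m) x"]
   by (simp add: sconj_def algebra_simps)
  then show ?thesis using sconj_K[OF M_K[OF that]] by (simp add: M_def)
 qed
 have "g : sconj m ` M k" if "g : M (k + m)" for g
  using sub[OF that, of "- m"] by (intro image_eqI[of _ _ "sconj (- m) g"]) auto
 then show ?thesis using sub by blast
qed

definition E :: "(seq => seq) set" where
 "E = {shift m o k |m k. k : K}"

text \<open>Well defined because a non-trivial shift does not preserve levels and so lies outside
  \<open>K\<close>.\<close>

definition deg :: "(seq => seq) => int" where
 "deg g = (THE m. shift (- m) o g : K)"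

lemma shift_K: "shift m o k : K ==> k : K ==> m = 0"
proof -
 assume k: "shift m o k : K" "k : K"
 have "(shift m o k) o invp k : K" by (rule K_comp[OF k(1) K_inv[OF k(2)]])
 also have "(shift m o k) o invp k = shift m" using k(2) by (simp add: comp_assoc)
 finally have "tree_aut (shift m)" by (rule K_aut)
 then have a: "agree i x y \<longleftrightarrow> agree (i - m) x y" for i x y using tree_aut_agree agree_shift by blast
 have b: "agree i (upd 0 0 1) 0 \<longleftrightarrow> 0 < i" for i by (auto simp: agree_def)
 have "0 < i \<longleftrightarrow> 0 < i - m" for i using a[of i "upd 0 0 1" 0] unfolding b .
 from this[of 0] this[of m] show "m = 0" by auto
qed

lemma deg_eq: "k : K ==> deg (shift m o k) = m" unfolding deg_def
proof (rule the_equality)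
 assume k: "k : K"
 show "shift (- m) o (shift m o k) : K" using k by (simp add: comp_assoc[symmetric] shift_comp) (simp add: comp_def)
 fix n assume n: "shift (- n) o (shift m o k) : K"
 have "shift (- n) o (shift m o k) = shift (m - n) o k" by (simp add: fun_eq_iff)
 then have "m - n = 0" using n k shift_K by metis
 then show "n = m" by simp
qed

lemma E_cases: "g : E ==> (!!m k. g = shift m o k ==> k : K ==> deg g = m ==> thesis) ==> thesis"
 using deg_eq by (auto simp: E_def)

lemma E_comp_eq: "(shift m o k) o (shift n o l) = shift (m + n) o (sconj (- n) k o l)"
 by (simp add: sconj_def fun_eq_iff)

lemma E_I: "k : K ==> shift m o k : E" by (auto simp: E_def)

lemma E_comp: "g : E ==> h : E ==> g o h : E" "g : E ==> h : E ==> deg (g o h) = deg g + deg h"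
proof -
 assume "g : E" "h : E"
 then obtain m k n l where "g = shift m o k" "k : K" "deg g = m" "h = shift n o l" "l : K" "deg h = n"
  by (elim E_cases) (rule that)
 moreover from this have "sconj (- n) k o l : K" by (intro K_comp sconj_K)
 ultimately show "g o h : E" "deg (g o h) = deg g + deg h" using E_I deg_eq by (simp_all only: E_comp_eq)
qed

lemma E_inv_eq: "k : K ==> invp (shift m o k) = shift (- m) o sconj m (invp k)"
 using bij[of k] bij_shift by (simp add: o_inv_distrib invp_shift) (simp add: sconj_def fun_eq_iff)

lemma K_E: "K = {g : E. deg g = 0}"
proof
 have s: "shift 0 o k = k" for k by (simp add: fun_eq_iff)
 show "K \<subseteq> {g : E. deg g = 0}"
 proof
  fix k assume "k : K"
  then show "k : {g : E. deg g = 0}" using E_I[of k 0] deg_eq[of k 0] unfolding s by simp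
 qed
 show "{g : E. deg g = 0} \<subseteq> K"
 proof
  fix g assume "g : {g : E. deg g = 0}"
  then have g: "g : E" "deg g = 0" by auto
  obtain m k where "g = shift m o k" "k : K" "deg g = m" by (rule E_cases[OF g(1)]) (rule that)
  then show "g : K" using g(2) s by metis
 qed
qed

lemma K_sub_E: "K \<subseteq> E" using K_E by auto

lemma perm_pair_E: "perm_pair E U"
proof
 show "bij g" if "g : E" for g using that bij bij_shift by (auto simp: E_def intro: bij_comp)
 show "g o h : E" if "g : E" "h : E" for g h by (rule E_comp(1)[OF that])
 show "invp g : E" if g: "g : E" for g
 proof -
  obtain m k where k: "g = shift m o k" "k : K" by (rule E_cases[OF g]) (rule that)
  show ?thesis unfolding k(1) E_inv_eq[OF k(2)] by (intro E_I sconj_K K_inv k(2))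
 qed
 show "U \<subseteq> E" using U_sub K_sub_E by blast
 show "\<exists>F. finite F \<and> (\<forall>u\<in>U. (\<forall>y\<in>F. u y = y) --> invp h o u o h : U)" if h: "h : E" for h
 proof -
  obtain m k where k: "h = shift m o k" "k : K" by (rule E_cases[OF h]) (rule that)
  obtain F where F: "finite F" "!!u. u : U ==> \<forall>y\<in>F. u y = y ==> invp k o u o k : U"
   using commensurated[OF k(2)] by blast
  have "invp h o u o h : U" if u: "u : U" "\<forall>y\<in>shift m ` F. u y = y" for u
  proof -
   have "invp k o sconj (- m) u o k : U" by (rule F(2)[OF sconj_U[OF u(1)]]) (use u(2) in \<open>auto simp: sconj_def\<close>)
   also have "invp k o sconj (- m) u o k = invp h o u o h"
    using bij[OF k(2)] bij_shift by (simp add: k(1) o_inv_distrib invp_shift sconj_def comp_assoc)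
   finally show ?thesis .
  qed
  then show ?thesis using F(1) by (intro exI[of _ "shift m ` F"]) blast
 qed
 obtain D where D: "countable D" "D \<subseteq> K" "!!g. g : K ==> \<exists>d\<in>D. invp d o g : U" using countable_cosets by blast
 let ?D = "(\<lambda>(m, d). shift m o d) ` (UNIV \<times> D)"
 have "\<exists>d\<in>?D. invp d o g : U" if g: "g : E" for g
 proof -
  obtain m k where k: "g = shift m o k" "k : K" by (rule E_cases[OF g]) (rule that)
  obtain d where d: "d : D" "invp d o k : U" using D(3)[OF k(2)] by blast
  have "invp (shift m o d) o g = invp d o k"
   using bij[of d] d(1) D(2) bij_shift by (auto simp: k(1) o_inv_distrib invp_shift fun_eq_iff)
  then show ?thesis using d by (intro bexI[of _ "shift m o d"]) auto
 qed
 moreover have "countable ?D" using D(1) by (intro countable_image countable_SIGMA) auto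
 moreover have "?D \<subseteq> E" using D(2) E_I by auto
 ultimately show "\<exists>D. countable D \<and> D \<subseteq> E \<and> (\<forall>g\<in>E. \<exists>d\<in>D. invp d o g : U)" by (intro exI[of _ ?D]) blast
qed (use U_id U_comp U_invp U_orbits U_closed countable_points in auto)

sublocale E: perm_pair E U by (rule perm_pair_E)

lemma subgroup_K_E: "subgroup K E.PG" by (rule E.subgroup_PGI) (use K_sub_E K_id K_comp K_inv in auto)

lemmas K_open_E = E.subgroup_above_U[OF subgroup_K_E U_sub]

lemma normal_K_E: "g : E ==> k : K ==> g o k o invp g : K"
proof -
 assume g: "g : E" and k: "k : K"
 have kE: "k : E" "deg k = 0" using k K_E by auto
 have gi: "invp g : E" by (rule E.invp[OF g])
 have "deg g + deg (invp g) = deg id" using E_comp(2)[OF g gi] g by simp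
 moreover have "deg id = 0" using K_E K_id by blast
 ultimately have "deg (g o k o invp g) = 0"
  using E_comp(2)[OF E_comp(1)[OF g kE(1)] gi] E_comp(2)[OF g kE(1)] kE(2) by simp
 then show ?thesis using E_comp(1)[OF E_comp(1)[OF g kE(1)] gi] K_E by blast
qed

text \<open>If a local action moved some label a, conjugation by a rooted element taking 0 to a
  would produce an element that moves a zero entry.\<close>

lemma core_U:
 assumes g: "g : U" "!!h. h : K ==> invp h o g o h : U" shows "g = id"
proof -
 note ag = K_aut[OF U_mem[OF g(1)]]
 have l: "loc g i x a = a" for i x a
 proof (rule ccontr)
  assume a: "loc g i x a \<noteq> a"
  obtain r where r: "r : H" "r 0 = a" using transitive by blast
  define b where "b = loc g i x a"
  have a0: "a \<noteq> 0"
  proof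
   assume "a = 0"
   then show False using a U_loc[OF g(1), of i x] by simp
  qed
  have inj: "inj (loc g i x)" using loc_inv(4)[OF ag] by (rule bij_is_inj)
  have b0: "b \<noteq> 0"
  proof
   assume "b = 0"
   then have "loc g i x a = loc g i x 0" using U_loc[OF g(1), of i x] by (simp add: b_def)
   then show False using injD[OF inj] a0 by blast
  qed
  let ?c = "rooted i x r" and ?z = "upd x i 0"
  have cz: "?c ?z = upd x i a" using r by (intro seq_eqI) (auto simp: rooted_def)
  have gc: "g (?c ?z) \<cdot> i = b" unfolding cz b_def by (simp add: loc_def)
  have "(invp ?c o g o ?c) ?z \<cdot> i \<noteq> 0"
  proof (cases "agree (i + 1) (g (?c ?z)) x")
   case True
   then have "(invp ?c o g o ?c) ?z \<cdot> i = invp r b" using gc r by (simp add: tree_aut_root_inv[OF H.bij] rooted_def)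
   moreover have "invp r b \<noteq> 0" using H.invp_apply(2)[OF r(1), of b] r(2) a b_def by metis
   ultimately show ?thesis by simp
  next
   case False
   then have "(invp ?c o g o ?c) ?z \<cdot> i = b" using gc r by (simp add: tree_aut_root_inv[OF H.bij] rooted_def)
   then show ?thesis using b0 by simp
  qed
  moreover have "invp ?c o g o ?c : U" by (rule g(2)[OF K_root[OF r(1)]])
  ultimately show False by (simp add: U_def)
 qed
 have "g x = x" for x using loc_entry[OF ag agree_refl] l by (intro seq_eqI) simp
 then show ?thesis by auto
qed

lemma root_conj_root:
 assumes "i < j" "r : H" shows "rooted j w r o rooted i v h o invp (rooted j w r) = rooted i (rooted j w r v) h"
proof
 fix z
 let ?r = "rooted j w r"
 note a = K_aut[OF K_root[OF assms(2), of j w]]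
 define y where "y = invp ?r z"
 have z: "z = ?r y" using a by (simp add: y_def)
 have *: "agree (i + 1) (?r y) (?r v) \<longleftrightarrow> agree (i + 1) y v" by (rule tree_aut_agree[OF a])
 have upd: "?r (upd y i b) = upd (?r y) i b" for b using assms(1) by (intro seq_eqI) (auto simp: rooted_def agree_def)
 have ent: "?r y \<cdot> i = y \<cdot> i" using assms(1) by (simp add: rooted_def)
 have "?r (rooted i v h y) = rooted i (?r v) h (?r y)"
 proof (cases "agree (i + 1) y v")
  case True
  then show ?thesis unfolding rooted_def[of i v h y] rooted_def[of i "?r v" h "?r y"] * ent by (simp only: upd if_True)
 next
  case False
  then show ?thesis unfolding rooted_def[of i v h y] rooted_def[of i "?r v" h "?r y"] * by (simp only: if_False)
 qed
 then show "(?r o rooted i v h o invp ?r) z = rooted i (?r v) h z"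
  unfolding comp_apply y_def[symmetric] z[symmetric] .
qed

text \<open>Induction on the number of levels above v on which it may differ from the zero sequence:
  conjugation by a rooted element at the topmost of these turns branch 0 into the right one.\<close>

lemma roots_from_path:
 assumes N: "subgroup N PG" and zero: "!!i h. h : H ==> rooted i 0 h : N" and h: "h : H" shows "rooted i v h : N"
proof -
 note N' = PG_subgroupD[OF N]
 have "\<forall>v. (\<forall>k>i + int d. v \<cdot> k = 0) --> rooted i v h : N" for d
 proof (induction d)
  case 0
  show ?case
  proof (intro allI impI)
   fix v :: seq assume "\<forall>k>i + int 0. v \<cdot> k = 0"
   then have "agree (i + 1) v 0" by (simp add: agree_def)
   then show "rooted i v h : N" using zero[OF h] root_cong by metis
  qed
 next
  case (Suc d)
  show ?case
  proof (intro allI impI)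
   fix v :: seq assume v: "\<forall>k>i + int (Suc d). v \<cdot> k = 0"
   let ?j = "i + int (Suc d)"
   obtain r where r: "r : H" "r 0 = v \<cdot> ?j" using transitive by blast
   let ?w = "upd v ?j 0"
   have "rooted i ?w h : N" using Suc v by auto
   then have "rooted ?j 0 r o rooted i ?w h o invp (rooted ?j 0 r) : N"
    using N'(3)[OF N'(3) N'(4)] zero[OF r(1)] by blast
   moreover have "rooted ?j 0 r ?w = v"
   proof -
    have "agree (?j + 1) ?w 0" using v by (auto simp: agree_def)
    then show ?thesis using r(2) by (intro seq_eqI) (auto simp: rooted_def)
   qed
   ultimately show "rooted i v h : N" using root_conj_root[OF _ r(1), of i ?j 0 ?w h] by simp
  qed
 qed
 moreover obtain d where "\<forall>k>i + int d. v \<cdot> k = 0"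
 proof -
  obtain m where m: "agree m v 0" using agree_eventually by blast
  have "\<forall>k>i + int (nat (m - i)). v \<cdot> k = 0" using agree_entry[OF m] by auto
  then show thesis by (rule that)
 qed
 ultimately show ?thesis by blast
qed

lemma generated_by_roots:
 assumes N: "subgroup N PG" and U: "U \<subseteq> N" and roots: "!!i v h. h : H ==> rooted i v h : N" shows "K \<subseteq> N"
proof
 have "open_subgroup N PG" using U by (intro open_subgroup_PG[OF N, of "{}"]) (auto simp: small_def)
 then have "closedin (perm_topology K U) N" using closed_open_subgroup[of N] by (simp add: closed_subgroup_def)
 then show "g : N" if "g : K" for g using roots_dense[OF N, of UNIV g] roots that by blast
qed

end

context stacked_tree
begin

lemma closed_normal_E_Int:
 assumes "subgroup N E.PG" "closedin (perm_topology E U) N" "!!g n. g : E ==> n : N ==> g o n o invp g : N"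
 shows "closed_normal (N \<inter> K) PG"
proof (rule closed_normal_PGI)
 note N' = E.PG_subgroupD[OF assms(1)]
 show "subgroup (N \<inter> K) PG" by (rule subgroup_PGI) (use N' K_id K_comp K_inv in auto)
 show "c o g o invp c : N \<inter> K" if "c : K" "g : N \<inter> K" for c g using that assms(3) normal_K_E K_sub_E by blast
 have "gtop (subgrp E.PG K) = perm_topology K U" using K_open_E(2) by simp
 then have "subtopology (perm_topology E U) K = perm_topology K U" by simp
 then show "closedin (perm_topology K U) (N \<inter> K)" using assms(2) by (metis closedin_subtopology)
qed

text \<open>Conjugation by shifts carries one member of the chain to all others, and only the whole
  group contains all of them.\<close>

lemma K_subset_of_M:
 assumes "subgroup N E.PG" "closedin (perm_topology E U) N" "!!g n. g : E ==> n : N ==> g o n o invp g : N"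
  "M k \<subseteq> N" shows "K \<subseteq> N"
proof -
 have inv: "sconj m n : N" if "n : N" for m n
 proof -
  have "shift m : E" using E_I[OF K_id, of m] by simp
  then show ?thesis using assms(3)[of "shift m" n] that by (simp add: sconj_def invp_shift)
 qed
 have *: "M (k + m) \<subseteq> N \<inter> K" for m using assms(4) inv M_K unfolding sconj_M[symmetric] by (auto intro: sconj_K)
 have "M j \<subseteq> N \<inter> K" for j using *[of "j - k"] by simp
 then have "N \<inter> K = carrier PG"
  using stack_system_K closed_normal_E_Int[OF assms(1-3)] unfolding stack_system_def by blast
 then show ?thesis by auto
qed

theorem glue_E:
 assumes "compactly_generated H.PG"
 obtains C where "glue E U deg (shift 1) C"
proof -
 obtain CH where CH: "compactin (perm_topology H V) CH" "generate H.PG CH = H"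
  using assms by (auto simp: compactly_generated_def)
 have CHH: "CH \<subseteq> H" using compactin_subset_topspace[OF CH(1)] by simp
 define C where "C = U \<union> rooted 0 0 ` CH"
 have top: "subtopology (perm_topology E U) K = perm_topology K U" using arg_cong[OF K_open_E(2), of gtop] by simp
 have "glue E U deg (shift 1) C"
 proof (intro glue.intro glue_axioms.intro perm_pair_E)
  show "deg (g o h) = deg g + deg h" if "g : E" "h : E" for g h by (rule E_comp(2)[OF that])
  show "shift 1 : E" "deg (shift 1) = 1" using E_I[OF K_id, of 1] deg_eq[OF K_id, of 1] by simp_all
  show "deg u = 0" if "u : U" for u using that U_mem K_E by blast
  show "g = id" if "g : E" "!!h. h : E ==> invp h o g o h : U" for g
  proof (rule core_U)
   show "g : U" using that(2)[OF E.id_mem] by (simp add: inv_id)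
   show "invp h o g o h : U" if "h : K" for h using that \<open>!!h. h : E ==> _\<close> K_sub_E by blast
  qed
  show "{g : E. deg g = 0} \<subseteq> N"
   if N: "subgroup N E.PG" "closedin (perm_topology E U) N" "!!g n. g : E ==> n : N ==> g o n o invp g : N"
    and comm: "!!g h. g : E ==> h : E ==> g o h o invp g o invp h : N" for N
  proof -
   \<comment> \<open>By the dichotomy a commutator outside \<open>M' 0\<close> forces
     \<open>M 0\<close> into the subgroup; shifting then gives all of \<open>K\<close>.\<close>
   obtain a b where ab: "a : M 0" "b : M 0" "a \<otimes>\<^bsub>PG\<^esub> b \<otimes>\<^bsub>PG\<^esub> inv\<^bsub>PG\<^esub> a \<otimes>\<^bsub>PG\<^esub> inv\<^bsub>PG\<^esub> b \<notin> M' 0"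
    using stack_system_K unfolding stack_system_def by meson
   have abK: "a : K" "b : K" using ab M_K by auto
   have "a o b o invp a o invp b : N \<inter> K"
    using comm[of a b] K_sub_E abK K_comp[OF K_comp[OF K_comp] K_inv] K_inv by auto
   moreover have "a o b o invp a o invp b \<notin> M' 0" using ab(3) abK by simp
   ultimately have "\<not> N \<inter> K \<subseteq> M' 0" by blast
   then have "M 0 \<subseteq> N \<inter> K" using stack_system_K closed_normal_E_Int[OF N] unfolding stack_system_def by blast
   then have "K \<subseteq> N" by (intro K_subset_of_M[OF N, of 0]) auto
   then show ?thesis using K_E by simp
  qed
  show "compactin (perm_topology E U) C"
  proof -
   have "compactin (perm_topology K U) C" unfolding C_def by (intro compactin_Un compactin_U compact_root CH)
   then show ?thesis unfolding top[symmetric] by (simp add: compactin_subtopology)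
  qed
  show "C \<subseteq> {g : E. deg g = 0}" unfolding K_E[symmetric] C_def using U_sub K_root CHH by auto
  show "{g : E. deg g = 0} \<subseteq> N"
   if N: "subgroup N E.PG" "C \<subseteq> N" "!!n. n : N ==> shift 1 o n o invp (shift 1) : N"
    "!!n. n : N ==> invp (shift 1) o n o shift 1 : N" for N
  proof -
   note N' = E.PG_subgroupD[OF N(1)]
   have NK: "subgroup (N \<inter> K) PG" by (rule subgroup_PGI) (use N' K_id K_comp K_inv in auto)
   have "rooted 0 0 ` CH \<subseteq> N \<inter> K" using N(2) K_root CHH by (auto simp: C_def)
   then have "rooted 0 0 ` H \<subseteq> N \<inter> K" using root_generate[OF NK _ CHH, of 0 0] CH(2) by simp
   then have r0: "rooted 0 0 h : N" if "h : H" for h using that by blast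
   have s0: "shift m 0 = 0" for m by (rule seq_eqI) simp
   \<comment> \<open>Conjugation by the shift moves rooted elements along the zero path to every
     level; the other vertices are reached by \<open>roots_from_path\<close>.\<close>
   have "rooted i 0 h : N" if h: "h : H" for i h
   proof (induction i rule: int_induct[of _ 0])
    case base
    show ?case by (rule r0[OF h])
   next
    case (step1 i)
    then show ?case using N(3)[of "rooted i 0 h"] sconj_root[of 1 i 0 h] by (simp add: sconj_def invp_shift s0)
   next
    case (step2 i)
    then show ?case using N(4)[of "rooted i 0 h"] sconj_root[of "- 1" i 0 h] by (simp add: sconj_def invp_shift s0)
   qed
   then have "rooted i 0 h : N \<inter> K" if "h : H" for i h using K_root that by blast
   then have "rooted i v h : N \<inter> K" if "h : H" for i v h by (rule roots_from_path[OF NK _ that])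
   then have "K \<subseteq> N \<inter> K" using N(2) U_sub by (intro generated_by_roots[OF NK]) (auto simp: C_def)
   then show ?thesis using K_E by auto
  qed
  show "{g : E. deg g = 0} \<subseteq> N"
   if N: "open_subgroup N E.PG" "!!g n. g : E ==> n : N ==> g o n o invp g : N" for N
  proof -
   have Ns: "subgroup N E.PG" "openin (perm_topology E U) N" "closedin (perm_topology E U) N"
    using N(1) E.closed_open_subgroup[OF N(1)] by (auto simp: open_subgroup_def closed_subgroup_def)
   then obtain F where F: "finite F" "E.small F \<subseteq> N" using E.openin_contains_small[of N] E.PG_subgroupD(2) by auto
   \<comment> \<open>Rooted at a vertex whose cone avoids \<open>F\<close>, an element of
     \<open>V\<close> outside \<open>H1\<close> lies in the given small neighbourhood and still has
     a local action outside \<open>H1\<close>.\<close>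
   obtain h where h: "h : V" "h \<notin> H1" using V_not_H1 by blast
   obtain a where a: "a \<notin> (\<lambda>y. y \<cdot> 1) ` F" using ex_new_if_finite[OF infinite_UNIV_nat finite_imageI[OF F(1)]] by blast
   let ?v = "upd 0 1 a" and ?r = "rooted 0 (upd 0 1 a) h"
   have "?r y = y" if "y : F" for y
   proof -
    have "y \<cdot> 1 \<noteq> a" using a that by blast
    then have "\<not> agree (0 + 1) y ?v" by (auto simp: agree_def)
    then show ?thesis by (simp add: rooted_def)
   qed
   moreover have "?r : U" using root_U_iff h(1) by blast
   ultimately have "?r : N \<inter> K" using F(2) U_sub by (auto simp: E.small_def)
   moreover have "?r : M 0" using root_M h(1) by auto
   moreover have "loc ?r 0 ?v \<notin> H1" using h(2) by (simp add: loc_root)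
   moreover have "closed_normal (N \<inter> K) PG" by (rule closed_normal_E_Int[OF Ns(1,3) N(2)])
   ultimately have "M 0 \<subseteq> N \<inter> K" by (intro M_subset_of_loc)
   then have "K \<subseteq> N" by (intro K_subset_of_M[OF Ns(1,3) N(2), of 0]) auto
   then show ?thesis using K_E by simp
  qed
 qed
 then show thesis by (rule that)
qed

end

section \<open>Induction on the exponent\<close>

definition int_shifts :: "(int => int) set" where
 "int_shifts = range (\<lambda>m x. x + m)"

lemma int_shift_inv: "invp (\<lambda>x :: int. x + m) = (\<lambda>x. x + - m)" by (rule inv_unique_comp) (simp_all add: fun_eq_iff)

lemma perm_pair_int_shifts: "perm_pair int_shifts {id}"
proof
 show "bij g" if "g : int_shifts" for g
  using that by (auto simp: int_shifts_def intro!: o_bij[of "invp g"] simp: int_shift_inv fun_eq_iff)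
 show "g o h : int_shifts" if "g : int_shifts" "h : int_shifts" for g h
  using that by (auto simp: int_shifts_def fun_eq_iff)
 show "invp g : int_shifts" if "g : int_shifts" for g
  using that by (auto simp: int_shifts_def int_shift_inv intro: image_eqI[of _ _ "- _"])
 show "{id} \<subseteq> int_shifts" by (auto simp: int_shifts_def fun_eq_iff intro!: image_eqI[of _ _ 0])
 show "f : {id}" if "!!F. finite F ==> \<exists>u\<in>{id}. \<forall>y\<in>F. u y = f y" for f :: "int => int"
 proof -
  have "f y = y" for y using that[of "{y}"] by simp
  then show ?thesis by auto
 qed
 show "\<exists>F. finite F \<and> (\<forall>u\<in>{id}. (\<forall>y\<in>F. u y = y) --> invp h o u o h : {id})" if h: "h : int_shifts" for h
 proof -
  have "invp h o id o h = id" using h by (auto simp: int_shifts_def int_shift_inv fun_eq_iff)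
  then show ?thesis by (intro exI[of _ "{}"]) simp
 qed
 have "countable int_shifts" by (simp add: int_shifts_def)
 moreover have "invp g o g : {id}" if "g : int_shifts" for g
  using that by (auto simp: int_shifts_def int_shift_inv fun_eq_iff)
 ultimately show "\<exists>D. countable D \<and> D \<subseteq> int_shifts \<and> (\<forall>g\<in>int_shifts. \<exists>d\<in>D. invp d o g : {id})" by blast
qed (auto simp: inv_id)

text \<open>The integers act on themselves by translation, with the trivial group as compact open
  subgroup. Their part of degree 0 is trivial, of rank 1, and \<beta> = 0 satisfies the bound for
  exponent 0 with equality.\<close>

lemma branching_0: "\<exists>H. branching 0 H"
proof -
 interpret T: perm_pair int_shifts "{id}" by (rule perm_pair_int_shifts)
 have K: "{g : int_shifts. g 0 = 0} = {id}" by (auto simp: int_shifts_def fun_eq_iff image_iff intro!: exI[of _ 0])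
 interpret glue int_shifts "{id}" "\<lambda>g. g 0" "\<lambda>x. x + 1" "{}"
 proof
  show "(g o h) 0 = g 0 + h 0" if "g : int_shifts" "h : int_shifts" for g h using that by (auto simp: int_shifts_def)
  show "(\<lambda>x. x + 1) : int_shifts" by (auto simp: int_shifts_def)
  show "g = id" if "g : int_shifts" "!!h. h : int_shifts ==> invp h o g o h : {id}" for g
   using that(2)[OF T.id_mem] by (simp add: inv_id)
 qed (use T.PG_subgroupD(2) in \<open>auto simp: K open_subgroup_def\<close>)
 interpret K: perm_pair "{id :: int => int}" "{id}" using perm_pair_K unfolding K .
 have "has_rank (perm_group {id} {id :: int => int}) 1" by (rule has_decomposition_rank.trivial[OF K.tdlcsc]) simp
 then show ?thesis using ex_branching[of 1 0 0] one_less_omega_power_Suc[of 0] unfolding K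
  by (simp add: omega_power_0 del: power_Suc)
qed

text \<open>The new \<beta> is \<open>omega ^ Suc n\<close>. The tree group has rank \<beta> + 1,
  and this exceeds 1 + \<beta> because 1 + \<beta> = \<beta>.\<close>

lemma (in stacked_tree) branching_rank_K:
 assumes "compactly_generated H.PG" "has_rank H.PG \<xi>" "\<xi> < omega ^ Suc n"
  and "\<beta> = 0 \<or> (\<exists>\<rho>. has_rank (Res H.PG) \<rho> \<and> 1 + \<beta> < \<rho>)" and "omega ^ n \<le> \<beta> + 1" shows "\<exists>H'. branching (Suc n) H'"
proof -
 obtain C where "glue E U deg (shift 1) C" by (rule glue_E[OF assms(1)])
 then interpret G: glue E U deg "shift 1" C .
 show ?thesis
 proof (rule G.ex_branching)
  show "has_rank (perm_group G.K U) (omega ^ Suc n + 1)" using rank_K[OF assms] by (simp flip: K_E)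
  show "omega ^ Suc n + 1 < omega ^ Suc (Suc n)"
   by (intro omega_power_add_closed omega_power_less_Suc one_less_omega_power_Suc)
  show "omega ^ Suc n = 0 \<or> 1 + omega ^ Suc n < omega ^ Suc n + 1"
   unfolding one_add_omega_power_Suc by (simp only: less_add_one_iff_omega1 order_refl simp_thms)
  show "omega ^ Suc n \<le> omega ^ Suc n + 1" by (rule ord_add_bounds(1))
 qed
qed

lemma ex_branching_all: "\<exists>H. branching n H"
proof (induction n)
 case 0
 show ?case by (rule branching_0)
next
 case (Suc n)
 then obtain H H1 \<xi> \<beta> where H: "stacked_tree H H1" "compactly_generated (perm_group H {h : H. h 0 = 0})"
  "has_rank (perm_group H {h : H. h 0 = 0}) \<xi>" "\<xi> < omega ^ Suc n"
  "\<beta> = 0 \<or> (\<exists>\<rho>. has_rank (Res (perm_group H {h : H. h 0 = 0})) \<rho> \<and> 1 + \<beta> < \<rho>)" "omega ^ n \<le> \<beta> + 1"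
  unfolding branching_def by blast
 show ?case by (rule stacked_tree.branching_rank_K[OF H])
qed

lemma (in top_group) trivial_quotient_top_iso:
 "(\<lambda>x. {\<one>} #> x) : top_iso G (quotient_group G {\<one>})" "topological_group (quotient_group G {\<one>})"
proof -
 interpret N: normal "{\<one>}" G by (rule one_is_normal)
 have inj: "inj_on (\<lambda>x. {\<one>} #> x) (carrier G)" by (auto simp: inj_on_def r_coset_def)
 have hom: "(\<lambda>x. {\<one>} #> x) : hom G (G Mod {\<one>})" by (rule N.r_coset_hom_Mod)
 have q: "quotient_map (gtop G) (quotient_topology G {\<one>}) (\<lambda>x. {\<one>} #> x)"
  by (rule quotient_map_quotient_topology) simp
 have img: "(\<lambda>x. {\<one>} #> x) ` carrier G = carrier (quotient_group G {\<one>})"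
  by (simp add: quotient_group_def carrier_FactGroup)
 show iso: "(\<lambda>x. {\<one>} #> x) : top_iso G (quotient_group G {\<one>})"
  using inj hom q img by (simp add: top_iso_def iso_def hom_def quotient_group_def homeomorphic_map_def bij_betw_def)
 show "topological_group (quotient_group G {\<one>})" by (rule topological_group_quotient[OF one_is_normal])
qed

lemma top_iso_comp: "f : top_iso G H ==> g : top_iso H Q ==> g o f : top_iso G Q"
 by (auto simp: top_iso_def iso_set_trans intro: homeomorphic_map_compose)

lemma top_iso_subgrp:
 assumes "\<phi> : top_iso G H" "topspace (gtop G) = carrier G" "S \<subseteq> carrier G"
 shows "\<phi> : top_iso (subgrp G S) (subgrp H (\<phi> ` S))"
proof -
 have b: "bij_betw \<phi> (carrier G) (carrier H)" by (rule top_iso_bij[OF assms(1)])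
 have "\<phi> : iso (subgrp G S) (subgrp H (\<phi> ` S))"
  using assms(1,3) b by (auto simp: top_iso_def iso_def hom_def bij_betw_def subset_iff intro: inj_on_subset)
 moreover have "homeomorphic_map (subtopology (gtop G) S) (subtopology (gtop H) (\<phi> ` S)) \<phi>"
  using assms b by (intro homeomorphic_map_subtopologies_alt) (auto simp: top_iso_def bij_betw_def inj_on_def)
 ultimately show ?thesis by (simp add: top_iso_def)
qed

context stacked_tree
begin

text \<open>Conjugation by a shift is inner in the topological group on \<open>E\<close>; continuity
  passes to the open subgroup \<open>K\<close>.\<close>

lemma sconj_top_iso: "sconj m : top_iso PG PG"
proof -
 have s: "shift m : E" "invp (shift m) = shift (- m)" for m using E_I[OF K_id, of m] invp_shift by simp_all
 have c: "continuous_map (gtop E.PG) (gtop E.PG) (\<lambda>g. shift m \<otimes>\<^bsub>E.PG\<^esub> g \<otimes>\<^bsub>E.PG\<^esub> shift (- m))" for m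
  using s by (intro E.continuous_intros_G) auto
 have "sconj m : cont_hom PG PG" for m
 proof -
  have "continuous_map (subtopology (gtop E.PG) K) (subtopology (gtop E.PG) K) (sconj m)"
   using c[of m] sconj_K by (auto simp: continuous_map_in_subtopology sconj_def[abs_def] intro!: continuous_map_from_subtopology)
  moreover have "subtopology (gtop E.PG) K = perm_topology K U" using arg_cong[OF K_open_E(2), of gtop] by simp
  ultimately show ?thesis using sconj_K by (auto simp: cont_hom_def hom_def sconj_comp)
 qed
 then have h: "sconj m : hom PG PG" "continuous_map (gtop PG) (gtop PG) (sconj m)" for m by (auto simp: cont_hom_def)
 have "homeomorphic_maps (gtop PG) (gtop PG) (sconj m) (sconj (- m))" using h(2) by (simp add: homeomorphic_maps_def)
 then have "homeomorphic_map (gtop PG) (gtop PG) (sconj m)" by (auto simp: homeomorphic_map_maps)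
 moreover from this have "bij_betw (sconj m) K K" using homeomorphic_imp_injective_map homeomorphic_imp_surjective_map
  by (fastforce simp: bij_betw_def)
 ultimately show ?thesis using h(1) by (simp add: top_iso_def iso_def)
qed

text \<open>\<open>E\<close> is represented on the naturals by its action on the cosets of
  \<open>U\<close>, and the chief factor is \<open>K\<close> over the trivial group: a non-trivial
  closed normal subgroup of \<open>E\<close> inside \<open>K\<close> contains a member of the chain
  and, being shift invariant, all of \<open>K\<close>. The shifts also provide the automorphisms
  that stacking type asks for.\<close>

theorem ex_stacking_factor:
 assumes "has_rank PG \<kappa>"
 shows "\<exists>(X :: (nat => nat) tgroup) K N. elementary X \<and> chief_factor X (K, N) \<and> stacking_type X (K, N) \<and>
  decomposition_rank (factor_group X (K, N)) = \<kappa>"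
proof -
 have U: "open_subgroup U E.PG" "compactin (gtop E.PG) U"
  using E.open_subgroup_PG[OF E.subgroup_small[of "{}"], of "{}"] E.compactin_U by (auto simp: E.small_def)
 have core: "g = \<one>\<^bsub>E.PG\<^esub>" if "g : carrier E.PG"
  "!!h. h : carrier E.PG ==> inv\<^bsub>E.PG\<^esub> h \<otimes>\<^bsub>E.PG\<^esub> g \<otimes>\<^bsub>E.PG\<^esub> h : U" for g
 proof -
  have *: "invp h o g o h : U" if "h : E" for h using that \<open>!!h. h : carrier E.PG ==> _\<close>[of h] by simp
  have "g = id" by (rule core_U) (use *[OF E.id_mem] * K_sub_E in \<open>auto simp: inv_id\<close>)
  then show ?thesis by simp
 qed
 have index: "\<exists>x\<in>carrier E.PG. \<forall>g\<in>J. inv\<^bsub>E.PG\<^esub> g \<otimes>\<^bsub>E.PG\<^esub> x \<notin> U" if J: "finite J" "J \<subseteq> carrier E.PG" for J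
 proof -
  obtain m where m: "m \<notin> deg ` J" using ex_new_if_finite[OF infinite_UNIV_int finite_imageI[OF J(1)]] by blast
  have sE: "shift m : E" "deg (shift m) = m" using E_I[OF K_id, of m] deg_eq[OF K_id, of m] by simp_all
  have "invp g o shift m \<notin> U" if "g : J" for g
  proof
   assume "invp g o shift m : U"
   then have u: "invp g o shift m : E" "deg (invp g o shift m) = 0" using U_mem K_E by auto
   have g: "g : E" using J(2) that by auto
   have "g o (invp g o shift m) = shift m" using g by (simp add: comp_assoc[symmetric])
   then have "deg g = m" using E_comp(2)[OF g u(1)] u(2) sE(2) by simp
   then show False using m that by blast
  qed
  then show ?thesis using sE(1) J(2) by (intro bexI[of _ "shift m"]) auto
 qed
 obtain G :: "(nat => nat) set" and \<rho> where G: "perm_pair G {h : G. h 0 = 0}"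
  "\<rho> : top_iso E.PG (perm_group G {h : G. h 0 = 0})"
  by (rule E.coset_action[OF U core index], assumption, assumption, assumption, assumption, rule that)
 define X where "X = perm_group G {h : G. h 0 = 0}"
 interpret G: perm_pair G "{h : G. h 0 = 0}" by (rule G(1))
 have \<rho>: "\<rho> : top_iso E.PG X" unfolding X_def by (rule G(2))
 have X: "topological_group X" "group X" "tdlc X" "topspace (gtop X) = carrier X"
  using G.topological_group_PG G.group_PG G.tdlc_PG by (simp_all add: X_def)
 interpret X: tdlc X by (rule X(3))
 have K_normal: "K \<lhd> E.PG" unfolding E.normal_inv_iff using subgroup_K_E normal_K_E by auto
 have Ko: "openin (gtop E.PG) K" "subgrp E.PG K = PG" using K_open_E by (auto simp: open_subgroup_def)
 have "has_rank (subgrp E.PG K) \<kappa>" using assms Ko(2) by simp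
 then obtain \<gamma> where "has_rank E.PG \<gamma>" using E.rank_open_normal[OF K_normal Ko(1)] by blast
 then have elem: "elementary X" using elementary_of_rank[OF top_iso_rank[OF E.tdlc_PG X(2,4) \<rho>] X(3)] by blast
 define L where "L = \<rho> ` K"
 have cK: "closed_normal K E.PG"
  using K_normal E.closed_open_subgroup[OF K_open_E(1)] by (simp add: closed_normal_def closed_subgroup_def)
 have L: "closed_normal L X" unfolding L_def by (rule top_iso_closed_normal[OF E.topological_group_PG X(1) \<rho> cK])
 have one: "closed_normal {\<one>\<^bsub>X\<^esub>} X"
  using X.one_is_normal X.closed_subgroup_one by (simp add: closed_normal_def closed_subgroup_def)
 interpret r: group_hom E.PG X \<rho> by (rule cont_hom_group_hom[OF E.group_PG X(2) top_iso_cont_hom[OF \<rho>]])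
 have inj: "inj_on \<rho> E" and img: "\<rho> ` E = carrier X" using top_iso_bij[OF \<rho>] by (auto simp: bij_betw_def)
 have \<rho>1: "\<rho> id = \<one>\<^bsub>X\<^esub>" using r.hom_one by simp
 have "M' 0 \<subset> M 0" by (rule stack_strict) (rule stack_system_K)
 then obtain g where g: "g : M 0" "g \<notin> M' 0" by blast
 moreover have "id : M' 0" using closed_normal_M'[of 0] PG_subgroupD(2) by (simp add: closed_normal_iff[OF group_PG])
 ultimately have g1: "g : K" "g \<noteq> id" using M_K by auto
 have chief: "chief_factor X (L, {\<one>\<^bsub>X\<^esub>})"
 proof -
  have "{\<one>\<^bsub>X\<^esub>} \<subset> L"
  proof
   show "{\<one>\<^bsub>X\<^esub>} \<subseteq> L" using \<rho>1 K_id by (auto simp: L_def intro!: image_eqI[of _ _ id])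
   have "\<rho> g \<noteq> \<rho> id" using inj g1 K_sub_E E.id_mem by (auto simp: inj_on_def)
   moreover have "\<rho> g : L" using g1(1) by (simp add: L_def)
   ultimately show "{\<one>\<^bsub>X\<^esub>} \<noteq> L" using \<rho>1 by auto
  qed
  moreover have False if N: "closed_normal N X" "{\<one>\<^bsub>X\<^esub>} \<subset> N" "N \<subset> L" for N
  proof -
   let ?\<psi> = "inv_into (carrier E.PG) \<rho>"
   have \<psi>: "?\<psi> : top_iso X E.PG" by (rule top_iso_inv[OF E.topological_group_PG X(2,4) \<rho>])
   define P where "P = ?\<psi> ` N"
   have NX: "N \<subseteq> \<rho> ` E" using N(3) image_mono[OF K_sub_E, of \<rho>] unfolding L_def by blast
   have \<rho>P: "\<rho> ` P = N" using NX by (simp add: P_def image_inv_into_cancel)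
   have PE: "P \<subseteq> E" using NX by (auto simp: P_def intro: inv_into_into)
   have "closed_normal P E.PG" unfolding P_def by (rule top_iso_closed_normal[OF X(1) E.topological_group_PG \<psi> N(1)])
   then have P: "subgroup P E.PG" "closedin (perm_topology E U) P" "!!g n. g : E ==> n : P ==> g o n o invp g : P"
    by (auto simp: closed_normal_iff[OF E.group_PG])
   have "P \<subseteq> K" using N(3) \<rho>P inj_on_image_subset_iff[OF inj PE K_sub_E] by (auto simp: L_def)
   then have "P \<inter> K = P" by blast
   then have cP: "closed_normal P PG" using closed_normal_E_Int[OF P] by simp
   have "P \<noteq> {\<one>\<^bsub>PG\<^esub>}" using N(2) \<rho>P \<rho>1 by auto
   then obtain k where "M k \<subseteq> P" by (rule stack_below[OF stack_system_K cP])
   then have "K \<subseteq> P" using K_subset_of_M[OF P] by blast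
   then have "L \<subseteq> N" using \<rho>P by (auto simp: L_def)
   then show False using N(3) by blast
  qed
  ultimately show ?thesis using L one unfolding chief_factor_def normal_factor_def by blast
 qed
 let ?F = "factor_group X (L, {\<one>\<^bsub>X\<^esub>})"
 have Ls: "subgroup L X" using L by (simp add: closed_normal_iff[OF X(2)])
 interpret L: top_group "subgrp X L" using X.top_group_subgrp[OF Ls] by unfold_locales
 have F: "?F = quotient_group (subgrp X L) {\<one>\<^bsub>subgrp X L\<^esub>}" by (simp add: factor_group_def)
 have Ft: "topological_group ?F" unfolding F by (rule L.trivial_quotient_top_iso(2))
 interpret F: top_group ?F using Ft by unfold_locales
 define \<phi> where "\<phi> = (\<lambda>x. {\<one>\<^bsub>subgrp X L\<^esub>} #>\<^bsub>subgrp X L\<^esub> x) o \<rho>"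
 have \<phi>: "\<phi> : top_iso PG ?F" unfolding \<phi>_def
 proof (rule top_iso_comp)
  show "\<rho> : top_iso PG (subgrp X L)" using top_iso_subgrp[OF \<rho> _ , of K] K_sub_E Ko(2) by (simp add: L_def)
  show "(\<lambda>x. {\<one>\<^bsub>subgrp X L\<^esub>} #>\<^bsub>subgrp X L\<^esub> x) : top_iso (subgrp X L) ?F" unfolding F by (rule L.trivial_quotient_top_iso(1))
 qed
 have sF: "stack_system ?F (\<lambda>k. \<phi> ` M k) (\<lambda>k. \<phi> ` M' k)"
  by (rule top_iso_stack_system[OF topological_group_PG Ft \<phi> stack_system_K])
 have aut: "\<exists>\<psi>\<in>top_iso ?F ?F. \<forall>k. \<psi> ` (\<phi> ` M k) = \<phi> ` M (k + j)" for j
 proof -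
  let ?\<theta> = "inv_into (carrier PG) \<phi>"
  have \<theta>: "?\<theta> : top_iso ?F PG" by (rule top_iso_inv[OF topological_group_PG F.is_group F.topspace \<phi>])
  have "\<phi> o (sconj j o ?\<theta>) : top_iso ?F ?F" by (intro top_iso_comp[OF _ \<phi>] top_iso_comp[OF \<theta> sconj_top_iso])
  moreover have "(\<phi> o (sconj j o ?\<theta>)) ` (\<phi> ` M k) = \<phi> ` M (k + j)" for k
  proof -
   have "?\<theta> ` \<phi> ` M k = M k" using top_iso_bij[OF \<phi>] M_K by (intro inv_into_image_cancel) (auto simp: bij_betw_def)
   then show ?thesis unfolding image_comp[symmetric] by (simp only: sconj_M)
  qed
  ultimately show ?thesis by blast
 qed
 have "stacking_type X (L, {\<one>\<^bsub>X\<^esub>})" unfolding stacking_type_def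
 proof (intro conjI ballI chief)
  show "minimally_covered_blocks ?F \<noteq> {}" using F.stack_block[OF sF] by blast
  fix \<aa> \<bb> assume "\<aa> : minimally_covered_blocks ?F" "\<bb> : minimally_covered_blocks ?F"
  then have "\<aa> : chief_blocks ?F" "\<bb> : chief_blocks ?F" by (auto simp: minimally_covered_blocks_def)
  then show "\<exists>\<psi>\<in>top_iso ?F ?F. block_less ?F (block_action ?F \<psi> \<aa>) \<bb>" by (rule F.stack_block_less[OF sF aut])
 qed
 moreover have "decomposition_rank ?F = \<kappa>"
  by (rule decomposition_rank_eq[OF top_iso_rank[OF tdlc_PG F.is_group F.topspace \<phi> assms]])
 ultimately show ?thesis using elem chief by blast
qed

end

theorem mainTheorem3:
  fixes n :: nat
  assumes "n \<ge> 1"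
  shows "\<exists>(E :: (nat \<Rightarrow> nat) tgroup) K N.
    elementary E \<and> chief_factor E (K, N) \<and> stacking_type E (K, N) \<and>
    decomposition_rank (factor_group E (K, N)) = omega ^ n + 1"
proof -
 obtain m where m: "n = Suc m" using assms by (cases n) auto
 obtain H H1 \<xi> \<beta> where H: "stacked_tree H H1" "compactly_generated (perm_group H {h : H. h 0 = 0})"
  "has_rank (perm_group H {h : H. h 0 = 0}) \<xi>" "\<xi> < omega ^ Suc m"
  "\<beta> = 0 \<or> (\<exists>\<rho>. has_rank (Res (perm_group H {h : H. h 0 = 0})) \<rho> \<and> 1 + \<beta> < \<rho>)" "omega ^ m \<le> \<beta> + 1"
  using ex_branching_all[of m] unfolding branching_def by blast
 show ?thesis unfolding m by (rule stacked_tree.ex_stacking_factor[OF H(1) stacked_tree.rank_K[OF H]])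
qed

end
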